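(* Let $K\ge 1$, $\epsilon\in(0,1)$ and $P_i>0$ for $i\in[K]$. There exists an $(n, M_{[K]}, \epsilon, P_{[K]})$-MAC code for the $K$-transmitter Gaussian MAC provided that \[ \Big(\sum_{s\in\mathcal{S}} \log M_s : \mathcal{S} \in \mathcal{P}([K])\Big) \in n\,\mathbf{C}(P_{[K]}) - \sqrt{n}\, Q_{\mathrm{inv}}(\mathsf{V}(P_{[K]}),\epsilon) + \tfrac12 \log n\,\mathbf{1} + O(1)\,\mathbf{1}, \] where the right-hand side denotes the set of vectors $n\mathbf{C}(P_{[K]}) - \sqrt{n}\,\mathbf{z} + \frac12\log n\,\mathbf{1} + O(1)\mathbf{1}$ with $\mathbf{z}\in Q_{\mathrm{inv}}(\mathsf{V}(P_{[K]}),\epsilon)$, the $O(1)$ term being bounded by a constant independent of $n$.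
   Context: Logarithms are natural. $[K]=\{1,\dots,K\}$ and $\mathcal{P}([K])$ denotes the set of nonempty subsets of $[K]$; vectors indexed by $\mathcal{P}([K])$ lie in $\mathbb{R}^{2^K-1}$. For $\mathcal{S}\subseteq[K]$, $P_{\langle\mathcal{S}\rangle} = \sum_{s\in\mathcal{S}} P_s$. The $K$-transmitter Gaussian MAC with blocklength $n$ has inputs $\mathbf{X}_1,\dots,\mathbf{X}_K\in\mathbb{R}^n$ and output $\mathbf{Y}_K = \sum_{i=1}^K \mathbf{X}_i + \mathbf{Z}$, $\mathbf{Z}\sim\mathcal{N}(\mathbf{0},\mathsf{I}_n)$ independent of the inputs. An $(n,M_{[K]},\epsilon,P_{[K]})$-MAC code consists of encoders $\mathsf{f}_i:[M_i]\to\mathbb{R}^n$ with $\|\mathsf{f}_i(m_i)\|^2\le nP_i$ for all $i\in[K]$, $m_i\in[M_i]$, and a decoder $\mathsf{g}:\mathbb{R}^n\to[M_1]\times\cdots\times[M_K]$ whose error probability, averaged uniformly over all message tuples $(m_1,\dots,m_K)$, is at most $\epsilon$. Let $C(P)=\frac12\log(1+P)$. The capacity vector is $\mathbf{C}(P_{[K]}) = (C(P_{\langle\mathcal{S}\rangle}) : \mathcal{S}\in\mathcal{P}([K]))$. The dispersion matrix $\mathsf{V}(P_{[K]})$ is the $(2^K-1)\times(2^K-1)$ matrix with entries, for $\mathcal{S}_1,\mathcal{S}_2\in\mathcal{P}([K])$, \[ \mathsf{V}_{\mathcal{S}_1,\mathcal{S}_2} = \frac{P_{\langle\mathcal{S}_1\rangle}P_{\langle\mathcal{S}_2\rangle}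 + 2P_{\langle\mathcal{S}_1\cap\mathcal{S}_2\rangle} + \big(P_{\langle\mathcal{S}_1\cap\mathcal{S}_2\rangle}\big)^2 - \sum_{i\in\mathcal{S}_1\cap\mathcal{S}_2} P_i^2}{2(1+P_{\langle\mathcal{S}_1\rangle})(1+P_{\langle\mathcal{S}_2\rangle})}. \] For a $d\times d$ positive semidefinite $\mathsf{V}$ and $\mathbf{W}\sim\mathcal{N}(\mathbf{0},\mathsf{V})$, $Q_{\mathrm{inv}}(\mathsf{V},\epsilon)=\{\mathbf{z}\in\mathbb{R}^d:\mathbb{P}[\mathbf{W}\le\mathbf{z}]\ge 1-\epsilon\}$ (componentwise inequality). $\mathbf{1}$ is the all-ones vector. *)

theory Defs
  imports "HOL-Probability.Probability"
begin

definition std_gauss :: "real measure" where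
  "std_gauss = density lborel (\<lambda>x. ennreal (std_normal_density x))"

definition PK :: "nat \<Rightarrow> nat set set" where
  "PK K = {S. S \<subseteq> {1..K} \<and> S \<noteq> {}}"

definition Psum :: "(nat \<Rightarrow> real) \<Rightarrow> nat set \<Rightarrow> real" where
  "Psum P S = (\<Sum>s\<in>S. P s)"

definition Cap :: "real \<Rightarrow> real" where
  "Cap x = ln (1 + x) / 2"

definition dispV :: "(nat \<Rightarrow> real) \<Rightarrow> nat set \<Rightarrow> nat set \<Rightarrow> real" where
  "dispV P S1 S2 =
     (Psum P S1 * Psum P S2 + 2 * Psum P (S1 \<inter> S2) + (Psum P (S1 \<inter> S2))\<^sup>2
        - (\<Sum>i\<in>S1 \<inter> S2. (P i)\<^sup>2))
     / (2 * (1 + Psum P S1) * (1 + Psum P S2))"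

text \<open>P[W \<le> z] for W ~ N(0,V) on the index set I, realised as W = A G with G iid
  standard normal on I and A A^T = V (so the distribution of W is N(0,V)).
  Q_inv(V,eps) = set of z with P[W \<le> z] \<ge> 1 - eps.\<close>
definition Qinv :: "nat set set \<Rightarrow> (nat set \<Rightarrow> nat set \<Rightarrow> real) \<Rightarrow> real \<Rightarrow> (nat set \<Rightarrow> real) set" where
  "Qinv I V eps = {z. \<exists>A :: nat set \<Rightarrow> nat set \<Rightarrow> real.
      (\<forall>S1\<in>I. \<forall>S2\<in>I. (\<Sum>T\<in>I. A S1 T * A S2 T) = V S1 S2) \<and>
      measure (PiM I (\<lambda>_. std_gauss))
        {g \<in> space (PiM I (\<lambda>_. std_gauss)). \<forall>S\<in>I. (\<Sum>T\<in>I. A S T * g T) \<le> z S}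
      \<ge> 1 - eps}"

definition mac_error :: "nat \<Rightarrow> nat \<Rightarrow> (nat \<Rightarrow> nat) \<Rightarrow> (nat \<Rightarrow> nat \<Rightarrow> nat \<Rightarrow> real)
                          \<Rightarrow> ((nat \<Rightarrow> real) \<Rightarrow> nat \<Rightarrow> nat) \<Rightarrow> real" where
  "mac_error K n M f g =
     (\<Sum>m\<in>PiE {1..K} (\<lambda>i. {1..M i}).
        1 - measure (PiM {..<n} (\<lambda>_. std_gauss))
              {z \<in> space (PiM {..<n} (\<lambda>_. std_gauss)).
                 \<forall>i\<in>{1..K}. g (\<lambda>t. if t < n then (\<Sum>j\<in>{1..K}. f j (m j) t) + z t else 0) i = m i})
     / (\<Prod>i\<in>{1..K}. real (M i))"

definition is_mac_code :: "nat \<Rightarrow> nat \<Rightarrow> (nat \<Rightarrow> nat) \<Rightarrow> real \<Rightarrow> (nat \<Rightarrow> real)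
                           \<Rightarrow> (nat \<Rightarrow> nat \<Rightarrow> nat \<Rightarrow> real) \<Rightarrow> ((nat \<Rightarrow> real) \<Rightarrow> nat \<Rightarrow> nat) \<Rightarrow> bool" where
  "is_mac_code K n M eps P f g \<longleftrightarrow>
     (\<forall>i\<in>{1..K}. \<forall>m\<in>{1..M i}. (\<Sum>t<n. (f i m t)\<^sup>2) \<le> real n * P i) \<and>
     mac_error K n M f g \<le> eps"

end

theory Submission
  imports Defs
begin

text \<open>Draw the codewords of user \<open>i\<close> uniformly from the sphere of radius \<open>sqrt (n P\<^sub>i)\<close> and decode to the nearest
  sum of codewords. By the union bound the error probability is at most the mean of \<open>min 1 U\<close>, where \<open>U\<close> sums over
  the nonempty \<open>S\<close> the number \<open>\<Prod>\<^bsub>s\<in>S\<^esub> M\<^sub>s\<close> of competitors times the probability that an independent sum over \<open>S\<close> falls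
  into the ball of radius \<open>|Z|\<close> around \<open>X\<^sub>S + Z\<close>. The direction of such a sum is uniform, so this probability is at
  most that of a spherical cap; its polynomial factor is the source of \<open>ln n / 2\<close>.

  Spherical codewords are normalized Gaussian vectors. Triangularizing the codewords and the noise leaves only
  finitely many coordinates that matter: exactly Gaussian inner products and chi-distributed norms. The logarithm of
  the cap bound is affine in the inner products and the normalized noise norm, up to a quadratic remainder of
  bounded mean, and the covariance of this affine form is the dispersion matrix. Conditionally on the other
  coordinates, the error event is a half-line for the noise norm, whose density differs from the Gaussian one by
  \<open>O(1 / sqrt n)\<close>. So the Gaussian probability \<open>eps\<close> is approximated up to \<open>O(1 / sqrt n)\<close>, and this error is
  absorbed by lowering the rates by a constant.\<close>

text \<open>The step from \<open>min 1 U\<close> to probabilities may cost only O(1) in the rates: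
  cutting \<open>U\<close> at the single level \<open>1 / sqrt n\<close> would lose another
  \<open>ln n / 2\<close>. The mean is therefore split over the dyadic levels 2^-k. Level
  \<open>k\<close> loosens the rates by a multiple of \<open>k\<close>, hence shifts the tail event
  by O(k / sqrt n), and the weights 2^-k keep the total at O(1 / sqrt n). Lowering the rates by
  \<open>B\<close> moves the half-line by a multiple of \<open>B / sqrt n\<close>. This gains
  probability only where the Gaussian density at its end point is bounded away from zero, uniformly
  over all \<open>z\<close> in \<open>Qinv\<close>, an unbounded set. The end point is Lipschitz in
  the other coordinates, so it can be far out only if the error probability is near 0 or near 1. The
  second case contradicts \<open>eps < 1\<close>; in the first there is room without any gain. The
  chi law is compared with the Gaussian one through a lower bound on its density: both have mass
  one, so a lower bound for the complement is an upper bound for the event.\<close>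

lemma sets_std_gauss [simp, measurable_cong]: "sets std_gauss = sets borel"
  by (simp add: std_gauss_def)

lemma space_std_gauss [simp]: "space std_gauss = UNIV"
  by (simp add: std_gauss_def)

lemma prob_space_std_gauss: "prob_space std_gauss"
  unfolding std_gauss_def by (rule prob_space_normal_density) simp

abbreviation gauss :: "'a set \<Rightarrow> ('a \<Rightarrow> real) measure" where
  "gauss I \<equiv> PiM I (\<lambda>_. std_gauss)"

interpretation G: product_sigma_finite "\<lambda>_. std_gauss"
  by (intro product_sigma_finite.intro prob_space_imp_sigma_finite prob_space_std_gauss)

lemma prob_space_gauss: "prob_space (gauss I)"
  by (intro prob_space_PiM prob_space_std_gauss)

definition dotp :: "'a set \<Rightarrow> ('a \<Rightarrow> real) \<Rightarrow> ('a \<Rightarrow> real) \<Rightarrow> real" where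
  "dotp I x y = (\<Sum>i\<in>I. x i * y i)"

lemma dotp_commute: "dotp I x y = dotp I y x"
  by (simp add: dotp_def mult.commute)

lemma dotp_self: "dotp I x x = (\<Sum>i\<in>I. (x i)\<^sup>2)"
  by (simp add: dotp_def power2_eq_square)

lemma dotp_self_nonneg [simp]: "0 \<le> dotp I x x"
  by (auto simp: dotp_self intro: sum_nonneg)

section \<open>Gaussian product measures as densities\<close>

lemma sets_gauss_lborel: "sets (gauss I) = sets (PiM I (\<lambda>_. lborel))"
  by (intro sets_PiM_cong) auto

lemma gauss_eq_density:
  assumes "finite I"
  shows "gauss I = density (PiM I (\<lambda>_. lborel)) (\<lambda>x. \<Prod>i\<in>I. ennreal (std_normal_density (x i)))"
proof (rule G.PiM_eqI[symmetric])
  interpret L: product_sigma_finite "\<lambda>_. lborel :: real measure" ..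
  show "finite I" by fact
  show "sets (density (PiM I (\<lambda>_. lborel)) (\<lambda>x. \<Prod>i\<in>I. ennreal (std_normal_density (x i)))) = sets (gauss I)"
    by (simp add: sets_gauss_lborel)
  fix A :: "'a \<Rightarrow> real set" assume A: "\<And>i. i \<in> I \<Longrightarrow> A i \<in> sets std_gauss"
  have A': "A i \<in> sets borel" if "i \<in> I" for i using A[OF that] by simp
  have "emeasure (density (PiM I (\<lambda>_. lborel)) (\<lambda>x. \<Prod>i\<in>I. ennreal (std_normal_density (x i)))) (Pi\<^sub>E I A)
     = (\<integral>\<^sup>+x. (\<Prod>i\<in>I. ennreal (std_normal_density (x i))) * indicator (Pi\<^sub>E I A) x \<partial>PiM I (\<lambda>_. lborel))"
    using A' assms by (subst emeasure_density) (auto intro!: sets_PiM_I_finite)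
  also have "\<dots> = (\<integral>\<^sup>+x. (\<Prod>i\<in>I. ennreal (std_normal_density (x i)) * indicator (A i) (x i)) \<partial>PiM I (\<lambda>_. lborel))"
  proof (rule nn_integral_cong)
    fix x :: "'a \<Rightarrow> real" assume "x \<in> space (PiM I (\<lambda>_. lborel))"
    then have x: "x \<in> extensional I" by (auto simp: space_PiM PiE_def)
    have "(\<Prod>i\<in>I. indicator (A i) (x i)) = (indicator (Pi\<^sub>E I A) x :: ennreal)"
    proof (cases "\<forall>i\<in>I. x i \<in> A i")
      case True then show ?thesis using x by (auto simp: indicator_def PiE_def)
    next
      case False
      then obtain i where i: "i \<in> I" "x i \<notin> A i" by auto
      then have "(\<Prod>i\<in>I. indicator (A i) (x i)) = (0::ennreal)"
        using assms by (intro prod_zero) (auto simp: indicator_def)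
      then show ?thesis using i by (auto simp: indicator_def PiE_def)
    qed
    then show "(\<Prod>i\<in>I. ennreal (std_normal_density (x i))) * indicator (Pi\<^sub>E I A) x =
      (\<Prod>i\<in>I. ennreal (std_normal_density (x i)) * indicator (A i) (x i))"
      by (simp add: prod.distrib)
  qed
  also have "\<dots> = (\<Prod>i\<in>I. \<integral>\<^sup>+t. ennreal (std_normal_density t) * indicator (A i) t \<partial>lborel)"
    using A' assms by (subst L.product_nn_integral_prod) auto
  also have "\<dots> = (\<Prod>i\<in>I. emeasure std_gauss (A i))"
    using A' by (intro prod.cong refl) (simp add: std_gauss_def emeasure_density)
  finally show "emeasure (density (PiM I (\<lambda>_. lborel)) (\<lambda>x. \<Prod>i\<in>I. ennreal (std_normal_density (x i)))) (Pi\<^sub>E I A)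
     = (\<Prod>i\<in>I. emeasure std_gauss (A i))" .
qed

lemma prod_std_normal_density:
  assumes "finite I"
  shows "(\<Prod>i\<in>I. ennreal (std_normal_density (x i)))
    = ennreal ((1 / sqrt (2 * pi)) ^ card I * exp (- dotp I x x / 2))"
proof -
  have "(\<Prod>i\<in>I. ennreal (std_normal_density (x i))) = ennreal (\<Prod>i\<in>I. std_normal_density (x i))"
    by (rule prod_ennreal) simp
  also have "(\<Prod>i\<in>I. std_normal_density (x i)) = (\<Prod>i\<in>I. 1 / sqrt (2 * pi)) * (\<Prod>i\<in>I. exp (- (x i)\<^sup>2 / 2))"
    unfolding std_normal_density_def by (rule prod.distrib)
  also have "(\<Prod>i\<in>I. exp (- (x i)\<^sup>2 / 2)) = exp (\<Sum>i\<in>I. - (x i)\<^sup>2 / 2)"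
    using assms by (simp add: exp_sum)
  also have "(\<Sum>i\<in>I. - (x i)\<^sup>2 / 2) = - dotp I x x / 2"
    by (simp add: dotp_self sum_negf sum_divide_distrib)
  finally show ?thesis by simp
qed

text \<open>The density depends on \<open>x\<close> only through \<open>dotp I x x\<close>. A map
  that preserves Lebesgue measure and inner products therefore preserves the Gaussian measure
  too.\<close>

lemma nn_integral_gauss:
  assumes "finite I" and f: "f \<in> borel_measurable (gauss I)"
  shows "(\<integral>\<^sup>+x. f x \<partial>gauss I)
    = (\<integral>\<^sup>+x. ennreal ((1 / sqrt (2 * pi)) ^ card I * exp (- dotp I x x / 2)) * f x \<partial>PiM I (\<lambda>_. lborel))"
proof -
  have [measurable]: "f \<in> borel_measurable (PiM I (\<lambda>_. lborel))"
    using f measurable_cong_sets[OF sets_gauss_lborel refl, of I "borel :: ennreal measure"] by auto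
  have [measurable]: "finite I" by fact
  show ?thesis
    unfolding prod_std_normal_density[OF assms(1), symmetric]
    by (subst gauss_eq_density[OF assms(1)], subst nn_integral_density) simp_all
qed

subsection \<open>Rotation invariance\<close>

text \<open>Integrating over coordinate \<open>k\<close> first leaves a one-dimensional affine
  substitution. Hypothesis \<open>l'\<close> says that the shift \<open>l\<close> ignores coordinate
  \<open>k\<close>, so it is constant during this inner integration.\<close>

lemma nn_integral_shear:
  fixes l :: "('a \<Rightarrow> real) \<Rightarrow> real"
  assumes "finite I" "k \<in> I" "c \<noteq> 0"
    and f: "f \<in> borel_measurable (PiM I (\<lambda>_. lborel))"
    and l [measurable]: "l \<in> borel_measurable (PiM I (\<lambda>_. lborel))"
    and l': "\<And>x t. l (x(k := t)) = l x"
  shows "(\<integral>\<^sup>+x. f (x(k := c * x k + l x)) \<partial>PiM I (\<lambda>_. lborel))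
    = ennreal (1 / \<bar>c\<bar>) * (\<integral>\<^sup>+x. f x \<partial>PiM I (\<lambda>_. lborel))"
proof -
  interpret L: product_sigma_finite "\<lambda>_. lborel :: real measure" ..
  define J where "J = I - {k}"
  have J: "finite J" "k \<notin> J" and I: "I = insert k J" using assms by (auto simp: J_def)
  note f' = f[unfolded I] and l'' = l[unfolded I]
  have [measurable]: "(\<lambda>x. x(k := c * x k + l x)) \<in> PiM I (\<lambda>_. lborel) \<rightarrow>\<^sub>M PiM I (\<lambda>_. lborel)"
    using \<open>k \<in> I\<close> by (intro measurable_PiM_single') (auto simp: space_PiM PiE_def extensional_def)
  have m: "(\<lambda>x. f (x(k := c * x k + l x))) \<in> borel_measurable (PiM (insert k J) (\<lambda>_. lborel))"
    unfolding I[symmetric] using f by measurable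
  have m2: "(\<lambda>x. \<integral>\<^sup>+y. f (x(k := y)) \<partial>lborel) \<in> borel_measurable (PiM J (\<lambda>_. lborel))"
    using f' J by measurable
  have "(\<integral>\<^sup>+x. f (x(k := c * x k + l x)) \<partial>PiM I (\<lambda>_. lborel))
     = (\<integral>\<^sup>+x. (\<integral>\<^sup>+y. f (x(k := c * y + l x)) \<partial>lborel) \<partial>PiM J (\<lambda>_. lborel))"
    unfolding I by (subst L.product_nn_integral_insert[OF J m]) (simp add: l')
  also have "\<dots> = (\<integral>\<^sup>+x. ennreal (1 / \<bar>c\<bar>) * (\<integral>\<^sup>+y. f (x(k := y)) \<partial>lborel) \<partial>PiM J (\<lambda>_. lborel))"
  proof (rule nn_integral_cong)
    fix x assume x: "x \<in> space (PiM J (\<lambda>_. lborel :: real measure))"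
    have [measurable]: "(\<lambda>y. f (x(k := y))) \<in> borel_measurable lborel"
      using f' x J by (auto intro!: measurable_compose[OF measurable_component_update[OF x J(2)] f'])
    have "(\<integral>\<^sup>+y. f (x(k := y)) \<partial>lborel) = ennreal \<bar>c\<bar> * (\<integral>\<^sup>+y. f (x(k := l x + c * y)) \<partial>lborel)"
      using \<open>c \<noteq> 0\<close> by (subst nn_integral_real_affine[where c=c and t="l x"]) auto
    then have "ennreal (1 / \<bar>c\<bar>) * (\<integral>\<^sup>+y. f (x(k := y)) \<partial>lborel)
       = (ennreal (1 / \<bar>c\<bar>) * ennreal \<bar>c\<bar>) * (\<integral>\<^sup>+y. f (x(k := c * y + l x)) \<partial>lborel)"
      by (simp add: mult.assoc add.commute)
    also have "ennreal (1 / \<bar>c\<bar>) * ennreal \<bar>c\<bar> = 1"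
      using \<open>c \<noteq> 0\<close> by (simp flip: ennreal_mult')
    finally show "(\<integral>\<^sup>+y. f (x(k := c * y + l x)) \<partial>lborel) = ennreal (1 / \<bar>c\<bar>) * (\<integral>\<^sup>+y. f (x(k := y)) \<partial>lborel)"
      by (simp only: mult_1_left)
  qed
  also have "\<dots> = ennreal (1 / \<bar>c\<bar>) * (\<integral>\<^sup>+x. (\<integral>\<^sup>+y. f (x(k := y)) \<partial>lborel) \<partial>PiM J (\<lambda>_. lborel))"
    by (rule nn_integral_cmult[OF m2])
  also have "\<dots> = ennreal (1 / \<bar>c\<bar>) * (\<integral>\<^sup>+x. f x \<partial>PiM I (\<lambda>_. lborel))"
    unfolding I by (subst L.product_nn_integral_insert[OF J f']) simp
  finally show ?thesis .
qed

lemma nn_integral_multi_shear: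
  fixes u :: "'a \<Rightarrow> real"
  assumes "finite I" "k \<in> I" "J \<subseteq> I - {k}"
    and f [measurable]: "f \<in> borel_measurable (PiM I (\<lambda>_. lborel))"
  shows "(\<integral>\<^sup>+x. f (\<lambda>i. if i \<in> J then x i + u i * x k else x i) \<partial>PiM I (\<lambda>_. lborel))
    = (\<integral>\<^sup>+x. f x \<partial>PiM I (\<lambda>_. lborel))"
proof -
  have "finite J" using assms finite_subset by blast
  then show ?thesis using assms(3)
  proof (induction J)
    case (insert j J)
    let ?L = "PiM I (\<lambda>_. lborel :: real measure)"
    let ?M = "\<lambda>x :: 'a \<Rightarrow> real. \<lambda>i. if i \<in> J then x i + u i * x k else x i"
    have M: "?M \<in> ?L \<rightarrow>\<^sub>M ?L"
      using insert.prems \<open>k \<in> I\<close>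
      by (intro measurable_PiM_single') (auto simp: space_PiM PiE_def extensional_def)
    have "(\<integral>\<^sup>+x. f (\<lambda>i. if i \<in> insert j J then x i + u i * x k else x i) \<partial>?L)
        = (\<integral>\<^sup>+x. f (?M (x(j := 1 * x j + u j * x k))) \<partial>?L)"
      using insert by (intro nn_integral_cong arg_cong[where f=f]) auto
    also have "\<dots> = ennreal (1 / \<bar>1\<bar>) * (\<integral>\<^sup>+x. f (?M x) \<partial>?L)"
      using insert.prems assms(1,2)
      by (intro nn_integral_shear[where f="\<lambda>x. f (?M x)" and l="\<lambda>x. u j * x k"])
         (auto intro!: measurable_compose[OF M f])
    also have "\<dots> = (\<integral>\<^sup>+x. f x \<partial>?L)"
      using insert by simp
    finally show ?case .
  qed simp
qed

text \<open>The Householder reflection in the hyperplane orthogonal to \<open>w\<close>. If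
  \<open>w\<close> vanishes on \<open>I\<close>, the quotient is 0 by convention and only the
  restriction to \<open>I\<close> remains.\<close>

definition reflection :: "'a set \<Rightarrow> ('a \<Rightarrow> real) \<Rightarrow> ('a \<Rightarrow> real) \<Rightarrow> 'a \<Rightarrow> real" where
  "reflection I w x = (\<lambda>i\<in>I. x i - 2 * (dotp I w x / dotp I w w) * w i)"

lemma dotp_reflection_right:
  "dotp I a (reflection I w x) = dotp I a x - 2 * (dotp I w x / dotp I w w) * dotp I a w"
proof -
  define c where "c = 2 * (dotp I w x / dotp I w w)"
  have "dotp I a (reflection I w x) = (\<Sum>i\<in>I. a i * x i - c * (a i * w i))"
    unfolding dotp_def[of I a] reflection_def c_def[symmetric]
    by (intro sum.cong) (auto simp: algebra_simps)
  also have "\<dots> = dotp I a x - c * dotp I a w"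
    by (simp add: sum_subtractf sum_distrib_left dotp_def)
  finally show ?thesis by (simp add: c_def)
qed

lemma dotp_reflection:
  "dotp I (reflection I w x) (reflection I w y) = dotp I x y"
proof -
  define p q r where "p = dotp I w x" and "q = dotp I w y" and "r = dotp I w w"
  have 1: "dotp I (reflection I w x) z = dotp I x z - 2 * (p / r) * dotp I w z" for z
    using dotp_reflection_right[of I z w x] by (simp add: dotp_commute[of I z] p_def r_def)
  have "dotp I (reflection I w x) (reflection I w y)
      = dotp I x y - 2 * (p / r) * q - 2 * (q / r) * (p - 2 * (p / r) * r)"
    unfolding dotp_reflection_right 1
    by (simp add: dotp_commute[of I x w] p_def q_def r_def)
  also have "\<dots> = dotp I x y"
    by (cases "r = 0") (simp_all add: field_simps)
  finally show ?thesis .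
qed

lemma measurable_dotp [measurable]:
  assumes "\<And>i. i \<in> I \<Longrightarrow> (\<lambda>x. f x i) \<in> borel_measurable M" "\<And>i. i \<in> I \<Longrightarrow> (\<lambda>x. g x i) \<in> borel_measurable M"
  shows "(\<lambda>x. dotp I (f x) (g x)) \<in> borel_measurable M"
  unfolding dotp_def using assms by (intro borel_measurable_sum borel_measurable_times) auto

lemma measurable_gauss_component:
  "i \<in> I \<Longrightarrow> (\<lambda>x. x i) \<in> borel_measurable (gauss I)"
  using measurable_component_singleton[of i I "\<lambda>_. std_gauss"]
  by (simp cong: measurable_cong_sets)

lemma measurable_to_gauss:
  assumes "\<And>i. i \<in> I \<Longrightarrow> (\<lambda>x. f x i) \<in> borel_measurable M"
    and "\<And>x i. x \<in> space M \<Longrightarrow> i \<notin> I \<Longrightarrow> f x i = undefined"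
  shows "f \<in> M \<rightarrow>\<^sub>M gauss I"
proof (rule measurable_PiM_single')
  fix i assume "i \<in> I"
  then show "(\<lambda>x. f x i) \<in> M \<rightarrow>\<^sub>M std_gauss" using assms(1) by (simp cong: measurable_cong_sets)
next
  show "f \<in> space M \<rightarrow> (\<Pi>\<^sub>E i\<in>I. space std_gauss)" using assms(2) by (auto simp: PiE_def extensional_def)
qed

lemma measurable_reflection:
  shows "reflection I w \<in> gauss I \<rightarrow>\<^sub>M gauss I"
  unfolding reflection_def
  by (rule measurable_to_gauss) (auto intro!: measurable_dotp measurable_gauss_component
       borel_measurable_diff borel_measurable_times borel_measurable_divide)

lemma measurable_lborel_update:
  assumes "k \<in> I" "g \<in> borel_measurable (PiM I (\<lambda>_. lborel :: real measure))"
  shows "(\<lambda>x. x(k := g x)) \<in> PiM I (\<lambda>_. lborel) \<rightarrow>\<^sub>M PiM I (\<lambda>_. lborel)"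
  using assms by (intro measurable_PiM_single') (auto simp: space_PiM PiE_def extensional_def)

text \<open>The reflection factors into elementary maps: coordinate \<open>k\<close> becomes
  \<open>dotp I w x\<close>, multiples of it are added to the other coordinates, its sign is
  flipped, and the old kind of coordinate \<open>k\<close> is solved for again. The absolute
  Jacobians of \<open>w k\<close>, 1, -1 and \<open>1 / w k\<close> multiply to 1.\<close>

lemma nn_integral_lborel_reflection:
  assumes "finite I" and f: "f \<in> borel_measurable (PiM I (\<lambda>_. lborel))"
  shows "(\<integral>\<^sup>+x. f (reflection I w x) \<partial>PiM I (\<lambda>_. lborel)) = (\<integral>\<^sup>+x. f x \<partial>PiM I (\<lambda>_. lborel))"
proof (cases "dotp I w w = 0")
  case True
  have "reflection I w x = x" if "x \<in> space (PiM I (\<lambda>_. lborel))" for x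
    using that unfolding reflection_def True by (auto simp: space_PiM PiE_def extensional_def)
  then show ?thesis by (intro nn_integral_cong arg_cong[where f=f]) auto
next
  case False
  let ?L = "PiM I (\<lambda>_. lborel :: real measure)"
  \<comment> \<open>The pivot: since \<open>w k\<close> is nonzero, coordinate \<open>k\<close> can
    be recovered from \<open>dotp I w x\<close> and the other coordinates.\<close>
  from False obtain k where k: "k \<in> I" "w k \<noteq> 0"
    unfolding dotp_def using sum.neutral[of I "\<lambda>i. w i * w i"] by fastforce
  define J where "J = I - {k}"
  define l where "l = (\<lambda>x. \<Sum>i\<in>J. w i * x i)"
  have dot: "dotp I w x = w k * x k + l x" for x
    using k assms by (simp add: dotp_def l_def J_def sum.remove)
  have lm [measurable]: "l \<in> borel_measurable ?L"
    unfolding l_def J_def by (intro borel_measurable_sum) auto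
  have lx: "l x = (\<Sum>i\<in>J. w i * x i)" for x by (simp add: l_def)
  have l': "l (x(k := t)) = l x" for x t
    unfolding l_def J_def by (intro sum.cong) auto
  define c where "c = - 2 / dotp I w w"
  define S' where "S' = (\<lambda>x :: 'a \<Rightarrow> real. x(k := 1 / w k * x k + (- l x / w k)))"
  define M where "M = (\<lambda>x :: 'a \<Rightarrow> real. \<lambda>i. if i \<in> J then x i + (c * w i) * x k else x i)"
  define N where "N = (\<lambda>x :: 'a \<Rightarrow> real. x(k := (-1) * x k + 0))"
  have k' [measurable]: "k \<in> I" by fact
  have S': "S' \<in> ?L \<rightarrow>\<^sub>M ?L"
    unfolding S'_def by (rule measurable_lborel_update[OF k']) measurable
  have N: "N \<in> ?L \<rightarrow>\<^sub>M ?L"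
    unfolding N_def by (rule measurable_lborel_update[OF k']) measurable
  have M: "M \<in> ?L \<rightarrow>\<^sub>M ?L"
    unfolding M_def J_def using k
    by (intro measurable_PiM_single') (auto simp: space_PiM PiE_def extensional_def)
  have eq: "reflection I w x = S' (N (M (x(k := w k * x k + l x))))" if "x \<in> space ?L" for x
  proof -
    let ?y = "M (x(k := w k * x k + l x))"
    have yk: "?y k = dotp I w x" by (simp add: M_def J_def dot)
    have yi: "?y i = x i + (c * w i) * dotp I w x" if "i \<in> J" for i
      using that by (auto simp: M_def J_def dot)
    have l1: "l (N ?y) = l x + c * dotp I w x * (dotp I w w - w k * w k)"
    proof -
      have "l (N ?y) = (\<Sum>i\<in>J. w i * (x i + (c * w i) * dotp I w x))"
        unfolding N_def l' unfolding lx[of ?y] by (intro sum.cong) (simp_all add: yi)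
      also have "\<dots> = l x + c * dotp I w x * l w"
        by (simp add: l_def algebra_simps sum.distrib sum_distrib_left)
      finally show ?thesis by (simp add: dot[of w])
    qed
    have c: "c * dotp I w w = - 2" using False by (simp add: c_def)
    show ?thesis
    proof
      fix i
      consider "i = k" | "i \<in> J" | "i \<notin> I" using J_def by blast
      then show "reflection I w x i = S' (N ?y) i"
      proof cases
        case 1
        have "S' (N ?y) k = (- dotp I w x - l (N ?y)) / w k"
          by (simp add: S'_def N_def yk diff_divide_distrib)
        also have "\<dots> = (- dotp I w x - l x - (c * dotp I w w) * dotp I w x + c * dotp I w x * (w k * w k)) / w k"
          unfolding l1 by (simp add: algebra_simps)
        also have "\<dots> = (dotp I w x - l x + c * dotp I w x * (w k * w k)) / w k"
          unfolding c by simp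
        also have "\<dots> = x k + c * dotp I w x * w k"
          using k by (simp add: add_divide_distrib dot[of x] diff_divide_distrib)
        finally show ?thesis using 1 k by (simp add: reflection_def c_def)
      next
        case 2
        then have "S' (N ?y) i = x i + (c * w i) * dotp I w x"
          using yi[OF 2] by (auto simp: S'_def N_def J_def)
        then show ?thesis using 2 by (simp add: reflection_def c_def J_def)
      next
        case 3
        then show ?thesis using that k by (auto simp: reflection_def S'_def N_def M_def J_def space_PiM PiE_def extensional_def)
      qed
    qed
  qed
  have "(\<integral>\<^sup>+x. f (reflection I w x) \<partial>?L) = (\<integral>\<^sup>+x. f (S' (N (M (x(k := w k * x k + l x))))) \<partial>?L)"
    by (intro nn_integral_cong) (simp add: eq)
  also have "\<dots> = ennreal (1 / \<bar>w k\<bar>) * (\<integral>\<^sup>+x. f (S' (N (M x))) \<partial>?L)"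
    by (rule nn_integral_shear[where f="\<lambda>x. f (S' (N (M x)))"])
       (use k assms l' in \<open>auto intro!: measurable_compose[OF M] measurable_compose[OF N] measurable_compose[OF S']\<close>)
  also have "(\<integral>\<^sup>+x. f (S' (N (M x))) \<partial>?L) = (\<integral>\<^sup>+x. f (S' (N x)) \<partial>?L)"
    unfolding M_def
    by (rule nn_integral_multi_shear[where f="\<lambda>x. f (S' (N x))"])
       (use k assms in \<open>auto intro!: measurable_compose[OF N] measurable_compose[OF S'] simp: J_def\<close>)
  also have "\<dots> = ennreal (1 / \<bar>-1\<bar>) * (\<integral>\<^sup>+x. f (S' x) \<partial>?L)"
    unfolding N_def
    by (rule nn_integral_shear[where f="\<lambda>x. f (S' x)"])
       (use k assms in \<open>auto intro!: measurable_compose[OF S']\<close>)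
  also have "(\<integral>\<^sup>+x. f (S' x) \<partial>?L) = ennreal (1 / \<bar>1 / w k\<bar>) * (\<integral>\<^sup>+x. f x \<partial>?L)"
    unfolding S'_def
    by (rule nn_integral_shear) (use k assms l' in \<open>auto simp del: fun_upd_apply\<close>)
  also have "ennreal (1 / \<bar>w k\<bar>) * (ennreal (1 / \<bar>-1\<bar>) * (ennreal (1 / \<bar>1 / w k\<bar>) * (\<integral>\<^sup>+x. f x \<partial>?L)))
     = (ennreal (1 / \<bar>w k\<bar>) * ennreal (\<bar>w k\<bar>)) * (\<integral>\<^sup>+x. f x \<partial>?L)"
    by (simp add: mult.assoc)
  also have "ennreal (1 / \<bar>w k\<bar>) * ennreal (\<bar>w k\<bar>) = 1"
    using k by (simp flip: ennreal_mult')
  finally show ?thesis by simp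
qed

definition gauss_isometry :: "'a set \<Rightarrow> (('a \<Rightarrow> real) \<Rightarrow> 'a \<Rightarrow> real) \<Rightarrow> bool" where
  "gauss_isometry I T \<longleftrightarrow> T \<in> gauss I \<rightarrow>\<^sub>M gauss I \<and> distr (gauss I) (gauss I) T = gauss I \<and>
     (\<forall>x y. dotp I (T x) (T y) = dotp I x y)"

lemma gauss_isometry_reflection:
  assumes "finite I"
  shows "gauss_isometry I (reflection I w)"
proof -
  have "distr (gauss I) (gauss I) (reflection I w) = gauss I"
  proof (rule measure_eqI)
    fix A assume "A \<in> sets (distr (gauss I) (gauss I) (reflection I w))"
    then have A [measurable]: "A \<in> sets (gauss I)" by simp
    let ?c = "\<lambda>x. ennreal ((1 / sqrt (2 * pi)) ^ card I * exp (- dotp I x x / 2))"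
    let ?f = "\<lambda>x. ?c x * indicator A x :: ennreal"
    note [measurable] = measurable_reflection[of I w]
    have m1: "?f \<in> borel_measurable (PiM I (\<lambda>_. lborel))"
      using A by (intro borel_measurable_times_ennreal measurable_ennreal) (auto simp: sets_gauss_lborel)
    have "emeasure (distr (gauss I) (gauss I) (reflection I w)) A
      = (\<integral>\<^sup>+x. indicator A (reflection I w x) \<partial>gauss I)"
      by (subst nn_integral_distr[symmetric, where f="indicator A" and M'="gauss I"]) auto
    also have "\<dots> = (\<integral>\<^sup>+x. ?c x * indicator A (reflection I w x) \<partial>PiM I (\<lambda>_. lborel))"
      by (subst nn_integral_gauss[OF assms]) auto
    also have "\<dots> = (\<integral>\<^sup>+x. ?f (reflection I w x) \<partial>PiM I (\<lambda>_. lborel))"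
      by (simp add: dotp_reflection)
    also have "\<dots> = (\<integral>\<^sup>+x. ?f x \<partial>PiM I (\<lambda>_. lborel))"
      by (rule nn_integral_lborel_reflection[OF assms m1])
    also have "\<dots> = emeasure (gauss I) A"
      by (subst nn_integral_gauss[OF assms, symmetric]) auto
    finally show "emeasure (distr (gauss I) (gauss I) (reflection I w)) A = emeasure (gauss I) A" .
  qed simp
  then show ?thesis
    unfolding gauss_isometry_def using measurable_reflection dotp_reflection by auto
qed

lemma gauss_isometry_compose:
  assumes "gauss_isometry I S" "gauss_isometry I T"
  shows "gauss_isometry I (S \<circ> T)"
  using assms unfolding gauss_isometry_def
  by (auto simp flip: distr_distr[where N="gauss I"])

lemma gauss_isometry_id: "gauss_isometry I (\<lambda>x. x)"
  unfolding gauss_isometry_def by (auto intro!: distr_id2)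

text \<open>Composing reflections: the reflection in the difference of two vectors of equal norm swaps
  them, and by equality of the Gram matrices it fixes the vectors that already agree.\<close>

lemma gram_isometry:
  assumes "finite I" "finite J"
    and "\<And>j j'. j \<in> J \<Longrightarrow> j' \<in> J \<Longrightarrow> dotp I (a j) (a j') = dotp I (b j) (b j')"
  obtains T where "gauss_isometry I T" "\<And>j i. j \<in> J \<Longrightarrow> i \<in> I \<Longrightarrow> T (b j) i = a j i"
proof -
  have "\<exists>T. gauss_isometry I T \<and> (\<forall>j\<in>J. \<forall>i\<in>I. T (b j) i = a j i)"
    using assms(2,3)
  proof (induction J)
    case empty
    then show ?case using gauss_isometry_id by auto
  next
    case (insert k J)
    then obtain T where T: "gauss_isometry I T" "\<forall>j\<in>J. \<forall>i\<in>I. T (b j) i = a j i" by auto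
    define c where "c = T (b k)"
    define w where "w = (\<lambda>i. c i - a k i)"
    have iso: "dotp I (T x) (T y) = dotp I x y" for x y using T(1) by (simp add: gauss_isometry_def)
    have cj: "dotp I (a j) c = dotp I (a j) (a k)" if "j \<in> J" for j
    proof -
      have "dotp I (a j) c = dotp I (T (b j)) (T (b k))"
        unfolding c_def dotp_def using T(2) that by (intro sum.cong) auto
      then show ?thesis using insert.prems that by (simp add: iso)
    qed
    have cc: "dotp I c c = dotp I (a k) (a k)"
      using insert.prems by (simp add: iso c_def)
    have fix_j: "dotp I w (a j) = 0" if "j \<in> J" for j
      using cj[OF that] by (simp add: dotp_def w_def algebra_simps sum_subtractf)
    have wc: "2 * dotp I w c = dotp I w w"
      using cc by (simp add: dotp_def w_def algebra_simps sum_subtractf sum.distrib sum_distrib_left)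
    have "reflection I w (T (b j)) i = a j i" if "j \<in> insert k J" "i \<in> I" for i j
    proof (cases "j = k")
      case True
      show ?thesis
      proof (cases "dotp I w w = 0")
        case True
        then have "\<forall>i\<in>I. w i = 0" using assms(1) by (simp add: dotp_self sum_nonneg_eq_0_iff)
        then show ?thesis using \<open>j = k\<close> that True by (auto simp: reflection_def w_def c_def)
      next
        case False
        then have "2 * (dotp I w c / dotp I w w) = 1" using wc by simp
        then have "reflection I w c i = c i - w i"
          using that unfolding reflection_def by (simp only: restrict_apply if_True mult_1)
        then show ?thesis using \<open>j = k\<close> by (simp add: w_def c_def)
      qed
    next
      case False
      then have j: "j \<in> J" using that by auto
      have "dotp I w (T (b j)) = dotp I w (a j)"
        unfolding dotp_def using T(2) j by (intro sum.cong) auto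
      then show ?thesis using fix_j[OF j] T(2) j that by (simp add: reflection_def)
    qed
    then show ?case
      using gauss_isometry_compose[OF gauss_isometry_reflection[OF assms(1), of w] T(1)]
      by (intro exI[of _ "reflection I w \<circ> T"] conjI ballI) (assumption, simp)
  qed
  then show ?thesis using that by blast
qed

lemma gauss_isometry_nn_integral:
  assumes "gauss_isometry I T" "f \<in> borel_measurable (gauss I)"
  shows "(\<integral>\<^sup>+x. f (T x) \<partial>gauss I) = (\<integral>\<^sup>+x. f x \<partial>gauss I)"
proof -
  have "(\<integral>\<^sup>+x. f x \<partial>gauss I) = (\<integral>\<^sup>+x. f x \<partial>distr (gauss I) (gauss I) T)"
    using assms by (simp add: gauss_isometry_def)
  also have "\<dots> = (\<integral>\<^sup>+x. f (T x) \<partial>gauss I)"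
    using assms by (intro nn_integral_distr) (auto simp: gauss_isometry_def)
  finally show ?thesis by simp
qed

subsection \<open>The chi distribution\<close>

definition vnorm :: "'a set \<Rightarrow> ('a \<Rightarrow> real) \<Rightarrow> real" where
  "vnorm I x = sqrt (dotp I x x)"

text \<open>The area of the unit sphere in dimension \<open>m\<close> times the normalization of the
  Gaussian density. Its reciprocal is the integral of \<open>r ^ (m - 1)\<close> against
  \<open>exp (- r\<^sup>2 / 2)\<close> over the half-line.\<close>

definition chi_const :: "nat \<Rightarrow> real" where
  "chi_const m = real m * unit_ball_vol (real m) * (1 / sqrt (2 * pi)) ^ m"

definition chi_density :: "nat \<Rightarrow> real \<Rightarrow> real" where
  "chi_density m r = chi_const m * r ^ (m - 1) * exp (- r\<^sup>2 / 2) * indicator {0..} r"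

lemma chi_const_pos: "m > 0 \<Longrightarrow> chi_const m > 0"
  by (simp add: chi_const_def)

lemma chi_density_nonneg: "0 \<le> chi_density m r"
  by (auto simp: chi_density_def chi_const_def indicator_def)

lemma borel_measurable_chi_density [measurable]: "chi_density m \<in> borel_measurable borel"
  unfolding chi_density_def by measurable

text \<open>The recursion that integration by parts would give for the Gaussian moments; here it is
  the functional equation of \<open>Gamma\<close> inside the volume of the unit ball.\<close>

lemma chi_const_step: "m > 0 \<Longrightarrow> chi_const (m + 2) = chi_const m / real m"
proof -
  assume m: "m > 0"
  have 1: "Gamma (real (m + 2) / 2 + 1) = (real m / 2 + 1) * Gamma (real m / 2 + 1)"
    using Gamma_plus1[of "real m / 2 + 1"] by (simp add: add_divide_distrib nonpos_Ints_def)
  have 2: "pi powr (real (m + 2) / 2) = pi * pi powr (real m / 2)"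
    by (simp add: add_divide_distrib powr_add)
  have G: "Gamma (real m / 2 + 1) > 0" by (rule Gamma_real_pos) (use m in auto)
  have 3: "(1 / sqrt (2 * pi)) ^ (m + 2) = (1 / sqrt (2 * pi)) ^ m / (2 * pi)"
    by (simp add: power_add power_divide)
  define g c p where "g = Gamma (real m / 2 + 1)" and "c = (1 / sqrt (2 * pi)) ^ m" and "p = pi powr (real m / 2)"
  have "g > 0" using G by (simp add: g_def)
  define h where "h = real m / 2 + 1"
  have "h > 0" and h: "real (m + 2) = 2 * h" using m by (simp_all add: h_def)
  then show ?thesis
    unfolding chi_const_def unit_ball_vol_def 1 2 3 unfolding h g_def[symmetric] c_def[symmetric] p_def[symmetric] h_def[symmetric]
    using m \<open>g > 0\<close> by (simp add: field_simps)
qed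

text \<open>Polar coordinates for radial functions. The law of the norm under Lebesgue measure is
  identified by its values on the half-lines \<open>{..a}\<close>: these are volumes of balls, and
  the density on the right is the derivative of such a volume in its radius.\<close>

lemma nn_integral_lborel_norm:
  assumes "finite A" "A \<noteq> {}" and f [measurable]: "f \<in> borel_measurable borel"
  shows "(\<integral>\<^sup>+x. f (vnorm A x) \<partial>PiM A (\<lambda>_. lborel))
    = (\<integral>\<^sup>+r. ennreal (real (card A) * unit_ball_vol (real (card A)) * r ^ (card A - 1) * indicator {0..} r) * f r \<partial>lborel)"
proof -
  interpret L: product_sigma_finite "\<lambda>_. lborel :: real measure" ..
  define m where "m = card A"
  have m: "m > 0" using assms by (auto simp: m_def card_gt_0_iff)
  define v where "v = unit_ball_vol (real m)"
  have v: "v > 0" by (simp add: v_def)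
  let ?L = "PiM A (\<lambda>_. lborel :: real measure)"
  let ?d = "\<lambda>r. real m * v * r ^ (m - 1) * indicator {0..} r :: real"
  have vm [measurable]: "vnorm A \<in> borel_measurable ?L"
    unfolding vnorm_def dotp_def by measurable
  define N1 where "N1 = distr ?L borel (vnorm A)"
  define N2 where "N2 = density lborel (\<lambda>r. ennreal (?d r))"
  have e1: "emeasure N1 {..a} = emeasure ?L ({x. vnorm A x \<le> a} \<inter> space ?L)" for a
    unfolding N1_def by (subst emeasure_distr) (auto intro!: arg_cong[where f="emeasure ?L"])
  have pos: "emeasure N1 {..a} = ennreal (v * a ^ m)" if "a > 0" for a
    using emeasure_cball_aux[OF assms(1) that] unfolding e1
    by (simp add: vnorm_def dotp_self v_def m_def)
  \<comment> \<open>For nonpositive \<open>a\<close> the set is contained in the origin, which is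
    Lebesgue null because \<open>A\<close> is nonempty.\<close>
  have neg: "emeasure N1 {..a} = 0" if "a \<le> 0" for a
  proof -
    have "{x. vnorm A x \<le> a} \<inter> space ?L \<subseteq> PiE A (\<lambda>_. {0})"
    proof
      fix x assume x: "x \<in> {x. vnorm A x \<le> a} \<inter> space ?L"
      then have "vnorm A x \<le> 0" using that by auto
      then have "(\<Sum>i\<in>A. (x i)\<^sup>2) = 0" using dotp_self_nonneg[of A x]
        by (simp add: vnorm_def flip: dotp_self)
      then have "\<forall>i\<in>A. x i = 0" using assms(1) by (simp add: sum_nonneg_eq_0_iff)
      then show "x \<in> PiE A (\<lambda>_. {0})" using x by (intro PiE_I) (auto simp: space_PiM PiE_def extensional_def)
    qed
    moreover have "emeasure ?L (PiE A (\<lambda>_. {0})) = 0"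
      using assms by (subst L.emeasure_PiM) (auto simp: card_gt_0_iff)
    moreover have "PiE A (\<lambda>_. {0}) \<in> sets ?L" using assms(1) by (intro sets_PiM_I_finite) auto
    ultimately show ?thesis unfolding e1 by (metis emeasure_mono le_zero_eq)
  qed
  have d1: "emeasure N2 {..a} = ennreal (v * (max 0 a) ^ m)" for a
  proof -
    have "emeasure N2 {..a} = (\<integral>\<^sup>+r. ennreal (?d r) * indicator {..a} r \<partial>lborel)"
      unfolding N2_def by (subst emeasure_density) auto
    also have "\<dots> = (\<integral>\<^sup>+r. ennreal (real m * v * r ^ (m - 1)) * indicator {0..max 0 a} r \<partial>lborel)"
      using m by (intro nn_integral_cong_AE AE_I[of _ _ "{0}"]) (auto simp: indicator_def)
    also have "\<dots> = ennreal (v * (max 0 a) ^ m - v * 0 ^ m)"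
    proof (rule nn_integral_FTC_Icc)
      fix x :: real
      show "((\<lambda>x. v * x ^ m) has_real_derivative real m * v * x ^ (m - 1)) (at x)"
        by (auto intro!: derivative_eq_intros)
    qed (use v in auto)
    finally show ?thesis using m by (simp add: zero_power)
  qed
  have "N1 = N2"
  proof (rule measure_eqI_generator_eq_countable[where E="range atMost" and \<Omega>=UNIV and A="range (\<lambda>n::nat. {..real n})"])
    show "Int_stable (range (atMost :: real \<Rightarrow> real set))"
      by (auto simp: Int_stable_def)
    have b: "sets borel = sigma_sets UNIV (range (atMost :: real \<Rightarrow> real set))"
      by (subst borel_eq_atMost) simp
    show "sets N1 = sigma_sets UNIV (range atMost)" "sets N2 = sigma_sets UNIV (range atMost)"
      using b by (simp_all add: N1_def N2_def)
    fix X :: "real set" assume "X \<in> range atMost"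
    then obtain a where X: "X = {..a}" by auto
    show "emeasure N1 X = emeasure N2 X"
      unfolding X d1 using pos[of a] neg[of a] m by (cases "a > 0") (auto simp: zero_power)
  next
    show "\<Union> (range (\<lambda>n::nat. {..real n})) = UNIV" using real_arch_simple by auto
  next
    fix a assume "a \<in> range (\<lambda>n::nat. {..real n})"
    then obtain n where a: "a = {..real n}" by auto
    show "emeasure N1 a \<noteq> \<infinity>"
      using pos[of "real n"] neg[of "real n"] unfolding a by (cases "n > 0") auto
  qed auto
  then have "(\<integral>\<^sup>+r. f r \<partial>N1) = (\<integral>\<^sup>+r. f r \<partial>N2)" by simp
  then show ?thesis
    unfolding N1_def N2_def m_def[symmetric] v_def[symmetric]
    by (subst (asm) nn_integral_distr, simp, simp, subst (asm) nn_integral_density) auto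
qed

lemma borel_measurable_vnorm [measurable]:
  assumes "\<And>i. i \<in> I \<Longrightarrow> (\<lambda>x. f x i) \<in> borel_measurable M"
  shows "(\<lambda>x. vnorm I (f x)) \<in> borel_measurable M"
  unfolding vnorm_def using assms by (intro measurable_compose[OF _ borel_measurable_sqrt] measurable_dotp)

lemma nn_integral_gauss_norm:
  assumes "finite A" "A \<noteq> {}" and f [measurable]: "f \<in> borel_measurable borel"
  shows "(\<integral>\<^sup>+x. f (vnorm A x) \<partial>gauss A) = (\<integral>\<^sup>+r. ennreal (chi_density (card A) r) * f r \<partial>lborel)"
proof -
  let ?c = "(1 / sqrt (2 * pi)) ^ card A"
  have m: "(\<lambda>x. f (vnorm A x)) \<in> borel_measurable (gauss A)"
    by (intro measurable_compose[OF _ f] borel_measurable_vnorm measurable_gauss_component)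
  have "(\<integral>\<^sup>+x. f (vnorm A x) \<partial>gauss A)
      = (\<integral>\<^sup>+x. ennreal (?c * exp (- (vnorm A x)\<^sup>2 / 2)) * f (vnorm A x) \<partial>PiM A (\<lambda>_. lborel))"
    by (subst nn_integral_gauss[OF assms(1) m]) (simp add: vnorm_def)
  also have "\<dots> = (\<integral>\<^sup>+r. ennreal (real (card A) * unit_ball_vol (real (card A)) * r ^ (card A - 1) * indicator {0..} r)
      * (ennreal (?c * exp (- r\<^sup>2 / 2)) * f r) \<partial>lborel)"
    by (rule nn_integral_lborel_norm[where f="\<lambda>r. ennreal (?c * exp (- r\<^sup>2 / 2)) * f r", OF assms(1,2)]) measurable
  also have "\<dots> = (\<integral>\<^sup>+r. ennreal (chi_density (card A) r) * f r \<partial>lborel)"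
  proof (rule nn_integral_cong)
    fix r :: real
    have "ennreal (real (card A) * unit_ball_vol (real (card A)) * r ^ (card A - 1) * indicator {0..} r)
      * ennreal (?c * exp (- r\<^sup>2 / 2)) = ennreal (chi_density (card A) r)"
      by (subst ennreal_mult''[symmetric]) (auto simp: chi_density_def chi_const_def mult_ac)
    then show "ennreal (real (card A) * unit_ball_vol (real (card A)) * r ^ (card A - 1) * indicator {0..} r)
      * (ennreal (?c * exp (- r\<^sup>2 / 2)) * f r) = ennreal (chi_density (card A) r) * f r"
      by (simp only: mult.assoc[symmetric])
  qed
  finally show ?thesis .
qed

lemma nn_integral_chi_density:
  assumes "m > 0"
  shows "(\<integral>\<^sup>+r. ennreal (chi_density m r) \<partial>lborel) = 1"
proof -
  have "(\<integral>\<^sup>+r. ennreal (chi_density (card {..<m}) r) * 1 \<partial>lborel) = (\<integral>\<^sup>+x. 1 \<partial>gauss {..<m})"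
    by (rule nn_integral_gauss_norm[symmetric]) (use assms in auto)
  also have "\<dots> = 1" using prob_space.emeasure_space_1[OF prob_space_gauss, of "{..<m}"] by simp
  finally show ?thesis by simp
qed

text \<open>No integral is computed: the value is forced by the total mass one of the law of the
  Gaussian norm.\<close>

lemma integral_chi_power:
  assumes "m > 0"
  shows "has_bochner_integral lborel (\<lambda>r. r ^ (m - 1) * exp (- r\<^sup>2 / 2) * indicator {0..} r) (1 / chi_const m)"
proof (rule has_bochner_integral_nn_integral)
  have "ennreal (chi_const m) * (\<integral>\<^sup>+r. ennreal (r ^ (m - 1) * exp (- r\<^sup>2 / 2) * indicator {0..} r) \<partial>lborel)
     = (\<integral>\<^sup>+r. ennreal (chi_density m r) \<partial>lborel)"
    using chi_const_pos[OF assms]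
    by (subst nn_integral_cmult[symmetric]) (auto simp: chi_density_def mult.assoc ennreal_mult' intro!: nn_integral_cong)
  then have *: "ennreal (chi_const m) * (\<integral>\<^sup>+r. ennreal (r ^ (m - 1) * exp (- r\<^sup>2 / 2) * indicator {0..} r) \<partial>lborel) = 1"
    using nn_integral_chi_density[OF assms] by simp
  have "ennreal (1 / chi_const m) * ennreal (chi_const m) = 1"
    using chi_const_pos[OF assms] by (simp flip: ennreal_mult')
  then show "(\<integral>\<^sup>+r. ennreal (r ^ (m - 1) * exp (- r\<^sup>2 / 2) * indicator {0..} r) \<partial>lborel) = ennreal (1 / chi_const m)"
    using arg_cong[OF *, of "\<lambda>z. ennreal (1 / chi_const m) * z"] unfolding mult.assoc[symmetric] by simp
  show "0 \<le> 1 / chi_const m" using chi_const_pos[OF assms] by simp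
qed (auto simp: indicator_def)

text \<open>Log-convexity of the Gaussian moments, through the weighted arithmetic-geometric mean
  \<open>2 r\<^sup>m \<le> a r\<^sup>m\<^sup>-\<^sup>1 + r\<^sup>m\<^sup>+\<^sup>1 / a\<close> with \<open>a = sqrt m\<close>.\<close>

lemma chi_const_ratio:
  assumes "m > 0"
  shows "chi_const (m + 2) / chi_const (m + 1) \<le> 1 / sqrt (real m)"
proof -
  let ?g = "\<lambda>k r. r ^ k * exp (- r\<^sup>2 / 2) * indicator {0..} (r::real) :: real"
  define a where "a = sqrt (real m)"
  have a: "a > 0" "a * a = real m" using assms by (auto simp: a_def)
  have h: "has_bochner_integral lborel (?g k) (1 / chi_const (Suc k))" for k
    using integral_chi_power[of "Suc k"] by simp
  have i: "integrable lborel (?g k)" "integral\<^sup>L lborel (?g k) = 1 / chi_const (Suc k)" for k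
    using h[of k] by (auto simp: has_bochner_integral_iff)
  have "1 / chi_const (m + 1) = integral\<^sup>L lborel (?g m)" using i(2)[of m] by simp
  also have "\<dots> \<le> integral\<^sup>L lborel (\<lambda>r. a / 2 * ?g (m - 1) r + 1 / (2 * a) * ?g (m + 1) r)"
  proof (intro integral_mono i(1) Bochner_Integration.integrable_add integrable_mult_right)
    fix r :: real
    show "?g m r \<le> a / 2 * ?g (m - 1) r + 1 / (2 * a) * ?g (m + 1) r"
    proof (cases "r \<ge> 0")
      case True
      have "0 \<le> (a - r)\<^sup>2 / (2 * a)" using a by simp
      then have "r \<le> a / 2 + r * r / (2 * a)" using a by (simp add: field_simps power2_eq_square)
      then have "r * (r ^ (m - 1) * exp (- r\<^sup>2 / 2)) \<le> (a / 2 + r * r / (2 * a)) * (r ^ (m - 1) * exp (- r\<^sup>2 / 2))"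
        using True by (intro mult_right_mono) auto
      moreover have "r ^ m = r * r ^ (m - 1)" "r ^ (m + 1) = r * r * r ^ (m - 1)"
        using assms by (cases m; simp)+
      ultimately show ?thesis using True by (simp add: algebra_simps)
    qed simp
  qed
  also have "\<dots> = a / 2 * (1 / chi_const m) + 1 / (2 * a) * (1 / chi_const (m + 2))"
    using assms i(2)[of "m - 1"] i(2)[of "m + 1"]
    by (subst Bochner_Integration.integral_add[OF integrable_mult_right[OF i(1)] integrable_mult_right[OF i(1)]])
      (simp add: mult.commute)
  \<comment> \<open>The recursion expresses the lower moment by the higher one. As
    \<open>a * a = real m\<close>, both halves of the mean become equal.\<close>
  also have "1 / chi_const m = 1 / (real m * chi_const (m + 2))"
    using chi_const_step[OF assms] assms by (simp add: field_simps)
  also have "a / 2 * (1 / (real m * chi_const (m + 2))) + 1 / (2 * a) * (1 / chi_const (m + 2)) = 1 / (a * chi_const (m + 2))"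
    unfolding a(2)[symmetric] using a(1) by (simp add: field_simps)
  finally show ?thesis
    using a(1) chi_const_pos[of "m + 1"] chi_const_pos[of "m + 2"] by (simp add: field_simps a_def)
qed

section \<open>Cubic bounds on the logarithm\<close>

lemma ln_upper_cubic:
  fixes x :: real
  assumes "x > -1"
  shows "ln (1 + x) \<le> x - x\<^sup>2 / 2 + x ^ 3 / 3"
proof -
  define g where "g = (\<lambda>x::real. x - x\<^sup>2 / 2 + x ^ 3 / 3 - ln (1 + x))"
  have d: "(g has_real_derivative (t ^ 3 / (1 + t))) (at t)" if "t > -1" for t
    unfolding g_def using that
    by (auto intro!: derivative_eq_intros simp: field_simps power2_eq_square power3_eq_cube)
  have "g 0 \<le> g x"
  proof (cases "x \<ge> 0")
    case True
    show ?thesis by (rule DERIV_nonneg_imp_nondecreasing[OF True]) (use d in force)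
  next
    case False
    then have x0: "x \<le> 0" by simp
    show ?thesis
    proof (rule DERIV_nonpos_imp_nonincreasing[OF x0])
      fix t assume t: "x \<le> t" "t \<le> 0"
      have "t ^ 3 \<le> 0" using mult_nonpos_nonneg[of t "t\<^sup>2"] t
        by (simp add: power3_eq_cube power2_eq_square mult.assoc)
      then have "t ^ 3 / (1 + t) \<le> 0" using t assms by (intro divide_nonpos_nonneg) auto
      then show "\<exists>y. (g has_real_derivative y) (at t) \<and> y \<le> 0" using d[of t] t assms by auto
    qed
  qed
  then show ?thesis by (simp add: g_def)
qed

text \<open>For negative \<open>x\<close> the difference of the two sides has derivative
  \<open>t\<^sup>2 / (1 + t) - 3 * t\<^sup>2\<close>, which is nonpositive for
  \<open>t \<ge> - 1 / 2\<close>. This is where the range of \<open>x\<close> and the coefficient 1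
  of the cube fit together.\<close>

lemma ln_lower_cubic:
  fixes x :: real
  assumes "\<bar>x\<bar> \<le> 1 / 2"
  shows "x - x\<^sup>2 / 2 - \<bar>x\<bar> ^ 3 \<le> ln (1 + x)"
proof (cases "x \<ge> 0")
  case True
  define g where "g = (\<lambda>x::real. ln (1 + x) - x + x\<^sup>2 / 2)"
  have d: "(g has_real_derivative (t\<^sup>2 / (1 + t))) (at t)" if "t > -1" for t
    unfolding g_def using that
    by (auto intro!: derivative_eq_intros simp: field_simps power2_eq_square)
  have "g 0 \<le> g x"
    by (rule DERIV_nonneg_imp_nondecreasing[OF True]) (use d in force)
  then have "x - x\<^sup>2 / 2 \<le> ln (1 + x)" by (simp add: g_def)
  then show ?thesis using zero_le_power[of "\<bar>x\<bar>" 3] by linarith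
next
  case False
  then have x0: "x \<le> 0" by simp
  define g where "g = (\<lambda>x::real. ln (1 + x) - x + x\<^sup>2 / 2 - x ^ 3)"
  have d: "(g has_real_derivative (t\<^sup>2 / (1 + t) - 3 * t\<^sup>2)) (at t)" if "t > -1" for t
    unfolding g_def using that
    by (auto intro!: derivative_eq_intros simp: field_simps power2_eq_square)
  have "g 0 \<le> g x"
  proof (rule DERIV_nonpos_imp_nonincreasing[OF x0])
    fix t assume t: "x \<le> t" "t \<le> 0"
    have "t\<^sup>2 * 1 \<le> t\<^sup>2 * (3 * (1 + t))" using t assms by (intro mult_left_mono) auto
    then have "t\<^sup>2 / (1 + t) \<le> 3 * t\<^sup>2" using t assms by (subst pos_divide_le_eq) (auto simp: algebra_simps)
    then show "\<exists>y. (g has_real_derivative y) (at t) \<and> y \<le> 0" using d[of t] t assms by force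
  qed
  then show ?thesis using x0 by (simp add: g_def power3_eq_cube)
qed

text \<open>The density of \<open>chi_dev\<close> below. The centre \<open>sqrt (real m - 1)\<close>
  is the mode of the chi density, so the exponent has no linear term, and the factor
  \<open>sqrt 2\<close> normalizes the limiting variance 1/2 of the norm.\<close>

definition chi_dev_density :: "nat \<Rightarrow> real \<Rightarrow> real" where
  "chi_dev_density m w = chi_density m (sqrt (real m - 1) + w / sqrt 2) / sqrt 2"

definition chi_dev :: "'a set \<Rightarrow> ('a \<Rightarrow> real) \<Rightarrow> real" where
  "chi_dev A x = sqrt 2 * (vnorm A x - sqrt (real (card A) - 1))"

lemma chi_dev_density_nonneg: "0 \<le> chi_dev_density m w"
  by (simp add: chi_dev_density_def chi_density_nonneg)

lemma borel_measurable_chi_dev_density [measurable]: "chi_dev_density m \<in> borel_measurable borel"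
  unfolding chi_dev_density_def by measurable

lemma borel_measurable_chi_dev: "chi_dev A \<in> borel_measurable (gauss A)"
  unfolding chi_dev_def
  by (intro borel_measurable_times borel_measurable_diff borel_measurable_const borel_measurable_vnorm
      measurable_gauss_component)

lemma nn_integral_gauss_chi_dev:
  assumes "finite A" "A \<noteq> {}" and f [measurable]: "f \<in> borel_measurable borel"
  shows "(\<integral>\<^sup>+x. f (chi_dev A x) \<partial>gauss A) = (\<integral>\<^sup>+w. ennreal (chi_dev_density (card A) w) * f w \<partial>lborel)"
proof -
  let ?a = "sqrt (real (card A) - 1)"
  have "(\<integral>\<^sup>+x. f (chi_dev A x) \<partial>gauss A) = (\<integral>\<^sup>+x. f (sqrt 2 * (vnorm A x - ?a)) \<partial>gauss A)"
    by (simp add: chi_dev_def)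
  also have "\<dots> = (\<integral>\<^sup>+r. ennreal (chi_density (card A) r) * f (sqrt 2 * (r - ?a)) \<partial>lborel)"
    by (rule nn_integral_gauss_norm[OF assms(1,2)]) measurable
  also have "\<dots> = ennreal \<bar>1 / sqrt 2\<bar> * (\<integral>\<^sup>+w. ennreal (chi_density (card A) (?a + (1 / sqrt 2) * w)) * f (sqrt 2 * (?a + (1 / sqrt 2) * w - ?a)) \<partial>lborel)"
    by (rule nn_integral_real_affine) auto
  also have "\<dots> = (\<integral>\<^sup>+w. ennreal (chi_dev_density (card A) w) * f w \<partial>lborel)"
  proof (subst nn_integral_cmult[symmetric], measurable, rule nn_integral_cong)
    fix w :: real
    show "ennreal \<bar>1 / sqrt 2\<bar> * (ennreal (chi_density (card A) (?a + (1 / sqrt 2) * w)) * f (sqrt 2 * (?a + (1 / sqrt 2) * w - ?a)))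
      = ennreal (chi_dev_density (card A) w) * f w"
      by (simp add: chi_dev_density_def mult.assoc[symmetric] chi_density_nonneg flip: ennreal_mult'')
  qed
  finally show ?thesis .
qed

text \<open>The exponent \<open>(m - 1) * (ln (1 + x) - x) - w\<^sup>2 / 4\<close> with \<open>w = sqrt 2 * sqrt (m - 1) * x\<close> of the
  density is compared with \<open>- w\<^sup>2 / 2\<close> through the cubic bounds on the logarithm.\<close>

definition chi_shape :: "real \<Rightarrow> nat \<Rightarrow> real \<Rightarrow> real" where
  "chi_shape a k w = (if 1 + w / (sqrt 2 * a) < 0 then 0
     else (1 + w / (sqrt 2 * a)) ^ k * exp (- a * w / sqrt 2 - w\<^sup>2 / 4))"

lemma chi_dev_density_shape:
  assumes "m \<ge> 2"
  defines "a \<equiv> sqrt (real m - 1)"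
  shows "chi_dev_density m w = (chi_const m * a ^ (m - 1) * exp (- a\<^sup>2 / 2) / sqrt 2) * chi_shape a (m - 1) w"
proof -
  have a: "a > 0" using assms by (simp add: a_def)
  have f: "a + w / sqrt 2 = a * (1 + w / (sqrt 2 * a))" using a by (simp add: field_simps)
  have e: "exp (- (a + w / sqrt 2)\<^sup>2 / 2) = exp (- a\<^sup>2 / 2) * exp (- a * w / sqrt 2 - w\<^sup>2 / 4)"
    unfolding exp_add[symmetric] by (simp add: power2_sum power_divide add_divide_distrib)
  have i: "a + w / sqrt 2 < 0 \<longleftrightarrow> 1 + w / (sqrt 2 * a) < 0"
    unfolding f using a by (simp add: mult_less_0_iff)
  show ?thesis
  proof (cases "a + w / sqrt 2 < 0")
    case True
    then show ?thesis using i by (simp add: chi_dev_density_def chi_density_def chi_shape_def a_def[symmetric])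
  next
    case False
    then have "chi_dev_density m w = chi_const m * (a + w / sqrt 2) ^ (m - 1) * exp (- (a + w / sqrt 2)\<^sup>2 / 2) / sqrt 2"
      by (simp add: chi_dev_density_def chi_density_def a_def[symmetric] not_less)
    also have "\<dots> = chi_const m * (a ^ (m - 1) * (1 + w / (sqrt 2 * a)) ^ (m - 1))
        * (exp (- a\<^sup>2 / 2) * exp (- a * w / sqrt 2 - w\<^sup>2 / 4)) / sqrt 2"
      unfolding e unfolding f power_mult_distrib ..
    also have "\<dots> = (chi_const m * a ^ (m - 1) * exp (- a\<^sup>2 / 2) / sqrt 2) * chi_shape a (m - 1) w"
      using False i by (simp add: chi_shape_def mult_ac)
    finally show ?thesis .
  qed
qed

lemma chi_shape_nonneg: "0 \<le> chi_shape a k w"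
  by (simp add: chi_shape_def)

lemma chi_shape_exp:
  assumes "a > 0" "real k = a\<^sup>2" "1 + w / (sqrt 2 * a) > 0"
  shows "chi_shape a k w = exp (a\<^sup>2 * (ln (1 + w / (sqrt 2 * a)) - w / (sqrt 2 * a)) - w\<^sup>2 / 4)"
proof -
  have "(1 + w / (sqrt 2 * a)) ^ k = exp (a\<^sup>2 * ln (1 + w / (sqrt 2 * a)))"
    using assms by (simp flip: assms(2) ln_realpow add: exp_of_nat_mult)
  moreover have "a\<^sup>2 * (w / (sqrt 2 * a)) = a * w / sqrt 2"
    using assms(1) by (simp add: power2_eq_square)
  ultimately show ?thesis
    using assms(3) by (simp add: chi_shape_def right_diff_distrib exp_add[symmetric])
qed

text \<open>The inequality \<open>ln (1 + x) \<le> x\<close> alone gives a Gaussian profile of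
  doubled variance. It holds uniformly in the dimension and serves as dominating function for
  integrability and moments.\<close>

lemma chi_shape_le:
  assumes "a > 0" "real k = a\<^sup>2"
  shows "chi_shape a k w \<le> exp (- w\<^sup>2 / 4)"
proof (cases "1 + w / (sqrt 2 * a) > 0")
  case True
  have "a\<^sup>2 * (ln (1 + w / (sqrt 2 * a)) - w / (sqrt 2 * a)) \<le> 0"
    using ln_add_one_self_le_self2[of "w / (sqrt 2 * a)"] True by (intro mult_nonneg_nonpos) auto
  then show ?thesis unfolding chi_shape_exp[OF assms True] by simp
next
  case False
  \<comment> \<open>At the end point of the support the base of the power is 0, so
    \<open>k > 0\<close> makes the value 0 there as well.\<close>
  have "k > 0" using assms by (cases k) auto
  then have "chi_shape a k w = 0" using False by (auto simp: chi_shape_def)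
  then show ?thesis by simp
qed

lemma sq_cube_scale:
  fixes a w :: real
  assumes "a > 0"
  shows "a\<^sup>2 * ((w / (sqrt 2 * a))\<^sup>2 / 2) = w\<^sup>2 / 4" "a\<^sup>2 * \<bar>w / (sqrt 2 * a)\<bar> ^ 3 \<le> \<bar>w\<bar> ^ 3 / a"
proof -
  show "a\<^sup>2 * ((w / (sqrt 2 * a))\<^sup>2 / 2) = w\<^sup>2 / 4"
    using assms by (simp add: power_divide power_mult_distrib)
  have "sqrt 2 ^ 3 \<ge> (1::real)" by (intro one_le_power) simp
  then have "\<bar>w\<bar> ^ 3 / (sqrt 2 ^ 3 * a) \<le> \<bar>w\<bar> ^ 3 / (1 * a)"
    using assms by (intro divide_left_mono mult_right_mono mult_pos_pos) auto
  moreover have "a\<^sup>2 * \<bar>w / (sqrt 2 * a)\<bar> ^ 3 = \<bar>w\<bar> ^ 3 / (sqrt 2 ^ 3 * a)"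
    using assms by (simp add: power_divide power_mult_distrib abs_mult power2_eq_square power3_eq_cube field_simps)
  ultimately show "a\<^sup>2 * \<bar>w / (sqrt 2 * a)\<bar> ^ 3 \<le> \<bar>w\<bar> ^ 3 / a" by simp
qed

text \<open>The tangent of the exponential gives \<open>exp h - exp g \<le> exp h * (h - g)\<close>,
  here with \<open>g = - w\<^sup>2 / 2\<close>. The cubic bound on the logarithm controls
  \<open>h - g\<close>, and \<open>chi_shape_le\<close> controls the factor
  \<open>exp h\<close>.\<close>

lemma chi_shape_upper:
  assumes a: "a > 0" "real k = a\<^sup>2"
  shows "chi_shape a k w \<le> exp (- w\<^sup>2 / 2) + exp (- w\<^sup>2 / 4) * \<bar>w\<bar> ^ 3 / a"
proof (cases "1 + w / (sqrt 2 * a) > 0")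
  case True
  define x where "x = w / (sqrt 2 * a)"
  define h where "h = a\<^sup>2 * (ln (1 + x) - x) - w\<^sup>2 / 4"
  have E: "chi_shape a k w = exp h" using chi_shape_exp[OF a True] by (simp add: h_def x_def)
  have "ln (1 + x) - x \<le> - x\<^sup>2 / 2 + \<bar>x\<bar> ^ 3"
  proof -
    have "x ^ 3 \<le> \<bar>x\<bar> ^ 3" by (metis abs_ge_self power_abs)
    moreover have "0 \<le> \<bar>x\<bar> ^ 3" by simp
    ultimately have "x ^ 3 / 3 \<le> \<bar>x\<bar> ^ 3" by linarith
    then show ?thesis using ln_upper_cubic[of x] True by (simp add: x_def)
  qed
  then have "a\<^sup>2 * (ln (1 + x) - x) \<le> a\<^sup>2 * (- x\<^sup>2 / 2 + \<bar>x\<bar> ^ 3)" by (intro mult_left_mono) auto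
  then have hw: "h + w\<^sup>2 / 2 \<le> \<bar>w\<bar> ^ 3 / a"
  proof -
    have "a\<^sup>2 * (x\<^sup>2 / 2) = w\<^sup>2 / 4" "a\<^sup>2 * \<bar>x\<bar> ^ 3 \<le> \<bar>w\<bar> ^ 3 / a"
      unfolding x_def by (rule sq_cube_scale[OF a(1)])+
    moreover have "a\<^sup>2 * (- x\<^sup>2 / 2 + \<bar>x\<bar> ^ 3) = - (a\<^sup>2 * (x\<^sup>2 / 2)) + a\<^sup>2 * \<bar>x\<bar> ^ 3"
      by (simp add: algebra_simps)
    ultimately show ?thesis
      using \<open>a\<^sup>2 * (ln (1 + x) - x) \<le> a\<^sup>2 * (- x\<^sup>2 / 2 + \<bar>x\<bar> ^ 3)\<close> unfolding h_def by linarith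
  qed
  have "exp h - exp (- w\<^sup>2 / 2) \<le> exp h * (h + w\<^sup>2 / 2)"
  proof -
    have "exp (- w\<^sup>2 / 2) = exp h * exp (- (h + w\<^sup>2 / 2))" by (simp flip: exp_add)
    moreover have "exp h * (1 + - (h + w\<^sup>2 / 2)) \<le> exp h * exp (- (h + w\<^sup>2 / 2))"
      by (intro mult_left_mono exp_ge_add_one_self) auto
    ultimately show ?thesis by (simp add: algebra_simps)
  qed
  also have "\<dots> \<le> exp h * (\<bar>w\<bar> ^ 3 / a)" using hw by (intro mult_left_mono) auto
  also have "\<dots> \<le> exp (- w\<^sup>2 / 4) * (\<bar>w\<bar> ^ 3 / a)"
    using chi_shape_le[OF a, of w] E a by (intro mult_right_mono) auto
  finally show ?thesis using E by simp
next
  case False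
  have "k > 0" using assms by (cases k) auto
  then have "chi_shape a k w = 0" using False by (auto simp: chi_shape_def)
  then show ?thesis using a by simp
qed

lemma chi_shape_lower:
  assumes a: "a > 0" "real k = a\<^sup>2" "a\<^sup>2 \<ge> 8"
  shows "exp (- w\<^sup>2 / 2) * (1 - \<bar>w\<bar> ^ 3 / a) \<le> chi_shape a k w"
proof -
  define x where "x = w / (sqrt 2 * a)"
  have cube: "a\<^sup>2 * \<bar>x\<bar> ^ 3 \<le> \<bar>w\<bar> ^ 3 / a" using sq_cube_scale(2)[OF a(1)] by (simp add: x_def)
  show ?thesis
  proof (cases "\<bar>x\<bar> \<le> 1 / 2")
    case True
    then have x1: "1 + x > 0" by linarith
    define h where "h = a\<^sup>2 * (ln (1 + x) - x) - w\<^sup>2 / 4"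
    have E: "chi_shape a k w = exp h" using chi_shape_exp[OF a(1,2)] x1 by (simp add: h_def x_def)
    have "a\<^sup>2 * (- x\<^sup>2 / 2 - \<bar>x\<bar> ^ 3) \<le> a\<^sup>2 * (ln (1 + x) - x)"
      using ln_lower_cubic[OF True] by (intro mult_left_mono) auto
    then have hw: "- w\<^sup>2 / 2 - \<bar>w\<bar> ^ 3 / a \<le> h"
      using sq_cube_scale(1)[OF a(1), of w] cube by (simp add: h_def x_def right_diff_distrib)
    have "exp (- w\<^sup>2 / 2) * (1 + - (\<bar>w\<bar> ^ 3 / a)) \<le> exp (- w\<^sup>2 / 2) * exp (- (\<bar>w\<bar> ^ 3 / a))"
      by (intro mult_left_mono exp_ge_add_one_self) auto
    also have "\<dots> = exp (- w\<^sup>2 / 2 - \<bar>w\<bar> ^ 3 / a)" by (simp flip: exp_add)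
    also have "\<dots> \<le> exp h" using hw by simp
    finally show ?thesis unfolding E by simp
  next
    case False
    \<comment> \<open>Outside the range of the logarithm bound, \<open>a\<^sup>2 \<ge> 8\<close>
      makes the cubic term at least 1. The left-hand side is then not positive and the claim is
      trivial.\<close>
    then have "(1/2) ^ 3 \<le> \<bar>x\<bar> ^ 3" by (intro power_mono) auto
    then have "8 * (1/2) ^ 3 \<le> a\<^sup>2 * \<bar>x\<bar> ^ 3" using a(3) by (intro mult_mono) auto
    then have "1 - \<bar>w\<bar> ^ 3 / a \<le> 0" using cube by (simp add: power3_eq_cube)
    then have "exp (- w\<^sup>2 / 2) * (1 - \<bar>w\<bar> ^ 3 / a) \<le> 0" by (intro mult_nonneg_nonpos) auto
    also have "0 \<le> chi_shape a k w" by (rule chi_shape_nonneg)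
    finally show ?thesis .
  qed
qed

lemma borel_measurable_chi_shape [measurable]: "chi_shape a k \<in> borel_measurable borel"
  unfolding chi_shape_def by measurable

lemma integrable_exp_quarter: "integrable lborel (\<lambda>w::real. exp (- w\<^sup>2 / 4) * \<bar>w\<bar> ^ k)"
proof -
  have "integrable lborel (\<lambda>x. sqrt (2 * pi * (sqrt 2)\<^sup>2) * (normal_density 0 (sqrt 2) x * \<bar>x - 0\<bar> ^ k))"
    by (intro integrable_mult_right integrable_normal_moment_abs) simp
  moreover have "(\<lambda>x. sqrt (2 * pi * (sqrt 2)\<^sup>2) * (normal_density 0 (sqrt 2) x * \<bar>x - 0\<bar> ^ k)) = (\<lambda>x. exp (- x\<^sup>2 / 4) * \<bar>x\<bar> ^ k)"
    by (rule ext) (simp add: normal_density_def)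
  ultimately show ?thesis by (simp only:)
qed

lemma exp_half_std_normal: "exp (- w\<^sup>2 / 2) = sqrt (2 * pi) * std_normal_density w"
  by (simp add: std_normal_density_def)

text \<open>The normalization is found without Stirling's formula. The density is \<open>K\<close>
  times \<open>chi_shape\<close> and has integral one, so \<open>K\<close> is the reciprocal of the
  integral \<open>Z\<close> of the shape, and the two-sided bounds on the shape place
  \<open>Z\<close> within O(1 / a) of \<open>sqrt (2 * pi)\<close>. Only the lower bound on the
  density is sharp; the upper one serves for moments.\<close>

lemma chi_dev_density_bounds:
  obtains C :: real where "C > 0"
    "\<And>m w. real m \<ge> C \<Longrightarrow> std_normal_density w * (1 - (C + \<bar>w\<bar> ^ 3) / sqrt (real m - 1)) \<le> chi_dev_density m w"
    "\<And>m w. real m \<ge> C \<Longrightarrow> chi_dev_density m w \<le> exp (- w\<^sup>2 / 4)"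
proof -
  define C1 where "C1 = integral\<^sup>L lborel (\<lambda>w::real. exp (- w\<^sup>2 / 4) * \<bar>w\<bar> ^ 3)"
  define C2 where "C2 = integral\<^sup>L lborel (\<lambda>w::real. std_normal_density w * \<bar>w\<bar> ^ 3)"
  have C1: "C1 \<ge> 0" unfolding C1_def by (intro integral_nonneg_AE) auto
  have C2: "C2 \<ge> 0" unfolding C2_def by (intro integral_nonneg_AE) auto
  define s where "s = sqrt (2 * pi)"
  have s: "s \<ge> 2" unfolding s_def using pi_gt3 by (intro real_le_rsqrt) auto
  \<comment> \<open>The number 10 yields \<open>a\<^sup>2 \<ge> 8\<close>. The square yields
    \<open>a \<ge> C1 + 2 * C2\<close>, hence \<open>C1 / a \<le> 1\<close> and
    \<open>C2 / a \<le> 1 / 2\<close>; the latter with \<open>s \<ge> 2\<close> gives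
    \<open>Z \<ge> 1\<close> and so \<open>K \<le> 1\<close>.\<close>
  define C where "C = 10 + C1 + (C1 + 2 * C2)\<^sup>2"
  have C0: "C > 0" using C1 by (simp add: C_def add_pos_nonneg)
  have main: "std_normal_density w * (1 - (C + \<bar>w\<bar> ^ 3) / sqrt (real m - 1)) \<le> chi_dev_density m w
      \<and> chi_dev_density m w \<le> exp (- w\<^sup>2 / 4)" if mC: "real m \<ge> C" for m w
  proof -
    have mC2: "real m \<ge> 10 + (C1 + 2 * C2)\<^sup>2" using mC C1 by (simp add: C_def)
    have m10: "real m \<ge> 10" using mC2 zero_le_power2[of "C1 + 2 * C2"] by linarith
    define a where "a = sqrt (real m - 1)"
    have a2: "a\<^sup>2 = real m - 1" using m10 by (simp add: a_def)
    have a: "a > 0" "real (m - 1) = a\<^sup>2" "a\<^sup>2 \<ge> 8" using m10 a2 by (auto simp: a_def)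
    have aC: "C1 + 2 * C2 \<le> a"
      unfolding a_def using mC2 by (intro real_le_rsqrt) simp
    define K where "K = chi_const m * a ^ (m - 1) * exp (- a\<^sup>2 / 2) / sqrt 2"
    have K0: "K > 0" using chi_const_pos[of m] a(1) m10 by (simp add: K_def)
    have p: "chi_dev_density m w = K * chi_shape a (m - 1) w" for w
      unfolding K_def a_def using m10 by (intro chi_dev_density_shape) auto
    have int: "integrable lborel (chi_shape a (m - 1))"
    proof (rule Bochner_Integration.integrable_bound[OF integrable_exp_quarter[of 0]])
      show "AE x in lborel. norm (chi_shape a (m - 1) x) \<le> norm (exp (- x\<^sup>2 / 4) * \<bar>x\<bar> ^ 0)"
        using chi_shape_le[OF a(1,2)] chi_shape_nonneg by (auto simp: abs_of_nonneg)
    qed auto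
    define Z where "Z = integral\<^sup>L lborel (chi_shape a (m - 1))"
    have KZ: "K * Z = 1"
    proof -
      have "(\<integral>\<^sup>+w. ennreal (chi_dev_density m w) \<partial>lborel) = 1"
      proof -
        have "(\<integral>\<^sup>+w. ennreal (chi_dev_density (card {..<m}) w) * 1 \<partial>lborel) = (\<integral>\<^sup>+x. 1 \<partial>gauss {..<m})"
          using m10 by (intro nn_integral_gauss_chi_dev[symmetric]) (auto simp: lessThan_empty_iff)
        then show ?thesis using prob_space.emeasure_space_1[OF prob_space_gauss, of "{..<m}"] by simp
      qed
      then have "integral\<^sup>L lborel (chi_dev_density m) = 1"
        by (subst integral_eq_nn_integral) (auto simp: chi_dev_density_nonneg)
      then show ?thesis unfolding p Z_def using int by simp
    qed
    have g: "integrable lborel (\<lambda>w::real. exp (- w\<^sup>2 / 2))" "integral\<^sup>L lborel (\<lambda>w::real. exp (- w\<^sup>2 / 2)) = s"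
      unfolding exp_half_std_normal s_def by auto
    have Zu: "Z \<le> s + C1 / a"
    proof -
      have "Z \<le> integral\<^sup>L lborel (\<lambda>w. exp (- w\<^sup>2 / 2) + exp (- w\<^sup>2 / 4) * \<bar>w\<bar> ^ 3 / a)"
        unfolding Z_def using chi_shape_upper[OF a(1,2)] int g integrable_exp_quarter[of 3]
        by (intro integral_mono) auto
      also have "\<dots> = s + C1 / a"
        using g integrable_exp_quarter[of 3] unfolding C1_def
        by (subst Bochner_Integration.integral_add) auto
      finally show ?thesis .
    qed
    have Zl: "s * (1 - C2 / a) \<le> Z"
    proof -
      have eq: "exp (- w\<^sup>2 / 2) * (1 - \<bar>w\<bar> ^ 3 / a) = s * (std_normal_density w - std_normal_density w * \<bar>w\<bar> ^ 3 / a)" for w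
        unfolding exp_half_std_normal s_def by (simp add: algebra_simps)
      have i: "integrable lborel (\<lambda>w. std_normal_density w - std_normal_density w * \<bar>w\<bar> ^ 3 / a)"
        using integrable_std_normal_moment_abs[of 3] by auto
      have "s * (1 - C2 / a) = integral\<^sup>L lborel (\<lambda>w. exp (- w\<^sup>2 / 2) * (1 - \<bar>w\<bar> ^ 3 / a))"
        unfolding eq C2_def using integrable_std_normal_moment_abs[of 3]
        by (simp add: Bochner_Integration.integral_diff)
      also have "\<dots> \<le> Z"
        unfolding Z_def using chi_shape_lower[OF a] int i
        by (intro integral_mono) (simp_all only: eq integrable_mult_right)
      finally show ?thesis .
    qed
    have Z1: "Z \<ge> 1"
    proof -
      have "C2 / a \<le> 1 / 2" using aC C1 a(1) by (simp add: field_simps)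
      then have "2 * (1 / 2) \<le> s * (1 - C2 / a)" using s by (intro mult_mono) auto
      then show ?thesis using Zl by simp
    qed
    then have K1: "K \<le> 1" using KZ K0 mult_left_mono[of 1 Z K] by simp
    \<comment> \<open>From \<open>K * Z = 1\<close> and \<open>Z \<le> s * (1 + C1 / a)\<close>.
      Multiplying by \<open>1 - C1 / a\<close> avoids a reciprocal, since
      \<open>(1 - q) * (1 + q) \<le> 1\<close>.\<close>
    have Kl: "1 - C1 / a \<le> K * s"
    proof -
      have "C1 / a * 1 \<le> C1 / a * s" using C1 a(1) s by (intro mult_left_mono) auto
      then have "Z \<le> s * (1 + C1 / a)" using Zu by (simp add: algebra_simps)
      then have "1 \<le> K * s * (1 + C1 / a)" using mult_left_mono[of Z _ K] K0 KZ by (simp add: mult.assoc)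
      then have "(1 - C1 / a) * 1 \<le> (1 - C1 / a) * (K * s * (1 + C1 / a))"
        using aC C2 a(1) by (intro mult_left_mono) (auto simp: field_simps)
      also have "\<dots> = K * s * (1 - (C1 / a)\<^sup>2)"
      proof -
        have "(1 - q) * (k * (1 + q)) = k * (1 - q\<^sup>2)" for q k :: real
          by (simp add: power2_eq_square algebra_simps)
        then show ?thesis .
      qed
      also have "\<dots> \<le> K * s * 1" using K0 s by (intro mult_left_mono) auto
      finally show ?thesis by simp
    qed
    have "chi_dev_density m w \<le> 1 * exp (- w\<^sup>2 / 4)"
      unfolding p using K1 K0 chi_shape_le[OF a(1,2), of w] chi_shape_nonneg by (intro mult_mono) auto
    moreover have "std_normal_density w * (1 - (C + \<bar>w\<bar> ^ 3) / a) \<le> chi_dev_density m w"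
    proof (cases "\<bar>w\<bar> ^ 3 / a \<le> 1")
      case False
      then have "1 - (C + \<bar>w\<bar> ^ 3) / a \<le> 0" using C0 a(1) by (simp add: field_simps)
      then have "std_normal_density w * (1 - (C + \<bar>w\<bar> ^ 3) / a) \<le> 0" by (intro mult_nonneg_nonpos) auto
      then show ?thesis using chi_dev_density_nonneg[of m w] by linarith
    next
      case True
      have "C1 / a \<le> C / a" using a(1) by (intro divide_right_mono) (auto simp: C_def)
      moreover have "0 \<le> C1 / a * (\<bar>w\<bar> ^ 3 / a)" using C1 a(1) by simp
      moreover have "(1 - q) * (1 - r) = 1 - q - r + q * r" for q r :: real
        by (simp add: algebra_simps)
      note this[of "C1 / a" "\<bar>w\<bar> ^ 3 / a"]
      ultimately have "1 - (C + \<bar>w\<bar> ^ 3) / a \<le> (1 - C1 / a) * (1 - \<bar>w\<bar> ^ 3 / a)"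
        unfolding add_divide_distrib by linarith
      also have "\<dots> \<le> K * s * (1 - \<bar>w\<bar> ^ 3 / a)" using Kl True by (intro mult_right_mono) auto
      finally have "std_normal_density w * (1 - (C + \<bar>w\<bar> ^ 3) / a) \<le> std_normal_density w * (K * s * (1 - \<bar>w\<bar> ^ 3 / a))"
        by (intro mult_left_mono) auto
      also have "\<dots> = K * (exp (- w\<^sup>2 / 2) * (1 - \<bar>w\<bar> ^ 3 / a))"
        unfolding exp_half_std_normal s_def by simp
      also have "\<dots> \<le> chi_dev_density m w"
        unfolding p using chi_shape_lower[OF a, of w] K0 by (intro mult_left_mono) auto
      finally show ?thesis .
    qed
    ultimately show ?thesis by (simp add: a_def)
  qed
  show ?thesis by (rule that[OF C0]) (use main in blast)+
qed

lemma nn_integral_std_gauss: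
  "f \<in> borel_measurable borel \<Longrightarrow> (\<integral>\<^sup>+x. f x \<partial>std_gauss) = (\<integral>\<^sup>+x. ennreal (std_normal_density x) * f x \<partial>lborel)"
  unfolding std_gauss_def by (subst nn_integral_density) auto

text \<open>For probabilities the lower density bound is applied to the complement of
  \<open>D\<close>; because both measures have mass one, it turns into an upper bound for
  \<open>D\<close> itself. Integrating the factor \<open>C0 + \<bar>w\<bar> ^ 3\<close> costs only a
  third absolute Gaussian moment.\<close>

lemma chi_dev_approx:
  obtains C :: real where "C > 0"
    "\<And>(A :: 'a set) D. finite A \<Longrightarrow> real (card A) \<ge> C \<Longrightarrow> D \<in> sets borel \<Longrightarrow>
       measure (gauss A) {x \<in> space (gauss A). chi_dev A x \<in> D} \<le> measure std_gauss D + C / sqrt (real (card A) - 1)"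
    "\<And>A :: 'a set. finite A \<Longrightarrow> real (card A) \<ge> C \<Longrightarrow> (\<integral>\<^sup>+x. ennreal ((chi_dev A x)\<^sup>2) \<partial>gauss A) \<le> ennreal C"
proof -
  obtain C0 :: real where C0: "C0 > 0"
    "\<And>m w. real m \<ge> C0 \<Longrightarrow> std_normal_density w * (1 - (C0 + \<bar>w\<bar> ^ 3) / sqrt (real m - 1)) \<le> chi_dev_density m w"
    "\<And>m w. real m \<ge> C0 \<Longrightarrow> chi_dev_density m w \<le> exp (- w\<^sup>2 / 4)"
    using chi_dev_density_bounds by blast
  define C3 where "C3 = integral\<^sup>L lborel (\<lambda>w. std_normal_density w * \<bar>w\<bar> ^ 3)"
  define C4 where "C4 = integral\<^sup>L lborel (\<lambda>w::real. exp (- w\<^sup>2 / 4) * \<bar>w\<bar> ^ 2)"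
  have C3: "C3 \<ge> 0" and C4: "C4 \<ge> 0" unfolding C3_def C4_def by (auto intro!: integral_nonneg_AE)
  define C where "C = C0 + C3 + C4 + 2"
  have "C > 0" using C0(1) C3 C4 by (simp add: C_def)
  moreover have "measure (gauss A) {x \<in> space (gauss A). chi_dev A x \<in> D} \<le> measure std_gauss D + C / sqrt (real (card A) - 1)"
    if A: "finite A" "real (card A) \<ge> C" and D: "D \<in> sets borel" for A :: "'a set" and D
  proof -
    interpret P: prob_space "gauss A" by (rule prob_space_gauss)
    interpret S: prob_space std_gauss by (rule prob_space_std_gauss)
    note [measurable] = D borel_measurable_chi_dev[of A]
    define m where "m = card A"
    have m: "real m \<ge> C0" "real m \<ge> 2" using A C0 C3 C4 by (auto simp: C_def m_def)
    define a where "a = sqrt (real m - 1)"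
    have a: "a > 0" using m by (simp add: a_def)
    have A': "A \<noteq> {}" using m by (auto simp: m_def)
    let ?E = "{x \<in> space (gauss A). chi_dev A x \<in> D}" and ?E' = "{x \<in> space (gauss A). chi_dev A x \<in> - D}"
    have i3: "(\<integral>\<^sup>+w. ennreal (std_normal_density w * ((C0 + \<bar>w\<bar> ^ 3) / a)) \<partial>lborel) = ennreal ((C0 + C3) / a)"
    proof -
      have eq: "std_normal_density w * ((C0 + \<bar>w\<bar> ^ 3) / a) = (C0 / a) * std_normal_density w + (1 / a) * (std_normal_density w * \<bar>w\<bar> ^ 3)" for w
        by (simp add: algebra_simps add_divide_distrib)
      have i: "integrable lborel (\<lambda>w. std_normal_density w * ((C0 + \<bar>w\<bar> ^ 3) / a))"
        unfolding eq by (intro Bochner_Integration.integrable_add integrable_mult_right integrable_std_normal_moment_abs integrable_normal_density) auto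
      have "integral\<^sup>L lborel (\<lambda>w. std_normal_density w * ((C0 + \<bar>w\<bar> ^ 3) / a)) = C0 / a + 1 / a * C3"
        unfolding eq C3_def using integrable_std_normal_moment_abs[of 3]
        by (subst Bochner_Integration.integral_add) auto
      then show ?thesis using i C0(1) a
        by (subst nn_integral_eq_integral) (auto simp: add_divide_distrib)
    qed
    have "ennreal (measure std_gauss (- D)) = emeasure std_gauss (- D)" by (simp add: S.emeasure_eq_measure)
    also have "\<dots> = (\<integral>\<^sup>+w. ennreal (std_normal_density w) * indicator (- D) w \<partial>lborel)"
      unfolding std_gauss_def by (subst emeasure_density) auto
    also have "\<dots> \<le> (\<integral>\<^sup>+w. ennreal (chi_dev_density m w) * indicator (- D) w + ennreal (std_normal_density w * ((C0 + \<bar>w\<bar> ^ 3) / a)) \<partial>lborel)"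
    proof (rule nn_integral_mono)
      fix w :: real
      have "std_normal_density w \<le> chi_dev_density m w + std_normal_density w * ((C0 + \<bar>w\<bar> ^ 3) / a)"
        using C0(2)[OF m(1), of w] by (simp add: a_def algebra_simps)
      then have "ennreal (std_normal_density w) \<le> ennreal (chi_dev_density m w) + ennreal (std_normal_density w * ((C0 + \<bar>w\<bar> ^ 3) / a))"
        using C0(1) a by (subst ennreal_plus[symmetric]) (auto intro: chi_dev_density_nonneg ennreal_leI)
      then show "ennreal (std_normal_density w) * indicator (- D) w \<le> ennreal (chi_dev_density m w) * indicator (- D) w + ennreal (std_normal_density w * ((C0 + \<bar>w\<bar> ^ 3) / a))"
        by (auto simp: indicator_def)
    qed
    also have "\<dots> = (\<integral>\<^sup>+w. ennreal (chi_dev_density m w) * indicator (- D) w \<partial>lborel) + ennreal ((C0 + C3) / a)"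
      unfolding i3[symmetric] by (rule nn_integral_add) measurable
    also have "(\<integral>\<^sup>+w. ennreal (chi_dev_density m w) * indicator (- D) w \<partial>lborel) = (\<integral>\<^sup>+x. indicator (- D) (chi_dev A x) \<partial>gauss A)"
      unfolding m_def by (rule nn_integral_gauss_chi_dev[symmetric, OF A(1) A']) measurable
    also have "\<dots> = (\<integral>\<^sup>+x. indicator ?E' x \<partial>gauss A)"
      by (intro nn_integral_cong) (auto simp: indicator_def)
    also have "\<dots> = ennreal (measure (gauss A) ?E')" by (subst nn_integral_indicator) (auto simp: P.emeasure_eq_measure)
    also have "ennreal (measure (gauss A) ?E') + ennreal ((C0 + C3) / a) = ennreal (measure (gauss A) ?E' + (C0 + C3) / a)"
      using C0(1) C3 a by simp
    finally have "measure std_gauss (- D) \<le> measure (gauss A) ?E' + (C0 + C3) / a"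
      using C0(1) C3 a by (subst (asm) ennreal_le_iff) auto
    moreover have "measure std_gauss (- D) = 1 - measure std_gauss D"
      using S.prob_compl[of D] by (simp add: Compl_eq_Diff_UNIV)
    moreover have "measure (gauss A) ?E' = 1 - measure (gauss A) ?E"
      by (subst P.prob_compl[symmetric]) (auto intro!: arg_cong[where f="measure (gauss A)"])
    moreover have "(C0 + C3) / a \<le> C / a" using a C4 by (intro divide_right_mono) (auto simp: C_def)
    ultimately show ?thesis by (simp add: a_def m_def)
  qed
  moreover have "(\<integral>\<^sup>+x. ennreal ((chi_dev A x)\<^sup>2) \<partial>gauss A) \<le> ennreal C"
    if A: "finite A" "real (card A) \<ge> C" for A :: "'a set"
  proof -
    define m where "m = card A"
    have m: "real m \<ge> C0" "real m \<ge> 2" using A C0 C3 C4 by (auto simp: C_def m_def)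
    have A': "A \<noteq> {}" using m by (auto simp: m_def)
    have "(\<integral>\<^sup>+x. ennreal ((chi_dev A x)\<^sup>2) \<partial>gauss A) = (\<integral>\<^sup>+w. ennreal (chi_dev_density m w) * ennreal (w\<^sup>2) \<partial>lborel)"
      unfolding m_def by (rule nn_integral_gauss_chi_dev[OF A(1) A', where f="\<lambda>w. ennreal (w\<^sup>2)"]) measurable
    also have "\<dots> \<le> (\<integral>\<^sup>+w. ennreal (exp (- w\<^sup>2 / 4) * \<bar>w\<bar> ^ 2) \<partial>lborel)"
      using C0(3)[OF m(1)]
      by (intro nn_integral_mono) (auto simp: chi_dev_density_nonneg ennreal_mult''[symmetric] intro!: ennreal_leI mult_right_mono)
    also have "\<dots> = ennreal C4"
      unfolding C4_def by (rule nn_integral_eq_integral[OF integrable_exp_quarter]) auto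
    also have "\<dots> \<le> ennreal C" using C0 C3 by (intro ennreal_leI) (auto simp: C_def)
    finally show ?thesis .
  qed
  ultimately show ?thesis using that by blast
qed

subsection \<open>Spherical caps\<close>

text \<open>The inserted factor \<open>y / a\<close> is at least 1 on the tail and makes the
  integrand an exact derivative.\<close>

lemma mills_bound:
  assumes "a > 0"
  shows "emeasure std_gauss {a..} \<le> ennreal (exp (- a\<^sup>2 / 2) / (a * sqrt (2 * pi)))"
proof -
  have "emeasure std_gauss {a..} = (\<integral>\<^sup>+y. ennreal (std_normal_density y) * indicator {a..} y \<partial>lborel)"
    unfolding std_gauss_def by (subst emeasure_density) auto
  also have "\<dots> \<le> (\<integral>\<^sup>+y. ennreal (y / a * std_normal_density y) * indicator {a..} y \<partial>lborel)"
  proof (intro nn_integral_mono)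
    fix y
    have "std_normal_density y * 1 \<le> std_normal_density y * (y / a)" if "y \<ge> a"
      using that assms by (intro mult_left_mono) auto
    then show "ennreal (std_normal_density y) * indicator {a..} y \<le> ennreal (y / a * std_normal_density y) * indicator {a..} y"
      by (auto simp: indicator_def mult.commute intro!: ennreal_leI)
  qed
  also have "\<dots> = ennreal (0 - (- std_normal_density a / a))"
  proof (rule nn_integral_FTC_atLeast[where F="\<lambda>y. - std_normal_density y / a"])
    show "(\<lambda>y. y / a * std_normal_density y) \<in> borel_measurable borel" by measurable
    fix y assume "a \<le> y"
    then show "0 \<le> y / a * std_normal_density y" using assms by simp
    show "((\<lambda>y. - std_normal_density y / a) has_real_derivative y / a * std_normal_density y) (at y)"
      using assms unfolding std_normal_density_def
      by (auto intro!: derivative_eq_intros simp: field_simps)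
  next
    have "((\<lambda>x::real. exp (- (x\<^sup>2 / 2))) \<longlongrightarrow> 0) at_top"
      using filterlim_tendsto_pos_mult_at_top[of "\<lambda>_. 1/2" "1/2" at_top "\<lambda>x::real. x\<^sup>2"]
      by (intro filterlim_compose[OF exp_at_bot] filterlim_compose[OF filterlim_uminus_at_bot_at_top])
         (simp add: filterlim_pow_at_top filterlim_ident)
    then have "((\<lambda>x. - (1 / sqrt (2 * pi) * exp (- (x\<^sup>2 / 2))) / a) \<longlongrightarrow> - (1 / sqrt (2 * pi) * 0) / a) at_top"
      using assms by (intro tendsto_intros) auto
    then show "((\<lambda>y. - std_normal_density y / a) \<longlongrightarrow> 0) at_top"
      by (simp add: std_normal_density_def)
  qed
  also have "0 - (- std_normal_density a / a) = exp (- a\<^sup>2 / 2) / (a * sqrt (2 * pi))"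
    by (simp add: std_normal_density_def mult.commute)
  finally show ?thesis .
qed

lemma vnorm_nonneg [simp]: "0 \<le> vnorm I x"
  by (simp add: vnorm_def)

lemma vnorm_sq: "(vnorm I x)\<^sup>2 = dotp I x x"
  by (simp add: vnorm_def)

text \<open>Here \<open>s\<close> is the sine of the half-angle of the cap in dimension
  \<open>n\<close>. The shift by 3 comes from the ratio of two chi constants.\<close>

definition cap_bound :: "nat \<Rightarrow> real \<Rightarrow> real" where
  "cap_bound n s = s ^ (n - 1) / (sqrt (1 - s\<^sup>2) * sqrt (2 * pi * (real n - 3)))"

text \<open>With \<open>u\<^sup>2 + s\<^sup>2 = 1\<close> the cap condition says that
  \<open>x k\<close> is at least \<open>u / s\<close> times the norm of the other coordinates. Given
  that norm, Mills' bound applies; integrating it against the chi density leaves another chi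
  integral, rescaled by \<open>s\<close>, which produces the power of \<open>s\<close> and the ratio
  of constants.\<close>

lemma emeasure_axis_cap:
  assumes I: "finite I" "k \<in> I" "card I = n" "n \<ge> 4" and s: "0 < s" "s < 1"
  shows "emeasure (gauss I) {x \<in> space (gauss I). sqrt (1 - s\<^sup>2) * vnorm I x \<le> x k} \<le> ennreal (cap_bound n s)"
proof -
  define u where "u = sqrt (1 - s\<^sup>2)"
  have s2: "s\<^sup>2 < 1" using s by (simp add: power_less_one_iff abs_square_less_1)
  have u: "u > 0" "u\<^sup>2 = 1 - s\<^sup>2" using s2 by (auto simp: u_def)
  define J where "J = I - {k}"
  have J: "finite J" "k \<notin> J" "I = insert k J" using I by (auto simp: J_def)
  define m where "m = card J"
  have m: "m = n - 1" using I by (simp add: m_def J_def)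
  have Jne: "J \<noteq> {}" using m I m_def by auto
  let ?E = "{x \<in> space (gauss I). u * vnorm I x \<le> x k}"
  note [measurable] = measurable_gauss_component[OF I(2)]
  have vm [measurable]: "vnorm I \<in> borel_measurable (gauss I)"
    by (intro borel_measurable_vnorm measurable_gauss_component)
  have E: "?E \<in> sets (gauss I)" by measurable
  \<comment> \<open>At \<open>r = 0\<close> Mills' bound has no meaning and the trivial bound 1
    replaces it; that single point is Lebesgue null.\<close>
  define B where "B = (\<lambda>r::real. if r > 0 then ennreal (exp (- (u / s * r)\<^sup>2 / 2) / (u / s * r * sqrt (2 * pi))) else 1)"
  have B [measurable]: "B \<in> borel_measurable borel" unfolding B_def by measurable
  have "emeasure (gauss I) ?E = (\<integral>\<^sup>+x. indicator ?E x \<partial>gauss I)" using E by simp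
  also have "\<dots> = (\<integral>\<^sup>+x. (\<integral>\<^sup>+y. indicator ?E (x(k := y)) \<partial>std_gauss) \<partial>gauss J)"
    using E unfolding J(3) by (subst G.product_nn_integral_insert[OF J(1,2)]) auto
  also have "\<dots> \<le> (\<integral>\<^sup>+x. B (vnorm J x) \<partial>gauss J)"
  proof (rule nn_integral_mono)
    fix x assume x: "x \<in> space (gauss J)"
    define a where "a = u / s * vnorm J x"
    have sub: "indicator ?E (x(k := y)) \<le> (indicator {a..} y :: ennreal)" for y
    proof (cases "x(k := y) \<in> ?E")
      case True
      then have le: "u * vnorm I (x(k := y)) \<le> y" by simp
      have "dotp I (x(k := y)) (x(k := y)) = y\<^sup>2 + dotp J x x"
        unfolding J(3) using J(1,2) by (auto simp: dotp_self intro!: sum.cong)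
      then have N: "(vnorm I (x(k := y)))\<^sup>2 = y\<^sup>2 + (vnorm J x)\<^sup>2" by (simp add: vnorm_sq)
      have y0: "y \<ge> 0" using le u by (meson mult_nonneg_nonneg order_trans vnorm_nonneg less_imp_le)
      have "(u * vnorm I (x(k := y)))\<^sup>2 \<le> y\<^sup>2"
        using le u by (intro power_mono mult_nonneg_nonneg) auto
      then have "u\<^sup>2 * (vnorm J x)\<^sup>2 \<le> (1 - u\<^sup>2) * y\<^sup>2" unfolding power_mult_distrib N by (simp add: algebra_simps)
      then have "(u * vnorm J x)\<^sup>2 \<le> (s * y)\<^sup>2" unfolding u(2) power_mult_distrib by simp
      then have "u * vnorm J x \<le> s * y" by (rule power2_le_imp_le) (use s y0 in simp)
      then have "a \<le> y" using s by (simp add: a_def pos_divide_le_eq mult.commute)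
      then show ?thesis by (simp add: indicator_def)
    qed simp
    have "(\<integral>\<^sup>+y. indicator ?E (x(k := y)) \<partial>std_gauss) \<le> (\<integral>\<^sup>+y. indicator {a..} y \<partial>std_gauss)"
      by (intro nn_integral_mono sub)
    also have "\<dots> = emeasure std_gauss {a..}" by simp
    also have "\<dots> \<le> B (vnorm J x)"
    proof (cases "vnorm J x > 0")
      case True
      then have "a > 0" using s u by (simp add: a_def)
      then show ?thesis using mills_bound[of a] True by (simp add: B_def a_def)
    next
      case False
      then show ?thesis using prob_space.emeasure_le_1[OF prob_space_std_gauss] by (simp add: B_def)
    qed
    finally show "(\<integral>\<^sup>+y. indicator ?E (x(k := y)) \<partial>std_gauss) \<le> B (vnorm J x)" .
  qed
  also have "\<dots> = (\<integral>\<^sup>+r. ennreal (chi_density m r) * B r \<partial>lborel)"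
    unfolding m_def by (rule nn_integral_gauss_norm[OF J(1) Jne]) measurable
  also have "\<dots> = (\<integral>\<^sup>+r. ennreal (chi_const m * s / (u * sqrt (2 * pi)) * (r ^ (m - 2) * exp (- (r / s)\<^sup>2 / 2) * indicator {0..} r)) \<partial>lborel)"
  proof (intro nn_integral_cong_AE AE_I[of _ _ "{0}"])
    show "{x \<in> space lborel. ennreal (chi_density m x) * B x \<noteq>
        ennreal (chi_const m * s / (u * sqrt (2 * pi)) * (x ^ (m - 2) * exp (- (x / s)\<^sup>2 / 2) * indicator {0..} x))} \<subseteq> {0}"
    proof safe
      fix r :: real
      assume ne: "ennreal (chi_density m r) * B r \<noteq>
        ennreal (chi_const m * s / (u * sqrt (2 * pi)) * (r ^ (m - 2) * exp (- (r / s)\<^sup>2 / 2) * indicator {0..} r))"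
      show "r = 0"
      proof (rule ccontr)
        assume "r \<noteq> 0"
        then consider "r > 0" | "r < 0" by linarith
        then show False
        proof cases
          case 1
          \<comment> \<open>The identity \<open>1 + (u / s)\<^sup>2 = 1 / s\<^sup>2\<close> merges
            both exponentials into one, so the substitution \<open>r = s * t\<close> restores a chi
            integral.\<close>
          have e: "exp (- r\<^sup>2 / 2) * exp (- (u / s * r)\<^sup>2 / 2) = exp (- (r / s)\<^sup>2 / 2)"
            unfolding exp_add[symmetric] power_mult_distrib power_divide u(2) using s by (simp add: field_simps)
          have "m - 1 = Suc (m - 2)" using m I by simp
          then have "r ^ (m - 1) = r * r ^ (m - 2)" by (simp only: power_Suc)
          then have "chi_density m r * (exp (- (u / s * r)\<^sup>2 / 2) / (u / s * r * sqrt (2 * pi)))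
            = chi_const m * s / (u * sqrt (2 * pi)) * (r ^ (m - 2) * (exp (- r\<^sup>2 / 2) * exp (- (u / s * r)\<^sup>2 / 2)) * indicator {0..} r)"
            using 1 u s by (simp add: chi_density_def field_simps)
          then have "ennreal (chi_density m r) * B r = ennreal (chi_const m * s / (u * sqrt (2 * pi)) * (r ^ (m - 2) * exp (- (r / s)\<^sup>2 / 2) * indicator {0..} r))"
            unfolding e using 1 u s
            by (simp add: B_def chi_density_nonneg flip: ennreal_mult')
          then show False using ne by simp
        qed (use ne in \<open>simp add: chi_density_def\<close>)
      qed
    qed
  qed auto
  also have "\<dots> = ennreal \<bar>s\<bar> * (\<integral>\<^sup>+t. ennreal (chi_const m * s / (u * sqrt (2 * pi)) * ((0 + s * t) ^ (m - 2) * exp (- ((0 + s * t) / s)\<^sup>2 / 2) * indicator {0..} (0 + s * t))) \<partial>lborel)"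
    using s by (intro nn_integral_real_affine) auto
  also have "\<dots> = ennreal s * (\<integral>\<^sup>+t. ennreal (chi_const m * s / (u * sqrt (2 * pi)) * s ^ (m - 2)) * ennreal (t ^ (m - 2) * exp (- t\<^sup>2 / 2) * indicator {0..} t) \<partial>lborel)"
  proof -
    have "chi_const m * s / (u * sqrt (2 * pi)) * ((0 + s * t) ^ (m - 2) * exp (- ((0 + s * t) / s)\<^sup>2 / 2) * indicator {0..} (0 + s * t))
       = chi_const m * s / (u * sqrt (2 * pi)) * s ^ (m - 2) * (t ^ (m - 2) * exp (- t\<^sup>2 / 2) * indicator {0..} t)" for t
      using s by (auto simp: indicator_def power_mult_distrib zero_le_mult_iff)
    moreover have "0 \<le> chi_const m * s / (u * sqrt (2 * pi)) * s ^ (m - 2)"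
      using chi_const_pos[of m] m I s u by simp
    ultimately show ?thesis using s by (simp only: ennreal_mult' abs_of_pos)
  qed
  also have "\<dots> = ennreal s * (ennreal (chi_const m * s / (u * sqrt (2 * pi)) * s ^ (m - 2)) * ennreal (1 / chi_const (m - 1)))"
  proof -
    have "m - 1 > 0" using m I by simp
    from integral_chi_power[OF this]
    have "(\<integral>\<^sup>+t. ennreal (t ^ (m - 1 - 1) * exp (- t\<^sup>2 / 2) * indicator {0..} t) \<partial>lborel) = ennreal (1 / chi_const (m - 1))"
      by (subst nn_integral_eq_integral) (auto simp: has_bochner_integral_iff indicator_def)
    then show ?thesis by (subst nn_integral_cmult) (auto simp: numeral_2_eq_2)
  qed
  also have "\<dots> = ennreal (s * (chi_const m * s / (u * sqrt (2 * pi)) * s ^ (m - 2) * (1 / chi_const (m - 1))))"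
    using chi_const_pos[of m] chi_const_pos[of "m - 1"] m I s u by (simp flip: ennreal_mult')
  also have "s * (chi_const m * s / (u * sqrt (2 * pi)) * s ^ (m - 2) * (1 / chi_const (m - 1)))
     = s ^ m / (u * sqrt (2 * pi)) * (chi_const m / chi_const (m - 1))"
  proof -
    have "m = Suc (Suc (m - 2))" using m I by simp
    then have "s ^ m = s * s * s ^ (m - 2)" using power_Suc[of s "Suc (m - 2)"] by simp
    then show ?thesis by simp
  qed
  also have "ennreal \<dots> \<le> ennreal (s ^ m / (u * sqrt (2 * pi)) * (1 / sqrt (real n - 3)))"
  proof (intro ennreal_leI mult_left_mono)
    \<comment> \<open>With \<open>m = n - 1\<close> the ratio bound is taken at
      \<open>n - 3\<close>, which is positive by \<open>n \<ge> 4\<close>.\<close>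
    have "m = (n - 3) + 2" "m - 1 = (n - 3) + 1" using m I by auto
    then show "chi_const m / chi_const (m - 1) \<le> 1 / sqrt (real n - 3)"
      using chi_const_ratio[of "n - 3"] I by (simp add: of_nat_diff)
  qed (use s u in auto)
  also have "s ^ m / (u * sqrt (2 * pi)) * (1 / sqrt (real n - 3)) = cap_bound n s"
    by (simp add: cap_bound_def m u_def real_sqrt_mult)
  finally show ?thesis by (simp add: u_def)
qed

lemma dotp_scale_left: "dotp I (\<lambda>i. c * x i) y = c * dotp I x y"
  by (simp add: dotp_def sum_distrib_left mult.assoc)

lemma dotp_scale_right: "dotp I x (\<lambda>i. c * y i) = c * dotp I x y"
  by (simp add: dotp_def sum_distrib_left mult_ac)

text \<open>A vector of the length of \<open>w\<close> along axis \<open>k\<close> is carried to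
  \<open>w\<close> by an isometry, which reduces the cap around \<open>w\<close> to the one around
  the axis.\<close>

lemma emeasure_cap:
  assumes I: "finite I" "card I = n" "n \<ge> 4" and s: "0 < s" "s < 1" and w: "vnorm I w > 0"
  shows "emeasure (gauss I) {x \<in> space (gauss I). sqrt (1 - s\<^sup>2) * vnorm I w * vnorm I x \<le> dotp I w x} \<le> ennreal (cap_bound n s)"
proof -
  have "I \<noteq> {}" using I by auto
  then obtain k where k: "k \<in> I" by auto
  define b where "b = (\<lambda>i. if i = k then vnorm I w else 0)"
  have bx: "dotp I b x = vnorm I w * x k" for x
    using k I(1) by (simp add: dotp_def b_def if_distrib[of "\<lambda>z. z * _"] cong: if_cong)
  have "dotp I w w = dotp I b b" by (simp add: bx) (simp add: b_def vnorm_sq flip: power2_eq_square)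
  then obtain T where T: "gauss_isometry I T" and Tb: "\<And>i. i \<in> I \<Longrightarrow> T b i = w i"
    using gram_isometry[of I "{()}" "\<lambda>_. w" "\<lambda>_. b"] I(1) by auto
  have iso: "dotp I (T x) (T y) = dotp I x y" for x y using T by (simp add: gauss_isometry_def)
  have wT: "dotp I w (T x) = dotp I b x" for x
  proof -
    have "dotp I w (T x) = dotp I (T b) (T x)" unfolding dotp_def by (intro sum.cong) (auto simp: Tb)
    then show ?thesis by (simp add: iso)
  qed
  have vT: "vnorm I (T x) = vnorm I x" for x by (simp add: vnorm_def iso)
  define E where "E = {x \<in> space (gauss I). sqrt (1 - s\<^sup>2) * vnorm I w * vnorm I x \<le> dotp I w x}"
  have [measurable]: "(\<lambda>x. vnorm I x) \<in> borel_measurable (gauss I)" "(\<lambda>x. dotp I w x) \<in> borel_measurable (gauss I)"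
    by (intro borel_measurable_vnorm measurable_dotp measurable_gauss_component borel_measurable_const; assumption)+
  have E: "E \<in> sets (gauss I)" unfolding E_def by measurable
  have Tm: "T \<in> gauss I \<rightarrow>\<^sub>M gauss I" using T by (simp add: gauss_isometry_def)
  have "emeasure (gauss I) E = (\<integral>\<^sup>+x. indicator E x \<partial>gauss I)" using E by simp
  also have "\<dots> = (\<integral>\<^sup>+x. indicator E (T x) \<partial>gauss I)"
    using E by (intro gauss_isometry_nn_integral[symmetric] T) auto
  also have "\<dots> = (\<integral>\<^sup>+x. indicator {x \<in> space (gauss I). sqrt (1 - s\<^sup>2) * vnorm I x \<le> x k} x \<partial>gauss I)"
  proof (rule nn_integral_cong)
    fix x assume x: "x \<in> space (gauss I)"
    have "T x \<in> space (gauss I)" using measurable_space[OF Tm x] .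
    moreover have "sqrt (1 - s\<^sup>2) * vnorm I w * vnorm I x \<le> vnorm I w * x k \<longleftrightarrow> sqrt (1 - s\<^sup>2) * vnorm I x \<le> x k"
    proof -
      have "sqrt (1 - s\<^sup>2) * vnorm I w * vnorm I x = vnorm I w * (sqrt (1 - s\<^sup>2) * vnorm I x)" by simp
      then show ?thesis using w by (simp only: mult_le_cancel_left_pos)
    qed
    ultimately show "indicator E (T x) = (indicator {x \<in> space (gauss I). sqrt (1 - s\<^sup>2) * vnorm I x \<le> x k} x :: ennreal)"
      using x by (simp add: E_def indicator_def wT vT bx)
  qed
  also have "\<dots> = emeasure (gauss I) {x \<in> space (gauss I). sqrt (1 - s\<^sup>2) * vnorm I x \<le> x k}"
    using \<open>(\<lambda>x. vnorm I x) \<in> borel_measurable (gauss I)\<close> measurable_gauss_component[OF k]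
    by (intro nn_integral_indicator borel_measurable_le borel_measurable_times borel_measurable_const)
  also have "\<dots> \<le> ennreal (cap_bound n s)" by (rule emeasure_axis_cap[OF I(1) k I(2,3) s])
  finally show ?thesis by (simp add: E_def)
qed

subsection \<open>Sums of independent spherical vectors\<close>

declare measurable_dotp [measurable del] borel_measurable_vnorm [measurable del]

definition xsum :: "'i set \<Rightarrow> 's set \<Rightarrow> ('s \<Rightarrow> real) \<Rightarrow> ('s \<Rightarrow> 'i \<Rightarrow> real) \<Rightarrow> 'i \<Rightarrow> real" where
  "xsum I S c G = (\<lambda>t. \<Sum>s\<in>S. c s * G s t / vnorm I (G s))"

text \<open>This formula and the next show that the length of the sum and its inner products are
  functions of a Gram matrix; an isometry applied to all vectors leaves them unchanged.\<close>

lemma dotp_xsum: "dotp I (xsum I S c G) v = (\<Sum>s\<in>S. c s / vnorm I (G s) * dotp I (G s) v)"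
  unfolding dotp_def xsum_def sum_distrib_right sum_distrib_left by (subst sum.swap) (simp add: mult_ac)

lemma dotp_xsum_self:
  "dotp I (xsum I S c G) (xsum I S c G)
    = (\<Sum>s\<in>S. \<Sum>s'\<in>S. c s / vnorm I (G s) * (c s' / vnorm I (G s')) * dotp I (G s') (G s))"
proof -
  have "dotp I (G s) (xsum I S c G) = (\<Sum>s'\<in>S. c s' / vnorm I (G s') * dotp I (G s') (G s))" for s
    by (subst dotp_commute) (rule dotp_xsum)
  then show ?thesis unfolding dotp_xsum[of I S c G "xsum I S c G"] by (simp only: sum_distrib_left mult.assoc)
qed

lemma measurable_gauss_nested:
  assumes "s \<in> S" "t \<in> I"
  shows "(\<lambda>G. G s t) \<in> borel_measurable (PiM S (\<lambda>_. gauss I))"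
  using measurable_compose[OF measurable_component_singleton[OF assms(1), of "\<lambda>_. gauss I"]
      measurable_gauss_component[OF assms(2)]] .

lemma prob_space_nested: "prob_space (PiM S (\<lambda>_. gauss I))"
  by (intro prob_space_PiM prob_space_gauss)

interpretation GG: product_sigma_finite "\<lambda>_. gauss I" for I
  by (intro product_sigma_finite.intro prob_space_imp_sigma_finite prob_space_gauss)

lemma nested_isometry:
  assumes "finite S" "gauss_isometry I T" and f: "f \<in> borel_measurable (PiM S (\<lambda>_. gauss I))"
  shows "(\<integral>\<^sup>+G. f (compose S T G) \<partial>PiM S (\<lambda>_. gauss I)) = (\<integral>\<^sup>+G. f G \<partial>PiM S (\<lambda>_. gauss I))"
proof -
  let ?M = "PiM S (\<lambda>_. gauss I)"
  have T: "T \<in> gauss I \<rightarrow>\<^sub>M gauss I" "distr (gauss I) (gauss I) T = gauss I"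
    using assms(2) by (auto simp: gauss_isometry_def)
  have m: "compose S T \<in> ?M \<rightarrow>\<^sub>M ?M"
    unfolding compose_def by (intro measurable_restrict measurable_compose[OF _ T(1)] measurable_component_singleton)
  have "distr ?M ?M (compose S T) = ?M"
    using distr_PiM_finite_prob_space'[OF assms(1) prob_space_gauss prob_space_gauss T(1)] T(2) by simp
  then have "(\<integral>\<^sup>+G. f G \<partial>?M) = (\<integral>\<^sup>+G. f G \<partial>distr ?M ?M (compose S T))" by simp
  also have "\<dots> = (\<integral>\<^sup>+G. f (compose S T G) \<partial>?M)" using m f by (intro nn_integral_distr) auto
  finally show ?thesis by simp
qed

lemma AE_vnorm_pos:
  assumes "finite I" "I \<noteq> {}"
  shows "AE x in gauss I. vnorm I x > 0"
proof -
  have [measurable]: "(\<lambda>x. vnorm I x) \<in> borel_measurable (gauss I)"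
    by (intro borel_measurable_vnorm measurable_gauss_component)
  have "emeasure (gauss I) {x \<in> space (gauss I). vnorm I x = 0}
      = (\<integral>\<^sup>+x. indicator {x \<in> space (gauss I). vnorm I x = 0} x \<partial>gauss I)"
    by (rule nn_integral_indicator[symmetric]) measurable
  also have "\<dots> = (\<integral>\<^sup>+x. indicator {0} (vnorm I x) \<partial>gauss I)"
    by (intro nn_integral_cong) (auto simp: indicator_def)
  also have "\<dots> = (\<integral>\<^sup>+r. ennreal (chi_density (card I) r) * indicator {0} r \<partial>lborel)"
    by (rule nn_integral_gauss_norm[OF assms]) measurable
  also have "\<dots> = 0"
    by (rule nn_integral_zero'[OF AE_I[of _ _ "{0}"]]) (auto simp: indicator_def split: if_splits)
  finally have "emeasure (gauss I) {x \<in> space (gauss I). vnorm I x = 0} = 0" .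
  then have "AE x in gauss I. vnorm I x \<noteq> 0"
    by (intro AE_I[of _ _ "{x \<in> space (gauss I). vnorm I x = 0}"]) auto
  then show ?thesis by eventually_elim (simp add: less_le)
qed

text \<open>The direction of the sum is uniform: by rotation invariance the fixed vector may be replaced by an
  independent Gaussian one, and then the cap bound applies conditionally on the sum.\<close>

lemma emeasure_xsum_cap:
  fixes S :: "'s set" and I :: "'i set"
  assumes I: "finite I" "card I = n" "n \<ge> 4" and S: "finite S" and s: "0 < s" "s < 1" and v: "vnorm I v > 0"
  shows "emeasure (PiM S (\<lambda>_. gauss I))
     {G \<in> space (PiM S (\<lambda>_. gauss I)). vnorm I (xsum I S c G) > 0 \<and>
        sqrt (1 - s\<^sup>2) * vnorm I (xsum I S c G) * vnorm I v \<le> dotp I (xsum I S c G) v} \<le> ennreal (cap_bound n s)"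
proof -
  let ?M = "PiM S (\<lambda>_. gauss I)"
  let ?X = "xsum I S c"
  interpret M: prob_space ?M by (rule prob_space_nested)
  interpret g: prob_space "gauss I" by (rule prob_space_gauss)
  interpret P: pair_sigma_finite ?M "gauss I" ..
  have Ine: "I \<noteq> {}" using I by auto
  define q where "q = (\<lambda>G v. if vnorm I (?X G) > 0 \<and> sqrt (1 - s\<^sup>2) * vnorm I (?X G) * vnorm I v \<le> dotp I (?X G) v then 1 else 0 :: ennreal)"
  have Xm: "(\<lambda>G. ?X G t) \<in> borel_measurable ?M" if "t \<in> I" for t
    unfolding xsum_def using that
    by (intro borel_measurable_sum borel_measurable_divide borel_measurable_times borel_measurable_const
        borel_measurable_vnorm measurable_gauss_nested)
  have qm: "(\<lambda>G. q G v) \<in> borel_measurable ?M" for v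
  proof -
    have "(\<lambda>G. vnorm I (?X G)) \<in> borel_measurable ?M" "(\<lambda>G. dotp I (?X G) v) \<in> borel_measurable ?M"
      by (intro borel_measurable_vnorm measurable_dotp Xm borel_measurable_const; assumption)+
    then show ?thesis
      unfolding q_def by (intro measurable_If borel_measurable_const sets.sets_Collect_conj borel_measurable_less
        borel_measurable_le borel_measurable_times)
  qed
  have qm2: "(\<lambda>(G, g). q G g) \<in> borel_measurable (?M \<Otimes>\<^sub>M gauss I)"
  proof -
    have 1: "(\<lambda>p. ?X (fst p) t) \<in> borel_measurable (?M \<Otimes>\<^sub>M gauss I)" if "t \<in> I" for t
      using measurable_compose[OF measurable_fst Xm[OF that]] .
    have 2: "(\<lambda>p. snd p t) \<in> borel_measurable (?M \<Otimes>\<^sub>M gauss I)" if "t \<in> I" for t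
      using measurable_compose[OF measurable_snd measurable_gauss_component[OF that]] .
    have "(\<lambda>p. vnorm I (?X (fst p))) \<in> borel_measurable (?M \<Otimes>\<^sub>M gauss I)"
      "(\<lambda>p. vnorm I (snd p)) \<in> borel_measurable (?M \<Otimes>\<^sub>M gauss I)"
      "(\<lambda>p. dotp I (?X (fst p)) (snd p)) \<in> borel_measurable (?M \<Otimes>\<^sub>M gauss I)"
      by (intro borel_measurable_vnorm measurable_dotp 1 2; assumption)+
    then show ?thesis
      unfolding q_def split_beta by (intro measurable_If borel_measurable_const sets.sets_Collect_conj borel_measurable_less
        borel_measurable_le borel_measurable_times)
  qed
  define h where "h = (\<lambda>v. \<integral>\<^sup>+G. q G v \<partial>?M)"
  have hg: "h v = h g" if g: "vnorm I g > 0" for g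
  proof -
    \<comment> \<open>The vector \<open>b\<close> points along \<open>g\<close> and has the length
      of \<open>v\<close>, so an isometry carries it to \<open>v\<close>. The cap condition is
      homogeneous in \<open>v\<close>, hence the rescaling is harmless.\<close>
    define b where "b = (\<lambda>i. (vnorm I v / vnorm I g) * g i)"
    have "dotp I v v = dotp I b b"
      unfolding b_def dotp_scale_left dotp_scale_right using g
      by (simp add: vnorm_sq[symmetric] power2_eq_square)
    then obtain T where T: "gauss_isometry I T" and Tb: "\<And>i. i \<in> I \<Longrightarrow> T b i = v i"
      using gram_isometry[of I "{()}" "\<lambda>_. v" "\<lambda>_. b"] I(1) by auto
    have iso: "dotp I (T x) (T y) = dotp I x y" for x y using T by (simp add: gauss_isometry_def)
    have vT: "vnorm I (T x) = vnorm I x" for x by (simp add: vnorm_def iso)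
    have xv: "dotp I (T x) v = vnorm I v / vnorm I g * dotp I x g" for x
    proof -
      have "dotp I (T x) v = dotp I (T x) (T b)" unfolding dotp_def by (intro sum.cong) (auto simp: Tb)
      then show ?thesis unfolding iso unfolding b_def dotp_scale_right .
    qed
    have "h v = (\<integral>\<^sup>+G. q (compose S T G) v \<partial>?M)"
      unfolding h_def by (rule nested_isometry[OF S T qm, symmetric])
    also have "\<dots> = h g"
      unfolding h_def
    proof (rule nn_integral_cong)
      fix G assume "G \<in> space ?M"
      have C: "compose S T G i = T (G i)" if "i \<in> S" for i using that by (simp add: compose_def)
      have "dotp I (?X (compose S T G)) (?X (compose S T G)) = dotp I (?X G) (?X G)"
        unfolding dotp_xsum_self by (intro sum.cong) (simp_all add: C vT iso)
      then have 1: "vnorm I (?X (compose S T G)) = vnorm I (?X G)" by (simp add: vnorm_def)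
      have "dotp I (?X (compose S T G)) v = (\<Sum>i\<in>S. vnorm I v / vnorm I g * (c i / vnorm I (G i) * dotp I (G i) g))"
        unfolding dotp_xsum by (intro sum.cong) (simp_all add: C vT xv mult_ac)
      then have 2: "dotp I (?X (compose S T G)) v = vnorm I v / vnorm I g * dotp I (?X G) g"
        unfolding dotp_xsum by (simp add: sum_distrib_left)
      have "sqrt (1 - s\<^sup>2) * vnorm I (?X G) * vnorm I v \<le> vnorm I v / vnorm I g * dotp I (?X G) g
          \<longleftrightarrow> sqrt (1 - s\<^sup>2) * vnorm I (?X G) * vnorm I g \<le> dotp I (?X G) g"
      proof -
        have "sqrt (1 - s\<^sup>2) * vnorm I (?X G) * vnorm I v
           = vnorm I v / vnorm I g * (sqrt (1 - s\<^sup>2) * vnorm I (?X G) * vnorm I g)" using g by simp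
        then show ?thesis using v g by (simp only: mult_le_cancel_left_pos divide_pos_pos)
      qed
      then show "q (compose S T G) v = q G g" unfolding q_def 1 2 by simp
    qed
    finally show ?thesis .
  qed
  have "h v = (\<integral>\<^sup>+g. h v \<partial>gauss I)" using g.emeasure_space_1 by simp
  also have "\<dots> = (\<integral>\<^sup>+g. h g \<partial>gauss I)"
    by (intro nn_integral_cong_AE) (use AE_vnorm_pos[OF I(1) Ine] in \<open>auto elim!: eventually_mono intro: hg\<close>)
  also have "\<dots> = (\<integral>\<^sup>+G. (\<integral>\<^sup>+g. q G g \<partial>gauss I) \<partial>?M)"
    unfolding h_def by (rule P.Fubini'[OF qm2])
  also have "\<dots> \<le> (\<integral>\<^sup>+G. ennreal (cap_bound n s) \<partial>?M)"
  proof (rule nn_integral_mono)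
    fix G assume "G \<in> space ?M"
    show "(\<integral>\<^sup>+g. q G g \<partial>gauss I) \<le> ennreal (cap_bound n s)"
    proof (cases "vnorm I (?X G) > 0")
      case True
      have vd: "(\<lambda>x. vnorm I x) \<in> borel_measurable (gauss I)" "(\<lambda>x. dotp I (?X G) x) \<in> borel_measurable (gauss I)"
        by (intro borel_measurable_vnorm measurable_dotp measurable_gauss_component borel_measurable_const; assumption)+
      have "(\<integral>\<^sup>+g. q G g \<partial>gauss I)
        = (\<integral>\<^sup>+g. indicator {x \<in> space (gauss I). sqrt (1 - s\<^sup>2) * vnorm I (?X G) * vnorm I x \<le> dotp I (?X G) x} g \<partial>gauss I)"
        by (intro nn_integral_cong) (use True in \<open>auto simp: q_def indicator_def\<close>)
      also have "\<dots> = emeasure (gauss I) {x \<in> space (gauss I). sqrt (1 - s\<^sup>2) * vnorm I (?X G) * vnorm I x \<le> dotp I (?X G) x}"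
        using vd by (intro nn_integral_indicator borel_measurable_le borel_measurable_times borel_measurable_const)
      also have "\<dots> \<le> ennreal (cap_bound n s)" by (rule emeasure_cap[OF I s True])
      finally show ?thesis .
    qed (simp add: q_def)
  qed
  also have "\<dots> = ennreal (cap_bound n s)" using M.emeasure_space_1 by simp
  finally have "h v \<le> ennreal (cap_bound n s)" .
  moreover have "h v = emeasure ?M {G \<in> space ?M. vnorm I (?X G) > 0 \<and> sqrt (1 - s\<^sup>2) * vnorm I (?X G) * vnorm I v \<le> dotp I (?X G) v}"
    (is "_ = emeasure ?M ?E")
  proof -
    have "?E = (\<lambda>G. q G v) -` {1} \<inter> space ?M" by (auto simp: q_def split: if_splits)
    then have "?E \<in> sets ?M" using measurable_sets[OF qm, of "{1}" v] by simp
    then have "emeasure ?M ?E = (\<integral>\<^sup>+G. indicator ?E G \<partial>?M)" by simp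
    also have "\<dots> = h v"
      unfolding h_def by (intro nn_integral_cong) (auto simp: q_def indicator_def)
    finally show ?thesis by simp
  qed
  ultimately show ?thesis by simp
qed

lemma vnorm_xsum_measurable:
  "(\<lambda>G. vnorm I (xsum I S c G)) \<in> borel_measurable (PiM S (\<lambda>_. gauss I))"
  "(\<lambda>G. dotp I (xsum I S c G) v) \<in> borel_measurable (PiM S (\<lambda>_. gauss I))"
  unfolding xsum_def
  by (intro borel_measurable_vnorm measurable_dotp borel_measurable_sum borel_measurable_divide borel_measurable_times
      borel_measurable_const measurable_gauss_nested; assumption)+

text \<open>By the arithmetic-geometric mean inequality, \<open>\<bar>v - X\<bar> \<le> r\<close> puts \<open>X\<close> in the cap around \<open>v\<close>
  of the tangent cone to the ball of radius \<open>r\<close>, whatever the length of \<open>X\<close>.\<close>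

lemma emeasure_xsum_near:
  fixes S :: "'s set" and I :: "'i set"
  assumes I: "finite I" "card I = n" "n \<ge> 4" and S: "finite S" and r: "0 < r" "r < vnorm I v"
  shows "emeasure (PiM S (\<lambda>_. gauss I))
     {G \<in> space (PiM S (\<lambda>_. gauss I)). dotp I (\<lambda>t. v t - xsum I S c G t) (\<lambda>t. v t - xsum I S c G t) \<le> r\<^sup>2}
     \<le> ennreal (cap_bound n (r / vnorm I v))"
proof -
  let ?M = "PiM S (\<lambda>_. gauss I)"
  let ?X = "xsum I S c"
  define s where "s = r / vnorm I v"
  have v: "vnorm I v > 0" and s: "0 < s" "s < 1" using r by (auto simp: s_def)
  have "emeasure ?M {G \<in> space ?M. dotp I (\<lambda>t. v t - ?X G t) (\<lambda>t. v t - ?X G t) \<le> r\<^sup>2}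
     \<le> emeasure ?M {G \<in> space ?M. vnorm I (?X G) > 0 \<and> sqrt (1 - s\<^sup>2) * vnorm I (?X G) * vnorm I v \<le> dotp I (?X G) v}"
  proof (rule emeasure_mono)
    show "{G \<in> space ?M. dotp I (\<lambda>t. v t - ?X G t) (\<lambda>t. v t - ?X G t) \<le> r\<^sup>2}
      \<subseteq> {G \<in> space ?M. vnorm I (?X G) > 0 \<and> sqrt (1 - s\<^sup>2) * vnorm I (?X G) * vnorm I v \<le> dotp I (?X G) v}"
    proof safe
      fix G assume G: "dotp I (\<lambda>t. v t - ?X G t) (\<lambda>t. v t - ?X G t) \<le> r\<^sup>2"
      define x where "x = vnorm I (?X G)"
      define d where "d = dotp I (?X G) v"
      have ex: "dotp I (\<lambda>t. v t - ?X G t) (\<lambda>t. v t - ?X G t) = (vnorm I v)\<^sup>2 - 2 * d + x\<^sup>2"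
        unfolding x_def d_def vnorm_sq
        by (simp add: dotp_def algebra_simps sum_subtractf sum.distrib sum_distrib_left)
      \<comment> \<open>Up to a square, the length of the tangent from the origin to the ball of
        radius \<open>r\<close> around \<open>v\<close>.\<close>
      have u2: "(sqrt (1 - s\<^sup>2) * vnorm I v)\<^sup>2 = (vnorm I v)\<^sup>2 - r\<^sup>2"
      proof -
        have "s\<^sup>2 \<le> 1" using s by (simp add: power_le_one)
        then show ?thesis using v by (simp add: power_mult_distrib s_def power_divide algebra_simps)
      qed
      have "2 * ((sqrt (1 - s\<^sup>2) * vnorm I v) * x) \<le> (sqrt (1 - s\<^sup>2) * vnorm I v)\<^sup>2 + x\<^sup>2"
        using sum_squares_bound[of "sqrt (1 - s\<^sup>2) * vnorm I v" x] by (simp add: mult.assoc)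
      then show le: "sqrt (1 - s\<^sup>2) * vnorm I (?X G) * vnorm I v \<le> dotp I (?X G) v"
        using G unfolding ex u2 x_def[symmetric] d_def[symmetric] by (simp add: mult_ac)
      \<comment> \<open>By \<open>r < vnorm I v\<close> the origin lies outside the ball, so a sum
        of length 0 cannot be near \<open>v\<close>.\<close>
      show "vnorm I (?X G) > 0"
      proof (rule ccontr)
        assume "\<not> vnorm I (?X G) > 0"
        then have x0: "x = 0" using vnorm_nonneg[of I "?X G"] by (simp add: x_def)
        then have "(\<Sum>i\<in>I. (?X G i)\<^sup>2) = 0" by (simp add: x_def vnorm_def dotp_self)
        then have "\<forall>i\<in>I. ?X G i = 0" using I(1) by (simp add: sum_nonneg_eq_0_iff)
        then have "d = 0" by (simp add: d_def dotp_def)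
        then have "(vnorm I v)\<^sup>2 \<le> r\<^sup>2" using G x0 unfolding ex by simp
        moreover have "r\<^sup>2 < (vnorm I v)\<^sup>2" using r by (intro power_strict_mono) auto
        ultimately show False by simp
      qed
    qed
    show "{G \<in> space ?M. vnorm I (?X G) > 0 \<and> sqrt (1 - s\<^sup>2) * vnorm I (?X G) * vnorm I v \<le> dotp I (?X G) v} \<in> sets ?M"
      by (intro sets.sets_Collect_conj borel_measurable_less borel_measurable_le borel_measurable_times
          borel_measurable_const vnorm_xsum_measurable)
  qed
  also have "\<dots> \<le> ennreal (cap_bound n s)" by (rule emeasure_xsum_cap[OF I S s v])
  finally show ?thesis by (simp add: s_def)
qed

subsection \<open>Triangularization of Gaussian vectors\<close>

text \<open>Vectors are numbered from 1 but coordinates from 0, so vector \<open>j\<close> keeps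
  \<open>j\<close> free coordinates and coordinate \<open>j\<close> absorbs the length of the rest.
  The inner product of vectors \<open>i < j\<close> is governed by entry \<open>i\<close> of vector
  \<open>j\<close>; coordinate 0 occurs only in error terms.\<close>

definition triang :: "nat \<Rightarrow> nat \<Rightarrow> (nat \<Rightarrow> real) \<Rightarrow> nat \<Rightarrow> real" where
  "triang n j g = (\<lambda>l\<in>{..<n}. if l < j then g l else if l = j then vnorm {j..<n} g else 0)"

definition gram_invariant :: "'i set \<Rightarrow> 's set \<Rightarrow> (('s \<Rightarrow> 'i \<Rightarrow> real) \<Rightarrow> ennreal) \<Rightarrow> bool" where
  "gram_invariant I S \<psi> \<longleftrightarrow> (\<forall>G G'. G \<in> space (PiM S (\<lambda>_. gauss I)) \<longrightarrow> G' \<in> space (PiM S (\<lambda>_. gauss I)) \<longrightarrow>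
     (\<forall>s\<in>S. \<forall>s'\<in>S. dotp I (G s) (G s') = dotp I (G' s) (G' s')) \<longrightarrow> \<psi> G = \<psi> G')"

lemma measurable_triang: "triang n j \<in> gauss {..<n} \<rightarrow>\<^sub>M gauss {..<n}"
proof (rule measurable_to_gauss)
  have v: "(\<lambda>x. vnorm {j..<n} x) \<in> borel_measurable (gauss {..<n})"
    by (intro borel_measurable_vnorm measurable_gauss_component) auto
  fix i assume i: "i \<in> {..<n}"
  consider "i < j" | "i = j" | "i > j" by linarith
  then show "(\<lambda>x. triang n j x i) \<in> borel_measurable (gauss {..<n})"
    unfolding triang_def using i v measurable_gauss_component[OF i] by cases simp_all
qed (auto simp: triang_def)

lemma triang_dotp_same:
  assumes "j < n"
  shows "dotp {..<n} (triang n j g) (triang n j g) = dotp {..<n} g g"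
proof -
  have U: "{..<n} = {..<j} \<union> {j..<n}" "{j..<n} = insert j {Suc j..<n}" using assms by auto
  have split: "dotp {..<n} x x = dotp {..<j} x x + dotp {j..<n} x x" for x :: "nat \<Rightarrow> real"
    unfolding dotp_def U(1) by (rule sum.union_disjoint) auto
  have 1: "dotp {..<j} (triang n j g) (triang n j g) = dotp {..<j} g g"
    unfolding dotp_def by (intro sum.cong) (use assms in \<open>auto simp: triang_def\<close>)
  have "dotp {Suc j..<n} (triang n j g) (triang n j g) = 0"
    unfolding dotp_def by (intro sum.neutral) (auto simp: triang_def)
  then have "dotp {j..<n} (triang n j g) (triang n j g) = (triang n j g j)\<^sup>2"
    unfolding U(2) by (simp add: dotp_def power2_eq_square)
  also have "\<dots> = dotp {j..<n} g g" using assms by (simp add: triang_def vnorm_sq)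
  finally show ?thesis unfolding split 1 by simp
qed

lemma triang_dotp_other:
  assumes "\<And>l. l \<ge> j \<Longrightarrow> l < n \<Longrightarrow> y l = 0"
  shows "dotp {..<n} y (triang n j g) = dotp {..<n} y g"
  unfolding dotp_def by (intro sum.cong) (use assms in \<open>auto simp: triang_def not_less\<close>)

text \<open>Given the first vectors, the joint law of their inner products with the next one depends only on their
  Gram matrix, so they may be replaced by triangular vectors; then only the first coordinates of the next
  vector matter.\<close>

lemma nn_integral_triang:
  assumes "m < n" "\<psi> \<in> borel_measurable (PiM {1..m} (\<lambda>_. gauss {..<n}))" "gram_invariant {..<n} {1..m} \<psi>"
  shows "(\<integral>\<^sup>+G. \<psi> G \<partial>PiM {1..m} (\<lambda>_. gauss {..<n}))
    = (\<integral>\<^sup>+G. \<psi> (\<lambda>j\<in>{1..m}. triang n j (G j)) \<partial>PiM {1..m} (\<lambda>_. gauss {..<n}))"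
  using assms
proof (induction m arbitrary: \<psi>)
  case 0
  show ?case by (intro nn_integral_cong) (auto simp: space_PiM)
next
  case (Suc m)
  let ?I = "{..<n}"
  let ?M = "\<lambda>m. PiM {1..m} (\<lambda>_. gauss ?I)"
  have S: "{1..Suc m} = insert (Suc m) {1..m}" "Suc m \<notin> {1..m}" "finite {1..m}" by auto
  define \<tau> where "\<tau> = (\<lambda>m (G :: nat \<Rightarrow> nat \<Rightarrow> real). \<lambda>j\<in>{1..m}. triang n j (G j))"
  have \<psi>m: "\<psi> \<in> borel_measurable (PiM (insert (Suc m) {1..m}) (\<lambda>_. gauss ?I))"
    using Suc.prems(2) unfolding S(1) .
  have inv: "\<psi> G = \<psi> G'" if "G \<in> space (?M (Suc m))" "G' \<in> space (?M (Suc m))"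
    "\<And>i j. i \<in> {1..Suc m} \<Longrightarrow> j \<in> {1..Suc m} \<Longrightarrow> dotp ?I (G i) (G j) = dotp ?I (G' i) (G' j)" for G G'
    using Suc.prems(3) that unfolding gram_invariant_def by blast
  have sp: "x(Suc m := y) \<in> space (?M (Suc m))" if "x \<in> space (?M m)" "y \<in> space (gauss ?I)" for x y
    unfolding S(1) using that by (auto simp: space_PiM PiE_def extensional_def)
  have tm: "\<tau> m \<in> ?M m \<rightarrow>\<^sub>M ?M m" for m
    unfolding \<tau>_def by (intro measurable_restrict measurable_compose[OF _ measurable_triang] measurable_component_singleton)
  have tsp: "triang n j g \<in> space (gauss ?I)" for j g by (auto simp: space_PiM triang_def)
  define \<psi>' where "\<psi>' = (\<lambda>x. \<integral>\<^sup>+y. \<psi> (x(Suc m := y)) \<partial>gauss ?I)"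
  have \<psi>'m: "\<psi>' \<in> borel_measurable (?M m)"
    unfolding \<psi>'_def using \<psi>m S by measurable
  have secm: "(\<lambda>y. \<psi> (x(Suc m := y))) \<in> borel_measurable (gauss ?I)" if "x \<in> space (?M m)" for x
    using measurable_compose[OF measurable_component_update[OF that S(2)] \<psi>m] .
  have \<psi>'i: "gram_invariant ?I {1..m} \<psi>'"
    unfolding gram_invariant_def
  proof (intro allI impI)
    fix G G' assume G: "G \<in> space (?M m)" "G' \<in> space (?M m)"
      and eq: "\<forall>s\<in>{1..m}. \<forall>s'\<in>{1..m}. dotp ?I (G s) (G s') = dotp ?I (G' s) (G' s')"
    \<comment> \<open>Equal Gram matrices provide an isometry from the second family to the first.
      Applied to the integration variable, it turns one inner integral into the other.\<close>
    obtain T where T: "gauss_isometry ?I T" and TG: "\<And>j i. j \<in> {1..m} \<Longrightarrow> i \<in> ?I \<Longrightarrow> T (G' j) i = G j i"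
      using gram_isometry[of ?I "{1..m}" G G'] eq by auto
    have Tm: "T \<in> gauss ?I \<rightarrow>\<^sub>M gauss ?I" and iso: "\<And>x y. dotp ?I (T x) (T y) = dotp ?I x y"
      using T by (auto simp: gauss_isometry_def)
    have GT: "dotp ?I (G j) (T y) = dotp ?I (G' j) y" if "j \<in> {1..m}" for j y
    proof -
      have "dotp ?I (G j) (T y) = dotp ?I (T (G' j)) (T y)"
        unfolding dotp_def by (intro sum.cong) (simp_all only: TG[OF that])
      then show ?thesis by (simp add: iso)
    qed
    have "\<psi>' G = (\<integral>\<^sup>+y. \<psi> (G(Suc m := T y)) \<partial>gauss ?I)"
      unfolding \<psi>'_def by (rule gauss_isometry_nn_integral[OF T secm[OF G(1)], symmetric])
    also have "\<dots> = \<psi>' G'"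
      unfolding \<psi>'_def
    proof (intro nn_integral_cong inv sp G)
      fix y assume y: "y \<in> space (gauss ?I)"
      show "y \<in> space (gauss ?I)" "T y \<in> space (gauss ?I)" using y measurable_space[OF Tm y] by auto
      have GT': "dotp ?I (T y) (G j) = dotp ?I y (G' j)" if "j \<in> {1..m}" for j
        using GT[OF that, of y] dotp_commute[of ?I "G j" "T y"] dotp_commute[of ?I "G' j" y] by argo
      fix i j assume "i \<in> {1..Suc m}" "j \<in> {1..Suc m}"
      then show "dotp ?I ((G(Suc m := T y)) i) ((G(Suc m := T y)) j) = dotp ?I ((G'(Suc m := y)) i) ((G'(Suc m := y)) j)"
        using GT GT' iso eq
        by (cases "i = Suc m"; cases "j = Suc m") (auto simp: le_Suc_eq)
    qed
    finally show "\<psi>' G = \<psi>' G'" .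
  qed
  have \<tau>S: "\<tau> (Suc m) (x(Suc m := y)) = (\<tau> m x)(Suc m := triang n (Suc m) y)" for x y
    unfolding \<tau>_def by (auto simp: fun_eq_iff)
  have "(\<integral>\<^sup>+G. \<psi> G \<partial>?M (Suc m)) = (\<integral>\<^sup>+x. \<psi>' x \<partial>?M m)"
    unfolding S(1) \<psi>'_def by (rule GG.product_nn_integral_insert[OF S(3,2) \<psi>m])
  also have "\<dots> = (\<integral>\<^sup>+x. \<psi>' (\<tau> m x) \<partial>?M m)"
    unfolding \<tau>_def using Suc.prems(1) by (intro Suc.IH[OF _ \<psi>'m \<psi>'i]) auto
  also have "\<dots> = (\<integral>\<^sup>+x. (\<integral>\<^sup>+y. \<psi> (\<tau> (Suc m) (x(Suc m := y))) \<partial>gauss ?I) \<partial>?M m)"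
    unfolding \<psi>'_def
  proof (intro nn_integral_cong)
    fix x y assume x: "x \<in> space (?M m)" and y: "y \<in> space (gauss ?I)"
    have tx: "\<tau> m x \<in> space (?M m)" by (rule measurable_space[OF tm x])
    \<comment> \<open>The earlier triangular vectors vanish from coordinate \<open>Suc m\<close> on.
      Collapsing that part of \<open>y\<close> to its norm therefore changes no inner
      product.\<close>
    show "\<psi> ((\<tau> m x)(Suc m := y)) = \<psi> (\<tau> (Suc m) (x(Suc m := y)))"
      unfolding \<tau>S
    proof (intro inv sp tx y tsp)
      fix i j assume "i \<in> {1..Suc m}" "j \<in> {1..Suc m}"
      moreover have t: "dotp ?I (\<tau> m x i) (triang n (Suc m) y) = dotp ?I (\<tau> m x i) y" if "i \<in> {1..m}" for i
        by (rule triang_dotp_other) (use that in \<open>auto simp: \<tau>_def triang_def\<close>)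
      moreover have "dotp ?I (triang n (Suc m) y) (\<tau> m x i) = dotp ?I y (\<tau> m x i)" if "i \<in> {1..m}" for i
        using t[OF that] dotp_commute[of ?I "\<tau> m x i" y] dotp_commute[of ?I "\<tau> m x i" "triang n (Suc m) y"] by argo
      moreover have "dotp ?I (triang n (Suc m) y) (triang n (Suc m) y) = dotp ?I y y"
        by (rule triang_dotp_same) (use Suc.prems(1) in auto)
      ultimately show "dotp ?I (((\<tau> m x)(Suc m := y)) i) (((\<tau> m x)(Suc m := y)) j)
          = dotp ?I (((\<tau> m x)(Suc m := triang n (Suc m) y)) i) (((\<tau> m x)(Suc m := triang n (Suc m) y)) j)"
        by (cases "i = Suc m"; cases "j = Suc m") (auto simp: le_Suc_eq)
    qed
  qed
  also have "\<dots> = (\<integral>\<^sup>+G. \<psi> (\<tau> (Suc m) G) \<partial>?M (Suc m))"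
    unfolding S(1)
    by (rule GG.product_nn_integral_insert[OF S(3,2), symmetric])
       (rule measurable_compose[OF tm[of "Suc m", unfolded S(1)] \<psi>m])
  finally show ?case unfolding \<tau>_def .
qed

subsection \<open>Linear images of Gaussian vectors\<close>

lemma nn_integral_PiM_reindex:
  assumes "prob_space N" "inj_on r I" "r ` I \<subseteq> L" and f: "f \<in> borel_measurable (PiM I (\<lambda>_. N))"
  shows "(\<integral>\<^sup>+g. f g \<partial>PiM I (\<lambda>_. N)) = (\<integral>\<^sup>+g. f (\<lambda>i\<in>I. g (r i)) \<partial>PiM L (\<lambda>_. N))"
proof -
  have m: "(\<lambda>g. \<lambda>i\<in>I. g (r i)) \<in> PiM L (\<lambda>_. N) \<rightarrow>\<^sub>M PiM I (\<lambda>_. N)"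
    using assms(3) by (intro measurable_restrict measurable_component_singleton) auto
  have "distr (PiM L (\<lambda>_. N)) (PiM I (\<lambda>_. N)) (\<lambda>g. \<lambda>i\<in>I. g (r i)) = PiM I (\<lambda>_. N)"
    using assms by (intro distr_PiM_reindex) auto
  then have "(\<integral>\<^sup>+g. f g \<partial>PiM I (\<lambda>_. N)) = (\<integral>\<^sup>+g. f g \<partial>distr (PiM L (\<lambda>_. N)) (PiM I (\<lambda>_. N)) (\<lambda>g. \<lambda>i\<in>I. g (r i)))" by simp
  also have "\<dots> = (\<integral>\<^sup>+g. f (\<lambda>i\<in>I. g (r i)) \<partial>PiM L (\<lambda>_. N))"
    using m f by (intro nn_integral_distr) auto
  finally show ?thesis .
qed

lemma polyhedron_measurable:
  assumes "finite K"
  shows "{g \<in> space (gauss I). \<forall>i\<in>K. dotp I (A i) g \<le> z i} \<in> sets (gauss I)"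
  by (rule sets.sets_Collect_finite_All[OF _ assms])
     (intro borel_measurable_le measurable_dotp measurable_gauss_component borel_measurable_const; assumption)

text \<open>The law of a linear image of a Gaussian vector depends on its covariance matrix only. Both index
  sets are embedded in their disjoint sum.\<close>

lemma gauss_linear_law:
  fixes I :: "'a set" and J :: "'b set" and K :: "'c set"
  assumes fin: "finite I" "finite J" "finite K"
    and cov: "\<And>i j. i \<in> K \<Longrightarrow> j \<in> K \<Longrightarrow> dotp I (A i) (A j) = dotp J (B i) (B j)"
  shows "emeasure (gauss I) {g \<in> space (gauss I). \<forall>i\<in>K. dotp I (A i) g \<le> z i}
       = emeasure (gauss J) {g \<in> space (gauss J). \<forall>i\<in>K. dotp J (B i) g \<le> z i}"
proof -
  define L where "L = Inl ` I \<union> Inr ` J"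
  have L: "finite L" using fin by (simp add: L_def)
  define A' where "A' = (\<lambda>i (x :: 'a + 'b). case x of Inl a \<Rightarrow> A i a | Inr b \<Rightarrow> 0)"
  define B' where "B' = (\<lambda>i (x :: 'a + 'b). case x of Inl a \<Rightarrow> 0 | Inr b \<Rightarrow> B i b)"
  have sL: "(\<Sum>x\<in>L. h x) = (\<Sum>a\<in>I. h (Inl a)) + (\<Sum>b\<in>J. h (Inr b))" for h :: "'a + 'b \<Rightarrow> real"
    unfolding L_def using fin by (subst sum.union_disjoint) (auto simp: sum.reindex)
  have dA: "dotp L (A' i) x = dotp I (A i) (\<lambda>a. x (Inl a))" for i x
    by (simp add: dotp_def sL A'_def)
  have dB: "dotp L (B' i) x = dotp J (B i) (\<lambda>b. x (Inr b))" for i x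
    by (simp add: dotp_def sL B'_def)
  have "dotp L (B' i) (B' j) = dotp L (A' i) (A' j)" if "i \<in> K" "j \<in> K" for i j
    using cov[OF that] unfolding dA dB by (simp add: A'_def B'_def)
  then obtain T where T: "gauss_isometry L T" and TA: "\<And>j i. j \<in> K \<Longrightarrow> i \<in> L \<Longrightarrow> T (A' j) i = B' j i"
    using gram_isometry[of L K B' A'] L fin by blast
  have BT: "dotp L (B' i) (T x) = dotp L (A' i) x" if "i \<in> K" for i x
  proof -
    have "dotp L (B' i) (T x) = dotp L (T (A' i)) (T x)"
      unfolding dotp_def by (intro sum.cong) (simp_all only: TA[OF that])
    then show ?thesis using T by (simp add: gauss_isometry_def)
  qed
  let ?EI = "{g \<in> space (gauss I). \<forall>i\<in>K. dotp I (A i) g \<le> z i}"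
  let ?EJ = "{g \<in> space (gauss J). \<forall>i\<in>K. dotp J (B i) g \<le> z i}"
  have EI: "?EI \<in> sets (gauss I)" and EJ: "?EJ \<in> sets (gauss J)" by (rule polyhedron_measurable[OF fin(3)])+
  let ?fB = "\<lambda>g. indicator ?EJ (\<lambda>b\<in>J. g (Inr b)) :: ennreal"
  have Tm: "T \<in> gauss L \<rightarrow>\<^sub>M gauss L" using T by (simp add: gauss_isometry_def)
  have mB: "?fB \<in> borel_measurable (gauss L)"
  proof -
    have "(\<lambda>g. \<lambda>b\<in>J. g (Inr b)) \<in> gauss L \<rightarrow>\<^sub>M gauss J"
      by (intro measurable_restrict measurable_component_singleton) (auto simp: L_def)
    from measurable_compose[OF this, of "indicator ?EJ" "borel :: ennreal measure"] show ?thesis using EJ by simp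
  qed
  have "emeasure (gauss I) ?EI = (\<integral>\<^sup>+g. indicator ?EI g \<partial>gauss I)" using EI by simp
  also have "\<dots> = (\<integral>\<^sup>+g. indicator ?EI (\<lambda>a\<in>I. g (Inl a)) \<partial>gauss L)"
    by (rule nn_integral_PiM_reindex[OF prob_space_std_gauss]) (use EI in \<open>auto simp: L_def\<close>)
  also have "\<dots> = (\<integral>\<^sup>+g. ?fB (T g) \<partial>gauss L)"
  proof (rule nn_integral_cong)
    fix g assume "g \<in> space (gauss L)"
    have 1: "dotp I (A i) (\<lambda>a\<in>I. g (Inl a)) = dotp L (A' i) g" for i
      unfolding dA by (simp add: dotp_def)
    have 2: "dotp J (B i) (\<lambda>b\<in>J. T g (Inr b)) = dotp L (B' i) (T g)" for i
      unfolding dB by (simp add: dotp_def)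
    show "indicator ?EI (\<lambda>a\<in>I. g (Inl a)) = ?fB (T g)"
      by (auto simp: indicator_def 1 2 BT space_PiM)
  qed
  also have "\<dots> = (\<integral>\<^sup>+g. ?fB g \<partial>gauss L)" by (rule gauss_isometry_nn_integral[OF T mB])
  also have "\<dots> = (\<integral>\<^sup>+g. indicator ?EJ g \<partial>gauss J)"
    by (rule nn_integral_PiM_reindex[OF prob_space_std_gauss, symmetric]) (use EJ in \<open>auto simp: L_def\<close>)
  also have "\<dots> = emeasure (gauss J) ?EJ" using EJ by simp
  finally show ?thesis .
qed

section \<open>Currying and resampling of Gaussian families\<close>

lemma nn_integral_uncurry:
  fixes f :: "('a \<times> 'b \<Rightarrow> real) \<Rightarrow> ennreal"
  assumes fin: "finite A" "finite B" and f: "f \<in> borel_measurable (gauss (A \<times> B))"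
  shows "(\<integral>\<^sup>+g. f g \<partial>gauss (A \<times> B)) = (\<integral>\<^sup>+G. f (\<lambda>p\<in>A \<times> B. G (fst p) (snd p)) \<partial>PiM A (\<lambda>_. gauss B))"
proof -
  let ?N = "PiM A (\<lambda>_. gauss B)"
  let ?u = "\<lambda>G :: 'a \<Rightarrow> 'b \<Rightarrow> real. \<lambda>p\<in>A \<times> B. G (fst p) (snd p)"
  have m: "?u \<in> ?N \<rightarrow>\<^sub>M gauss (A \<times> B)"
  proof (rule measurable_to_gauss)
    fix p assume "p \<in> A \<times> B"
    then show "(\<lambda>G. ?u G p) \<in> borel_measurable ?N"
      using measurable_gauss_nested[of "fst p" A "snd p" B] by auto
  qed auto
  have "distr ?N (gauss (A \<times> B)) ?u = gauss (A \<times> B)"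
  proof (rule G.PiM_eqI)
    fix E :: "'a \<times> 'b \<Rightarrow> real set" assume E: "\<And>p. p \<in> A \<times> B \<Longrightarrow> E p \<in> sets std_gauss"
    have box: "PiE B (\<lambda>b. E (a, b)) \<in> sets (gauss B)" if "a \<in> A" for a
      using E that fin by (intro sets_PiM_I_finite) auto
    have "PiE (A \<times> B) E \<in> sets (gauss (A \<times> B))" using E fin by (intro sets_PiM_I_finite) auto
    then have "emeasure (distr ?N (gauss (A \<times> B)) ?u) (PiE (A \<times> B) E) = emeasure ?N (?u -` PiE (A \<times> B) E \<inter> space ?N)"
      by (rule emeasure_distr[OF m])
    also have "?u -` PiE (A \<times> B) E \<inter> space ?N = PiE A (\<lambda>a. PiE B (\<lambda>b. E (a, b)))"
      by (auto simp: space_PiM PiE_iff)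
    also have "emeasure ?N \<dots> = (\<Prod>a\<in>A. emeasure (gauss B) (PiE B (\<lambda>b. E (a, b))))"
      using box fin by (intro GG.emeasure_PiM) auto
    also have "\<dots> = (\<Prod>a\<in>A. \<Prod>b\<in>B. emeasure std_gauss (E (a, b)))"
      using E fin by (intro prod.cong refl G.emeasure_PiM) auto
    also have "\<dots> = (\<Prod>p\<in>A \<times> B. emeasure std_gauss (E p))"
      by (subst prod.cartesian_product) (simp add: split_beta)
    finally show "emeasure (distr ?N (gauss (A \<times> B)) ?u) (PiE (A \<times> B) E) = (\<Prod>p\<in>A \<times> B. emeasure std_gauss (E p))" .
  qed (use fin in auto)
  then have "(\<integral>\<^sup>+g. f g \<partial>gauss (A \<times> B)) = (\<integral>\<^sup>+g. f g \<partial>distr ?N (gauss (A \<times> B)) ?u)" by simp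
  also have "\<dots> = (\<integral>\<^sup>+G. f (?u G) \<partial>?N)" using m f by (intro nn_integral_distr) auto
  finally show ?thesis .
qed

text \<open>Averaging over an independent redraw of the coordinates in \<open>J\<close> expresses
  conditioning on those in \<open>I\<close>, while everything stays on the one space
  \<open>gauss (I \<union> J)\<close>.\<close>

lemma nn_integral_resample:
  assumes fin: "finite I" "finite J" "I \<inter> J = {}" and f: "f \<in> borel_measurable (gauss (I \<union> J))"
  shows "(\<integral>\<^sup>+x. f x \<partial>gauss (I \<union> J)) = (\<integral>\<^sup>+x. (\<integral>\<^sup>+y. f (merge I J (x, y)) \<partial>gauss J) \<partial>gauss (I \<union> J))"
proof -
  interpret J: prob_space "gauss J" by (rule prob_space_gauss)
  have mm: "(\<lambda>p. f (merge I J p)) \<in> borel_measurable (gauss I \<Otimes>\<^sub>M gauss J)"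
    using measurable_compose[OF measurable_merge f] .
  have r: "(\<lambda>x. \<integral>\<^sup>+y. f (merge I J (x, y)) \<partial>gauss J) \<in> borel_measurable (gauss I)"
    by (rule sigma_finite_measure.borel_measurable_nn_integral[OF prob_space_imp_sigma_finite[OF prob_space_gauss]])
       (use mm in \<open>simp add: split_beta'\<close>)
  have rr: "(\<lambda>x. restrict x I) \<in> gauss (I \<union> J) \<rightarrow>\<^sub>M gauss I" by (intro measurable_restrict_subset) auto
  have eq: "merge I J (x, y) = merge I J (restrict x I, y)" for x y :: "'a \<Rightarrow> real"
    by (auto simp: merge_def)
  have "(\<lambda>x. \<integral>\<^sup>+y. f (merge I J (restrict x I, y)) \<partial>gauss J) \<in> borel_measurable (gauss (I \<union> J))"
    by (rule measurable_compose[OF rr r])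
  then have m2: "(\<lambda>x. \<integral>\<^sup>+y. f (merge I J (x, y)) \<partial>gauss J) \<in> borel_measurable (gauss (I \<union> J))"
    by (subst eq)
  have "(\<integral>\<^sup>+x. (\<integral>\<^sup>+y. f (merge I J (x, y)) \<partial>gauss J) \<partial>gauss (I \<union> J))
     = (\<integral>\<^sup>+x1. (\<integral>\<^sup>+x2. (\<integral>\<^sup>+y. f (merge I J (merge I J (x1, x2), y)) \<partial>gauss J) \<partial>gauss J) \<partial>gauss I)"
    by (rule G.product_nn_integral_fold[OF fin(3,1,2) m2])
  also have "\<dots> = (\<integral>\<^sup>+x1. (\<integral>\<^sup>+x2. (\<integral>\<^sup>+y. f (merge I J (x1, y)) \<partial>gauss J) \<partial>gauss J) \<partial>gauss I)"
  proof (intro nn_integral_cong arg_cong[where f=f])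
    fix x1 x2 y :: "'a \<Rightarrow> real"
    show "merge I J (merge I J (x1, x2), y) = merge I J (x1, y)" by (auto simp: merge_def)
  qed
  also have "\<dots> = (\<integral>\<^sup>+x1. (\<integral>\<^sup>+y. f (merge I J (x1, y)) \<partial>gauss J) \<partial>gauss I)"
    using J.emeasure_space_1 by simp
  also have "\<dots> = (\<integral>\<^sup>+x. f x \<partial>gauss (I \<union> J))"
    by (rule G.product_nn_integral_fold[OF fin(3,1,2) f, symmetric])
  finally show ?thesis by simp
qed

lemma measurable_resample_row:
  assumes "I \<inter> J = {}"
  shows "(\<lambda>p. (fst p)(r := merge I J (fst p r, snd p)))
    \<in> PiM (insert r R) (\<lambda>_. gauss (I \<union> J)) \<Otimes>\<^sub>M gauss J \<rightarrow>\<^sub>M PiM (insert r R) (\<lambda>_. gauss (I \<union> J))"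
proof (rule measurable_PiM_single')
  let ?M = "PiM (insert r R) (\<lambda>_. gauss (I \<union> J))"
  have m: "(\<lambda>p. merge I J (fst p r, snd p)) \<in> ?M \<Otimes>\<^sub>M gauss J \<rightarrow>\<^sub>M gauss (I \<union> J)"
  proof (rule measurable_to_gauss)
    fix i assume i: "i \<in> I \<union> J"
    have 1: "(\<lambda>p. fst p r i) \<in> borel_measurable (?M \<Otimes>\<^sub>M gauss J)"
      using measurable_compose[OF measurable_fst measurable_gauss_nested[of r "insert r R" i "I \<union> J"]] i by simp
    have 2: "(\<lambda>p. snd p i) \<in> borel_measurable (?M \<Otimes>\<^sub>M gauss J)" if "i \<in> J"
      using measurable_compose[OF measurable_snd measurable_gauss_component[OF that]] .
    show "(\<lambda>p. merge I J (fst p r, snd p) i) \<in> borel_measurable (?M \<Otimes>\<^sub>M gauss J)"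
      using 1 2 i by (cases "i \<in> I") (auto simp: merge_def)
  qed (auto simp: merge_def)
  fix i assume i: "i \<in> insert r R"
  show "(\<lambda>p. ((fst p)(r := merge I J (fst p r, snd p))) i) \<in> ?M \<Otimes>\<^sub>M gauss J \<rightarrow>\<^sub>M gauss (I \<union> J)"
  proof (cases "i = r")
    case False
    then show ?thesis using measurable_compose[OF measurable_fst measurable_component_singleton[OF i]] by simp
  qed (use m in simp)
next
  show "(\<lambda>p. (fst p)(r := merge I J (fst p r, snd p))) \<in> space (PiM (insert r R) (\<lambda>_. gauss (I \<union> J)) \<Otimes>\<^sub>M gauss J)
      \<rightarrow> (\<Pi>\<^sub>E i\<in>insert r R. space (gauss (I \<union> J)))"
  proof (intro funcsetI PiE_I)
    fix p i assume p: "p \<in> space (PiM (insert r R) (\<lambda>_. gauss (I \<union> J)) \<Otimes>\<^sub>M gauss J)"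
    then have fp: "fst p \<in> (\<Pi>\<^sub>E i\<in>insert r R. space (gauss (I \<union> J)))"
      by (auto simp: space_pair_measure space_PiM[of "insert r R"])
    show "((fst p)(r := merge I J (fst p r, snd p))) i \<in> space (gauss (I \<union> J))" if "i \<in> insert r R"
    proof (cases "i = r")
      case True
      then show ?thesis by (simp add: space_PiM PiE_def extensional_def merge_def)
    next
      case False
      then show ?thesis using PiE_mem[OF fp that] by simp
    qed
    show "((fst p)(r := merge I J (fst p r, snd p))) i = undefined" if "i \<notin> insert r R"
      using PiE_arb[OF fp that] that by simp
  qed
qed

lemma measurable_nn_integral_resample_row:
  assumes "I \<inter> J = {}" and f: "f \<in> borel_measurable (PiM (insert r R) (\<lambda>_. gauss (I \<union> J)))"
  shows "(\<lambda>G. \<integral>\<^sup>+y. f (G(r := merge I J (G r, y))) \<partial>gauss J) \<in> borel_measurable (PiM (insert r R) (\<lambda>_. gauss (I \<union> J)))"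
  using measurable_compose[OF measurable_resample_row[OF assms(1)] f]
  by (intro sigma_finite_measure.borel_measurable_nn_integral[OF prob_space_imp_sigma_finite[OF prob_space_gauss]])
     (simp add: split_beta')

lemma nn_integral_resample_row:
  assumes fin: "finite I" "finite J" "I \<inter> J = {}" and R: "finite R" "r \<notin> R"
    and f: "f \<in> borel_measurable (PiM (insert r R) (\<lambda>_. gauss (I \<union> J)))"
  shows "(\<integral>\<^sup>+G. f G \<partial>PiM (insert r R) (\<lambda>_. gauss (I \<union> J)))
    = (\<integral>\<^sup>+G. (\<integral>\<^sup>+y. f (G(r := merge I J (G r, y))) \<partial>gauss J) \<partial>PiM (insert r R) (\<lambda>_. gauss (I \<union> J)))"
proof -
  have "(\<integral>\<^sup>+G. f G \<partial>PiM (insert r R) (\<lambda>_. gauss (I \<union> J)))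
      = (\<integral>\<^sup>+x. (\<integral>\<^sup>+g. f (x(r := g)) \<partial>gauss (I \<union> J)) \<partial>PiM R (\<lambda>_. gauss (I \<union> J)))"
    by (rule GG.product_nn_integral_insert[OF R f])
  also have "\<dots> = (\<integral>\<^sup>+x. (\<integral>\<^sup>+g. (\<integral>\<^sup>+y. f (x(r := merge I J (g, y))) \<partial>gauss J) \<partial>gauss (I \<union> J)) \<partial>PiM R (\<lambda>_. gauss (I \<union> J)))"
  proof (rule nn_integral_cong)
    fix x assume x: "x \<in> space (PiM R (\<lambda>_. gauss (I \<union> J)))"
    have "(\<lambda>g. f (x(r := g))) \<in> borel_measurable (gauss (I \<union> J))"
      using measurable_compose[OF measurable_component_update[OF x R(2)] f] .
    then show "(\<integral>\<^sup>+g. f (x(r := g)) \<partial>gauss (I \<union> J))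
        = (\<integral>\<^sup>+g. (\<integral>\<^sup>+y. f (x(r := merge I J (g, y))) \<partial>gauss J) \<partial>gauss (I \<union> J))"
      by (rule nn_integral_resample[OF fin])
  qed
  also have "\<dots> = (\<integral>\<^sup>+G. (\<integral>\<^sup>+y. f (G(r := merge I J (G r, y))) \<partial>gauss J) \<partial>PiM (insert r R) (\<lambda>_. gauss (I \<union> J)))"
    by (subst GG.product_nn_integral_insert[OF R measurable_nn_integral_resample_row[OF fin(3) f]]) simp
  finally show ?thesis .
qed

subsection \<open>The random coding union bound\<close>

text \<open>The vector \<open>G (Suc K)\<close> is the noise. If the noise is longer than the output, the ball around the output of radius the
  norm of the noise contains the origin and the cap bound is replaced by \<open>1\<close>.\<close>

definition cap_error :: "nat \<Rightarrow> nat \<Rightarrow> (nat \<Rightarrow> real) \<Rightarrow> nat set \<Rightarrow> (nat \<Rightarrow> nat \<Rightarrow> real) \<Rightarrow> real" where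
  "cap_error n K c S G =
     (if 0 < vnorm {..<n} (G (Suc K)) \<and>
         vnorm {..<n} (G (Suc K)) < vnorm {..<n} (\<lambda>t. G (Suc K) t + xsum {..<n} S c G t)
      then cap_bound n (vnorm {..<n} (G (Suc K)) / vnorm {..<n} (\<lambda>t. G (Suc K) t + xsum {..<n} S c G t))
      else 1)"

definition rcu_bound :: "nat \<Rightarrow> nat \<Rightarrow> (nat \<Rightarrow> real) \<Rightarrow> (nat \<Rightarrow> nat) \<Rightarrow> (nat \<Rightarrow> nat \<Rightarrow> real) \<Rightarrow> real" where
  "rcu_bound n K c M G = min 1 (\<Sum>S\<in>PK K. (\<Prod>s\<in>S. real (M s)) * cap_error n K c S G)"

lemma finite_PK: "finite (PK K)"
  unfolding PK_def by (rule finite_subset[of _ "Pow {1..K}"]) auto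

lemma cap_error_nonneg:
  assumes "n \<ge> 4"
  shows "0 \<le> cap_error n K c S G"
proof -
  have "0 \<le> cap_bound n (a / b)" if "0 < a" "a < b" for a b
  proof -
    have "(a / b)\<^sup>2 \<le> 1" using that by (intro power_le_one) auto
    then show ?thesis unfolding cap_bound_def using that assms by simp
  qed
  then show ?thesis by (simp add: cap_error_def)
qed

lemma borel_measurable_cap_bound: "cap_bound n \<in> borel_measurable borel"
  unfolding cap_bound_def by measurable

lemma borel_measurable_cap_error:
  assumes "S \<subseteq> {1..K}"
  shows "cap_error n K c S \<in> borel_measurable (PiM {1..Suc K} (\<lambda>_. gauss {..<n}))"
proof -
  let ?M = "PiM {1..Suc K} (\<lambda>_. gauss {..<n})"
  have 1: "(\<lambda>G. vnorm {..<n} (G (Suc K))) \<in> borel_measurable ?M"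
    by (intro borel_measurable_vnorm measurable_gauss_nested) auto
  have 2: "(\<lambda>G. vnorm {..<n} (\<lambda>t. G (Suc K) t + xsum {..<n} S c G t)) \<in> borel_measurable ?M"
    unfolding xsum_def using assms
    by (intro borel_measurable_vnorm measurable_gauss_nested borel_measurable_add borel_measurable_sum
        borel_measurable_divide borel_measurable_times borel_measurable_const) auto
  show ?thesis
    unfolding cap_error_def
    by (intro measurable_If sets.sets_Collect_conj borel_measurable_less borel_measurable_const 1 2
        measurable_compose[OF _ borel_measurable_cap_bound] borel_measurable_divide)
qed

lemma borel_measurable_rcu_bound:
  "rcu_bound n K c M \<in> borel_measurable (PiM {1..Suc K} (\<lambda>_. gauss {..<n}))"
  unfolding rcu_bound_def
  by (intro borel_measurable_min borel_measurable_const borel_measurable_sum borel_measurable_times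
      borel_measurable_cap_error) (auto simp: PK_def)

text \<open>The passage from a random codebook to a fixed one: some point does no worse than the
  mean.\<close>

lemma nn_integral_le_obtain:
  assumes "prob_space N" "f \<in> borel_measurable N" "(\<integral>\<^sup>+x. f x \<partial>N) \<le> ennreal c"
  obtains x where "x \<in> space N" "f x \<le> ennreal c"
proof -
  interpret prob_space N by fact
  have "\<exists>x\<in>space N. f x \<le> ennreal c"
  proof (rule ccontr)
    assume "\<not> (\<exists>x\<in>space N. f x \<le> ennreal c)"
    then have gt: "\<And>x. x \<in> space N \<Longrightarrow> ennreal c < f x" by (auto simp: not_le)
    have "(\<integral>\<^sup>+x. ennreal c \<partial>N) < (\<integral>\<^sup>+x. f x \<partial>N)"
    proof (rule nn_integral_less)
      show "\<not> (AE x in N. f x \<le> ennreal c)"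
      proof
        assume "AE x in N. f x \<le> ennreal c"
        then have "AE x in N. False" using gt by (auto elim!: AE_mp intro!: AE_I2 simp: not_le[symmetric])
        then show False by simp
      qed
    qed (use assms gt in \<open>auto intro!: AE_I2 less_imp_le simp: emeasure_space_1\<close>)
    then show False using assms(3) emeasure_space_1 by simp
  qed
  then show ?thesis using that by blast
qed

section \<open>Minimum distance decoding of a random codebook\<close>

context
  fixes K n :: nat and M :: "nat \<Rightarrow> nat" and c :: "nat \<Rightarrow> real"
  assumes K: "K \<ge> 1" and n: "n \<ge> 4" and M: "\<And>i. i \<in> {1..K} \<Longrightarrow> M i \<ge> 1"
begin

definition messages :: "(nat \<Rightarrow> nat) set" where
  "messages = PiE {1..K} (\<lambda>i. {1..M i})"

text \<open>A tie yields the constant 0, which is no message because messages start at 1. Ties thus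
  count as errors, and correct decoding is the exact complement of \<open>confused\<close>.\<close>

definition decoder :: "(nat \<Rightarrow> nat \<Rightarrow> nat \<Rightarrow> real) \<Rightarrow> (nat \<Rightarrow> real) \<Rightarrow> nat \<Rightarrow> nat" where
  "decoder f y =
     (let d = \<lambda>m. \<Sum>t<n. (y t - (\<Sum>j\<in>{1..K}. f j (m j) t))\<^sup>2;
          best = \<lambda>m. m \<in> messages \<and> (\<forall>m'\<in>messages - {m}. d m < d m')
      in if \<exists>m. best m then THE m. best m else (\<lambda>_. 0))"

definition confused :: "(nat \<Rightarrow> nat \<Rightarrow> nat \<Rightarrow> real) \<Rightarrow> (nat \<Rightarrow> nat) \<Rightarrow> (nat \<Rightarrow> real) \<Rightarrow> bool" where
  "confused f m z \<longleftrightarrow> (\<exists>m'\<in>messages - {m}.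
     (\<Sum>t<n. (z t + (\<Sum>j\<in>{1..K}. f j (m j) t) - (\<Sum>j\<in>{1..K}. f j (m' j) t))\<^sup>2) \<le> (\<Sum>t<n. (z t)\<^sup>2))"

lemma finite_messages: "finite messages"
  unfolding messages_def by (intro finite_PiE) auto

lemma decoder_correct:
  assumes m: "m \<in> messages"
  shows "(\<forall>i\<in>{1..K}. decoder f (\<lambda>t. if t < n then (\<Sum>j\<in>{1..K}. f j (m j) t) + z t else 0) i = m i) \<longleftrightarrow> \<not> confused f m z"
proof -
  let ?y = "\<lambda>t. if t < n then (\<Sum>j\<in>{1..K}. f j (m j) t) + z t else 0"
  define d where "d = (\<lambda>m. \<Sum>t<n. (?y t - (\<Sum>j\<in>{1..K}. f j (m j) t))\<^sup>2)"
  define best where "best = (\<lambda>m. m \<in> messages \<and> (\<forall>m'\<in>messages - {m}. d m < d m'))"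
  have dec: "decoder f ?y = (if \<exists>m. best m then THE m. best m else (\<lambda>_. 0))"
    unfolding decoder_def Let_def best_def d_def ..
  have dm: "d m = (\<Sum>t<n. (z t)\<^sup>2)" unfolding d_def by (intro sum.cong) auto
  have dm': "d m' = (\<Sum>t<n. (z t + (\<Sum>j\<in>{1..K}. f j (m j) t) - (\<Sum>j\<in>{1..K}. f j (m' j) t))\<^sup>2)" for m'
    unfolding d_def by (intro sum.cong) (auto simp: add.commute)
  have conf: "\<not> confused f m z \<longleftrightarrow> best m"
    unfolding confused_def best_def dm dm' using m by (auto simp: not_le)
  have uniq: "m1 = m2" if "best m1" "best m2" for m1 m2
  proof (rule ccontr)
    assume "m1 \<noteq> m2"
    then have "d m1 < d m2" "d m2 < d m1" using that by (auto simp: best_def)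
    then show False by simp
  qed
  show ?thesis
  proof (cases "\<exists>m0. best m0")
    case True
    then obtain m0 where m0: "best m0" by auto
    have "(THE m. best m) = m0" using m0 uniq by (intro the_equality) auto
    then have y: "decoder f ?y = m0" unfolding dec using True by simp
    have "m0 \<in> messages" using m0 by (simp add: best_def)
    then have "(\<forall>i\<in>{1..K}. m0 i = m i) \<longleftrightarrow> m0 = m"
      using m unfolding messages_def by (auto intro: PiE_ext)
    moreover have "best m \<longleftrightarrow> m0 = m" using m0 uniq by blast
    ultimately show ?thesis unfolding y conf by blast
  next
    case False
    then have "decoder f ?y = (\<lambda>_. 0)" by (simp add: dec)
    moreover have "1 \<in> {1..K}" using K by simp
    moreover have "m 1 \<noteq> 0" using PiE_mem[OF m[unfolded messages_def], of 1] K by auto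
    ultimately show ?thesis using conf False by auto
  qed
qed

lemma confused_measurable: "{z \<in> space (gauss {..<n}). confused f m z} \<in> sets (gauss {..<n})"
  unfolding confused_def
  by (intro sets.sets_Collect_finite_Ex borel_measurable_le borel_measurable_sum borel_measurable_power
      borel_measurable_add borel_measurable_diff measurable_gauss_component borel_measurable_const)
     (auto intro: finite_messages)

lemma mac_error_decoder:
  "mac_error K n M f (decoder f)
    = (\<Sum>m\<in>messages. measure (gauss {..<n}) {z \<in> space (gauss {..<n}). confused f m z}) / (\<Prod>i\<in>{1..K}. real (M i))"
proof -
  interpret prob_space "gauss {..<n}" by (rule prob_space_gauss)
  have "1 - measure (gauss {..<n}) {z \<in> space (gauss {..<n}).
        \<forall>i\<in>{1..K}. decoder f (\<lambda>t. if t < n then (\<Sum>j\<in>{1..K}. f j (m j) t) + z t else 0) i = m i}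
     = measure (gauss {..<n}) {z \<in> space (gauss {..<n}). confused f m z}" if "m \<in> messages" for m
  proof -
    have "measure (gauss {..<n}) {z \<in> space (gauss {..<n}). \<not> confused f m z}
       = 1 - measure (gauss {..<n}) {z \<in> space (gauss {..<n}). confused f m z}"
      using prob_compl[OF confused_measurable[of f m]]
      by (simp add: set_diff_eq conj_commute cong: conj_cong)
    then show ?thesis unfolding decoder_correct[OF that] by simp
  qed
  then show ?thesis unfolding mac_error_def messages_def[symmetric] by simp
qed

abbreviation codebook_index :: "(nat \<times> nat) set" where
  "codebook_index \<equiv> Sigma {1..K} (\<lambda>i. {1..M i})"

abbreviation codebooks :: "(nat \<times> nat \<Rightarrow> nat \<Rightarrow> real) measure" where
  "codebooks \<equiv> PiM codebook_index (\<lambda>_. gauss {..<n})"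

definition codeword :: "(nat \<times> nat \<Rightarrow> nat \<Rightarrow> real) \<Rightarrow> nat \<Rightarrow> nat \<Rightarrow> nat \<Rightarrow> real" where
  "codeword w i m t = c i * w (i, m) t / vnorm {..<n} (w (i, m))"

lemma confused_codeword_measurable:
  assumes m: "m \<in> messages"
  shows "{p \<in> space (codebooks \<Otimes>\<^sub>M gauss {..<n}). confused (codeword (fst p)) m (snd p)} \<in> sets (codebooks \<Otimes>\<^sub>M gauss {..<n})"
proof -
  let ?P = "codebooks \<Otimes>\<^sub>M gauss {..<n}"
  have 1: "(\<lambda>p. snd p t) \<in> borel_measurable ?P" if "t \<in> {..<n}" for t
    using measurable_compose[OF measurable_snd measurable_gauss_component[OF that]] .
  have 2: "(\<lambda>p. codeword (fst p) j (m' j) t) \<in> borel_measurable ?P" if "m' \<in> messages" "j \<in> {1..K}" "t \<in> {..<n}" for m' j t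
  proof -
    have i: "(j, m' j) \<in> codebook_index" using that by (auto simp: messages_def)
    have 3: "(\<lambda>p. fst p (j, m' j) t) \<in> borel_measurable ?P" if "t \<in> {..<n}" for t
      using measurable_compose[OF measurable_fst measurable_gauss_nested[OF i that]] .
    show ?thesis unfolding codeword_def
      by (intro borel_measurable_divide borel_measurable_times borel_measurable_const borel_measurable_vnorm 3 that)
  qed
  show ?thesis unfolding confused_def
    by (intro sets.sets_Collect_finite_Ex borel_measurable_le borel_measurable_sum borel_measurable_power
      borel_measurable_add borel_measurable_diff 1 2 m) (auto intro: finite_messages)
qed

text \<open>Competitors are grouped by the set \<open>S\<close> of users on which they differ from
  \<open>m\<close>. Within a group a competitor is determined by its values on \<open>S\<close>,
  which bounds the size of the group by the product of the \<open>M s\<close>.\<close>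

lemma sum_messages_diff:
  assumes m: "m \<in> messages" and a: "\<And>S. S \<in> PK K \<Longrightarrow> 0 \<le> a S"
  shows "(\<Sum>m'\<in>messages - {m}. a {i \<in> {1..K}. m' i \<noteq> m i}) \<le> (\<Sum>S\<in>PK K. (\<Prod>s\<in>S. real (M s)) * a S)"
proof -
  let ?d = "\<lambda>m'. {i \<in> {1..K}. m' i \<noteq> m i}"
  have sub: "?d ` (messages - {m}) \<subseteq> PK K"
  proof (rule image_subsetI)
    fix m' assume m': "m' \<in> messages - {m}"
    have "\<exists>i\<in>{1..K}. m' i \<noteq> m i"
    proof (rule ccontr)
      assume "\<not> (\<exists>i\<in>{1..K}. m' i \<noteq> m i)"
      then have "m' = m" using m m' unfolding messages_def by (intro PiE_ext[of m' "{1..K}" _ m]) auto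
      then show False using m' by simp
    qed
    then show "?d m' \<in> PK K" by (auto simp: PK_def)
  qed
  have "(\<Sum>m'\<in>messages - {m}. a (?d m')) = (\<Sum>S\<in>PK K. \<Sum>m'\<in>{m'\<in>messages - {m}. ?d m' = S}. a (?d m'))"
    by (rule sum.group[symmetric]) (use finite_messages finite_PK sub in auto)
  also have "\<dots> \<le> (\<Sum>S\<in>PK K. (\<Prod>s\<in>S. real (M s)) * a S)"
  proof (rule sum_mono)
    fix S assume S: "S \<in> PK K"
    then have SK: "S \<subseteq> {1..K}" "finite S" using finite_subset by (auto simp: PK_def)
    let ?A = "{m'\<in>messages - {m}. ?d m' = S}"
    have "inj_on (\<lambda>m'. restrict m' S) ?A"
    proof (rule inj_onI)
      fix p q assume p: "p \<in> ?A" and q: "q \<in> ?A" and e: "restrict p S = restrict q S"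
      have "p i = q i" if "i \<in> {1..K}" for i
      proof (cases "i \<in> S")
        case True then show ?thesis using fun_cong[OF e, of i] by simp
      next
        case False
        have "?d p = S" "?d q = S" using p q by blast+
        then have "p i = m i" "q i = m i" using False that by blast+
        then show ?thesis by simp
      qed
      moreover have "p \<in> PiE {1..K} (\<lambda>i. {1..M i})" "q \<in> PiE {1..K} (\<lambda>i. {1..M i})"
        using p q unfolding messages_def by blast+
      ultimately show "p = q" by (intro PiE_ext[of p "{1..K}" _ q])
    qed
    moreover have "(\<lambda>m'. restrict m' S) ` ?A \<subseteq> PiE S (\<lambda>i. {1..M i})"
      using SK unfolding messages_def by (auto simp: PiE_iff)
    ultimately have "card ?A \<le> card (PiE S (\<lambda>i. {1..M i}))"
      using SK by (intro card_inj_on_le finite_PiE) auto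
    also have "\<dots> = (\<Prod>s\<in>S. M s)" using SK by (simp add: card_PiE)
    finally have "real (card ?A) \<le> (\<Prod>s\<in>S. real (M s))" by (simp flip: of_nat_prod)
    then have "real (card ?A) * a S \<le> (\<Prod>s\<in>S. real (M s)) * a S" by (intro mult_right_mono a S)
    moreover have "(\<Sum>m'\<in>?A. a (?d m')) = (\<Sum>m'\<in>?A. a S)" by (intro sum.cong) auto
    ultimately show "(\<Sum>m'\<in>?A. a (?d m')) \<le> (\<Prod>s\<in>S. real (M s)) * a S" by simp
  qed
  finally show ?thesis .
qed

text \<open>The transmitted codewords \<open>C1\<close> and the noise are held fixed and only the
  remaining codewords \<open>C2\<close> are random. A competitor that differs from \<open>m\<close>
  on \<open>S\<close> uses entries of \<open>C2\<close> for exactly the users in \<open>S\<close>,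
  so its sum over \<open>S\<close> is independent of everything fixed and
  \<open>emeasure_xsum_near\<close> applies; the rest is the union bound.\<close>

lemma confused_conditional:
  assumes m: "m \<in> messages"
  defines "C1 \<equiv> (\<lambda>i. (i, m i)) ` {1..K}"
  defines "C2 \<equiv> codebook_index - C1"
  shows "(\<integral>\<^sup>+w2. indicator {w2. confused (codeword (merge C1 C2 (w1, w2))) m z} w2 \<partial>PiM C2 (\<lambda>_. gauss {..<n}))
     \<le> ennreal (rcu_bound n K c M ((\<lambda>i\<in>{1..K}. w1 (i, m i))(Suc K := z)))"
proof -
  let ?N = "{..<n}"
  let ?P2 = "PiM C2 (\<lambda>_. gauss ?N)"
  interpret P2: prob_space ?P2 by (rule prob_space_nested)
  define G where "G = (\<lambda>i\<in>{1..K}. w1 (i, m i))(Suc K := z)"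
  define d where "d = (\<lambda>m'. {i \<in> {1..K}. m' i \<noteq> m i})"
  \<comment> \<open>The channel output after removing the codewords of the users outside
    \<open>S\<close>, which a competitor shares with \<open>m\<close>.\<close>
  define v where "v = (\<lambda>S t. z t + xsum ?N S c G t)"
  define bad where "bad = (\<lambda>m' w2. dotp ?N (\<lambda>t. v (d m') t - xsum ?N (d m') c (\<lambda>s\<in>d m'. w2 (s, m' s)) t)
       (\<lambda>t. v (d m') t - xsum ?N (d m') c (\<lambda>s\<in>d m'. w2 (s, m' s)) t) \<le> (vnorm ?N z)\<^sup>2)"
  have idx: "(s, m' s) \<in> C2" if "m' \<in> messages" "s \<in> d m'" for m' s
    using that unfolding C2_def C1_def d_def messages_def by (auto simp: PiE_iff)
  have eq: "(\<Sum>t<n. (z t + (\<Sum>j\<in>{1..K}. codeword (merge C1 C2 (w1, w2)) j (m j) t)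
        - (\<Sum>j\<in>{1..K}. codeword (merge C1 C2 (w1, w2)) j (m' j) t))\<^sup>2) \<le> (\<Sum>t<n. (z t)\<^sup>2) \<longleftrightarrow> bad m' w2"
    if m': "m' \<in> messages" for m' w2
  proof -
    let ?w = "merge C1 C2 (w1, w2)"
    have "(\<Sum>j\<in>{1..K}. codeword ?w j (m j) t) - (\<Sum>j\<in>{1..K}. codeword ?w j (m' j) t)
       = xsum ?N (d m') c G t - xsum ?N (d m') c (\<lambda>s\<in>d m'. w2 (s, m' s)) t" for t
    proof -
      have D: "d m' \<subseteq> {1..K}" by (auto simp: d_def)
      have "(\<Sum>j\<in>{1..K}. codeword ?w j (m j) t) - (\<Sum>j\<in>{1..K}. codeword ?w j (m' j) t)
         = (\<Sum>j\<in>{1..K}. codeword ?w j (m j) t - codeword ?w j (m' j) t)" by (simp add: sum_subtractf)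
      also have "\<dots> = (\<Sum>j\<in>d m'. codeword ?w j (m j) t - codeword ?w j (m' j) t)"
        by (rule sum.mono_neutral_right) (auto simp: d_def)
      also have "\<dots> = (\<Sum>j\<in>d m'. c j * G j t / vnorm ?N (G j)
          - c j * (\<lambda>s\<in>d m'. w2 (s, m' s)) j t / vnorm ?N ((\<lambda>s\<in>d m'. w2 (s, m' s)) j))"
      proof (rule sum.cong[OF refl])
        fix j assume j: "j \<in> d m'"
        then have jK: "j \<in> {1..K}" using D by auto
        then have "?w (j, m j) = G j" by (auto simp: merge_def C1_def G_def)
        moreover have "?w (j, m' j) = w2 (j, m' j)"
          using idx[OF m' j] by (auto simp: merge_def C2_def)
        ultimately show "codeword ?w j (m j) t - codeword ?w j (m' j) t = c j * G j t / vnorm ?N (G j)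
          - c j * (\<lambda>s\<in>d m'. w2 (s, m' s)) j t / vnorm ?N ((\<lambda>s\<in>d m'. w2 (s, m' s)) j)"
          using j by (simp add: codeword_def)
      qed
      finally show ?thesis by (simp add: xsum_def sum_subtractf)
    qed
    then have "z t + (\<Sum>j\<in>{1..K}. codeword ?w j (m j) t) - (\<Sum>j\<in>{1..K}. codeword ?w j (m' j) t)
       = v (d m') t - xsum ?N (d m') c (\<lambda>s\<in>d m'. w2 (s, m' s)) t" for t
      unfolding v_def by (simp add: add_diff_eq[symmetric] add.assoc)
    then show ?thesis unfolding bad_def vnorm_sq dotp_self by simp
  qed
  have badm: "{w2 \<in> space ?P2. bad m' w2} \<in> sets ?P2" if "m' \<in> messages" for m'
  proof -
    have *: "(\<lambda>w2. (\<lambda>s\<in>d m'. w2 (s, m' s)) s t) \<in> borel_measurable ?P2" if "s \<in> d m'" "t \<in> ?N" for s t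
      using measurable_gauss_nested[OF idx[OF \<open>m' \<in> messages\<close> that(1)] that(2)] that(1) by simp
    show ?thesis
      unfolding bad_def xsum_def
      by (intro borel_measurable_le measurable_dotp borel_measurable_diff borel_measurable_const borel_measurable_sum
         borel_measurable_divide borel_measurable_times borel_measurable_vnorm *)
  qed
  have P2bad: "emeasure ?P2 {w2 \<in> space ?P2. bad m' w2} \<le> ennreal (cap_error n K c (d m') G)"
    if m': "m' \<in> messages" for m'
  proof -
    let ?S = "d m'"
    let ?A = "{H \<in> space (PiM ?S (\<lambda>_. gauss ?N)).
       dotp ?N (\<lambda>t. v ?S t - xsum ?N ?S c H t) (\<lambda>t. v ?S t - xsum ?N ?S c H t) \<le> (vnorm ?N z)\<^sup>2}"
    have G: "G (Suc K) = z" by (simp add: G_def)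
    have ve: "(\<lambda>t. G (Suc K) t + xsum ?N ?S c G t) = v ?S" by (simp add: v_def G)
    show ?thesis
    proof (cases "0 < vnorm ?N z \<and> vnorm ?N z < vnorm ?N (v ?S)")
      case True
      have A: "?A \<in> sets (PiM ?S (\<lambda>_. gauss ?N))"
        unfolding xsum_def
        by (intro borel_measurable_le measurable_dotp borel_measurable_diff borel_measurable_const borel_measurable_sum
           borel_measurable_divide borel_measurable_times borel_measurable_vnorm measurable_gauss_nested)
      have "emeasure ?P2 {w2 \<in> space ?P2. bad m' w2} = (\<integral>\<^sup>+w2. indicator {w2 \<in> space ?P2. bad m' w2} w2 \<partial>?P2)"
        using badm[OF m'] by simp
      also have "\<dots> = (\<integral>\<^sup>+w2. indicator ?A (\<lambda>s\<in>?S. w2 (s, m' s)) \<partial>?P2)"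
      proof (rule nn_integral_cong)
        fix w2 assume w2: "w2 \<in> space ?P2"
        have "(\<lambda>s\<in>?S. w2 (s, m' s)) \<in> space (PiM ?S (\<lambda>_. gauss ?N))"
          using w2 idx[OF m'] by (auto simp: space_PiM PiE_iff)
        then show "indicator {w2 \<in> space ?P2. bad m' w2} w2 = (indicator ?A (\<lambda>s\<in>?S. w2 (s, m' s)) :: ennreal)"
          using w2 by (simp add: indicator_def bad_def)
      qed
      also have "\<dots> = (\<integral>\<^sup>+H. indicator ?A H \<partial>PiM ?S (\<lambda>_. gauss ?N))"
        by (rule nn_integral_PiM_reindex[OF prob_space_gauss, symmetric])
           (use idx[OF m'] A in \<open>auto simp: inj_on_def\<close>)
      also have "\<dots> = emeasure (PiM ?S (\<lambda>_. gauss ?N)) ?A" using A by simp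
      also have "\<dots> \<le> ennreal (cap_bound n (vnorm ?N z / vnorm ?N (v ?S)))"
        by (rule emeasure_xsum_near) (use True n in \<open>auto simp: d_def\<close>)
      also have "cap_bound n (vnorm ?N z / vnorm ?N (v ?S)) = cap_error n K c ?S G"
        unfolding cap_error_def ve unfolding G using True by simp
      finally show ?thesis .
    next
      case False
      then have "cap_error n K c ?S G = 1" unfolding cap_error_def ve unfolding G by auto
      then show ?thesis using P2.emeasure_le_1 by simp
    qed
  qed
  have ce: "0 \<le> cap_error n K c S G" for S by (rule cap_error_nonneg[OF n])
  have "(\<integral>\<^sup>+w2. indicator {w2. confused (codeword (merge C1 C2 (w1, w2))) m z} w2 \<partial>?P2)
     \<le> (\<integral>\<^sup>+w2. (\<Sum>m'\<in>messages - {m}. indicator {w2 \<in> space ?P2. bad m' w2} w2) \<partial>?P2)"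
  proof (rule nn_integral_mono)
    fix w2 assume w2: "w2 \<in> space ?P2"
    show "indicator {w2. confused (codeword (merge C1 C2 (w1, w2))) m z} w2
       \<le> (\<Sum>m'\<in>messages - {m}. indicator {w2 \<in> space ?P2. bad m' w2} w2 :: ennreal)"
    proof (cases "confused (codeword (merge C1 C2 (w1, w2))) m z")
      case True
      then obtain m' where m': "m' \<in> messages - {m}" "bad m' w2"
        unfolding confused_def using eq by blast
      have "(1::ennreal) = indicator {w2 \<in> space ?P2. bad m' w2} w2" using m' w2 by simp
      also have "\<dots> \<le> (\<Sum>m'\<in>messages - {m}. indicator {w2 \<in> space ?P2. bad m' w2} w2)"
        using m' finite_messages by (intro member_le_sum) auto
      finally show ?thesis using True by simp
    qed simp
  qed
  also have "\<dots> = (\<Sum>m'\<in>messages - {m}. emeasure ?P2 {w2 \<in> space ?P2. bad m' w2})"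
    using badm by (subst nn_integral_sum) (auto intro!: sum.cong borel_measurable_indicator)
  also have "\<dots> \<le> (\<Sum>m'\<in>messages - {m}. ennreal (cap_error n K c (d m') G))"
    using P2bad by (intro sum_mono) auto
  also have "\<dots> = ennreal (\<Sum>m'\<in>messages - {m}. cap_error n K c (d m') G)"
    using ce by simp
  also have "\<dots> \<le> ennreal (\<Sum>S\<in>PK K. (\<Prod>s\<in>S. real (M s)) * cap_error n K c S G)"
    unfolding d_def by (intro ennreal_leI sum_messages_diff m ce)
  finally have 1: "(\<integral>\<^sup>+w2. indicator {w2. confused (codeword (merge C1 C2 (w1, w2))) m z} w2 \<partial>?P2)
     \<le> ennreal (\<Sum>S\<in>PK K. (\<Prod>s\<in>S. real (M s)) * cap_error n K c S G)" .
  have "(\<integral>\<^sup>+w2. indicator {w2. confused (codeword (merge C1 C2 (w1, w2))) m z} w2 \<partial>?P2) \<le> (\<integral>\<^sup>+w2. 1 \<partial>?P2)"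
    by (intro nn_integral_mono) (auto simp: indicator_def)
  then have 2: "(\<integral>\<^sup>+w2. indicator {w2. confused (codeword (merge C1 C2 (w1, w2))) m z} w2 \<partial>?P2) \<le> ennreal 1"
    using P2.emeasure_space_1 by simp
  show ?thesis using 1 2 unfolding rcu_bound_def G_def[symmetric] min_def by auto
qed

text \<open>After the noise and the codebook are exchanged by Fubini, the codebook splits into
  transmitted and other codewords. The bound obtained is the same for every message tuple, so it
  survives averaging over the messages.\<close>

lemma random_coding:
  assumes "(\<integral>\<^sup>+G. ennreal (rcu_bound n K c M G) \<partial>PiM {1..Suc K} (\<lambda>_. gauss {..<n})) \<le> ennreal eps"
    and eps: "0 \<le> eps" and c: "\<And>i. i \<in> {1..K} \<Longrightarrow> (c i)\<^sup>2 \<le> real n * P i" and P: "\<And>i. i \<in> {1..K} \<Longrightarrow> 0 \<le> P i"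
  shows "\<exists>f g. is_mac_code K n M eps P f g"
proof -
  let ?N = "{..<n}"
  interpret W: prob_space codebooks by (rule prob_space_nested)
  interpret N: prob_space "gauss ?N" by (rule prob_space_gauss)
  interpret WN: pair_sigma_finite codebooks "gauss ?N" ..
  define e where "e = (\<lambda>m w z. indicator {p \<in> space (codebooks \<Otimes>\<^sub>M gauss ?N). confused (codeword (fst p)) m (snd p)} (w, z) :: ennreal)"
  have em: "case_prod (e m) \<in> borel_measurable (codebooks \<Otimes>\<^sub>M gauss ?N)" if "m \<in> messages" for m
    unfolding e_def using confused_codeword_measurable[OF that] by (simp add: split_beta')
  have ez: "(\<integral>\<^sup>+z. e m w z \<partial>gauss ?N) = ennreal (measure (gauss ?N) {z \<in> space (gauss ?N). confused (codeword w) m z})"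
    if "w \<in> space codebooks" for m w
  proof -
    have "(\<integral>\<^sup>+z. e m w z \<partial>gauss ?N) = (\<integral>\<^sup>+z. indicator {z \<in> space (gauss ?N). confused (codeword w) m z} z \<partial>gauss ?N)"
      using that by (intro nn_integral_cong) (auto simp: e_def space_pair_measure indicator_def)
    also have "\<dots> = emeasure (gauss ?N) {z \<in> space (gauss ?N). confused (codeword w) m z}"
      using confused_measurable by (rule nn_integral_indicator)
    finally show ?thesis by (simp add: N.emeasure_eq_measure)
  qed
  have main: "(\<integral>\<^sup>+w. (\<integral>\<^sup>+z. e m w z \<partial>gauss ?N) \<partial>codebooks) \<le> ennreal eps" if m: "m \<in> messages" for m
  proof -
    define C1 where "C1 = (\<lambda>i. (i, m i)) ` {1..K}"
    define C2 where "C2 = codebook_index - C1"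
    have C: "codebook_index = C1 \<union> C2" "C1 \<inter> C2 = {}" "finite C1" "finite C2"
      using m by (auto simp: C1_def C2_def messages_def PiE_iff)
    have "(\<integral>\<^sup>+w. (\<integral>\<^sup>+z. e m w z \<partial>gauss ?N) \<partial>codebooks) = (\<integral>\<^sup>+z. (\<integral>\<^sup>+w. e m w z \<partial>codebooks) \<partial>gauss ?N)"
      by (rule WN.Fubini'[OF em[OF m], symmetric])
    also have "\<dots> \<le> (\<integral>\<^sup>+z. (\<integral>\<^sup>+x. ennreal (rcu_bound n K c M (x(Suc K := z))) \<partial>PiM {1..K} (\<lambda>_. gauss ?N)) \<partial>gauss ?N)"
    proof (rule nn_integral_mono)
      fix z assume z: "z \<in> space (gauss ?N)"
      have ewz: "(\<lambda>w. e m w z) \<in> borel_measurable (PiM (C1 \<union> C2) (\<lambda>_. gauss ?N))"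
        using measurable_compose[OF measurable_Pair2'[OF z] em[OF m]] unfolding C(1)[symmetric] by simp
      have "(\<integral>\<^sup>+w. e m w z \<partial>codebooks)
         = (\<integral>\<^sup>+w1. (\<integral>\<^sup>+w2. e m (merge C1 C2 (w1, w2)) z \<partial>PiM C2 (\<lambda>_. gauss ?N)) \<partial>PiM C1 (\<lambda>_. gauss ?N))"
        unfolding C(1) by (rule GG.product_nn_integral_fold[OF C(2-4) ewz])
      also have "\<dots> \<le> (\<integral>\<^sup>+w1. ennreal (rcu_bound n K c M ((\<lambda>i\<in>{1..K}. w1 (i, m i))(Suc K := z))) \<partial>PiM C1 (\<lambda>_. gauss ?N))"
      proof (rule nn_integral_mono)
        fix w1 assume w1: "w1 \<in> space (PiM C1 (\<lambda>_. gauss ?N))"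
        have "(\<integral>\<^sup>+w2. e m (merge C1 C2 (w1, w2)) z \<partial>PiM C2 (\<lambda>_. gauss ?N))
          \<le> (\<integral>\<^sup>+w2. indicator {w2. confused (codeword (merge C1 C2 (w1, w2))) m z} w2 \<partial>PiM C2 (\<lambda>_. gauss ?N))"
          by (intro nn_integral_mono) (auto simp: e_def indicator_def)
        also have "\<dots> \<le> ennreal (rcu_bound n K c M ((\<lambda>i\<in>{1..K}. w1 (i, m i))(Suc K := z)))"
          unfolding C2_def C1_def by (rule confused_conditional[OF m])
        finally show "(\<integral>\<^sup>+w2. e m (merge C1 C2 (w1, w2)) z \<partial>PiM C2 (\<lambda>_. gauss ?N))
          \<le> ennreal (rcu_bound n K c M ((\<lambda>i\<in>{1..K}. w1 (i, m i))(Suc K := z)))" .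
      qed
      \<comment> \<open>The transmitted codewords are independent entries of the codebook, one for
        each user; relabelling them by the users removes the dependence on \<open>m\<close>.\<close>
      also have "\<dots> = (\<integral>\<^sup>+x. ennreal (rcu_bound n K c M (x(Suc K := z))) \<partial>PiM {1..K} (\<lambda>_. gauss ?N))"
      proof (rule nn_integral_PiM_reindex[OF prob_space_gauss, symmetric])
        have S: "{1..Suc K} = insert (Suc K) {1..K}" by auto
        have "(\<lambda>x. x(Suc K := z)) \<in> PiM {1..K} (\<lambda>_. gauss ?N) \<rightarrow>\<^sub>M PiM {1..Suc K} (\<lambda>_. gauss ?N)"
          unfolding S using z
          by (intro measurable_fun_upd[where J="{1..K}"] measurable_const measurable_ident_sets) auto
        from measurable_compose[OF this borel_measurable_rcu_bound]
        show "(\<lambda>x. ennreal (rcu_bound n K c M (x(Suc K := z)))) \<in> borel_measurable (PiM {1..K} (\<lambda>_. gauss ?N))"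
          by simp
      qed (auto simp: C1_def inj_on_def)
      finally show "(\<integral>\<^sup>+w. e m w z \<partial>codebooks) \<le> (\<integral>\<^sup>+x. ennreal (rcu_bound n K c M (x(Suc K := z))) \<partial>PiM {1..K} (\<lambda>_. gauss ?N))" .
    qed
    also have "\<dots> = (\<integral>\<^sup>+G. ennreal (rcu_bound n K c M G) \<partial>PiM {1..Suc K} (\<lambda>_. gauss ?N))"
    proof -
      have S: "{1..Suc K} = insert (Suc K) {1..K}" by auto
      have "(\<lambda>G. ennreal (rcu_bound n K c M G)) \<in> borel_measurable (PiM (insert (Suc K) {1..K}) (\<lambda>_. gauss ?N))"
        using measurable_compose[OF borel_measurable_rcu_bound[of n K c M] measurable_ennreal] unfolding S .
      from GG.product_nn_integral_insert_rev[OF _ _ this] show ?thesis unfolding S by simp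
    qed
    also have "\<dots> \<le> ennreal eps" by (rule assms(1))
    finally show ?thesis .
  qed
  \<comment> \<open>One codebook has to serve all messages, so it is selected by the total of the
    error probabilities and not message by message.\<close>
  define tot where "tot = (\<lambda>w. \<Sum>m\<in>messages. (\<integral>\<^sup>+z. e m w z \<partial>gauss ?N))"
  have em2: "(\<lambda>w. \<integral>\<^sup>+z. e m w z \<partial>gauss ?N) \<in> borel_measurable codebooks" if "m \<in> messages" for m
    by (rule sigma_finite_measure.borel_measurable_nn_integral[OF prob_space_imp_sigma_finite[OF prob_space_gauss] em[OF that]])
  have "(\<integral>\<^sup>+w. tot w \<partial>codebooks) = (\<Sum>m\<in>messages. (\<integral>\<^sup>+w. (\<integral>\<^sup>+z. e m w z \<partial>gauss ?N) \<partial>codebooks))"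
    unfolding tot_def using em2 by (rule nn_integral_sum)
  also have "\<dots> \<le> (\<Sum>m\<in>messages. ennreal eps)" using main by (rule sum_mono)
  also have "\<dots> = ennreal (real (card messages) * eps)" using eps by (simp add: ennreal_mult' ennreal_of_nat_eq_real_of_nat)
  finally have "(\<integral>\<^sup>+w. tot w \<partial>codebooks) \<le> ennreal (real (card messages) * eps)" .
  moreover have "tot \<in> borel_measurable codebooks" unfolding tot_def using em2 by (rule borel_measurable_sum)
  ultimately obtain w where w: "w \<in> space codebooks" "tot w \<le> ennreal (real (card messages) * eps)"
    using nn_integral_le_obtain[of codebooks tot "real (card messages) * eps"] W.prob_space_axioms by blast
  have "tot w = ennreal (\<Sum>m\<in>messages. measure (gauss ?N) {z \<in> space (gauss ?N). confused (codeword w) m z})"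
    unfolding tot_def ez[OF w(1)] by simp
  then have "(\<Sum>m\<in>messages. measure (gauss ?N) {z \<in> space (gauss ?N). confused (codeword w) m z}) \<le> real (card messages) * eps"
    using w(2) eps by (simp add: ennreal_le_iff)
  moreover have "real (card messages) = (\<Prod>i\<in>{1..K}. real (M i))"
    unfolding messages_def by (simp add: card_PiE)
  moreover have "(\<Prod>i\<in>{1..K}. real (M i)) > 0" using M by (intro prod_pos) force
  ultimately have "mac_error K n M (codeword w) (decoder (codeword w)) \<le> eps"
    unfolding mac_error_decoder by (simp add: pos_divide_le_eq mult.commute)
  moreover have "(\<Sum>t<n. (codeword w i m t)\<^sup>2) \<le> real n * P i" if i: "i \<in> {1..K}" for i m
  proof -
    have "(\<Sum>t<n. (codeword w i m t)\<^sup>2) = (c i)\<^sup>2 * dotp ?N (w (i, m)) (w (i, m)) / (vnorm ?N (w (i, m)))\<^sup>2"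
      by (simp add: codeword_def power_divide power_mult_distrib dotp_self sum_distrib_left sum_divide_distrib)
    \<comment> \<open>Equality holds unless the Gaussian vector is 0; then division by zero makes
      the codeword 0.\<close>
    also have "\<dots> \<le> (c i)\<^sup>2" by (simp add: vnorm_sq)
    also have "\<dots> \<le> real n * P i" by (rule c[OF i])
    finally show ?thesis .
  qed
  ultimately show ?thesis unfolding is_mac_code_def by blast
qed

end

subsection \<open>Second-order expansion of the information density\<close>

text \<open>The vectors \<open>G 1, \<dots>, G K\<close> generate the codewords and \<open>G (Suc K)\<close> is the noise; \<open>quad\<close>
  dominates the second-order terms except for the norm of the noise, which is kept apart.\<close>

definition quad :: "nat \<Rightarrow> nat \<Rightarrow> (nat \<Rightarrow> nat \<Rightarrow> real) \<Rightarrow> real" where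
  "quad n K G = 1 + (\<Sum>j\<in>{1..Suc K}. \<Sum>l<j. (G j l)\<^sup>2) + (\<Sum>j\<in>{1..K}. (vnorm {j..<n} (G j) - sqrt (real n))\<^sup>2)"

text \<open>With \<open>slope\<close> times the normalized noise norm added, this is minus the
  first-order fluctuation of the information density over \<open>sqrt n\<close>. Its sources are the
  inner products of codewords with each other, entries \<open>G j l\<close>, and with the noise,
  entries \<open>G (Suc K) l\<close>. The sign makes large values bad.\<close>

definition lin_form :: "nat \<Rightarrow> (nat \<Rightarrow> real) \<Rightarrow> nat set \<Rightarrow> (nat \<Rightarrow> nat \<Rightarrow> real) \<Rightarrow> real" where
  "lin_form K P S G = - ((\<Sum>j\<in>S. \<Sum>l\<in>{l\<in>S. l < j}. sqrt (P j) * sqrt (P l) * G j l) + (\<Sum>l\<in>S. sqrt (P l) * G (Suc K) l))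
     / (1 + Psum P S)"

definition slope :: "(nat \<Rightarrow> real) \<Rightarrow> nat set \<Rightarrow> real" where
  "slope P S = Psum P S / (sqrt 2 * (1 + Psum P S))"

lemma sum_symmetric_split:
  fixes f :: "nat \<Rightarrow> nat \<Rightarrow> real"
  assumes finS: "finite S" and sym: "\<And>s s'. f s s' = f s' s"
  shows "(\<Sum>s\<in>S. \<Sum>s'\<in>S. f s s') = (\<Sum>s\<in>S. f s s) + 2 * (\<Sum>j\<in>S. \<Sum>i\<in>{i\<in>S. i < j}. f j i)"
proof -
  have "(\<Sum>s'\<in>S. f s s') = f s s + (\<Sum>i\<in>{i\<in>S. i < s}. f s i) + (\<Sum>i\<in>{i\<in>S. s < i}. f s i)" if s: "s \<in> S" for s
  proof -
    have "S = insert s ({i\<in>S. i < s} \<union> {i\<in>S. s < i})" using s by auto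
    then have "(\<Sum>s'\<in>S. f s s') = (\<Sum>s'\<in>insert s ({i\<in>S. i < s} \<union> {i\<in>S. s < i}). f s s')" by simp
    also have "\<dots> = f s s + (\<Sum>s'\<in>{i\<in>S. i < s} \<union> {i\<in>S. s < i}. f s s')"
      using finS by (subst sum.insert) auto
    also have "(\<Sum>s'\<in>{i\<in>S. i < s} \<union> {i\<in>S. s < i}. f s s') = (\<Sum>i\<in>{i\<in>S. i < s}. f s i) + (\<Sum>i\<in>{i\<in>S. s < i}. f s i)"
      using finS by (intro sum.union_disjoint) auto
    finally show ?thesis by simp
  qed
  then have "(\<Sum>s\<in>S. \<Sum>s'\<in>S. f s s') = (\<Sum>s\<in>S. f s s) + (\<Sum>s\<in>S. \<Sum>i\<in>{i\<in>S. i < s}. f s i) + (\<Sum>s\<in>S. \<Sum>i\<in>{i\<in>S. s < i}. f s i)"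
    by (simp add: sum.distrib)
  also have "(\<Sum>s\<in>S. \<Sum>i\<in>{i\<in>S. s < i}. f s i) = (\<Sum>i\<in>S. \<Sum>s\<in>{s\<in>S. s < i}. f s i)"
    by (rule sum.swap_restrict[OF finS finS])
  also have "\<dots> = (\<Sum>i\<in>S. \<Sum>s\<in>{s\<in>S. s < i}. f i s)"
    by (intro sum.cong refl) (rule sym)
  finally show ?thesis by simp
qed

text \<open>Only the coordinates up to the smaller index survive. The last term is the main one,
  because the norm in it is of order \<open>sqrt n\<close>, while the sum involves finitely many
  Gaussian entries, independently of \<open>n\<close>.\<close>

lemma dotp_triang:
  assumes "i < j" "j < n"
  shows "dotp {..<n} (triang n j g) (triang n i h) = (\<Sum>l<i. g l * h l) + g i * vnorm {i..<n} h"
proof -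
  have "dotp {..<n} (triang n j g) (triang n i h) = (\<Sum>l\<in>{..<Suc i}. triang n j g l * triang n i h l)"
    unfolding dotp_def by (rule sum.mono_neutral_right) (use assms in \<open>auto simp: triang_def\<close>)
  also have "\<dots> = (\<Sum>l<i. triang n j g l * triang n i h l) + triang n j g i * triang n i h i" by simp
  also have "(\<Sum>l<i. triang n j g l * triang n i h l) = (\<Sum>l<i. g l * h l)"
    by (rule sum.cong) (use assms in \<open>auto simp: triang_def\<close>)
  also have "triang n j g i = g i" using assms by (simp add: triang_def)
  also have "triang n i h i = vnorm {i..<n} h" using assms by (simp add: triang_def)
  finally show ?thesis .
qed

lemma vnorm_triang: "j < n \<Longrightarrow> vnorm {..<n} (triang n j g) = vnorm {..<n} g"
  by (simp add: vnorm_def triang_dotp_same)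

lemma vnorm_split:
  fixes j n :: nat
  assumes "j \<le> n"
  shows "(vnorm {..<n} g)\<^sup>2 = (\<Sum>l<j. (g l)\<^sup>2) + (vnorm {j..<n} g)\<^sup>2"
proof -
  have U: "{..<n} = {..<j} \<union> {j..<n}" using assms by auto
  show ?thesis unfolding vnorm_sq dotp_self U by (rule sum.union_disjoint) auto
qed

section \<open>Norms and inner products of triangular vectors up to quadratic errors\<close>

context
  fixes n K :: nat and G :: "nat \<Rightarrow> nat \<Rightarrow> real" and w Q :: real
  assumes nK: "Suc K < n" and w: "w = chi_dev {Suc K..<n} (G (Suc K))" and Q: "Q = quad n K G + w\<^sup>2"
    and small: "16 * Q \<le> real n"
begin

private abbreviation (input) "T j \<equiv> triang n j (G j)"
private abbreviation (input) "N j \<equiv> vnorm {..<n} (G j)"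
private abbreviation (input) "R j \<equiv> vnorm {j..<n} (G j)"

lemma quad_parts:
  shows "1 + w\<^sup>2 \<le> Q" and "\<And>j. j \<in> {1..Suc K} \<Longrightarrow> (\<Sum>l<j. (G j l)\<^sup>2) \<le> Q"
    and "\<And>j. j \<in> {1..K} \<Longrightarrow> (R j - sqrt (real n))\<^sup>2 \<le> Q"
proof -
  have 1: "0 \<le> (\<Sum>j\<in>{1..Suc K}. \<Sum>l<j. (G j l)\<^sup>2)" and 2: "0 \<le> (\<Sum>j\<in>{1..K}. (R j - sqrt (real n))\<^sup>2)"
    by (intro sum_nonneg zero_le_power2)+
  have w0: "0 \<le> w\<^sup>2" by simp
  show "1 + w\<^sup>2 \<le> Q" unfolding Q quad_def using 1 2 by linarith
  fix j
  show "(\<Sum>l<j. (G j l)\<^sup>2) \<le> Q" if "j \<in> {1..Suc K}"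
  proof -
    have "(\<Sum>l<j. (G j l)\<^sup>2) \<le> (\<Sum>j\<in>{1..Suc K}. \<Sum>l<j. (G j l)\<^sup>2)"
      using that by (intro member_le_sum[of j "{1..Suc K}" "\<lambda>j. \<Sum>l<j. (G j l)\<^sup>2"]) (auto intro: sum_nonneg)
    then show ?thesis unfolding Q quad_def using 2 w0 by linarith
  qed
  show "(R j - sqrt (real n))\<^sup>2 \<le> Q" if "j \<in> {1..K}"
  proof -
    have "(R j - sqrt (real n))\<^sup>2 \<le> (\<Sum>j\<in>{1..K}. (R j - sqrt (real n))\<^sup>2)"
      using that by (intro member_le_sum[of j "{1..K}" "\<lambda>j. (R j - sqrt (real n))\<^sup>2"]) auto
    then show ?thesis unfolding Q quad_def using 1 w0 by linarith
  qed
qed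

text \<open>The summand 1 in \<open>quad\<close> is there for this bound: additive constants can be
  absorbed into multiples of \<open>Q\<close>.\<close>

lemma Q_ge_1: "1 \<le> Q" using quad_parts(1) zero_le_power2[of w] by linarith

lemma Q_nonneg: "0 \<le> Q" using Q_ge_1 by simp

text \<open>The constant 16 in \<open>small\<close> gives the last bound. Codeword norms deviate
  from \<open>sqrt (real n)\<close> by at most \<open>2 * sqrt Q\<close>, so they stay above half of
  it.\<close>

lemma sqrt_Q: "0 < sqrt Q" "sqrt Q * sqrt Q = Q" "4 * sqrt Q \<le> sqrt (real n)"
proof -
  show "0 < sqrt Q" "sqrt Q * sqrt Q = Q" using Q_ge_1 by simp_all
  have "sqrt (16 * Q) \<le> sqrt (real n)" using small by simp
  then show "4 * sqrt Q \<le> sqrt (real n)" by (simp add: real_sqrt_mult)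
qed

lemma entry_le:
  assumes "j \<in> {1..Suc K}" "l < j"
  shows "\<bar>G j l\<bar> \<le> sqrt Q"
proof -
  have "(G j l)\<^sup>2 \<le> (\<Sum>l<j. (G j l)\<^sup>2)"
    using assms by (intro member_le_sum[of l "{..<j}" "\<lambda>l. (G j l)\<^sup>2"]) auto
  also have "\<dots> \<le> Q" by (rule quad_parts(2)[OF assms(1)])
  finally show ?thesis by (simp add: real_le_rsqrt)
qed

lemma cross_le:
  assumes "i \<in> {1..Suc K}" "j \<in> {1..Suc K}" "i \<le> j"
  shows "\<bar>\<Sum>l<i. G j l * G i l\<bar> \<le> Q"
proof -
  have "\<bar>\<Sum>l<i. G j l * G i l\<bar> \<le> (\<Sum>l<i. \<bar>G j l * G i l\<bar>)" by (rule sum_abs)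
  also have "\<dots> \<le> (\<Sum>l<i. ((G j l)\<^sup>2 + (G i l)\<^sup>2) / 2)"
  proof (rule sum_mono)
    fix l
    show "\<bar>G j l * G i l\<bar> \<le> ((G j l)\<^sup>2 + (G i l)\<^sup>2) / 2"
      using sum_squares_bound[of "\<bar>G j l\<bar>" "\<bar>G i l\<bar>"] by (simp add: abs_mult)
  qed
  also have "\<dots> = ((\<Sum>l<i. (G j l)\<^sup>2) + (\<Sum>l<i. (G i l)\<^sup>2)) / 2" by (simp add: sum.distrib flip: sum_divide_distrib)
  also have "(\<Sum>l<i. (G j l)\<^sup>2) \<le> (\<Sum>l<j. (G j l)\<^sup>2)" using assms by (intro sum_mono2) auto
  finally show ?thesis using quad_parts(2)[OF assms(1)] quad_parts(2)[OF assms(2)] by simp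
qed

lemma norm_bounds:
  assumes j: "j \<in> {1..K}"
  shows "R j \<le> N j" "N j - R j \<le> sqrt Q" "\<bar>sqrt (real n) - N j\<bar> \<le> 2 * sqrt Q" "sqrt (real n) / 2 \<le> N j"
proof -
  have sp: "(N j)\<^sup>2 = (\<Sum>l<j. (G j l)\<^sup>2) + (R j)\<^sup>2" using j nK by (intro vnorm_split) auto
  have s0: "0 \<le> (\<Sum>l<j. (G j l)\<^sup>2)" by (intro sum_nonneg) auto
  show RN: "R j \<le> N j" by (rule power2_le_imp_le) (use sp s0 in auto)
  have "(N j)\<^sup>2 \<le> (R j + sqrt Q)\<^sup>2"
  proof -
    have "(N j)\<^sup>2 \<le> Q + (R j)\<^sup>2" unfolding sp using quad_parts(2)[of j] j by simp
    also have "\<dots> \<le> (R j + sqrt Q)\<^sup>2"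
    proof -
      have "0 \<le> R j * sqrt Q" using sqrt_Q(1) by simp
      then show ?thesis using Q_ge_1 by (simp add: power2_sum)
    qed
    finally show ?thesis .
  qed
  then have "N j \<le> R j + sqrt Q" by (rule power2_le_imp_le) (use sqrt_Q(1) in simp)
  then show NR: "N j - R j \<le> sqrt Q" by simp
  have "\<bar>R j - sqrt (real n)\<bar> \<le> sqrt Q" using quad_parts(3)[OF j] by (simp add: real_le_rsqrt)
  then show 3: "\<bar>sqrt (real n) - N j\<bar> \<le> 2 * sqrt Q" using RN NR by linarith
  show "sqrt (real n) / 2 \<le> N j" using 3 sqrt_Q(3) by linarith
qed

lemma sqrt_n_pos: "0 < sqrt (real n)" using nK by simp

lemma N_pos: "j \<in> {1..K} \<Longrightarrow> 0 < N j"
  using norm_bounds(4)[of j] sqrt_n_pos by linarith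

text \<open>Besides the main term there are the cross terms below \<open>i\<close>, at most
  \<open>Q\<close>, and the replacement of \<open>R i\<close> by \<open>N i\<close> times an entry,
  at most \<open>sqrt Q * sqrt Q\<close>. Both carry the factor \<open>sqrt n / N i\<close>, which
  is at most 2.\<close>

lemma code_noise:
  assumes i: "i \<in> {1..K}"
  shows "\<bar>sqrt (real n) * dotp {..<n} (T i) (T (Suc K)) / N i - sqrt (real n) * G (Suc K) i\<bar> \<le> 4 * Q"
proof -
  define r where "r = sqrt (real n)"
  define s where "s = (\<Sum>l<i. G (Suc K) l * G i l)"
  have r: "r > 0" using sqrt_n_pos by (simp add: r_def)
  have Ni: "r / 2 \<le> N i" "N i > 0" using norm_bounds(4)[OF i] N_pos[OF i] by (simp_all add: r_def)
  have d: "dotp {..<n} (T i) (T (Suc K)) = s + G (Suc K) i * R i"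
    using i nK by (subst dotp_commute, subst dotp_triang) (auto simp: s_def)
  have s: "\<bar>s\<bar> \<le> Q" unfolding s_def using i by (intro cross_le) auto
  have "r * (s + G (Suc K) i * R i) / N i - r * G (Suc K) i = r / N i * (s + G (Suc K) i * (R i - N i))"
    using Ni by (simp add: field_simps)
  also have "\<bar>\<dots>\<bar> = r / N i * \<bar>s + G (Suc K) i * (R i - N i)\<bar>" using r Ni by (simp add: abs_mult)
  also have "\<dots> \<le> 2 * (Q + Q)"
  proof (rule mult_mono)
    show "r / N i \<le> 2" using Ni by (simp add: pos_divide_le_eq)
    have "\<bar>G (Suc K) i * (R i - N i)\<bar> \<le> sqrt Q * sqrt Q"
      unfolding abs_mult using i norm_bounds(1,2)[OF i] Q_nonneg by (intro mult_mono entry_le) auto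
    then show "\<bar>s + G (Suc K) i * (R i - N i)\<bar> \<le> Q + Q" using s sqrt_Q(2) by linarith
  qed auto
  finally show ?thesis by (simp add: d r_def)
qed

text \<open>As for the noise, but with two normalizations: the cross terms give
  \<open>4 * Q\<close>, the deviation of \<open>N j\<close> from \<open>sqrt n\<close> gives another
  \<open>4 * Q\<close>, and replacing \<open>R i\<close> by \<open>N i\<close> gives
  \<open>2 * Q\<close>.\<close>

lemma code_code:
  assumes i: "i \<in> {1..K}" and j: "j \<in> {1..K}" and ij: "i < j"
  shows "\<bar>real n * dotp {..<n} (T j) (T i) / (N i * N j) - sqrt (real n) * G j i\<bar> \<le> 10 * Q"
proof -
  define r where "r = sqrt (real n)"
  define s where "s = (\<Sum>l<i. G j l * G i l)"
  have r: "r > 0" "real n = r * r" using sqrt_n_pos by (simp_all add: r_def)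
  have Ni: "r / 2 \<le> N i" "N i > 0" using norm_bounds(4)[OF i] N_pos[OF i] by (simp_all add: r_def)
  have Nj: "r / 2 \<le> N j" "N j > 0" using norm_bounds(4)[OF j] N_pos[OF j] by (simp_all add: r_def)
  have d: "dotp {..<n} (T j) (T i) = s + G j i * R i"
    using i j ij nK by (subst dotp_triang) (auto simp: s_def)
  have s: "\<bar>s\<bar> \<le> Q" unfolding s_def using i j ij by (intro cross_le) auto
  have ri: "0 \<le> r / N i" "r / N i \<le> 2" and rj: "0 \<le> r / N j" "r / N j \<le> 2"
    using Ni Nj r by (simp_all add: pos_divide_le_eq)
  have RN: "0 \<le> R i / N i" "R i / N i \<le> 1" using Ni norm_bounds(1)[OF i] by (simp_all add: pos_divide_le_eq)
  have eq: "r * r * (s + g * u) / (a * b) - r * g = (r / a) * (r / b) * s + g * ((r / b) * (r - b) * (u / a) + (r / a) * (u - a))"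
    if "a > 0" "b > 0" for g u a b :: real
    using that by (simp add: field_simps)
  have "real n * dotp {..<n} (T j) (T i) / (N i * N j) - r * G j i
      = (r / N i) * (r / N j) * s + G j i * ((r / N j) * (r - N j) * (R i / N i) + (r / N i) * (R i - N i))"
    unfolding d r(2) by (rule eq[OF Ni(2) Nj(2)])
  also have "\<bar>\<dots>\<bar> \<le> 2 * 2 * Q + sqrt Q * (2 * (2 * sqrt Q) * 1 + 2 * sqrt Q)"
  proof -
    have 1: "\<bar>(r / N i) * (r / N j) * s\<bar> \<le> 2 * 2 * Q"
      unfolding abs_mult using s ri rj by (intro mult_mono) auto
    have 2: "\<bar>(r / N j) * (r - N j) * (R i / N i)\<bar> \<le> 2 * (2 * sqrt Q) * 1"
      unfolding abs_mult using rj RN norm_bounds(3)[OF j] Q_nonneg by (intro mult_mono) (auto simp: r_def)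
    have 3: "\<bar>(r / N i) * (R i - N i)\<bar> \<le> 2 * sqrt Q"
      unfolding abs_mult using ri norm_bounds(1,2)[OF i] by (intro mult_mono) auto
    have "\<bar>G j i * ((r / N j) * (r - N j) * (R i / N i) + (r / N i) * (R i - N i))\<bar>
       \<le> sqrt Q * (2 * (2 * sqrt Q) * 1 + 2 * sqrt Q)"
      unfolding abs_mult[of "G j i"] using 2 3 sqrt_Q(1) j ij
      by (intro mult_mono entry_le order_trans[OF abs_triangle_ineq add_mono]) auto
    then show ?thesis using 1 by linarith
  qed
  also have "\<dots> = 10 * Q" using sqrt_Q(2) by (simp add: algebra_simps)
  finally show ?thesis by (simp add: r_def)
qed

text \<open>The tail of the noise has norm \<open>a + w / sqrt 2\<close> with
  \<open>a\<^sup>2 = n - K - 2\<close>. Squaring gives the linear term in \<open>w\<close>; the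
  other contributions are the \<open>Suc K\<close> leading entries, the shift \<open>K + 2\<close>,
  the mismatch of \<open>a\<close> and \<open>sqrt n\<close>, and
  \<open>w\<^sup>2 / 2\<close>.\<close>

lemma noise_norm:
  "\<bar>(N (Suc K))\<^sup>2 - real n - sqrt (real n) * (sqrt 2 * w)\<bar> \<le> (2 * real K + 6) * Q"
proof -
  define r where "r = sqrt (real n)"
  define a where "a = sqrt (real (n - Suc K) - 1)"
  have a2: "a\<^sup>2 = real n - real K - 2" using nK by (simp add: a_def of_nat_diff)
  have a0: "a \<ge> 0" unfolding a_def using nK by simp
  have r: "r > 0" "r\<^sup>2 = real n" using sqrt_n_pos by (simp_all add: r_def)
  have r1: "r \<ge> 1" unfolding r_def using nK by simp
  have RK: "R (Suc K) = a + w / sqrt 2"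
    unfolding w chi_dev_def by (simp add: a_def)
  have sp: "(N (Suc K))\<^sup>2 = (\<Sum>l<Suc K. (G (Suc K) l)\<^sup>2) + (R (Suc K))\<^sup>2" using nK by (intro vnorm_split) auto
  have "(R (Suc K))\<^sup>2 = a\<^sup>2 + sqrt 2 * a * w + w\<^sup>2 / 2"
    unfolding RK power2_sum power_divide by (simp add: real_div_sqrt field_simps)
  then have e: "(N (Suc K))\<^sup>2 - real n - r * (sqrt 2 * w)
      = (\<Sum>l<Suc K. (G (Suc K) l)\<^sup>2) - (real K + 2) + sqrt 2 * w * (a - r) + w\<^sup>2 / 2"
    unfolding sp a2 by (simp add: algebra_simps)
  have "a \<le> r" by (rule power2_le_imp_le) (use a2 r in auto)
  \<comment> \<open>The difference of the roots is bounded by the difference of the squares because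
    their sum is at least 1.\<close>
  have "(r - a) * 1 \<le> (r - a) * (r + a)" using \<open>a \<le> r\<close> r1 a0 by (intro mult_left_mono) auto
  also have "\<dots> = real K + 2" using a2 r by (simp add: power2_eq_square algebra_simps)
  finally have ra: "\<bar>a - r\<bar> \<le> real K + 2" using \<open>a \<le> r\<close> by simp
  have "2 * \<bar>w\<bar> \<le> 1 + w\<^sup>2" using sum_squares_bound[of 1 "\<bar>w\<bar>"] by simp
  moreover have "sqrt 2 \<le> 2" by (rule real_le_lsqrt) auto
  then have "sqrt 2 * \<bar>w\<bar> \<le> 2 * \<bar>w\<bar>" by (rule mult_right_mono) simp
  ultimately have "sqrt 2 * \<bar>w\<bar> \<le> Q" using quad_parts(1) by linarith
  then have "\<bar>sqrt 2 * w * (a - r)\<bar> \<le> Q * (real K + 2)"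
    unfolding abs_mult using ra Q_ge_1 by (intro mult_mono) auto
  moreover have "(real K + 2) * 1 \<le> (real K + 2) * Q" using Q_ge_1 by (intro mult_left_mono) auto
  moreover have "0 \<le> (\<Sum>l<Suc K. (G (Suc K) l)\<^sup>2)" by (rule sum_nonneg) simp
  moreover have "(\<Sum>l<Suc K. (G (Suc K) l)\<^sup>2) \<le> Q" by (rule quad_parts(2)) simp
  moreover have "0 \<le> real K" by simp
  moreover have "0 \<le> w\<^sup>2" "w\<^sup>2 / 2 \<le> Q" using quad_parts(1) zero_le_power2[of w] by linarith+
  moreover have "(2 * real K + 6) * Q = Q * (real K + 2) + (real K + 2) * Q + 2 * Q" by (simp add: algebra_simps)
  moreover have "\<bar>u - k + x + v\<bar> \<le> d"
    if "\<bar>x\<bar> \<le> b" "k * 1 \<le> b'" "0 \<le> u" "u \<le> Q" "0 \<le> k" "0 \<le> v" "v \<le> Q" "d = b + b' + 2 * Q" for u k x v b b' d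
    using that by linarith
  moreover have "0 \<le> real K + 2" "0 \<le> w\<^sup>2 / 2" by simp_all
  ultimately have "\<bar>(N (Suc K))\<^sup>2 - real n - r * (sqrt 2 * w)\<bar> \<le> (2 * real K + 6) * Q"
    unfolding e by blast
  then show ?thesis by (simp add: r_def)
qed

text \<open>The square of noise plus codewords is expanded into noise norm, mixed products and
  codeword products. The doubled bounds of \<open>code_noise\<close> and \<open>code_code\<close>
  explain 8 and 20, and \<open>noise_norm\<close> contributes \<open>2 * real K + 6\<close>.\<close>

lemma output_norm:
  fixes P :: "nat \<Rightarrow> real" and H :: "nat \<Rightarrow> nat \<Rightarrow> real"
  assumes S: "S \<subseteq> {1..K}" and P: "\<And>i. i \<in> {1..K} \<Longrightarrow> P i > 0"
    and H: "\<And>j. j \<in> {1..Suc K} \<Longrightarrow> H j = T j"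
  defines "c \<equiv> \<lambda>i. sqrt (real n * P i)"
  defines "L \<equiv> - 2 * (1 + Psum P S) * lin_form K P S G"
  shows "\<bar>(vnorm {..<n} (\<lambda>t. H (Suc K) t + xsum {..<n} S c H t))\<^sup>2 - real n * (1 + Psum P S) - sqrt (real n) * (L + sqrt 2 * w)\<bar>
     \<le> (2 * real K + 6 + 8 * (\<Sum>i\<in>S. sqrt (P i)) + 20 * (\<Sum>i\<in>S. \<Sum>j\<in>S. sqrt (P i) * sqrt (P j))) * Q"
    and "\<bar>L\<bar> \<le> 2 * ((\<Sum>i\<in>S. \<Sum>j\<in>S. sqrt (P i) * sqrt (P j)) + (\<Sum>i\<in>S. sqrt (P i))) * sqrt Q"
proof -
  let ?N = "{..<n}"
  define r where "r = sqrt (real n)"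
  have r: "r > 0" "r * r = real n" using sqrt_n_pos by (simp_all add: r_def)
  have finS: "finite S" using S finite_subset by blast
  define p where "p = (\<lambda>i. sqrt (P i))"
  have pp: "sqrt (P i) = p i" for i by (simp add: p_def)
  have p: "p i > 0" "p i * p i = P i" if "i \<in> S" for i using P[of i] that S by (auto simp: p_def)
  have c: "c i = r * p i" for i by (simp add: c_def r_def p_def real_sqrt_mult)
  have SK: "i \<in> {1..K}" if "i \<in> S" for i using that S by auto
  have P0: "0 \<le> Psum P S" unfolding Psum_def by (rule sum_nonneg) (use P SK in force)
  define X where "X = xsum ?N S c H"
  define Z where "Z = H (Suc K)"
  define A where "A = (\<Sum>j\<in>S. \<Sum>l\<in>{l\<in>S. l < j}. p j * p l * G j l)"
  define B where "B = (\<Sum>l\<in>S. p l * G (Suc K) l)"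
  have L: "L = 2 * A + 2 * B"
  proof -
    have "- 2 * (1 + x) * (- (a + b) / (1 + x)) = 2 * a + 2 * b" if "0 \<le> x" for x a b :: real
      using that by (simp add: field_simps)
    from this[OF P0] show ?thesis unfolding L_def lin_form_def A_def B_def p_def .
  qed
  have HT: "H s = T s" if "s \<in> S" for s using H SK[OF that] by auto
  have ZT: "Z = T (Suc K)" by (simp add: Z_def H)
  have nH: "vnorm ?N (H s) = N s" if "s \<in> S" for s
    using HT[OF that] SK[OF that] nK vnorm_triang[of s n "G s"] by simp
  have nT: "vnorm ?N (T s) = N s" if "s \<in> S" for s
    using nH[OF that] HT[OF that] by simp
  have ex: "(vnorm ?N (\<lambda>t. Z t + X t))\<^sup>2 = dotp ?N Z Z + 2 * dotp ?N X Z + dotp ?N X X"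
    unfolding vnorm_sq by (simp add: dotp_def algebra_simps sum.distrib sum_distrib_left)
  have ZZ: "dotp ?N Z Z = (N (Suc K))\<^sup>2"
    unfolding ZT vnorm_sq using nK by (rule triang_dotp_same)
  have XZ: "\<bar>dotp ?N X Z - r * B\<bar> \<le> 4 * Q * (\<Sum>i\<in>S. p i)"
  proof -
    have "dotp ?N X Z - r * B = (\<Sum>s\<in>S. p s * (r * dotp ?N (T s) (T (Suc K)) / N s - r * G (Suc K) s))"
      unfolding X_def dotp_xsum B_def sum_distrib_left sum_subtractf[symmetric]
      by (intro sum.cong refl) (simp add: c nT HT ZT algebra_simps)
    also have "\<bar>\<dots>\<bar> \<le> (\<Sum>s\<in>S. p s * (4 * Q))"
    proof (rule order_trans[OF sum_abs sum_mono])
      fix s assume s: "s \<in> S"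
      show "\<bar>p s * (r * dotp ?N (T s) (T (Suc K)) / N s - r * G (Suc K) s)\<bar> \<le> p s * (4 * Q)"
        unfolding abs_mult using p(1)[OF s] code_noise[OF SK[OF s]]
        by (intro mult_mono) (auto simp: r_def)
    qed
    also have "\<dots> = 4 * Q * (\<Sum>i\<in>S. p i)" by (simp add: mult.commute flip: sum_distrib_right)
    finally show ?thesis .
  qed
  define gm where "gm = (\<lambda>a b. if a < b then G b a else G a b)"
  have XX: "\<bar>dotp ?N X X - real n * Psum P S - r * (2 * A)\<bar> \<le> 20 * Q * (\<Sum>i\<in>S. \<Sum>j\<in>S. p i * p j)"
  proof -
    define u where "u = (\<lambda>s s'. c s / N s * (c s' / N s') * dotp ?N (T s') (T s))"
    have XXu: "dotp ?N X X = (\<Sum>s\<in>S. \<Sum>s'\<in>S. u s s')"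
      unfolding X_def dotp_xsum_self u_def by (intro sum.cong refl) (simp add: nT HT)
    have usym: "u s s' = u s' s" for s s' unfolding u_def by (simp add: dotp_commute[of ?N "T s" "T s'"] mult_ac)
    have udiag: "u s s = real n * P s" if s: "s \<in> S" for s
    proof -
      have "dotp ?N (T s) (T s) = N s * N s"
        using SK[OF s] nK triang_dotp_same[of s n "G s"] vnorm_sq[of ?N "G s"] by (simp add: power2_eq_square)
      moreover have "r * p s * (r * p s) = real n * P s"
        unfolding r(2)[symmetric] p(2)[OF s, symmetric] by (simp add: mult_ac)
      ultimately show ?thesis using N_pos[OF SK[OF s]] by (simp add: u_def c)
    qed
    have uoff: "\<bar>u j i - r * (p j * p i * G j i)\<bar> \<le> 10 * Q * (p j * p i)" if "i \<in> S" "j \<in> S" "i < j" for i j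
    proof -
      have "u j i = p j * p i * (real n * dotp ?N (T j) (T i) / (N i * N j))"
        unfolding u_def c r(2)[symmetric] by (simp add: dotp_commute[of ?N "T i" "T j"] mult_ac)
      then have "u j i - r * (p j * p i * G j i) = (p j * p i) * (real n * dotp ?N (T j) (T i) / (N i * N j) - r * G j i)"
        by (simp add: algebra_simps)
      also have "\<bar>\<dots>\<bar> \<le> (p j * p i) * (10 * Q)"
        unfolding abs_mult[of "p j * p i"] using p(1)[OF that(1)] p(1)[OF that(2)] code_code[OF SK[OF that(1)] SK[OF that(2)] that(3)]
        by (intro mult_mono) (auto simp: r_def)
      finally show ?thesis by (simp add: mult_ac)
    qed
    have split: "(\<Sum>s\<in>S. \<Sum>s'\<in>S. u s s') = (\<Sum>s\<in>S. u s s) + 2 * (\<Sum>j\<in>S. \<Sum>i\<in>{i\<in>S. i < j}. u j i)"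
      by (rule sum_symmetric_split[OF finS usym])
    have "dotp ?N X X = real n * Psum P S + 2 * (\<Sum>j\<in>S. \<Sum>i\<in>{i\<in>S. i < j}. u j i)"
      unfolding XXu split Psum_def sum_distrib_left by (simp add: udiag)
    then have "dotp ?N X X - real n * Psum P S - r * (2 * A) = 2 * (\<Sum>j\<in>S. \<Sum>i\<in>{i\<in>S. i < j}. u j i - r * (p j * p i * G j i))"
      by (simp add: A_def sum_subtractf sum_distrib_left algebra_simps)
    also have "\<bar>\<dots>\<bar> \<le> 2 * (\<Sum>j\<in>S. \<Sum>i\<in>{i\<in>S. i < j}. 10 * Q * (p j * p i))"
    proof -
      have "\<bar>\<Sum>j\<in>S. \<Sum>i\<in>{i\<in>S. i < j}. u j i - r * (p j * p i * G j i)\<bar> \<le> (\<Sum>j\<in>S. \<Sum>i\<in>{i\<in>S. i < j}. 10 * Q * (p j * p i))"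
        by (intro order_trans[OF sum_abs sum_mono]) (use uoff in auto)
      then show ?thesis by simp
    qed
    also have "\<dots> \<le> 2 * (\<Sum>j\<in>S. \<Sum>i\<in>S. 10 * Q * (p j * p i))"
      using finS p(1) Q_ge_1 by (intro mult_left_mono sum_mono sum_mono2) (auto intro!: mult_nonneg_nonneg less_imp_le)
    also have "\<dots> = 20 * Q * (\<Sum>i\<in>S. \<Sum>j\<in>S. p i * p j)" by (simp add: sum_distrib_left mult_ac)
    finally show ?thesis .
  qed
  have e: "real n * (1 + x) = real n + real n * x" "(a + 8 * b + 20 * d) * Q = a * Q + 2 * (4 * Q * b) + 20 * Q * d"
    "r * (2 * A + 2 * B + sqrt 2 * w) = r * (2 * A) + 2 * (r * B) + r * (sqrt 2 * w)" for x a b d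
    by (simp_all add: algebra_simps)
  show "\<bar>(vnorm ?N (\<lambda>t. H (Suc K) t + xsum ?N S c H t))\<^sup>2 - real n * (1 + Psum P S) - sqrt (real n) * (L + sqrt 2 * w)\<bar>
     \<le> (2 * real K + 6 + 8 * (\<Sum>i\<in>S. sqrt (P i)) + 20 * (\<Sum>i\<in>S. \<Sum>j\<in>S. sqrt (P i) * sqrt (P j))) * Q"
    unfolding Z_def[symmetric] X_def[symmetric] ex ZZ r_def[symmetric] pp L e
    using XZ XX noise_norm[folded r_def] by linarith
  have "\<bar>A\<bar> \<le> (\<Sum>j\<in>S. \<Sum>l\<in>{l\<in>S. l < j}. p j * p l * sqrt Q)"
    unfolding A_def
  proof (intro order_trans[OF sum_abs sum_mono])
    fix j l assume "j \<in> S" "l \<in> {l\<in>S. l < j}"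
    then show "\<bar>p j * p l * G j l\<bar> \<le> p j * p l * sqrt Q"
      unfolding abs_mult using p(1)[of j] p(1)[of l] SK[of j] entry_le[of j l] by (intro mult_mono) auto
  qed
  also have "\<dots> \<le> (\<Sum>j\<in>S. \<Sum>l\<in>S. p j * p l * sqrt Q)"
    using finS p(1) sqrt_Q(1) by (intro sum_mono sum_mono2) (auto intro!: mult_nonneg_nonneg less_imp_le)
  finally have A: "\<bar>A\<bar> \<le> (\<Sum>i\<in>S. \<Sum>j\<in>S. p i * p j) * sqrt Q" by (simp add: sum_distrib_right)
  have "\<bar>B\<bar> \<le> (\<Sum>l\<in>S. p l * sqrt Q)"
    unfolding B_def
  proof (intro order_trans[OF sum_abs sum_mono])
    fix l assume "l \<in> S"
    then show "\<bar>p l * G (Suc K) l\<bar> \<le> p l * sqrt Q"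
      unfolding abs_mult using p(1)[of l] SK[of l] entry_le[of "Suc K" l] by (intro mult_mono) auto
  qed
  then have B: "\<bar>B\<bar> \<le> (\<Sum>i\<in>S. p i) * sqrt Q" by (simp add: sum_distrib_right)
  show "\<bar>L\<bar> \<le> 2 * ((\<Sum>i\<in>S. \<Sum>j\<in>S. sqrt (P i) * sqrt (P j)) + (\<Sum>i\<in>S. sqrt (P i))) * sqrt Q"
    unfolding L pp using A B by (simp add: algebra_simps)
qed

end

text \<open>\<open>A\<close> and \<open>V\<close> are the squared norms of the noise and of the output.\<close>

lemma log_ratio_expansion:
  fixes p c :: real
  assumes p: "p > 0" and c: "c \<ge> 1"
  obtains D :: real where "D > 0"
    "\<And>n A V x L Q. n \<ge> 1 \<Longrightarrow> 1 \<le> Q \<Longrightarrow> D * Q \<le> n \<Longrightarrow> \<bar>A - n - sqrt n * x\<bar> \<le> c * Q \<Longrightarrow>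
       \<bar>V - n * (1 + p) - sqrt n * (L + x)\<bar> \<le> c * Q \<Longrightarrow> \<bar>x\<bar> \<le> 2 * sqrt Q \<Longrightarrow> \<bar>L\<bar> \<le> c * sqrt Q \<Longrightarrow>
       0 < A \<and> A \<le> (1 - p / (2 * (1 + p))) * V \<and>
       n / 2 * ln (1 + p) + sqrt n * (L - p * x) / (2 * (1 + p)) - D * Q \<le> (n - 1) / 2 * ln (V / A)"
proof -
  \<comment> \<open>The admissible relative deviation of \<open>A\<close> and \<open>V\<close> from
    \<open>n\<close> and \<open>n * (1 + p)\<close>. The second term in the minimum keeps
    \<open>1 - A / V\<close> above half of its limiting value \<open>p / (1 + p)\<close>.\<close>
  define \<eta> where "\<eta> = min (1/2) (p / (2 * (2 + p)))"
  have \<eta>: "0 < \<eta>" "\<eta> \<le> 1/2" "\<eta> * (2 + p) \<le> p / 2"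
  proof -
    show "0 < \<eta>" "\<eta> \<le> 1/2" using p by (auto simp: \<eta>_def)
    have "\<eta> * (2 + p) \<le> p / (2 * (2 + p)) * (2 + p)" using p by (intro mult_right_mono) (auto simp: \<eta>_def)
    also have "\<dots> = p / 2" using p by (simp add: field_simps)
    finally show "\<eta> * (2 + p) \<le> p / 2" .
  qed
  \<comment> \<open>Both relative deviations are at most \<open>b * sqrt (Q / n)\<close>: the output
    has a linear part with coefficient at most \<open>c + 2\<close> and a remainder with coefficient
    \<open>c\<close>.\<close>
  define b where "b = 2 * c + 2"
  have b: "b \<ge> 4" using c by (simp add: b_def)
  \<comment> \<open>The square forces \<open>b * sqrt (Q / n) \<le> \<eta>\<close> as soon as
    \<open>D * Q \<le> n\<close>; the other summands collect the coefficient of \<open>Q\<close> in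
    the remainder.\<close>
  define D where "D = (b / \<eta>)\<^sup>2 + c + b\<^sup>2 + p + 1"
  have D0: "D > 0" using c p by (simp add: D_def add_nonneg_pos)
  have D1: "(b / \<eta>)\<^sup>2 \<le> D" "c + b\<^sup>2 / 2 + (p + 1) \<le> D" using c p by (auto simp: D_def)
  have main: "0 < A \<and> A \<le> (1 - p / (2 * (1 + p))) * V \<and>
       n / 2 * ln (1 + p) + sqrt n * (L - p * x) / (2 * (1 + p)) - D * Q \<le> (n - 1) / 2 * ln (V / A)"
    if n: "n \<ge> 1" and Q: "1 \<le> Q" and DQ: "D * Q \<le> n" and A: "\<bar>A - n - sqrt n * x\<bar> \<le> c * Q"
      and V: "\<bar>V - n * (1 + p) - sqrt n * (L + x)\<bar> \<le> c * Q" and x: "\<bar>x\<bar> \<le> 2 * sqrt Q" and L: "\<bar>L\<bar> \<le> c * sqrt Q"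
    for n A V x L Q
  proof -
    define r where "r = sqrt n"
    define t where "t = sqrt Q"
    have r: "r \<ge> 1" "n = r * r" using n by (auto simp: r_def)
    have t: "t \<ge> 1" "Q = t * t" using Q by (auto simp: t_def)
    have "(b / \<eta>)\<^sup>2 * Q \<le> n" using D1(1) DQ Q mult_right_mono[OF D1(1), of Q] by linarith
    then have "(b / \<eta> * t)\<^sup>2 \<le> r\<^sup>2" by (simp add: power_mult_distrib r(2) t(2) power2_eq_square mult_ac)
    then have "b / \<eta> * t \<le> r" by (rule power2_le_imp_le) (use r in simp)
    then have bt: "b * (t / r) \<le> \<eta>" using \<eta>(1) r by (simp add: field_simps)
    have trp: "0 < t / r" using t r by simp
    then have "1 * (t / r) \<le> b * (t / r)" using b by (intro mult_right_mono) auto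
    then have tr1: "t / r \<le> 1" using bt \<eta>(2) by linarith
    define \<omega> where "\<omega> = A / n - 1"
    define \<alpha> where "\<alpha> = V / (n * (1 + p)) - 1"
    have Aw: "A = n * (1 + \<omega>)" using n by (simp add: \<omega>_def)
    have Va: "V = n * (1 + p) * (1 + \<alpha>)" using n p by (simp add: \<alpha>_def)
    have Q_le: "Q \<le> t * r" using tr1 t r by (simp add: pos_divide_le_eq)
    have nw: "\<bar>n * \<omega>\<bar> \<le> b * (t * r)"
    proof -
      have "\<bar>r * x\<bar> \<le> r * (2 * t)" unfolding abs_mult using x r by (intro mult_mono) (auto simp: t_def)
      moreover have "c * Q \<le> c * (t * r)" using Q_le c by (intro mult_left_mono) auto
      moreover have "n * \<omega> = (A - n - r * x) + r * x" unfolding Aw by (simp add: algebra_simps)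
      moreover have "b * (t * r) = c * (t * r) + r * (2 * t) + c * (t * r)" by (simp add: b_def algebra_simps)
      moreover have "0 \<le> c * (t * r)" using c t r by simp
      ultimately show ?thesis using A[folded r_def] by linarith
    qed
    have na: "\<bar>n * ((1 + p) * \<alpha>)\<bar> \<le> b * (t * r)"
    proof -
      have "\<bar>r * (L + x)\<bar> \<le> r * ((c + 2) * t)"
        unfolding abs_mult using x L r by (intro mult_mono) (auto simp: t_def algebra_simps)
      moreover have "c * Q \<le> c * (t * r)" using Q_le c by (intro mult_left_mono) auto
      moreover have "n * ((1 + p) * \<alpha>) = (V - n * (1 + p) - r * (L + x)) + r * (L + x)" unfolding Va by (simp add: algebra_simps)
      moreover have "b * (t * r) = c * (t * r) + r * ((c + 2) * t)" by (simp add: b_def algebra_simps)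
      ultimately show ?thesis using V[folded r_def] by linarith
    qed
    have scale: "\<bar>y\<bar> \<le> b * (t / r)" if "\<bar>n * y\<bar> \<le> b * (t * r)" for y
    proof -
      have "n * \<bar>y\<bar> \<le> n * (b * (t / r))" using that n r unfolding abs_mult r(2) by (simp add: mult_ac)
      then show ?thesis by (rule mult_left_le_imp_le) (use n in simp)
    qed
    have w: "\<bar>\<omega>\<bar> \<le> b * (t / r)" by (rule scale[OF nw])
    have "\<bar>(1 + p) * \<alpha>\<bar> \<le> b * (t / r)" by (rule scale[OF na])
    moreover have "\<bar>\<alpha>\<bar> \<le> \<bar>(1 + p) * \<alpha>\<bar>" unfolding abs_mult using p by (simp add: mult_le_cancel_right1)
    ultimately have a: "\<bar>\<alpha>\<bar> \<le> b * (t / r)" by simp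
    have w\<eta>: "\<bar>\<omega>\<bar> \<le> \<eta>" "\<bar>\<alpha>\<bar> \<le> \<eta>" using w a bt by linarith+
    then have w12: "\<bar>\<omega>\<bar> \<le> 1/2" "\<bar>\<alpha>\<bar> \<le> 1/2" using \<eta>(2) by linarith+
    have A0: "0 < A" unfolding Aw using n w12 by simp
    have V0: "0 < V" unfolding Va using n p w12 by simp
    have AV: "A \<le> (1 - p / (2 * (1 + p))) * V"
    proof -
      have "(1 - p / (2 * (1 + p))) * V = n * ((1 + p / 2) * (1 + \<alpha>))"
        unfolding Va using p by (simp add: field_simps)
      moreover have "1 + \<omega> \<le> (1 + p / 2) * (1 + \<alpha>)"
      proof -
        have "(1 + p / 2) * (1 - \<eta>) \<le> (1 + p / 2) * (1 + \<alpha>)" using w\<eta> p by (intro mult_left_mono) auto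
        moreover have "0 \<le> \<eta> * p" using \<eta> p by simp
        then have "1 + \<eta> \<le> (1 + p / 2) * (1 - \<eta>)" using \<eta> by (simp add: algebra_simps)
        ultimately show ?thesis using w\<eta> by linarith
      qed
      ultimately show ?thesis unfolding Aw using n by simp
    qed
    \<comment> \<open>A lower bound for \<open>ln (V / A)\<close>: the numerator needs the quadratic
      term of the logarithm, while for the denominator
      \<open>ln (1 + \<omega>) \<le> \<omega>\<close> goes in the right direction.\<close>
    define E where "E = ln (1 + p) + \<alpha> - \<alpha>\<^sup>2 - \<omega>"
    have lnE: "E \<le> ln (V / A)"
    proof -
      have "V / A = (1 + p) * (1 + \<alpha>) / (1 + \<omega>)" unfolding Va Aw using n by simp
      then have "ln (V / A) = ln (1 + p) + ln (1 + \<alpha>) - ln (1 + \<omega>)"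
      proof -
        have "0 < 1 + \<alpha>" "0 < 1 + \<omega>" "0 < 1 + p" using w12 p by linarith+
        then show ?thesis using \<open>V / A = _\<close> by (simp add: ln_mult_pos ln_divide_pos)
      qed
      moreover have "\<alpha> - \<alpha>\<^sup>2 \<le> ln (1 + \<alpha>)"
      proof -
        have "\<bar>\<alpha>\<bar> ^ 3 \<le> \<alpha>\<^sup>2 * (1/2)"
          using w12 mult_left_mono[of "\<bar>\<alpha>\<bar>" "1/2" "\<bar>\<alpha>\<bar> * \<bar>\<alpha>\<bar>"] by (simp add: power3_eq_cube power2_eq_square)
        then show ?thesis using ln_lower_cubic[of \<alpha>] w12 by linarith
      qed
      moreover have "ln (1 + \<omega>) \<le> \<omega>" using w12 by (intro ln_add_one_self_le_self2) auto
      ultimately show ?thesis unfolding E_def by linarith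
    qed
    \<comment> \<open>Pays for the factor \<open>n - 1\<close> in place of \<open>n\<close>: the
      difference is \<open>E / 2\<close>, a constant.\<close>
    have Eup: "E \<le> p + 1"
    proof -
      have "ln (1 + p) \<le> p" using p by (intro ln_add_one_self_le_self) auto
      then show ?thesis unfolding E_def using w12 zero_le_power2[of \<alpha>] by linarith
    qed
    have "n * \<alpha>\<^sup>2 \<le> b\<^sup>2 * Q"
    proof -
      have "\<alpha>\<^sup>2 \<le> (b * (t / r))\<^sup>2" using power_mono[OF a, of 2] by simp
      then have "n * \<alpha>\<^sup>2 \<le> n * (b * (t / r))\<^sup>2" using n by (intro mult_left_mono) auto
      also have "\<dots> = b\<^sup>2 * Q" unfolding t(2) r(2) using r by (simp add: power_mult_distrib power_divide power2_eq_square)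
      finally show ?thesis .
    qed
    moreover have "n * \<omega> \<le> r * x + c * Q" using A[folded r_def] unfolding Aw by (simp add: algebra_simps abs_le_iff)
    moreover have "n * \<alpha> \<ge> (r * (L + x) - c * Q) / (1 + p)"
    proof -
      have "r * (L + x) - c * Q \<le> n * \<alpha> * (1 + p)" using V[folded r_def] unfolding Va by (simp add: algebra_simps abs_le_iff)
      then show ?thesis using p by (simp add: pos_divide_le_eq)
    qed
    moreover have "(r * (L + x) - c * Q) / (1 + p) \<ge> r * (L + x) / (1 + p) - c * Q"
    proof -
      have "c * Q / (1 + p) \<le> c * Q / 1" using c Q p by (intro divide_left_mono) auto
      then show ?thesis by (simp add: diff_divide_distrib)
    qed
    moreover have "r * (L + x) / (1 + p) - r * x = r * (L - p * x) / (1 + p)" using p by (simp add: field_simps)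
    ultimately have "n * (\<alpha> - \<alpha>\<^sup>2 - \<omega>) \<ge> r * (L - p * x) / (1 + p) - 2 * (c * Q) - b\<^sup>2 * Q"
      unfolding right_diff_distrib by linarith
    then have nE: "n * E \<ge> n * ln (1 + p) + r * (L - p * x) / (1 + p) - 2 * (c * Q) - b\<^sup>2 * Q"
      unfolding E_def by (simp add: algebra_simps)
    have f1: "p + 1 \<le> (p + 1) * Q" using p Q mult_left_mono[of 1 Q "p + 1"] by simp
    have f2: "(c + b\<^sup>2 / 2 + (p + 1)) * Q \<le> D * Q" using D1(2) Q by (intro mult_right_mono) auto
    have f3: "(c + b\<^sup>2 / 2 + (p + 1)) * Q = c * Q + b\<^sup>2 * Q / 2 + (p + 1) * Q" by (simp add: algebra_simps)
    have gen: "X1 / 2 + X2 / 2 - X6 \<le> X7 / 2 - E / 2"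
      if "p + 1 \<le> X5" "s \<le> X6" "s = X3 + X4 / 2 + X5" "X1 + X2 - 2 * X3 - X4 \<le> X7" for s X1 X2 X3 X4 X5 X6 X7 :: real
      using that Eup p by linarith
    have "n * ln (1 + p) / 2 + r * (L - p * x) / (1 + p) / 2 - D * Q \<le> n * E / 2 - E / 2"
      by (rule gen[OF f1 f2 f3 nE])
    moreover have "(n - 1) / 2 * E = n * E / 2 - E / 2" by (simp add: field_simps)
    moreover have "r * (L - p * x) / (2 * (1 + p)) = r * (L - p * x) / (1 + p) / 2" by simp
    moreover have "n / 2 * ln (1 + p) = n * ln (1 + p) / 2" by simp
    ultimately have "n / 2 * ln (1 + p) + r * (L - p * x) / (2 * (1 + p)) - D * Q \<le> (n - 1) / 2 * E"
      by (simp only:)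
    also have "\<dots> \<le> (n - 1) / 2 * ln (V / A)" using lnE n by (intro mult_left_mono) auto
    finally show ?thesis using A0 AV by (simp add: r_def)
  qed
  show ?thesis by (rule that[OF D0]) (use main in blast)
qed

text \<open>The assumption with \<open>\<theta>\<close> keeps the factor
  \<open>sqrt (1 - s\<^sup>2)\<close> away from zero, so it costs a constant. Since
  \<open>2 * pi * (real n - 3) \<ge> real n\<close> for \<open>n \<ge> 4\<close>, the remaining
  factor gives \<open>ln (real n) / 2\<close>, and the level costs at most
  \<open>real k\<close>.\<close>

lemma cap_bound_log:
  fixes \<theta> s m :: real
  assumes n: "n \<ge> 4" and s: "0 < s" "s\<^sup>2 \<le> 1 - \<theta>" and \<theta>: "0 < \<theta>" and m: "m > 0"
    and ge: "(1/2) ^ k \<le> m * cap_bound n s"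
  shows "(real n - 1) * ln (1 / s) \<le> ln m + real k + ln (1 / \<theta>) / 2 - ln (real n) / 2"
proof -
  have u: "1 - s\<^sup>2 \<ge> \<theta>" using s by simp
  have u0: "1 - s\<^sup>2 > 0" using u \<theta> by linarith
  have q: "2 * pi * (real n - 3) \<ge> real n"
  proof -
    have "2 * 3 * (real n - 3) \<le> 2 * pi * (real n - 3)" using n pi_gt3 by (intro mult_right_mono) auto
    moreover have "real n \<le> 2 * 3 * (real n - 3)" using n by simp
    ultimately show ?thesis by (rule order_trans[rotated])
  qed
  have n0: "real n > 0" using n by simp
  then have q0: "2 * pi * (real n - 3) > 0" using q by linarith
  have cb: "cap_bound n s > 0" unfolding cap_bound_def using s u0 q0 by simp
  have "ln ((1/2) ^ k :: real) \<le> ln (m * cap_bound n s)" using ge m cb by (subst ln_le_cancel_iff) auto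
  moreover have "ln ((1/2) ^ k :: real) = - (real k * ln 2)" by (simp add: ln_realpow ln_div)
  moreover have "ln (m * cap_bound n s) = ln m + (real (n - 1) * ln s - (ln (1 - s\<^sup>2) / 2 + ln (2 * pi * (real n - 3)) / 2))"
    unfolding cap_bound_def using m s u0 q0
    using n by (simp add: ln_mult ln_div ln_realpow ln_sqrt)
  moreover have "ln (1 - s\<^sup>2) \<ge> - ln (1 / \<theta>)"
  proof -
    have "ln \<theta> \<le> ln (1 - s\<^sup>2)" using u u0 \<theta> by (subst ln_le_cancel_iff) auto
    then show ?thesis using \<theta> by (simp add: ln_div)
  qed
  moreover have "ln (2 * pi * (real n - 3)) \<ge> ln (real n)" using q n0 q0 by (subst ln_le_cancel_iff) auto
  moreover have "real k * ln 2 \<le> real k * 1" using ln_2_less_1 by (intro mult_left_mono) auto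
  moreover have "(real n - 1) * ln (1 / s) = - (real (n - 1) * ln s)" using s n by (simp add: ln_div of_nat_diff)
  ultimately show ?thesis by linarith
qed

text \<open>If the contribution of \<open>S\<close> is at least 2^-k, then \<open>ln M\<close> must
  reach the information density up to a remainder linear in \<open>k\<close>. The expansion is valid
  only while the quadratic terms are below a multiple of \<open>n\<close>; the complementary event
  is estimated separately by Markov's inequality.\<close>

lemma bad_event_expansion:
  fixes P :: "nat \<Rightarrow> real"
  assumes S: "S \<in> PK K" and P: "\<And>i. i \<in> {1..K} \<Longrightarrow> P i > 0"
  obtains D :: real where "D > 0"
    "\<And>n k G M w. real n \<ge> D \<Longrightarrow> w = chi_dev {Suc K..<n} (G (Suc K)) \<Longrightarrow> D * (quad n K G + w\<^sup>2) \<le> real n \<Longrightarrow> M > 0 \<Longrightarrow>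
       (1/2) ^ k \<le> M * cap_error n K (\<lambda>i. sqrt (real n * P i)) S (\<lambda>j\<in>{1..Suc K}. triang n j (G j)) \<Longrightarrow>
       real n * Cap (Psum P S) - sqrt (real n) * (lin_form K P S G + slope P S * w) - D * (quad n K G + w\<^sup>2 + real k)
         \<le> ln M - ln (real n) / 2"
proof -
  have SK: "S \<subseteq> {1..K}" "S \<noteq> {}" using S by (auto simp: PK_def)
  then have finS: "finite S" using finite_subset by blast
  define p where "p = Psum P S"
  have p: "p > 0" unfolding p_def Psum_def by (rule sum_pos) (use finS SK P in auto)
  define c1 where "c1 = (\<Sum>i\<in>S. sqrt (P i))"
  define c2 where "c2 = (\<Sum>i\<in>S. \<Sum>j\<in>S. sqrt (P i) * sqrt (P j))"
  have Pn: "0 \<le> P i" if "i \<in> S" for i using P[of i] SK that by auto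
  have c12: "c1 \<ge> 0" "c2 \<ge> 0" unfolding c1_def c2_def using Pn by (auto intro!: sum_nonneg)
  define c where "c = 2 * real K + 6 + 8 * c1 + 20 * c2"
  have c: "c \<ge> 1" "2 * real K + 6 \<le> c" "2 * (c2 + c1) \<le> c" using c12 by (auto simp: c_def)
  obtain D0 :: real where D0: "D0 > 0" and
    ex: "\<And>n A V x L Q. n \<ge> 1 \<Longrightarrow> 1 \<le> Q \<Longrightarrow> D0 * Q \<le> n \<Longrightarrow> \<bar>A - n - sqrt n * x\<bar> \<le> c * Q \<Longrightarrow>
       \<bar>V - n * (1 + p) - sqrt n * (L + x)\<bar> \<le> c * Q \<Longrightarrow> \<bar>x\<bar> \<le> 2 * sqrt Q \<Longrightarrow> \<bar>L\<bar> \<le> c * sqrt Q \<Longrightarrow>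
       0 < A \<and> A \<le> (1 - p / (2 * (1 + p))) * V \<and>
       n / 2 * ln (1 + p) + sqrt n * (L - p * x) / (2 * (1 + p)) - D0 * Q \<le> (n - 1) / 2 * ln (V / A)"
    using log_ratio_expansion[OF p c(1)] by blast
  define \<theta> where "\<theta> = p / (2 * (1 + p))"
  have \<theta>: "0 < \<theta>" "\<theta> < 1" using p by (auto simp: \<theta>_def)
  have l\<theta>: "ln (1 / \<theta>) \<ge> 0" using \<theta> by simp
  define D where "D = D0 + 16 + (real K + 10) + ln (1 / \<theta>)"
  have D: "D > 0" "D \<ge> D0" "D \<ge> 16" "D \<ge> real K + 10" "D \<ge> D0 + ln (1 / \<theta>) / 2" "D \<ge> 1"
    using D0 l\<theta> by (auto simp: D_def)
  have main: "real n * Cap (Psum P S) - sqrt (real n) * (lin_form K P S G + slope P S * w) - D * (quad n K G + w\<^sup>2 + real k)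
         \<le> ln M - ln (real n) / 2"
    if n: "real n \<ge> D" and w: "w = chi_dev {Suc K..<n} (G (Suc K))" and DQ: "D * (quad n K G + w\<^sup>2) \<le> real n"
      and M: "M > 0" and ge: "(1/2) ^ k \<le> M * cap_error n K (\<lambda>i. sqrt (real n * P i)) S (\<lambda>j\<in>{1..Suc K}. triang n j (G j))"
    for n k G M w
  proof -
    define Q where "Q = quad n K G + w\<^sup>2"
    define H where "H = (\<lambda>j\<in>{1..Suc K}. triang n j (G j))"
    have nK: "Suc K < n" and n4: "n \<ge> 4" and n1: "real n \<ge> 1" using n D(4) by linarith+
    have Q1: "1 \<le> Q"
    proof -
      have "0 \<le> (\<Sum>j\<in>{1..Suc K}. \<Sum>l<j. (G j l)\<^sup>2)" "0 \<le> (\<Sum>j\<in>{1..K}. (vnorm {j..<n} (G j) - sqrt (real n))\<^sup>2)" "0 \<le> w\<^sup>2"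
        by (intro sum_nonneg zero_le_power2)+
      then show ?thesis unfolding Q_def quad_def by linarith
    qed
    have "16 * Q \<le> D * Q" "D0 * Q \<le> D * Q" using D Q1 by (auto intro!: mult_right_mono)
    then have small: "16 * Q \<le> real n" and D0Q: "D0 * Q \<le> real n" using DQ by (auto simp: Q_def)
    have HT: "H j = triang n j (G j)" if "j \<in> {1..Suc K}" for j using that by (simp add: H_def)
    define z where "z = vnorm {..<n} (H (Suc K))"
    define v where "v = vnorm {..<n} (\<lambda>t. H (Suc K) t + xsum {..<n} S (\<lambda>i. sqrt (real n * P i)) H t)"
    have z: "z = vnorm {..<n} (G (Suc K))" using nK by (simp add: z_def HT vnorm_triang)
    define L where "L = - 2 * (1 + p) * lin_form K P S G"
    have cQ: "a * Q \<le> c * Q" if "a \<le> c" for a using that Q1 by (intro mult_right_mono) auto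
    have 1: "\<bar>z\<^sup>2 - real n - sqrt (real n) * (sqrt 2 * w)\<bar> \<le> c * Q"
      using noise_norm[OF nK w Q_def small] cQ[OF c(2)] unfolding z by linarith
    have 2: "\<bar>v\<^sup>2 - real n * (1 + p) - sqrt (real n) * (L + sqrt 2 * w)\<bar> \<le> c * Q"
      using output_norm(1)[OF nK w Q_def small SK(1) P HT]
      unfolding v_def L_def p_def c_def c1_def c2_def .
    have 3: "\<bar>L\<bar> \<le> c * sqrt Q"
    proof -
      have "\<bar>L\<bar> \<le> 2 * (c2 + c1) * sqrt Q"
        using output_norm(2)[OF nK w Q_def small SK(1) P HT] unfolding L_def p_def c1_def c2_def .
      also have "\<dots> \<le> c * sqrt Q" using c(3) Q1 by (intro mult_right_mono) auto
      finally show ?thesis .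
    qed
    have 4: "\<bar>sqrt 2 * w\<bar> \<le> 2 * sqrt Q"
    proof -
      have "\<bar>w\<bar> \<le> sqrt Q" using quad_parts(1)[OF nK w Q_def small] by (intro real_le_rsqrt) simp
      moreover have "sqrt 2 \<le> 2" by (rule real_le_lsqrt) auto
      ultimately show ?thesis unfolding abs_mult by (intro mult_mono) auto
    qed
    have r: "0 < z\<^sup>2" "z\<^sup>2 \<le> (1 - \<theta>) * v\<^sup>2"
      "real n / 2 * ln (1 + p) + sqrt (real n) * (L - p * (sqrt 2 * w)) / (2 * (1 + p)) - D0 * Q \<le> (real n - 1) / 2 * ln (v\<^sup>2 / z\<^sup>2)"
      using ex[OF n1 Q1 D0Q 1 2 4 3] by (auto simp: \<theta>_def)
    have z0: "0 < z" using r(1) vnorm_nonneg[of "{..<n}" "H (Suc K)"] unfolding z_def[symmetric] by (simp add: less_le)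
    have v0: "0 \<le> v" by (simp add: v_def)
    have v2: "0 < v\<^sup>2"
    proof (rule ccontr)
      assume "\<not> 0 < v\<^sup>2"
      then have "v\<^sup>2 = 0" using zero_le_power2[of v] by linarith
      then show False using r(1,2) by simp
    qed
    then have vp: "0 < v" using v0 by (cases "v = 0") auto
    have "z\<^sup>2 < v\<^sup>2"
    proof -
      have "0 < \<theta> * v\<^sup>2" using \<theta> v2 by simp
      then show ?thesis using r(2) by (simp add: left_diff_distrib)
    qed
    then have zv: "z < v" by (rule power2_less_imp_less[OF _ v0])
    have ce: "cap_error n K (\<lambda>i. sqrt (real n * P i)) S H = cap_bound n (z / v)"
      unfolding cap_error_def using z0 zv by (simp add: z_def v_def)
    have s2: "(z / v)\<^sup>2 \<le> 1 - \<theta>" using r(2) v2 by (simp add: power_divide pos_divide_le_eq)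
    have "(real n - 1) * ln (1 / (z / v)) \<le> ln M + real k + ln (1 / \<theta>) / 2 - ln (real n) / 2"
      by (rule cap_bound_log[OF n4 _ s2 \<theta>(1) M]) (use z0 vp ge ce in \<open>auto simp: H_def\<close>)
    \<comment> \<open>The 2 cancels against \<open>(n - 1) / 2\<close>, which leaves precisely the
      exponent \<open>n - 1\<close> of \<open>cap_bound\<close>.\<close>
    moreover have "ln (v\<^sup>2 / z\<^sup>2) = 2 * ln (1 / (z / v))"
      using z0 vp by (simp add: ln_div ln_realpow)
    ultimately have up: "(real n - 1) / 2 * ln (v\<^sup>2 / z\<^sup>2) \<le> ln M + real k + ln (1 / \<theta>) / 2 - ln (real n) / 2"
      by simp
    have lin: "sqrt (real n) * (L - p * (sqrt 2 * w)) / (2 * (1 + p)) = - sqrt (real n) * (lin_form K P S G + slope P S * w)"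
    proof -
      have "p * (sqrt 2 * w) / (2 * (1 + p)) = p / (sqrt 2 * (1 + p)) * w"
      proof -
        have "p * (s * w) / (s * s * q) = p / (s * q) * w" if "s > 0" "q > 0" for s q :: real
          using that by (simp add: field_simps)
        from this[of "sqrt 2" "1 + p"] show ?thesis using p by simp
      qed
      moreover have "L / (2 * (1 + p)) = - lin_form K P S G"
      proof -
        have "- 2 * q * y / (2 * q) = - y" if "q > 0" for q y :: real using that by simp
        from this[of "1 + p" "lin_form K P S G"] show ?thesis using p unfolding L_def by linarith
      qed
      ultimately have "(L - p * (sqrt 2 * w)) / (2 * (1 + p)) = - (lin_form K P S G + slope P S * w)"
        by (simp add: diff_divide_distrib slope_def p_def)
      then show ?thesis by (simp only: times_divide_eq_right[symmetric] mult_minus_left mult_minus_right)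
    qed
    have "D0 * Q + real k + ln (1 / \<theta>) / 2 \<le> D * (Q + real k)"
    proof -
      have "(D0 + ln (1 / \<theta>) / 2) * Q \<le> D * Q" using D(5) Q1 by (intro mult_right_mono) auto
      moreover have "ln (1 / \<theta>) / 2 \<le> ln (1 / \<theta>) / 2 * Q" using l\<theta> Q1 mult_left_mono[of 1 Q "ln (1 / \<theta>) / 2"] by simp
      moreover have "real k \<le> D * real k" using D(6) mult_right_mono[of 1 D "real k"] by simp
      ultimately show ?thesis unfolding distrib_left distrib_right by linarith
    qed
    moreover have "real n * Cap (Psum P S) = real n / 2 * ln (1 + p)" by (simp add: Cap_def p_def)
    ultimately show ?thesis using r(3) up unfolding lin Q_def[symmetric] by linarith
  qed
  show ?thesis by (rule that[OF D(1)]) (use main in blast)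
qed

subsection \<open>Perturbation of Gaussian probabilities\<close>

lemma std_gauss_Icc_le:
  assumes "a \<le> b" "0 \<le> c" "\<And>w. a \<le> w \<Longrightarrow> w \<le> b \<Longrightarrow> std_normal_density w \<le> c"
  shows "measure std_gauss {a..b} \<le> c * (b - a)"
proof -
  interpret prob_space std_gauss by (rule prob_space_std_gauss)
  have "emeasure std_gauss {a..b} = (\<integral>\<^sup>+w. ennreal (std_normal_density w) * indicator {a..b} w \<partial>lborel)"
    unfolding std_gauss_def by (subst emeasure_density) auto
  also have "\<dots> \<le> (\<integral>\<^sup>+w. ennreal c * indicator {a..b} w \<partial>lborel)"
    using assms(3) by (intro nn_integral_mono) (auto simp: indicator_def intro!: ennreal_leI)
  also have "\<dots> = ennreal (c * (b - a))" using assms(1,2) by (simp add: nn_integral_cmult_indicator ennreal_mult')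
  finally show ?thesis using assms(1,2) by (simp add: emeasure_eq_measure)
qed

lemma std_gauss_Ioc_ge:
  assumes "a \<le> b" "0 \<le> c" "\<And>w. a < w \<Longrightarrow> w \<le> b \<Longrightarrow> c \<le> std_normal_density w"
  shows "c * (b - a) \<le> measure std_gauss {a<..b}"
proof -
  interpret prob_space std_gauss by (rule prob_space_std_gauss)
  have "ennreal (c * (b - a)) = (\<integral>\<^sup>+w. ennreal c * indicator {a<..b} w \<partial>lborel)"
    using assms(1,2) by (simp add: nn_integral_cmult_indicator ennreal_mult')
  also have "\<dots> \<le> (\<integral>\<^sup>+w. ennreal (std_normal_density w) * indicator {a<..b} w \<partial>lborel)"
    using assms(3) by (intro nn_integral_mono) (auto simp: indicator_def intro!: ennreal_leI)
  also have "\<dots> = emeasure std_gauss {a<..b}"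
    unfolding std_gauss_def by (subst emeasure_density) auto
  finally show ?thesis by (simp add: emeasure_eq_measure)
qed

lemma std_normal_density_le_1: "std_normal_density w \<le> 1"
proof -
  have "1 \<le> sqrt (2 * pi)" using pi_gt3 by simp
  then have "1 / sqrt (2 * pi) * exp (- w\<^sup>2 / 2) \<le> 1 * 1" by (intro mult_mono) auto
  then show ?thesis by (simp add: std_normal_density_def)
qed

lemma std_normal_density_antimono:
  assumes "\<bar>v\<bar> \<le> \<bar>w\<bar>"
  shows "std_normal_density w \<le> std_normal_density v"
proof -
  have "v\<^sup>2 \<le> w\<^sup>2" using assms by (simp add: abs_le_square_iff)
  then show ?thesis unfolding std_normal_density_def by (intro mult_left_mono) auto
qed

lemma nn_integral_std_gauss_square: "(\<integral>\<^sup>+w. ennreal (w\<^sup>2) \<partial>std_gauss) = 1"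
proof -
  have "(\<integral>\<^sup>+w. ennreal (w\<^sup>2) \<partial>std_gauss) = (\<integral>\<^sup>+w. ennreal (std_normal_density w * w ^ (2 * 1)) \<partial>lborel)"
    by (subst nn_integral_std_gauss) (auto simp: ennreal_mult'')
  also have "\<dots> = ennreal (fact (2 * 1) / (2 ^ 1 * fact 1))"
    by (subst nn_integral_eq_integral[OF integrable_std_normal_moment])
       (simp_all only: integral_std_normal_moment_even, auto)
  finally show ?thesis by simp
qed

lemma markov_square:
  assumes "prob_space N" and X: "X \<in> borel_measurable N" and "0 < a" and "(\<integral>\<^sup>+x. ennreal ((X x)\<^sup>2) \<partial>N) \<le> ennreal c" and "0 \<le> c"
  shows "measure N {x \<in> space N. a < \<bar>X x\<bar>} \<le> c / a\<^sup>2"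
proof -
  interpret prob_space N by fact
  note [measurable] = X
  have "ennreal (a\<^sup>2) * emeasure N {x \<in> space N. a < \<bar>X x\<bar>} = (\<integral>\<^sup>+x. ennreal (a\<^sup>2) * indicator {x \<in> space N. a < \<bar>X x\<bar>} x \<partial>N)"
    by (subst nn_integral_cmult_indicator) auto
  also have "\<dots> \<le> (\<integral>\<^sup>+x. ennreal ((X x)\<^sup>2) \<partial>N)"
  proof (rule nn_integral_mono)
    fix x
    have "a\<^sup>2 \<le> (X x)\<^sup>2" if "a < \<bar>X x\<bar>" using power_mono[of a "\<bar>X x\<bar>" 2] that \<open>0 < a\<close> by simp
    then show "ennreal (a\<^sup>2) * indicator {x \<in> space N. a < \<bar>X x\<bar>} x \<le> ennreal ((X x)\<^sup>2)"
      by (auto simp: indicator_def intro!: ennreal_leI)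
  qed
  also have "\<dots> \<le> ennreal c" by fact
  finally have "a\<^sup>2 * measure N {x \<in> space N. a < \<bar>X x\<bar>} \<le> c"
    using assms(3,5) by (simp add: emeasure_eq_measure flip: ennreal_mult')
  then show ?thesis using assms(3) by (simp add: pos_le_divide_eq mult.commute)
qed

lemma markov_nonneg:
  assumes "prob_space N" and X: "X \<in> borel_measurable N" and "0 < a" and "(\<integral>\<^sup>+x. ennreal (X x) \<partial>N) \<le> ennreal c" and "0 \<le> c"
  shows "measure N {x \<in> space N. a < X x} \<le> c / a"
proof -
  have [measurable]: "(\<lambda>x. sqrt (max 0 (X x))) \<in> borel_measurable N" using X by measurable
  have "(\<integral>\<^sup>+x. ennreal ((sqrt (max 0 (X x)))\<^sup>2) \<partial>N) = (\<integral>\<^sup>+x. ennreal (X x) \<partial>N)"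
    by (intro nn_integral_cong) (auto simp: max_def ennreal_neg)
  then have "measure N {x \<in> space N. sqrt a < \<bar>sqrt (max 0 (X x))\<bar>} \<le> c / (sqrt a)\<^sup>2"
    using assms by (intro markov_square) auto
  moreover have "sqrt a < \<bar>sqrt (max 0 (X x))\<bar> \<longleftrightarrow> a < X x" for x using \<open>0 < a\<close> by auto
  ultimately show ?thesis using assms(3) by simp
qed

text \<open>For \<open>\<bar>w\<bar>\<close> above \<open>r / (2 * c)\<close> Chebyshev's inequality
  suffices. Otherwise the perturbation is at most \<open>\<bar>w\<bar> / 2\<close>, so a point that
  crosses \<open>s\<close> has size comparable to \<open>s\<close> and lies in a window below
  \<open>s\<close> whose length grows like the square of \<open>s\<close>. The Gaussian density
  decays faster than that, which makes the bound uniform in \<open>s\<close>.\<close>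

lemma quad_perturb:
  assumes c: "c > 0" and r: "r \<ge> 1"
  shows "measure std_gauss {w. s < w + c * w\<^sup>2 / r} \<le> measure std_gauss {s<..} + (18 * c + 4 * c\<^sup>2) / r"
proof -
  interpret prob_space std_gauss by (rule prob_space_std_gauss)
  define I where "I = {s - 4 * c * s\<^sup>2 / r..s} \<inter> {w. 2 * \<bar>s\<bar> / 3 \<le> \<bar>w\<bar>}"
  have I [measurable]: "I \<in> sets borel" unfolding I_def by measurable
  have sub: "{w. s < w + c * w\<^sup>2 / r} \<subseteq> {s<..} \<union> ({w. r / (2 * c) < \<bar>w\<bar>} \<union> I)"
  proof
    fix w assume "w \<in> {w. s < w + c * w\<^sup>2 / r}"
    then have w: "s < w + c * w\<^sup>2 / r" by simp
    show "w \<in> {s<..} \<union> ({w. r / (2 * c) < \<bar>w\<bar>} \<union> I)"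
    proof (cases "s < w \<or> r / (2 * c) < \<bar>w\<bar>")
      case False
      then have ws: "w \<le> s" and wr: "\<bar>w\<bar> \<le> r / (2 * c)" by auto
      have "c * \<bar>w\<bar> / r \<le> 1 / 2" using wr c r by (simp add: field_simps)
      then have "c * \<bar>w\<bar> / r * \<bar>w\<bar> \<le> 1 / 2 * \<bar>w\<bar>" by (rule mult_right_mono) simp
      then have half: "c * w\<^sup>2 / r \<le> \<bar>w\<bar> / 2" by (simp add: power2_eq_square mult.assoc)
      have b: "\<bar>w\<bar> \<le> 2 * \<bar>s\<bar>" "2 * \<bar>s\<bar> / 3 \<le> \<bar>w\<bar>" using half w ws by linarith+
      have "w\<^sup>2 \<le> (2 * \<bar>s\<bar>)\<^sup>2" using power_mono[OF b(1), of 2] by simp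
      then have "c * w\<^sup>2 / r \<le> c * (4 * s\<^sup>2) / r" using c r by (intro divide_right_mono mult_left_mono) (auto simp: power_mult_distrib)
      then have "s - 4 * c * s\<^sup>2 / r \<le> w" using w by (simp add: mult_ac)
      then show ?thesis using ws b(2) by (simp add: I_def)
    qed auto
  qed
  have tail: "measure std_gauss {w. r / (2 * c) < \<bar>w\<bar>} \<le> 4 * c\<^sup>2 / r"
  proof -
    have "measure std_gauss {w \<in> space std_gauss. r / (2 * c) < \<bar>w\<bar>} \<le> 1 / (r / (2 * c))\<^sup>2"
      by (rule markov_square) (use c r nn_integral_std_gauss_square in \<open>auto intro: prob_space_std_gauss\<close>)
    also have "\<dots> = 4 * c\<^sup>2 / (r * r)" by (simp add: power_divide power_mult_distrib power2_eq_square)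
    also have "\<dots> \<le> 4 * c\<^sup>2 / (r * 1)" using r by (intro divide_left_mono mult_left_mono) auto
    finally show ?thesis by simp
  qed
  have mI: "measure std_gauss I \<le> 18 * c / r"
  proof -
    define d where "d = 4 * c * s\<^sup>2 / r"
    have d0: "d \<ge> 0" using c r by (simp add: d_def)
    have "emeasure std_gauss I = (\<integral>\<^sup>+w. ennreal (std_normal_density w) * indicator I w \<partial>lborel)"
      unfolding std_gauss_def by (subst emeasure_density) auto
    also have "\<dots> \<le> (\<integral>\<^sup>+w. ennreal (std_normal_density (2 * s / 3)) * indicator {s - d..s} w \<partial>lborel)"
    proof (rule nn_integral_mono)
      fix w
      show "ennreal (std_normal_density w) * indicator I w \<le> ennreal (std_normal_density (2 * s / 3)) * indicator {s - d..s} w"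
        using std_normal_density_antimono[of "2 * s / 3" w]
        by (auto simp: I_def d_def indicator_def intro!: ennreal_leI)
    qed
    also have "\<dots> = ennreal (std_normal_density (2 * s / 3) * d)"
      using d0 by (simp add: nn_integral_cmult_indicator ennreal_mult')
    finally have "measure std_gauss I \<le> std_normal_density (2 * s / 3) * d"
      using d0 by (simp add: emeasure_eq_measure)
    also have "\<dots> \<le> 18 * c / r"
    proof -
      \<comment> \<open>The exponent of the density at \<open>2 * s / 3\<close>. The window has
        length \<open>x * (18 * c / r)\<close>, and \<open>x * exp (- x) \<le> 1\<close>.\<close>
      define x where "x = 2 * s\<^sup>2 / 9"
      have "std_normal_density (2 * s / 3) \<le> 1 * exp (- x)"
        unfolding std_normal_density_def x_def using pi_gt3
        by (intro mult_mono) (auto simp: power_divide power_mult_distrib)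
      then have "std_normal_density (2 * s / 3) * d \<le> exp (- x) * d" using d0 by (intro mult_right_mono) auto
      also have "\<dots> = (x * exp (- x)) * (18 * c / r)" using r by (simp add: d_def x_def field_simps)
      also have "\<dots> \<le> 1 * (18 * c / r)"
      proof (rule mult_right_mono)
        have "x \<le> exp x" using exp_ge_add_one_self[of x] by linarith
        then show "x * exp (- x) \<le> 1" by (simp add: exp_minus field_simps)
      qed (use c r in simp)
      finally show ?thesis by simp
    qed
    finally show ?thesis .
  qed
  have m2: "{w. r / (2 * c) < \<bar>w\<bar>} \<in> sets std_gauss" by simp
  have "measure std_gauss {w. s < w + c * w\<^sup>2 / r} \<le> measure std_gauss ({s<..} \<union> ({w. r / (2 * c) < \<bar>w\<bar>} \<union> I))"
    using I by (intro finite_measure_mono sub) auto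
  also have "\<dots> \<le> measure std_gauss {s<..} + measure std_gauss ({w. r / (2 * c) < \<bar>w\<bar>} \<union> I)"
    using I by (intro measure_Un_le) auto
  also have "measure std_gauss ({w. r / (2 * c) < \<bar>w\<bar>} \<union> I) \<le> measure std_gauss {w. r / (2 * c) < \<bar>w\<bar>} + measure std_gauss I"
    using I by (intro measure_Un_le) auto
  finally show ?thesis using tail mI by (simp add: add_divide_distrib)
qed

text \<open>A shift to the left costs at most its length, as the density is at most 1. A shift to
  the right by at least \<open>b'\<close> with \<open>b' \<le> 1\<close> removes an interval whose
  points have absolute value at most \<open>\<bar>s\<bar> + 1\<close>, where the density is no
  smaller than its value there.\<close>

lemma std_gauss_tail_shift:
  shows "b \<le> 0 \<Longrightarrow> measure std_gauss {s + b<..} \<le> measure std_gauss {s<..} - b"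
    and "0 \<le> b \<Longrightarrow> measure std_gauss {s + b<..} \<le> measure std_gauss {s<..}"
    and "0 \<le> b' \<Longrightarrow> b' \<le> b \<Longrightarrow> b' \<le> 1 \<Longrightarrow>
      measure std_gauss {s + b<..} + b' * std_normal_density (\<bar>s\<bar> + 1) \<le> measure std_gauss {s<..}"
proof -
  interpret prob_space std_gauss by (rule prob_space_std_gauss)
  show "measure std_gauss {s + b<..} \<le> measure std_gauss {s<..} - b" if "b \<le> 0"
  proof -
    have "measure std_gauss {s + b<..} \<le> measure std_gauss ({s<..} \<union> {s + b..s})"
      by (intro finite_measure_mono) auto
    also have "\<dots> \<le> measure std_gauss {s<..} + measure std_gauss {s + b..s}"
      by (intro measure_Un_le) auto
    also have "measure std_gauss {s + b..s} \<le> 1 * (s - (s + b))"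
      by (rule std_gauss_Icc_le) (use that std_normal_density_le_1 in auto)
    finally show ?thesis by simp
  qed
  show "measure std_gauss {s + b<..} \<le> measure std_gauss {s<..}" if "0 \<le> b"
    using that by (intro finite_measure_mono) auto
  show "measure std_gauss {s + b<..} + b' * std_normal_density (\<bar>s\<bar> + 1) \<le> measure std_gauss {s<..}"
    if "0 \<le> b'" "b' \<le> b" "b' \<le> 1"
  proof -
    have "std_normal_density (\<bar>s\<bar> + 1) * (s + b' - s) \<le> measure std_gauss {s<..s + b'}"
    proof (rule std_gauss_Ioc_ge)
      fix w assume "s < w" "w \<le> s + b'"
      then have "\<bar>w\<bar> \<le> \<bar>\<bar>s\<bar> + 1\<bar>" using that by linarith
      then show "std_normal_density (\<bar>s\<bar> + 1) \<le> std_normal_density w" by (rule std_normal_density_antimono)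
    qed (use that in auto)
    moreover have "measure std_gauss {s + b<..} + measure std_gauss {s<..s + b'} = measure std_gauss ({s + b<..} \<union> {s<..s + b'})"
      using that by (intro finite_measure_Union[symmetric]) auto
    moreover have "\<dots> \<le> measure std_gauss {s<..}" using that by (intro finite_measure_mono) auto
    ultimately show ?thesis by (simp add: mult.commute)
  qed
qed

text \<open>Here \<open>q\<close> collects the second-order terms of the other coordinates and \<open>B\<close> the gap in the rate.\<close>

lemma perturbed_tail:
  fixes c :: real and K :: nat
  assumes c: "c > 0"
  obtains C :: real where "C > 0"
    "\<And>n q B t. real n \<ge> C \<Longrightarrow> q \<ge> 1 \<Longrightarrow> 0 \<le> B \<Longrightarrow>
      measure (gauss {Suc K..<n}) {y \<in> space (gauss {Suc K..<n}).
          t + (B - c * q) / sqrt (real n) < chi_dev {Suc K..<n} y + c * (chi_dev {Suc K..<n} y)\<^sup>2 / sqrt (real n)}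
        \<le> measure std_gauss {t<..} + C * q / sqrt (real n)"
    "\<And>n q B t. real n \<ge> C \<Longrightarrow> q \<ge> 1 \<Longrightarrow> 2 * c * q \<le> B \<Longrightarrow> B \<le> 2 * sqrt (real n) \<Longrightarrow>
      measure (gauss {Suc K..<n}) {y \<in> space (gauss {Suc K..<n}).
          t + (B - c * q) / sqrt (real n) < chi_dev {Suc K..<n} y + c * (chi_dev {Suc K..<n} y)\<^sup>2 / sqrt (real n)}
        + B / (2 * sqrt (real n)) * std_normal_density (\<bar>t\<bar> + 1)
        \<le> measure std_gauss {t<..} + C * q / sqrt (real n)"
    "\<And>n q d. real n \<ge> C \<Longrightarrow> q \<ge> 1 \<Longrightarrow> d \<ge> 0 \<Longrightarrow>
      measure (gauss {Suc K..<n}) {y \<in> space (gauss {Suc K..<n}). real n < d * (q + (chi_dev {Suc K..<n} y)\<^sup>2)}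
        \<le> d * C * q / sqrt (real n)"
proof -
  obtain C0 :: real where C0: "C0 > 0"
    "\<And>(A :: nat set) D. finite A \<Longrightarrow> real (card A) \<ge> C0 \<Longrightarrow> D \<in> sets borel \<Longrightarrow>
       measure (gauss A) {x \<in> space (gauss A). chi_dev A x \<in> D} \<le> measure std_gauss D + C0 / sqrt (real (card A) - 1)"
    "\<And>A :: nat set. finite A \<Longrightarrow> real (card A) \<ge> C0 \<Longrightarrow> (\<integral>\<^sup>+x. ennreal ((chi_dev A x)\<^sup>2) \<partial>gauss A) \<le> ennreal C0"
    using chi_dev_approx by blast
  define C1 where "C1 = 18 * c + 4 * c\<^sup>2 + 2 * C0"
  define C where "C = C0 + C1 + c + 2 * real K + 10"
  have C1: "C1 > 0" using c C0(1) by (simp add: C1_def add_pos_nonneg)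
  have C: "C > 0" "C1 + c \<le> C" "1 + C0 \<le> C" "C1 \<le> C" using c C0(1) C1 by (auto simp: C_def)
  have size: "real (card {Suc K..<n}) \<ge> C0" "1 \<le> sqrt (real n)" "C0 / sqrt (real (card {Suc K..<n}) - 1) \<le> 2 * C0 / sqrt (real n)"
    if n: "real n \<ge> C" for n
  proof -
    have n1: "real n \<ge> C0 + 2 * real K + 10" using n C1 c by (simp add: C_def)
    have card: "real (card {Suc K..<n}) = real n - real K - 1" using n1 C0(1) by (simp add: of_nat_diff)
    then show "real (card {Suc K..<n}) \<ge> C0" using n1 by linarith
    show r1: "1 \<le> sqrt (real n)" using n1 C0(1) by simp
    \<comment> \<open>The noise block keeps a fixed fraction of the dimensions, so its error terms
      are of order \<open>1 / sqrt n\<close> as well.\<close>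
    have "real n / 4 \<le> real n - real K - 1 - 1" using n1 C0(1) by linarith
    then have "sqrt (real n / 4) \<le> sqrt (real n - real K - 1 - 1)" by simp
    then have h: "sqrt (real n) / 2 \<le> sqrt (real (card {Suc K..<n}) - 1)" unfolding card by (simp add: real_sqrt_divide)
    moreover have "0 < sqrt (real (card {Suc K..<n}) - 1)" using h r1 by linarith
    ultimately have "C0 / sqrt (real (card {Suc K..<n}) - 1) \<le> C0 / (sqrt (real n) / 2)"
      using C0(1) r1 by (intro divide_left_mono mult_pos_pos) linarith+
    then show "C0 / sqrt (real (card {Suc K..<n}) - 1) \<le> 2 * C0 / sqrt (real n)" by (simp add: mult.commute)
  qed
  have base: "measure (gauss {Suc K..<n}) {y \<in> space (gauss {Suc K..<n}).
          s < chi_dev {Suc K..<n} y + c * (chi_dev {Suc K..<n} y)\<^sup>2 / sqrt (real n)}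
        \<le> measure std_gauss {s<..} + C1 / sqrt (real n)" if n: "real n \<ge> C" for n s
  proof -
    have "measure (gauss {Suc K..<n}) {y \<in> space (gauss {Suc K..<n}).
          chi_dev {Suc K..<n} y \<in> {w. s < w + c * w\<^sup>2 / sqrt (real n)}}
       \<le> measure std_gauss {w. s < w + c * w\<^sup>2 / sqrt (real n)} + C0 / sqrt (real (card {Suc K..<n}) - 1)"
      by (rule C0(2)) (use size(1)[OF n] in auto)
    also have "\<dots> \<le> (measure std_gauss {s<..} + (18 * c + 4 * c\<^sup>2) / sqrt (real n)) + 2 * C0 / sqrt (real n)"
      by (intro add_mono quad_perturb c size[OF n])
    finally show ?thesis by (simp add: C1_def add_divide_distrib)
  qed
  have 1: "measure (gauss {Suc K..<n}) {y \<in> space (gauss {Suc K..<n}).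
          t + (B - c * q) / sqrt (real n) < chi_dev {Suc K..<n} y + c * (chi_dev {Suc K..<n} y)\<^sup>2 / sqrt (real n)}
        \<le> measure std_gauss {t<..} + C * q / sqrt (real n)"
    if n: "real n \<ge> C" and q: "q \<ge> 1" and B: "0 \<le> B" for n q B t
  proof -
    define b where "b = (B - c * q) / sqrt (real n)"
    have r: "sqrt (real n) > 0" using size(2)[OF n] by linarith
    have "0 \<le> B / sqrt (real n)" using B r by simp
    then have "- b \<le> c * q / sqrt (real n)" unfolding b_def diff_divide_distrib by linarith
    moreover have "0 \<le> c * q / sqrt (real n)" using c q r by simp
    ultimately have "measure std_gauss {t + b<..} \<le> measure std_gauss {t<..} + c * q / sqrt (real n)"
      using std_gauss_tail_shift(1)[of b t] std_gauss_tail_shift(2)[of b t] by (cases "b \<le> 0") linarith+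
    moreover have "C1 / sqrt (real n) + c * q / sqrt (real n) \<le> C * q / sqrt (real n)"
    proof -
      have "C1 \<le> C1 * q" using C1 q by simp
      moreover have "(C1 + c) * q \<le> C * q" using C(2) q by (intro mult_right_mono) auto
      ultimately have "C1 + c * q \<le> C * q" by (simp add: algebra_simps)
      then show ?thesis using r by (simp add: divide_right_mono flip: add_divide_distrib)
    qed
    ultimately show ?thesis using base[OF n, of "t + b"] unfolding b_def by linarith
  qed
  have 2: "measure (gauss {Suc K..<n}) {y \<in> space (gauss {Suc K..<n}).
          t + (B - c * q) / sqrt (real n) < chi_dev {Suc K..<n} y + c * (chi_dev {Suc K..<n} y)\<^sup>2 / sqrt (real n)}
        + B / (2 * sqrt (real n)) * std_normal_density (\<bar>t\<bar> + 1)
        \<le> measure std_gauss {t<..} + C * q / sqrt (real n)"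
    if n: "real n \<ge> C" and q: "q \<ge> 1" and B: "2 * c * q \<le> B" "B \<le> 2 * sqrt (real n)" for n q B t
  proof -
    define b where "b = (B - c * q) / sqrt (real n)"
    have r: "sqrt (real n) > 0" using size(2)[OF n] by linarith
    have B0: "0 \<le> B" using B(1) c q by (smt (verit) mult_pos_pos)
    \<comment> \<open>One half of \<open>B\<close> pays for the second-order terms; the other half
      is the net shift to the right.\<close>
    have "B / 2 \<le> B - c * q" using B(1) by simp
    then have "B / 2 / sqrt (real n) \<le> b" unfolding b_def using r by (intro divide_right_mono) auto
    then have "measure std_gauss {t + b<..} + B / (2 * sqrt (real n)) * std_normal_density (\<bar>t\<bar> + 1) \<le> measure std_gauss {t<..}"
      using B0 r B(2) by (intro std_gauss_tail_shift(3)) (auto simp: pos_divide_le_eq)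
    moreover have "C1 / sqrt (real n) \<le> C * q / sqrt (real n)"
    proof -
      have "C1 * 1 \<le> C * q" using C1 C q by (intro mult_mono) auto
      then show ?thesis using r by (intro divide_right_mono) auto
    qed
    ultimately show ?thesis using base[OF n, of "t + b"] unfolding b_def by linarith
  qed
  have 3: "measure (gauss {Suc K..<n}) {y \<in> space (gauss {Suc K..<n}). real n < d * (q + (chi_dev {Suc K..<n} y)\<^sup>2)}
        \<le> d * C * q / sqrt (real n)" if n: "real n \<ge> C" and q: "q \<ge> 1" and d: "d \<ge> 0" for n q d
  proof -
    let ?J = "{Suc K..<n}"
    have r: "sqrt (real n) \<ge> 1" using size(2)[OF n] .
    then have n0: "real n > 0" by (simp add: real_sqrt_ge_1_iff)
    have m: "(\<lambda>y. d * (q + (chi_dev ?J y)\<^sup>2)) \<in> borel_measurable (gauss ?J)"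
      using borel_measurable_chi_dev[of ?J] by measurable
    have "(\<integral>\<^sup>+y. ennreal (d * (q + (chi_dev ?J y)\<^sup>2)) \<partial>gauss ?J) = (\<integral>\<^sup>+y. ennreal (d * q) + ennreal d * ennreal ((chi_dev ?J y)\<^sup>2) \<partial>gauss ?J)"
      using d q by (intro nn_integral_cong) (simp add: distrib_left ennreal_mult')
    also have "\<dots> = ennreal (d * q) + ennreal d * (\<integral>\<^sup>+y. ennreal ((chi_dev ?J y)\<^sup>2) \<partial>gauss ?J)"
      using borel_measurable_chi_dev[of ?J] prob_space.emeasure_space_1[OF prob_space_gauss, of ?J]
      by (subst nn_integral_add) (auto simp: nn_integral_cmult)
    also have "\<dots> \<le> ennreal (d * q) + ennreal d * ennreal C0"
      using C0(3)[of ?J] size(1)[OF n] by (intro add_left_mono mult_left_mono) auto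
    also have "\<dots> = ennreal (d * (q + C0))" using d q C0(1) by (simp add: distrib_left ennreal_mult')
    finally have "measure (gauss ?J) {y \<in> space (gauss ?J). real n < d * (q + (chi_dev ?J y)\<^sup>2)} \<le> d * (q + C0) / real n"
      using d q C0(1) n0 by (intro markov_nonneg[OF prob_space_gauss m]) auto
    also have "\<dots> \<le> d * (C * q) / sqrt (real n)"
    proof (rule frac_le)
      have "C0 \<le> C0 * q" using C0(1) q by simp
      then have "q + C0 \<le> (1 + C0) * q" by (simp add: algebra_simps)
      also have "\<dots> \<le> C * q" using C(3) q by (intro mult_right_mono) auto
      finally show "d * (q + C0) \<le> d * (C * q)" using d by (rule mult_left_mono)
      show "0 \<le> d * (C * q)" using d q C by simp
      show "0 < sqrt (real n)" using r by linarith
      have "sqrt (real n) * 1 \<le> sqrt (real n) * sqrt (real n)" using r by (intro mult_left_mono) auto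
      then show "sqrt (real n) \<le> real n" by simp
    qed
    finally show ?thesis by (simp add: mult_ac)
  qed
  show ?thesis by (rule that[OF C(1)]) (use 1 2 3 in blast)+
qed

text \<open>A dyadic layer-cake bound: it reduces the mean of \<open>min 1 U\<close> to the
  probabilities of the events that \<open>U\<close> is at least 2^-k.\<close>

lemma min_dyadic:
  fixes x :: real
  assumes "0 \<le> x"
  shows "min 1 x \<le> (\<Sum>k\<in>{1..n}. (1/2) ^ k * (if (1/2) ^ k \<le> x then 1 else 0)) + (1/2) ^ n"
proof (induction n)
  case (Suc n)
  show ?case
  proof (cases "(1/2) ^ Suc n \<le> x")
    case True
    then show ?thesis using Suc by simp
  next
    case False
    then have "min 1 x \<le> (1/2) ^ Suc n" by simp
    moreover have "0 \<le> (\<Sum>k\<in>{1..Suc n}. (1/2) ^ k * (if (1/2) ^ k \<le> x then 1 else 0 :: real))"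
      by (intro sum_nonneg) auto
    ultimately show ?thesis by linarith
  qed
qed simp

lemma sum_dyadic:
  "(\<Sum>k\<in>{1..n}. (1/2) ^ k) = (1 - (1/2) ^ n :: real)"
  "(\<Sum>k\<in>{1..n}. (1/2) ^ k * real k) = (2 - (real n + 2) * (1/2) ^ n :: real)"
  by (induction n) (auto simp: field_simps)

subsection \<open>The limiting Gaussian vector\<close>

text \<open>The index \<open>(0, 0)\<close>, which no coordinate \<open>G j l\<close> with \<open>j \<ge> 1\<close> uses, stands for the normalized norm of the noise.\<close>

definition coef :: "nat \<Rightarrow> (nat \<Rightarrow> real) \<Rightarrow> nat set \<Rightarrow> nat \<times> nat \<Rightarrow> real" where
  "coef K P S p = (if p = (0, 0) then slope P S
     else if fst p \<in> S \<and> snd p \<in> S \<and> snd p < fst p then - (sqrt (P (fst p)) * sqrt (P (snd p))) / (1 + Psum P S)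
     else if fst p = Suc K \<and> snd p \<in> S then - sqrt (P (snd p)) / (1 + Psum P S) else 0)"

lemma sum_coef:
  assumes S: "S \<subseteq> {1..K}" and n: "K < n"
  shows "(\<Sum>j\<in>{1..Suc K}. \<Sum>l<n. coef K P S (j, l) * h j l)
    = - ((\<Sum>j\<in>S. \<Sum>l\<in>{l\<in>S. l < j}. sqrt (P j) * sqrt (P l) * h j l) + (\<Sum>l\<in>S. sqrt (P l) * h (Suc K) l)) / (1 + Psum P S)"
proof -
  have U: "{1..Suc K} = insert (Suc K) {1..K}" by auto
  have Sn: "S \<subseteq> {..<n}" using S n by auto
  have fin: "finite S" using S finite_subset by blast
  let ?d = "1 + Psum P S"
  have last: "(\<Sum>l<n. coef K P S (Suc K, l) * h (Suc K) l) = (\<Sum>l\<in>S. - sqrt (P l) / ?d * h (Suc K) l)"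
  proof -
    have "(\<Sum>l<n. coef K P S (Suc K, l) * h (Suc K) l) = (\<Sum>l\<in>S. coef K P S (Suc K, l) * h (Suc K) l)"
      using Sn S by (intro sum.mono_neutral_right) (auto simp: coef_def)
    also have "\<dots> = (\<Sum>l\<in>S. - sqrt (P l) / ?d * h (Suc K) l)"
      using S by (intro sum.cong) (auto simp: coef_def)
    finally show ?thesis .
  qed
  have inner: "(\<Sum>l<n. coef K P S (j, l) * h j l) = (\<Sum>l\<in>{l\<in>S. l < j}. - (sqrt (P j) * sqrt (P l)) / ?d * h j l)"
    if j: "j \<in> S" for j
  proof -
    have "(\<Sum>l<n. coef K P S (j, l) * h j l) = (\<Sum>l\<in>{l\<in>S. l < j}. coef K P S (j, l) * h j l)"
      using Sn S j by (intro sum.mono_neutral_right) (auto simp: coef_def)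
    also have "\<dots> = (\<Sum>l\<in>{l\<in>S. l < j}. - (sqrt (P j) * sqrt (P l)) / ?d * h j l)"
      using S j by (intro sum.cong) (auto simp: coef_def)
    finally show ?thesis .
  qed
  have "(\<Sum>j\<in>{1..Suc K}. \<Sum>l<n. coef K P S (j, l) * h j l)
     = (\<Sum>l<n. coef K P S (Suc K, l) * h (Suc K) l) + (\<Sum>j\<in>{1..K}. \<Sum>l<n. coef K P S (j, l) * h j l)"
    unfolding U by (subst sum.insert) auto
  also have "(\<Sum>j\<in>{1..K}. \<Sum>l<n. coef K P S (j, l) * h j l) = (\<Sum>j\<in>S. \<Sum>l<n. coef K P S (j, l) * h j l)"
    using S by (intro sum.mono_neutral_right) (auto simp: coef_def intro!: sum.neutral)
  also have "\<dots> = (\<Sum>j\<in>S. \<Sum>l\<in>{l\<in>S. l < j}. - (sqrt (P j) * sqrt (P l)) / ?d * h j l)"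
    by (intro sum.cong inner refl)
  finally show ?thesis unfolding last
    by (simp add: sum_negf sum_divide_distrib diff_divide_distrib)
qed

lemma coef_lin_form:
  assumes "S \<subseteq> {1..K}" "K < n"
  shows "(\<Sum>p\<in>{1..Suc K} \<times> {..<n}. coef K P S p * G (fst p) (snd p)) = lin_form K P S G"
  using sum_coef[OF assms, of P G] by (simp add: sum.cartesian_product lin_form_def split_beta)

text \<open>The origin of the dispersion matrix. The noise norm contributes the product of the
  slopes, the noise entries the power of the intersection \<open>T\<close>, and the entries for
  pairs the sum \<open>X\<close> of \<open>P j * P l\<close> over \<open>l < j\<close> in
  \<open>T\<close>; twice \<open>X\<close> is the square of the power of \<open>T\<close> minus the
  sum of the squared powers.\<close>

lemma dotp_coef:
  assumes S: "S1 \<in> PK K" "S2 \<in> PK K" and n: "K < n" and P: "\<forall>i\<in>{1..K}. P i > 0"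
  shows "dotp (insert (0, 0) ({1..Suc K} \<times> {..<n})) (coef K P S1) (coef K P S2) = dispV P S1 S2"
proof -
  have S': "S1 \<subseteq> {1..K}" "S2 \<subseteq> {1..K}" using S by (auto simp: PK_def)
  define T where "T = S1 \<inter> S2"
  have T: "finite T" "T \<subseteq> {1..K}" using S' finite_subset[of T "{1..K}"] by (auto simp: T_def)
  have pos: "Psum P S \<ge> 0" if "S \<subseteq> {1..K}" for S
    unfolding Psum_def by (rule sum_nonneg) (use that P in force)
  define d1 d2 where "d1 = 1 + Psum P S1" and "d2 = 1 + Psum P S2"
  have d: "d1 > 0" "d2 > 0" using pos[OF S'(1)] pos[OF S'(2)] by (simp_all add: d1_def d2_def)
  define p1 p2 where "p1 = Psum P S1" and "p2 = Psum P S2"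
  have sq: "sqrt (P i) * sqrt (P i) = P i" if "i \<in> T" for i using that T(2) bspec[OF P, of i] by auto
  define X where "X = (\<Sum>j\<in>T. \<Sum>l\<in>{l\<in>T. l < j}. P j * P l)"
  have "dotp (insert (0, 0) ({1..Suc K} \<times> {..<n})) (coef K P S1) (coef K P S2)
     = slope P S1 * slope P S2 + (\<Sum>p\<in>{1..Suc K} \<times> {..<n}. coef K P S1 p * coef K P S2 p)"
    unfolding dotp_def by (subst sum.insert) (auto simp: coef_def)
  also have "(\<Sum>p\<in>{1..Suc K} \<times> {..<n}. coef K P S1 p * coef K P S2 p)
     = (\<Sum>j\<in>{1..Suc K}. \<Sum>l<n. coef K P S1 (j, l) * coef K P S2 (j, l))"
    by (simp add: sum.cartesian_product split_beta)
  also have "\<dots> = - ((\<Sum>j\<in>S1. \<Sum>l\<in>{l\<in>S1. l < j}. sqrt (P j) * sqrt (P l) * coef K P S2 (j, l))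
      + (\<Sum>l\<in>S1. sqrt (P l) * coef K P S2 (Suc K, l))) / d1"
    unfolding d1_def by (rule sum_coef[OF S'(1) n])
  also have "(\<Sum>l\<in>S1. sqrt (P l) * coef K P S2 (Suc K, l)) = (\<Sum>l\<in>T. - P l / d2)"
  proof -
    have "(\<Sum>l\<in>S1. sqrt (P l) * coef K P S2 (Suc K, l)) = (\<Sum>l\<in>T. sqrt (P l) * coef K P S2 (Suc K, l))"
      using S' finite_subset[OF S'(1)] by (intro sum.mono_neutral_right) (auto simp: coef_def T_def)
    also have "\<dots> = (\<Sum>l\<in>T. - P l / d2)"
    proof (rule sum.cong[OF refl])
      fix l assume l: "l \<in> T"
      then have "coef K P S2 (Suc K, l) = - sqrt (P l) / d2" using S' by (auto simp: coef_def T_def d2_def)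
      then show "sqrt (P l) * coef K P S2 (Suc K, l) = - P l / d2" using sq[OF l] by simp
    qed
    finally show ?thesis .
  qed
  also have "(\<Sum>j\<in>S1. \<Sum>l\<in>{l\<in>S1. l < j}. sqrt (P j) * sqrt (P l) * coef K P S2 (j, l))
     = (\<Sum>j\<in>T. \<Sum>l\<in>{l\<in>T. l < j}. - (P j * P l) / d2)"
  proof -
    have z: "coef K P S2 (j, l) = 0" if "j \<in> S1" "l \<in> S1" "j \<notin> T \<or> l \<notin> T" for j l
      using that S' by (auto simp: coef_def T_def)
    have "(\<Sum>j\<in>S1. \<Sum>l\<in>{l\<in>S1. l < j}. sqrt (P j) * sqrt (P l) * coef K P S2 (j, l))
       = (\<Sum>j\<in>T. \<Sum>l\<in>{l\<in>S1. l < j}. sqrt (P j) * sqrt (P l) * coef K P S2 (j, l))"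
      using finite_subset[OF S'(1)] z by (intro sum.mono_neutral_right) (auto simp: T_def intro!: sum.neutral)
    also have "\<dots> = (\<Sum>j\<in>T. \<Sum>l\<in>{l\<in>T. l < j}. sqrt (P j) * sqrt (P l) * coef K P S2 (j, l))"
      using finite_subset[OF S'(1)] z by (intro sum.cong refl sum.mono_neutral_right) (auto simp: T_def)
    also have "\<dots> = (\<Sum>j\<in>T. \<Sum>l\<in>{l\<in>T. l < j}. - (P j * P l) / d2)"
    proof (intro sum.cong refl)
      fix j l assume jl: "j \<in> T" "l \<in> {l\<in>T. l < j}"
      then have "coef K P S2 (j, l) = - (sqrt (P j) * sqrt (P l)) / d2" using S' by (auto simp: coef_def T_def d2_def)
      then have "sqrt (P j) * sqrt (P l) * coef K P S2 (j, l) = - ((sqrt (P j) * sqrt (P j)) * (sqrt (P l) * sqrt (P l))) / d2"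
        by (simp add: mult_ac)
      then show "sqrt (P j) * sqrt (P l) * coef K P S2 (j, l) = - (P j * P l) / d2" using sq jl by simp
    qed
    finally show ?thesis .
  qed
  also have "(\<Sum>j\<in>T. \<Sum>l\<in>{l\<in>T. l < j}. - (P j * P l) / d2) = - X / d2"
    by (simp add: X_def sum_negf sum_divide_distrib)
  also have "(\<Sum>l\<in>T. - P l / d2) = - Psum P T / d2"
    by (simp add: Psum_def sum_negf sum_divide_distrib)
  also have "slope P S1 * slope P S2 = p1 * p2 / (2 * d1 * d2)"
  proof -
    have "p1 / (s * d1) * (p2 / (s * d2)) = p1 * p2 / (s * s * d1 * d2)" for s by (simp add: mult_ac)
    from this[of "sqrt 2"] show ?thesis by (simp add: slope_def d1_def d2_def p1_def p2_def)
  qed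
  finally have 1: "dotp (insert (0, 0) ({1..Suc K} \<times> {..<n})) (coef K P S1) (coef K P S2)
     = p1 * p2 / (2 * d1 * d2) + - (- X / d2 + - Psum P T / d2) / d1" .
  have 2: "(Psum P T)\<^sup>2 = (\<Sum>i\<in>T. (P i)\<^sup>2) + 2 * X"
  proof -
    have "(Psum P T)\<^sup>2 = (\<Sum>i\<in>T. \<Sum>j\<in>T. P i * P j)"
      unfolding Psum_def power2_eq_square by (rule sum_product)
    also have "\<dots> = (\<Sum>i\<in>T. P i * P i) + 2 * (\<Sum>j\<in>T. \<Sum>i\<in>{i\<in>T. i < j}. P j * P i)"
      by (rule sum_symmetric_split[OF T(1)]) (rule mult.commute)
    finally show ?thesis by (simp add: X_def power2_eq_square)
  qed
  have "p1 * p2 / (2 * d1 * d2) + - (- X / d2 + - Psum P T / d2) / d1 = (p1 * p2 + 2 * Psum P T + 2 * X) / (2 * d1 * d2)"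
    using d by (simp add: field_simps)
  also have "\<dots> = dispV P S1 S2"
    unfolding dispV_def T_def[symmetric] 2 by (simp add: p1_def p2_def d1_def d2_def)
  finally show ?thesis using 1 by simp
qed

section \<open>The bad event as a half-line in the noise norm\<close>

lemma slope_bounds:
  assumes "S \<in> PK K" and P: "\<forall>i\<in>{1..K}. P i > 0"
  shows "0 < slope P S" "slope P S \<le> 1"
proof -
  have S: "S \<subseteq> {1..K}" "S \<noteq> {}" using assms by (auto simp: PK_def)
  have p: "Psum P S > 0" unfolding Psum_def by (rule sum_pos) (use S P finite_subset in auto)
  show "0 < slope P S" using p by (simp add: slope_def)
  have "1 * Psum P S \<le> sqrt 2 * (1 + Psum P S)" using p by (intro mult_mono) auto
  then show "slope P S \<le> 1" using p by (simp add: slope_def pos_divide_le_eq)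
qed

text \<open>Because every slope is positive, each condition with index \<open>S\<close> bounds the
  noise coordinate from above. All of them together amount to the smallest of these bounds.\<close>

definition threshold :: "nat \<Rightarrow> (nat \<Rightarrow> real) \<Rightarrow> (nat set \<Rightarrow> real) \<Rightarrow> (nat \<Rightarrow> nat \<Rightarrow> real) \<Rightarrow> real" where
  "threshold K P z G = Min ((\<lambda>S. (z S - lin_form K P S G) / slope P S) ` PK K)"

lemma PK_nonempty: "K \<ge> 1 \<Longrightarrow> PK K \<noteq> {}"
  by (auto simp: PK_def intro!: exI[of _ "{1}"])

lemma threshold_less_iff:
  assumes K: "K \<ge> 1" and P: "\<forall>i\<in>{1..K}. P i > 0"
  shows "threshold K P z G < w \<longleftrightarrow> (\<exists>S\<in>PK K. z S < lin_form K P S G + slope P S * w)"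
proof -
  have "threshold K P z G < w \<longleftrightarrow> (\<exists>S\<in>PK K. (z S - lin_form K P S G) / slope P S < w)"
    unfolding threshold_def using finite_PK PK_nonempty[OF K] by (subst Min_less_iff) auto
  also have "\<dots> \<longleftrightarrow> (\<exists>S\<in>PK K. z S < lin_form K P S G + slope P S * w)"
    using slope_bounds(1)[OF _ P] by (intro bex_cong refl) (simp add: pos_divide_less_eq algebra_simps)
  finally show ?thesis .
qed

lemma threshold_le:
  assumes "S \<in> PK K"
  shows "threshold K P z G \<le> (z S - lin_form K P S G) / slope P S"
  unfolding threshold_def using finite_PK assms by (intro Min_le) auto

lemma borel_measurable_lin_form:
  assumes "S \<subseteq> {1..K}" "K < n"
  shows "lin_form K P S \<in> borel_measurable (PiM {1..Suc K} (\<lambda>_. gauss {..<n}))"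
proof -
  have *: "(\<lambda>G. G j l) \<in> borel_measurable (PiM {1..Suc K} (\<lambda>_. gauss {..<n}))" if "j \<in> {1..Suc K}" "l < n" for j l
    using measurable_gauss_nested[of j "{1..Suc K}" l "{..<n}"] that by auto
  show ?thesis unfolding lin_form_def
    by (intro borel_measurable_divide borel_measurable_uminus borel_measurable_add borel_measurable_sum
        borel_measurable_times borel_measurable_const *) (use assms in auto)
qed

lemma borel_measurable_threshold:
  assumes "K \<ge> 1" "K < n" and P: "\<forall>i\<in>{1..K}. P i > 0"
  shows "threshold K P z \<in> borel_measurable (PiM {1..Suc K} (\<lambda>_. gauss {..<n}))"
proof (rule borel_measurable_iff_less[THEN iffD2, rule_format])
  fix w
  have "{G \<in> space (PiM {1..Suc K} (\<lambda>_. gauss {..<n})). threshold K P z G < w}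
      = {G \<in> space (PiM {1..Suc K} (\<lambda>_. gauss {..<n})). \<exists>S\<in>PK K. z S < lin_form K P S G + slope P S * w}"
    using threshold_less_iff[OF assms(1) P] by simp
  also have "\<dots> \<in> sets (PiM {1..Suc K} (\<lambda>_. gauss {..<n}))"
    by (intro sets.sets_Collect_finite_Ex borel_measurable_less borel_measurable_const borel_measurable_add
        borel_measurable_lin_form finite_PK) (use assms in \<open>auto simp: PK_def\<close>)
  finally show "{G \<in> space (PiM {1..Suc K} (\<lambda>_. gauss {..<n})). threshold K P z G < w} \<in> sets (PiM {1..Suc K} (\<lambda>_. gauss {..<n}))" .
qed

lemma measurable_tail: "(\<lambda>t. measure std_gauss {t<..}) \<in> borel_measurable borel"
proof -
  interpret prob_space std_gauss by (rule prob_space_std_gauss)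
  have "antimono (\<lambda>t. measure std_gauss {t<..})"
    by (intro antimonoI finite_measure_mono) auto
  then have "mono (\<lambda>t. - measure std_gauss {t<..})" by (auto simp: mono_def antimono_def)
  from borel_measurable_mono[OF this] show ?thesis by simp
qed

lemma measurable_section_integral:
  assumes "f \<in> borel_measurable (gauss (insert i I))"
  shows "(\<lambda>g. \<integral>\<^sup>+w. f (g(i := w)) \<partial>std_gauss) \<in> borel_measurable (gauss I)"
  using measurable_compose[OF measurable_add_dim[of i I "\<lambda>_. std_gauss"] assms]
  by (intro sigma_finite_measure.borel_measurable_nn_integral[OF prob_space_imp_sigma_finite[OF prob_space_std_gauss]])
     (simp add: split_beta')

text \<open>The matrix in \<open>Qinv\<close> is an arbitrary factor of the dispersion matrix. By
  \<open>gauss_linear_law\<close> it can be exchanged for \<open>coef\<close>, whose rows have the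
  same Gram matrix and live on the coordinates of the coding problem; integrating out the noise
  coordinate leaves a Gaussian tail at the threshold.\<close>

lemma Qinv_threshold:
  assumes K: "K \<ge> 1" and P: "\<forall>i\<in>{1..K}. P i > 0" and n: "K < n" and z: "z \<in> Qinv (PK K) (dispV P) eps"
  shows "(\<integral>\<^sup>+G. ennreal (measure std_gauss {threshold K P z G<..}) \<partial>PiM {1..Suc K} (\<lambda>_. gauss {..<n})) \<le> ennreal eps"
proof -
  let ?R = "{1..Suc K} \<times> {..<n}"
  let ?J = "insert (0, 0) ?R"
  interpret PK: prob_space "gauss (PK K)" by (rule prob_space_gauss)
  interpret J: prob_space "gauss ?J" by (rule prob_space_gauss)
  interpret S: prob_space std_gauss by (rule prob_space_std_gauss)
  obtain A where cov: "\<And>S1 S2. S1 \<in> PK K \<Longrightarrow> S2 \<in> PK K \<Longrightarrow> dotp (PK K) (A S1) (A S2) = dispV P S1 S2"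
    and pr: "measure (gauss (PK K)) {g \<in> space (gauss (PK K)). \<forall>S\<in>PK K. dotp (PK K) (A S) g \<le> z S} \<ge> 1 - eps"
    using z unfolding Qinv_def dotp_def by blast
  let ?E = "{g \<in> space (gauss ?J). \<forall>S\<in>PK K. dotp ?J (coef K P S) g \<le> z S}"
  have E: "?E \<in> sets (gauss ?J)" by (rule polyhedron_measurable[OF finite_PK])
  have "emeasure (gauss (PK K)) {g \<in> space (gauss (PK K)). \<forall>S\<in>PK K. dotp (PK K) (A S) g \<le> z S} = emeasure (gauss ?J) ?E"
    by (rule gauss_linear_law) (simp_all only: finite_PK finite_insert finite_cartesian_product finite_atLeastAtMost
        finite_lessThan cov dotp_coef[OF _ _ n P])
  then have pE: "measure (gauss ?J) ?E \<ge> 1 - eps" using pr by (simp add: measure_def)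
  let ?E' = "space (gauss ?J) - ?E"
  have E': "?E' \<in> sets (gauss ?J)" using E by auto
  have "measure (gauss ?J) ?E' \<le> eps" using pE J.prob_compl[OF E] by linarith
  then have "emeasure (gauss ?J) ?E' \<le> ennreal eps" unfolding J.emeasure_eq_measure by (rule ennreal_leI)
  moreover have "emeasure (gauss ?J) ?E' = (\<integral>\<^sup>+G. ennreal (measure std_gauss {threshold K P z G<..}) \<partial>PiM {1..Suc K} (\<lambda>_. gauss {..<n}))"
  proof -
    have fR: "finite ?R" and nR: "(0, 0) \<notin> ?R" by auto
    have iE: "indicator ?E' \<in> borel_measurable (gauss ?J)" using E' by simp
    have sec: "(\<lambda>g. \<integral>\<^sup>+w. indicator ?E' (g((0, 0) := w)) \<partial>std_gauss) \<in> borel_measurable (gauss ?R)"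
      by (rule measurable_section_integral[OF iE])
    have "emeasure (gauss ?J) ?E' = (\<integral>\<^sup>+g. indicator ?E' g \<partial>gauss ?J)" using E' by simp
    also have "\<dots> = (\<integral>\<^sup>+g. (\<integral>\<^sup>+w. indicator ?E' (g((0, 0) := w)) \<partial>std_gauss) \<partial>gauss ?R)"
      by (rule G.product_nn_integral_insert[OF fR nR iE])
    \<comment> \<open>The remaining pairs are regrouped into \<open>Suc K\<close> vectors, the space
      on which the union bound lives.\<close>
    also have "\<dots> = (\<integral>\<^sup>+G. (\<integral>\<^sup>+w. indicator ?E' ((\<lambda>p\<in>?R. G (fst p) (snd p))((0, 0) := w)) \<partial>std_gauss) \<partial>PiM {1..Suc K} (\<lambda>_. gauss {..<n}))"
      by (rule nn_integral_uncurry[OF _ _ sec]) auto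
    also have "\<dots> = (\<integral>\<^sup>+G. ennreal (measure std_gauss {threshold K P z G<..}) \<partial>PiM {1..Suc K} (\<lambda>_. gauss {..<n}))"
    proof (rule nn_integral_cong)
      fix G assume "G \<in> space (PiM {1..Suc K} (\<lambda>_. gauss {..<n}))"
      have dot: "dotp ?J (coef K P S) ((\<lambda>p\<in>?R. G (fst p) (snd p))((0, 0) := w)) = lin_form K P S G + slope P S * w"
        if S: "S \<in> PK K" for S w
      proof -
        have SK: "S \<subseteq> {1..K}" using S by (auto simp: PK_def)
        have "dotp ?J (coef K P S) ((\<lambda>p\<in>?R. G (fst p) (snd p))((0, 0) := w))
           = slope P S * w + (\<Sum>p\<in>?R. coef K P S p * ((\<lambda>p\<in>?R. G (fst p) (snd p))((0, 0) := w)) p)"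
          unfolding dotp_def using fR nR by (subst sum.insert) (auto simp: coef_def)
        also have "(\<Sum>p\<in>?R. coef K P S p * ((\<lambda>p\<in>?R. G (fst p) (snd p))((0, 0) := w)) p)
           = (\<Sum>p\<in>?R. coef K P S p * G (fst p) (snd p))"
          using nR by (intro sum.cong) auto
        finally show ?thesis unfolding coef_lin_form[OF SK n, of P G] by (simp only: add.commute)
      qed
      have sp: "(\<lambda>p\<in>?R. G (fst p) (snd p))((0, 0) := w) \<in> space (gauss ?J)" for w
        by (auto simp: space_PiM PiE_iff extensional_def)
      define u where "u = (\<lambda>w. (\<lambda>p\<in>?R. G (fst p) (snd p))((0, 0) := w))"
      have "u w \<in> ?E' \<longleftrightarrow> threshold K P z G < w" for w
        using sp[of w] dot[of _ w] unfolding threshold_less_iff[OF K P] u_def[symmetric] by (auto simp: not_le)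
      then have "indicator ?E' (u w) = (indicator {threshold K P z G<..} w :: ennreal)" for w
        unfolding indicator_def greaterThan_iff by presburger
      then have "indicator ?E' ((\<lambda>p\<in>?R. G (fst p) (snd p))((0, 0) := w)) = (indicator {threshold K P z G<..} w :: ennreal)" for w
        unfolding u_def .
      then show "(\<integral>\<^sup>+w. indicator ?E' ((\<lambda>p\<in>?R. G (fst p) (snd p))((0, 0) := w)) \<partial>std_gauss) = ennreal (measure std_gauss {threshold K P z G<..})"
        by (simp add: S.emeasure_eq_measure)
    qed
    finally show ?thesis .
  qed
  ultimately show ?thesis by simp
qed

section \<open>Size of the second-order terms\<close>

lemma quad_ge: "1 \<le> quad n K G"
proof -
  have "0 \<le> (\<Sum>j\<in>{1..Suc K}. \<Sum>l<j. (G j l)\<^sup>2)" "0 \<le> (\<Sum>j\<in>{1..K}. (vnorm {j..<n} (G j) - sqrt (real n))\<^sup>2)"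
    by (intro sum_nonneg zero_le_power2)+
  then show ?thesis unfolding quad_def by linarith
qed

text \<open>By \<open>2 * \<bar>x\<bar> \<le> 1 + x\<^sup>2\<close> a linear quantity is traded for
  \<open>quad\<close>, whose mean is what is controlled below.\<close>

lemma entry_le_quad:
  assumes "j \<in> {1..Suc K}" "l < j"
  shows "\<bar>G j l\<bar> \<le> quad n K G"
proof -
  have "(G j l)\<^sup>2 \<le> (\<Sum>l<j. (G j l)\<^sup>2)"
    using assms by (intro member_le_sum[of l "{..<j}" "\<lambda>l. (G j l)\<^sup>2"]) auto
  also have "\<dots> \<le> (\<Sum>j\<in>{1..Suc K}. \<Sum>l<j. (G j l)\<^sup>2)"
    using assms by (intro member_le_sum[of j "{1..Suc K}" "\<lambda>j. \<Sum>l<j. (G j l)\<^sup>2"]) (auto intro: sum_nonneg)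
  finally have "(G j l)\<^sup>2 \<le> (\<Sum>j\<in>{1..Suc K}. \<Sum>l<j. (G j l)\<^sup>2)" .
  moreover have "0 \<le> (\<Sum>j\<in>{1..K}. (vnorm {j..<n} (G j) - sqrt (real n))\<^sup>2)" by (intro sum_nonneg zero_le_power2)
  moreover have "2 * \<bar>G j l\<bar> \<le> 1 + (G j l)\<^sup>2" using sum_squares_bound[of 1 "\<bar>G j l\<bar>"] by simp
  ultimately show ?thesis unfolding quad_def by linarith
qed

text \<open>The value at the zero array depends on \<open>z\<close> only, so it locates the
  threshold up to a multiple of \<open>quad\<close>. The constant depends neither on
  \<open>z\<close> nor on \<open>n\<close>.\<close>

lemma threshold_lipschitz:
  assumes K: "K \<ge> 1" and P: "\<forall>i\<in>{1..K}. P i > 0"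
  obtains L :: real where "L > 0" "\<And>n z G. \<bar>threshold K P z G - threshold K P z (\<lambda>_ _. 0)\<bar> \<le> L * quad n K G"
proof -
  define lb where "lb = (\<lambda>S. ((\<Sum>j\<in>S. \<Sum>l\<in>S. sqrt (P j) * sqrt (P l)) + (\<Sum>l\<in>S. sqrt (P l))) / slope P S)"
  have lb0: "0 \<le> lb S" if S: "S \<in> PK K" for S
  proof -
    have "0 \<le> P i" if "i \<in> S" for i using bspec[OF P, of i] S that by (auto simp: PK_def)
    then show ?thesis unfolding lb_def using slope_bounds(1)[OF S P]
      by (intro divide_nonneg_pos add_nonneg_nonneg sum_nonneg mult_nonneg_nonneg) auto
  qed
  define L where "L = 1 + (\<Sum>S\<in>PK K. lb S)"
  have L0: "L > 0" unfolding L_def using lb0 by (intro add_pos_nonneg sum_nonneg) auto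
  have lin: "\<bar>lin_form K P S G / slope P S\<bar> \<le> L * quad n K G" if S: "S \<in> PK K" for S n G
  proof -
    have SK: "S \<subseteq> {1..K}" "finite S" using S finite_subset by (auto simp: PK_def)
    have Pn: "0 \<le> sqrt (P i)" if "i \<in> S" for i using bspec[OF P, of i] SK that by (auto simp: less_imp_le)
    define q where "q = quad n K G"
    have q: "q \<ge> 1" unfolding q_def by (rule quad_ge)
    define A where "A = (\<Sum>j\<in>S. \<Sum>l\<in>{l\<in>S. l < j}. sqrt (P j) * sqrt (P l) * G j l)"
    define B where "B = (\<Sum>l\<in>S. sqrt (P l) * G (Suc K) l)"
    have pS: "Psum P S \<ge> 0" unfolding Psum_def by (rule sum_nonneg) (use SK P in force)
    have "\<bar>A\<bar> \<le> (\<Sum>j\<in>S. \<Sum>l\<in>{l\<in>S. l < j}. sqrt (P j) * sqrt (P l) * q)"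
      unfolding A_def
    proof (intro order_trans[OF sum_abs sum_mono])
      fix j l assume jl: "j \<in> S" "l \<in> {l\<in>S. l < j}"
      then have "\<bar>G j l\<bar> \<le> q" unfolding q_def using SK by (intro entry_le_quad) auto
      then show "\<bar>sqrt (P j) * sqrt (P l) * G j l\<bar> \<le> sqrt (P j) * sqrt (P l) * q"
        unfolding abs_mult[of "sqrt (P j) * sqrt (P l)"] using Pn jl by (intro mult_mono) auto
    qed
    also have "\<dots> \<le> (\<Sum>j\<in>S. \<Sum>l\<in>S. sqrt (P j) * sqrt (P l) * q)"
      using SK Pn q by (intro sum_mono sum_mono2) auto
    finally have A: "\<bar>A\<bar> \<le> (\<Sum>j\<in>S. \<Sum>l\<in>S. sqrt (P j) * sqrt (P l)) * q" by (simp add: sum_distrib_right)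
    have "\<bar>B\<bar> \<le> (\<Sum>l\<in>S. sqrt (P l) * q)"
      unfolding B_def
    proof (intro order_trans[OF sum_abs sum_mono])
      fix l assume l: "l \<in> S"
      then have "\<bar>G (Suc K) l\<bar> \<le> q" unfolding q_def using SK by (intro entry_le_quad) auto
      then show "\<bar>sqrt (P l) * G (Suc K) l\<bar> \<le> sqrt (P l) * q"
        unfolding abs_mult using Pn l by (intro mult_mono) auto
    qed
    then have B: "\<bar>B\<bar> \<le> (\<Sum>l\<in>S. sqrt (P l)) * q" by (simp add: sum_distrib_right)
    have "\<bar>lin_form K P S G\<bar> = \<bar>A + B\<bar> / (1 + Psum P S)"
      unfolding lin_form_def A_def[symmetric] B_def[symmetric] using pS by (simp add: abs_div abs_minus_commute)
    also have "\<dots> \<le> \<bar>A + B\<bar> / 1" using pS by (intro divide_left_mono) auto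
    also have "\<dots> \<le> \<bar>A\<bar> + \<bar>B\<bar>" by simp
    also have "\<dots> \<le> ((\<Sum>j\<in>S. \<Sum>l\<in>S. sqrt (P j) * sqrt (P l)) + (\<Sum>l\<in>S. sqrt (P l))) * q"
      unfolding distrib_right by (rule add_mono[OF A B])
    finally have "\<bar>lin_form K P S G / slope P S\<bar> \<le> lb S * q"
      using slope_bounds(1)[OF S P] unfolding lb_def abs_divide by (simp add: divide_right_mono)
    also have "\<dots> \<le> L * q"
    proof (rule mult_right_mono)
      have "lb S \<le> (\<Sum>S\<in>PK K. lb S)" using lb0 S finite_PK by (intro member_le_sum) auto
      then show "lb S \<le> L" by (simp add: L_def)
    qed (use q in simp)
    finally show ?thesis by (simp add: q_def)
  qed
  have "\<bar>threshold K P z G - threshold K P z (\<lambda>_ _. 0)\<bar> \<le> L * quad n K G" for n z G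
  proof -
    have l0: "lin_form K P S (\<lambda>_ _. 0) = 0" for S by (simp add: lin_form_def)
    \<comment> \<open>The minimum is attained. Evaluating each threshold at the minimizer of the
      other one bounds the difference in both directions.\<close>
    have att: "\<exists>S\<in>PK K. threshold K P z H = (z S - lin_form K P S H) / slope P S" for H
    proof -
      have "threshold K P z H \<in> (\<lambda>S. (z S - lin_form K P S H) / slope P S) ` PK K"
        unfolding threshold_def using finite_PK PK_nonempty[OF K] by (intro Min_in) auto
      then show ?thesis by auto
    qed
    obtain S1 where S1: "S1 \<in> PK K" "threshold K P z G = (z S1 - lin_form K P S1 G) / slope P S1" using att by blast
    obtain S0 where S0: "S0 \<in> PK K" "threshold K P z (\<lambda>_ _. 0) = (z S0 - lin_form K P S0 (\<lambda>_ _. 0)) / slope P S0" using att by blast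
    have "threshold K P z (\<lambda>_ _. 0) \<le> z S1 / slope P S1" using threshold_le[OF S1(1), of P z "\<lambda>_ _. 0"] by (simp add: l0)
    moreover have "threshold K P z G \<le> z S0 / slope P S0 - lin_form K P S0 G / slope P S0"
      using threshold_le[OF S0(1), of P z G] by (simp add: diff_divide_distrib)
    ultimately show ?thesis using S0(2) S1(2) lin[OF S0(1), of G n] lin[OF S1(1), of G n]
      unfolding l0 diff_divide_distrib by linarith
  qed
  then show ?thesis using that L0 by blast
qed

lemma nn_integral_component:
  assumes "prob_space N" "j \<in> I" "f \<in> borel_measurable N"
  shows "(\<integral>\<^sup>+G. f (G j) \<partial>PiM I (\<lambda>_. N)) = (\<integral>\<^sup>+x. f x \<partial>N)"
proof -
  have "(\<integral>\<^sup>+x. f x \<partial>N) = (\<integral>\<^sup>+x. f x \<partial>distr (PiM I (\<lambda>_. N)) N (\<lambda>G. G j))"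
    using distr_PiM_component[of I "\<lambda>_. N" j] assms by simp
  also have "\<dots> = (\<integral>\<^sup>+G. f (G j) \<partial>PiM I (\<lambda>_. N))"
    using assms by (intro nn_integral_distr) auto
  finally show ?thesis by simp
qed

lemma borel_measurable_quad:
  assumes "K < n"
  shows "quad n K \<in> borel_measurable (PiM {1..Suc K} (\<lambda>_. gauss {..<n}))"
proof -
  have *: "(\<lambda>G. G j l) \<in> borel_measurable (PiM {1..Suc K} (\<lambda>_. gauss {..<n}))" if "j \<in> {1..Suc K}" "l < n" for j l
    using measurable_gauss_nested[of j "{1..Suc K}" l "{..<n}"] that by auto
  show ?thesis unfolding quad_def
    by (intro borel_measurable_add borel_measurable_const borel_measurable_sum borel_measurable_power
        borel_measurable_diff borel_measurable_vnorm *) (use assms in auto)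
qed

text \<open>The entries are standard normal. The norm in row \<open>j\<close> is centred at
  \<open>sqrt (n - j - 1)\<close>, which is within \<open>K + 1\<close> of \<open>sqrt n\<close>,
  and its fluctuation has a second moment bounded by \<open>chi_dev_approx\<close>.\<close>

lemma quad_mean:
  obtains C :: real where "C \<ge> 1"
    "\<And>n. real n \<ge> C \<Longrightarrow> (\<integral>\<^sup>+G. ennreal (quad n K G) \<partial>PiM {1..Suc K} (\<lambda>_. gauss {..<n})) \<le> ennreal C"
proof -
  obtain C0 :: real where C0: "C0 > 0"
    "\<And>(A :: nat set) D. finite A \<Longrightarrow> real (card A) \<ge> C0 \<Longrightarrow> D \<in> sets borel \<Longrightarrow>
       measure (gauss A) {x \<in> space (gauss A). chi_dev A x \<in> D} \<le> measure std_gauss D + C0 / sqrt (real (card A) - 1)"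
    "\<And>A :: nat set. finite A \<Longrightarrow> real (card A) \<ge> C0 \<Longrightarrow> (\<integral>\<^sup>+x. ennreal ((chi_dev A x)\<^sup>2) \<partial>gauss A) \<le> ennreal C0"
    using chi_dev_approx by blast
  define k where "k = real K + 1"
  define C where "C = 1 + (\<Sum>j\<in>{1..Suc K}. real j) + (\<Sum>j\<in>{1..K}. 2 * k\<^sup>2 + C0) + C0 + k + 1"
  have C1: "C \<ge> 1" "C \<ge> C0 + k + 1" using C0(1) by (auto simp: C_def k_def sum_nonneg add_nonneg_nonneg)
  have "(\<integral>\<^sup>+G. ennreal (quad n K G) \<partial>PiM {1..Suc K} (\<lambda>_. gauss {..<n})) \<le> ennreal C" if n: "real n \<ge> C" for n
  proof -
    let ?M = "PiM {1..Suc K} (\<lambda>_. gauss {..<n})"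
    interpret M: prob_space ?M by (rule prob_space_nested)
    have nK: "real n \<ge> C0 + k + 1" using n C1 by linarith
    then have Kn: "Suc K < n" using C0(1) by (simp add: k_def)
    have ent: "(\<lambda>G. G j l) \<in> borel_measurable ?M" if "j \<in> {1..Suc K}" "l < n" for j l
      using measurable_gauss_nested[of j "{1..Suc K}" l "{..<n}"] that by auto
    have e1: "(\<integral>\<^sup>+G. ennreal ((G j l)\<^sup>2) \<partial>?M) = 1" if "j \<in> {1..Suc K}" "l < n" for j l
    proof -
      have c: "(\<lambda>x. x l) \<in> borel_measurable (gauss {..<n})" using that by (intro measurable_gauss_component) auto
      have "(\<integral>\<^sup>+G. ennreal ((G j l)\<^sup>2) \<partial>?M) = (\<integral>\<^sup>+x. ennreal ((x l)\<^sup>2) \<partial>gauss {..<n})"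
        using that c by (intro nn_integral_component[OF prob_space_gauss, where f="\<lambda>x. ennreal ((x l)\<^sup>2)"]) auto
      also have "\<dots> = (\<integral>\<^sup>+w. ennreal (w\<^sup>2) \<partial>std_gauss)"
        using that by (intro nn_integral_component[OF prob_space_std_gauss, where f="\<lambda>w. ennreal (w\<^sup>2)"]) auto
      finally show ?thesis by (simp add: nn_integral_std_gauss_square)
    qed
    have e2: "(\<integral>\<^sup>+G. ennreal ((vnorm {j..<n} (G j) - sqrt (real n))\<^sup>2) \<partial>?M) \<le> ennreal (2 * k\<^sup>2 + C0)" if j: "j \<in> {1..K}" for j
    proof -
      let ?A = "{j..<n}"
      have f: "(\<lambda>x. ennreal ((vnorm ?A x - sqrt (real n))\<^sup>2)) \<in> borel_measurable (gauss I)" if "?A \<subseteq> I" for I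
      proof -
        have "(\<lambda>x. vnorm ?A x) \<in> borel_measurable (gauss I)"
          using that by (intro borel_measurable_vnorm measurable_gauss_component) auto
        then show ?thesis by measurable
      qed
      have "(\<integral>\<^sup>+G. ennreal ((vnorm ?A (G j) - sqrt (real n))\<^sup>2) \<partial>?M) = (\<integral>\<^sup>+x. ennreal ((vnorm ?A x - sqrt (real n))\<^sup>2) \<partial>gauss {..<n})"
      proof (rule nn_integral_component[OF prob_space_gauss, where f="\<lambda>x. ennreal ((vnorm ?A x - sqrt (real n))\<^sup>2)"])
        show "j \<in> {1..Suc K}" using j by simp
        show "(\<lambda>x. ennreal ((vnorm ?A x - sqrt (real n))\<^sup>2)) \<in> borel_measurable (gauss {..<n})"
          by (rule f) auto
      qed
      also have "\<dots> = (\<integral>\<^sup>+x. ennreal ((vnorm ?A (\<lambda>i\<in>?A. x i) - sqrt (real n))\<^sup>2) \<partial>gauss {..<n})"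
        by (intro nn_integral_cong) (simp add: vnorm_def dotp_def)
      also have "\<dots> = (\<integral>\<^sup>+x. ennreal ((vnorm ?A x - sqrt (real n))\<^sup>2) \<partial>gauss ?A)"
      proof (rule nn_integral_PiM_reindex[OF prob_space_std_gauss, of "\<lambda>i. i", symmetric])
        show "(\<lambda>x. ennreal ((vnorm ?A x - sqrt (real n))\<^sup>2)) \<in> borel_measurable (gauss ?A)"
          by (rule f) auto
      qed auto
      also have "\<dots> \<le> (\<integral>\<^sup>+x. ennreal (2 * k\<^sup>2) + ennreal ((chi_dev ?A x)\<^sup>2) \<partial>gauss ?A)"
      proof (rule nn_integral_mono)
        fix x
        define a where "a = sqrt (real (card ?A) - 1)"
        have card: "real (card ?A) - 1 = real n - real j - 1" using j Kn by (simp add: of_nat_diff)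
        have a2: "a\<^sup>2 = real n - real j - 1" unfolding a_def card using j Kn by simp
        have ar: "a \<le> sqrt (real n)" unfolding a_def card by simp
        have r1: "1 \<le> sqrt (real n)" using Kn by simp
        have a0: "0 \<le> a" unfolding a_def card using j Kn by simp
        have "(sqrt (real n) - a) * 1 \<le> (sqrt (real n) - a) * (sqrt (real n) + a)" using ar r1 a0 by (intro mult_left_mono) linarith+
        also have "\<dots> = real j + 1" using a2 by (simp add: power2_eq_square algebra_simps)
        also have "\<dots> \<le> k" using j by (simp add: k_def)
        finally have "\<bar>a - sqrt (real n)\<bar> \<le> k" using ar by simp
        then have "(a - sqrt (real n))\<^sup>2 \<le> k\<^sup>2" using power_mono[of "\<bar>a - sqrt (real n)\<bar>" k 2] by simp
        moreover have "vnorm ?A x - sqrt (real n) = (a - sqrt (real n)) + chi_dev ?A x / sqrt 2"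
          by (simp add: chi_dev_def a_def)
        moreover have "(u + v / sqrt 2)\<^sup>2 \<le> 2 * u\<^sup>2 + v\<^sup>2" for u v :: real
          using zero_le_power2[of "u - v / sqrt 2"] by (simp add: power2_sum power2_diff power_divide)
        ultimately have "(vnorm ?A x - sqrt (real n))\<^sup>2 \<le> 2 * k\<^sup>2 + (chi_dev ?A x)\<^sup>2"
          by (smt (verit))
        then show "ennreal ((vnorm ?A x - sqrt (real n))\<^sup>2) \<le> ennreal (2 * k\<^sup>2) + ennreal ((chi_dev ?A x)\<^sup>2)"
          by (simp add: ennreal_leI flip: ennreal_plus)
      qed
      also have "\<dots> = ennreal (2 * k\<^sup>2) + (\<integral>\<^sup>+x. ennreal ((chi_dev ?A x)\<^sup>2) \<partial>gauss ?A)"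
        using borel_measurable_chi_dev[of ?A] prob_space.emeasure_space_1[OF prob_space_gauss, of ?A]
        by (subst nn_integral_add) auto
      also have "\<dots> \<le> ennreal (2 * k\<^sup>2) + ennreal C0"
        using C0(3)[of ?A] nK j Kn by (intro add_left_mono) (auto simp: of_nat_diff k_def)
      finally show ?thesis using C0(1) by simp
    qed
    have m2: "(\<lambda>G. ennreal ((vnorm {j..<n} (G j) - sqrt (real n))\<^sup>2)) \<in> borel_measurable ?M" if "j \<in> {1..K}" for j
    proof -
      have "(\<lambda>G. vnorm {j..<n} (G j)) \<in> borel_measurable ?M"
        using that by (intro borel_measurable_vnorm ent) auto
      then show ?thesis by measurable
    qed
    have "(\<integral>\<^sup>+G. ennreal (quad n K G) \<partial>?M) = (\<integral>\<^sup>+G. (1 + (\<Sum>j\<in>{1..Suc K}. \<Sum>l<j. ennreal ((G j l)\<^sup>2)))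
        + (\<Sum>j\<in>{1..K}. ennreal ((vnorm {j..<n} (G j) - sqrt (real n))\<^sup>2)) \<partial>?M)"
      unfolding quad_def by (intro nn_integral_cong) (simp add: sum_nonneg add_nonneg_nonneg)
    also have "\<dots> = (\<integral>\<^sup>+G. 1 + (\<Sum>j\<in>{1..Suc K}. \<Sum>l<j. ennreal ((G j l)\<^sup>2)) \<partial>?M)
        + (\<integral>\<^sup>+G. (\<Sum>j\<in>{1..K}. ennreal ((vnorm {j..<n} (G j) - sqrt (real n))\<^sup>2)) \<partial>?M)"
      by (intro nn_integral_add borel_measurable_add borel_measurable_const borel_measurable_sum m2
          measurable_compose[OF borel_measurable_power[OF ent] measurable_ennreal]) (use Kn in auto)
    also have "(\<integral>\<^sup>+G. 1 + (\<Sum>j\<in>{1..Suc K}. \<Sum>l<j. ennreal ((G j l)\<^sup>2)) \<partial>?M)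
       = (\<integral>\<^sup>+G. 1 \<partial>?M) + (\<integral>\<^sup>+G. (\<Sum>j\<in>{1..Suc K}. \<Sum>l<j. ennreal ((G j l)\<^sup>2)) \<partial>?M)"
      by (intro nn_integral_add borel_measurable_const borel_measurable_sum
          measurable_compose[OF borel_measurable_power[OF ent] measurable_ennreal]) (use Kn in auto)
    also have "(\<integral>\<^sup>+G. (\<Sum>j\<in>{1..Suc K}. \<Sum>l<j. ennreal ((G j l)\<^sup>2)) \<partial>?M) = (\<Sum>j\<in>{1..Suc K}. \<integral>\<^sup>+G. (\<Sum>l<j. ennreal ((G j l)\<^sup>2)) \<partial>?M)"
      by (intro nn_integral_sum borel_measurable_sum
          measurable_compose[OF borel_measurable_power[OF ent] measurable_ennreal]) (use Kn in auto)
    also have "\<dots> = (\<Sum>j\<in>{1..Suc K}. \<Sum>l<j. \<integral>\<^sup>+G. ennreal ((G j l)\<^sup>2) \<partial>?M)"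
      by (intro sum.cong refl nn_integral_sum
          measurable_compose[OF borel_measurable_power[OF ent] measurable_ennreal]) (use Kn in auto)
    also have "\<dots> = (\<Sum>j\<in>{1..Suc K}. \<Sum>l<j. 1)"
      by (intro sum.cong refl e1) (use Kn in auto)
    also have "\<dots> = ennreal (\<Sum>j\<in>{1..Suc K}. real j)"
      by (simp add: ennreal_of_nat_eq_real_of_nat flip: of_nat_sum)
    also have "(\<integral>\<^sup>+G. (\<Sum>j\<in>{1..K}. ennreal ((vnorm {j..<n} (G j) - sqrt (real n))\<^sup>2)) \<partial>?M)
       = (\<Sum>j\<in>{1..K}. \<integral>\<^sup>+G. ennreal ((vnorm {j..<n} (G j) - sqrt (real n))\<^sup>2) \<partial>?M)"
      using m2 by (rule nn_integral_sum)
    also have "\<dots> \<le> (\<Sum>j\<in>{1..K}. ennreal (2 * k\<^sup>2 + C0))" using e2 by (rule sum_mono)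
    also have "(\<integral>\<^sup>+G. 1 \<partial>?M) + ennreal (\<Sum>j\<in>{1..Suc K}. real j) + (\<Sum>j\<in>{1..K}. ennreal (2 * k\<^sup>2 + C0))
       = ennreal (1 + (\<Sum>j\<in>{1..Suc K}. real j) + (\<Sum>j\<in>{1..K}. 2 * k\<^sup>2 + C0))"
    proof -
      have "(\<Sum>j\<in>{1..K}. ennreal (2 * k\<^sup>2 + C0)) = ennreal (\<Sum>j\<in>{1..K}. 2 * k\<^sup>2 + C0)"
        using C0(1) by (intro sum_ennreal) auto
      moreover have "0 \<le> (\<Sum>j\<in>{1..K}. 2 * k\<^sup>2 + C0)" using C0(1) by (intro sum_nonneg) auto
      moreover have "0 \<le> (\<Sum>j\<in>{1..Suc K}. real j)" by (intro sum_nonneg) auto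
      moreover have "1 + ennreal a + ennreal b = ennreal (1 + a + b)" if "0 \<le> b" "0 \<le> a" for a b
        using that by simp
      moreover have "(\<integral>\<^sup>+G. 1 \<partial>?M) = 1" using M.emeasure_space_1 by simp
      ultimately show ?thesis by presburger
    qed
    also have "\<dots> \<le> ennreal C" using C0(1) by (intro ennreal_leI) (simp add: C_def k_def)
    finally show ?thesis by (simp add: add_left_mono)
  qed
  then show ?thesis using that C1(1) by blast
qed

subsection \<open>Achievability\<close>

text \<open>Written through inner products, the output norm is visibly a function of the Gram
  matrix, which the passage to triangular vectors demands.\<close>

lemma vnorm_output_gram:
  "vnorm I (\<lambda>t. G k t + xsum I S c G t) = sqrt (dotp I (G k) (G k)
     + 2 * (\<Sum>s\<in>S. c s / vnorm I (G s) * dotp I (G s) (G k))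
     + (\<Sum>s\<in>S. \<Sum>s'\<in>S. c s / vnorm I (G s) * (c s' / vnorm I (G s')) * dotp I (G s') (G s)))"
proof -
  have h: "dotp I (\<lambda>t. G k t + xsum I S c G t) (\<lambda>t. G k t + xsum I S c G t)
     = dotp I (G k) (G k) + 2 * dotp I (xsum I S c G) (G k) + dotp I (xsum I S c G) (xsum I S c G)"
    by (simp add: dotp_def algebra_simps sum.distrib sum_distrib_left)
  show ?thesis unfolding vnorm_def[of I "\<lambda>t. G k t + xsum I S c G t"] h dotp_xsum_self unfolding dotp_xsum ..
qed

lemma gram_invariant_rcu_bound:
  "gram_invariant {..<n} {1..Suc K} (\<lambda>G. ennreal (rcu_bound n K c M G))"
  unfolding gram_invariant_def
proof (intro allI impI)
  fix G G' :: "nat \<Rightarrow> nat \<Rightarrow> real"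
  assume eq: "\<forall>s\<in>{1..Suc K}. \<forall>s'\<in>{1..Suc K}. dotp {..<n} (G s) (G s') = dotp {..<n} (G' s) (G' s')"
  have v: "vnorm {..<n} (G s) = vnorm {..<n} (G' s)" if "s \<in> {1..Suc K}" for s
    using eq that by (simp add: vnorm_def)
  have "cap_error n K c S G = cap_error n K c S G'" if S: "S \<in> PK K" for S
  proof -
    have SK: "s \<in> {1..Suc K}" if "s \<in> S" for s using S that by (auto simp: PK_def)
    have "(\<Sum>s\<in>S. c s / vnorm {..<n} (G s) * dotp {..<n} (G s) (G (Suc K)))
        = (\<Sum>s\<in>S. c s / vnorm {..<n} (G' s) * dotp {..<n} (G' s) (G' (Suc K)))"
      using SK v eq by (intro sum.cong refl) simp
    moreover have "(\<Sum>s\<in>S. \<Sum>s'\<in>S. c s / vnorm {..<n} (G s) * (c s' / vnorm {..<n} (G s')) * dotp {..<n} (G s') (G s))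
        = (\<Sum>s\<in>S. \<Sum>s'\<in>S. c s / vnorm {..<n} (G' s) * (c s' / vnorm {..<n} (G' s')) * dotp {..<n} (G' s') (G' s))"
      using SK v eq by (intro sum.cong refl) simp
    ultimately show ?thesis unfolding cap_error_def vnorm_output_gram using v[of "Suc K"] eq by simp
  qed
  then show "ennreal (rcu_bound n K c M G) = ennreal (rcu_bound n K c M G')"
    unfolding rcu_bound_def by simp
qed

section \<open>Level sets of the union bound\<close>

definition rcu_sum :: "nat \<Rightarrow> nat \<Rightarrow> (nat \<Rightarrow> real) \<Rightarrow> (nat \<Rightarrow> nat) \<Rightarrow> (nat \<Rightarrow> nat \<Rightarrow> real) \<Rightarrow> real" where
  "rcu_sum n K c M G = (\<Sum>S\<in>PK K. (\<Prod>s\<in>S. real (M s)) * cap_error n K c S (\<lambda>j\<in>{1..Suc K}. triang n j (G j)))"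

definition rcu_level :: "nat \<Rightarrow> nat \<Rightarrow> (nat \<Rightarrow> real) \<Rightarrow> (nat \<Rightarrow> nat) \<Rightarrow> nat \<Rightarrow> (nat \<Rightarrow> nat \<Rightarrow> real) set" where
  "rcu_level n K c M k = {G \<in> space (PiM {1..Suc K} (\<lambda>_. gauss {..<n})). (1/2) ^ k \<le> rcu_sum n K c M G}"

lemma borel_measurable_rcu_sum:
  "rcu_sum n K c M \<in> borel_measurable (PiM {1..Suc K} (\<lambda>_. gauss {..<n}))"
proof -
  have "(\<lambda>G. \<lambda>j\<in>{1..Suc K}. triang n j (G j)) \<in> PiM {1..Suc K} (\<lambda>_. gauss {..<n}) \<rightarrow>\<^sub>M PiM {1..Suc K} (\<lambda>_. gauss {..<n})"
    by (intro measurable_restrict measurable_compose[OF _ measurable_triang] measurable_component_singleton)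
  from measurable_compose[OF this borel_measurable_cap_error] show ?thesis
    unfolding rcu_sum_def by (intro borel_measurable_sum borel_measurable_times borel_measurable_const) (auto simp: PK_def)
qed

lemma rcu_level_sets: "rcu_level n K c M k \<in> sets (PiM {1..Suc K} (\<lambda>_. gauss {..<n}))"
  unfolding rcu_level_def
  by (intro borel_measurable_le borel_measurable_const borel_measurable_rcu_sum)

text \<open>The integrand is passed to triangular vectors and decomposed dyadically. Stopping after
  \<open>n\<close> levels leaves \<open>(1/2) ^ n\<close>, which is below
  \<open>1 / sqrt n\<close>.\<close>

lemma nn_integral_rcu_levels:
  assumes n: "n \<ge> 4" "Suc K < n"
  shows "(\<integral>\<^sup>+G. ennreal (rcu_bound n K c M G) \<partial>PiM {1..Suc K} (\<lambda>_. gauss {..<n}))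
    \<le> ennreal ((\<Sum>k\<in>{1..n}. (1/2) ^ k * measure (PiM {1..Suc K} (\<lambda>_. gauss {..<n})) (rcu_level n K c M k)) + (1/2) ^ n)"
proof -
  let ?M = "PiM {1..Suc K} (\<lambda>_. gauss {..<n})"
  interpret M: prob_space ?M by (rule prob_space_nested)
  have "(\<integral>\<^sup>+G. ennreal (rcu_bound n K c M G) \<partial>?M)
      = (\<integral>\<^sup>+G. ennreal (rcu_bound n K c M (\<lambda>j\<in>{1..Suc K}. triang n j (G j))) \<partial>?M)"
    by (rule nn_integral_triang[OF n(2) measurable_compose[OF borel_measurable_rcu_bound measurable_ennreal] gram_invariant_rcu_bound])
  also have "\<dots> \<le> (\<integral>\<^sup>+G. (\<Sum>k\<in>{1..n}. ennreal ((1/2) ^ k) * indicator (rcu_level n K c M k) G) + ennreal ((1/2) ^ n) \<partial>?M)"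
  proof (rule nn_integral_mono)
    fix G assume G: "G \<in> space ?M"
    have x0: "0 \<le> rcu_sum n K c M G"
      unfolding rcu_sum_def using cap_error_nonneg[OF n(1)] by (intro sum_nonneg mult_nonneg_nonneg prod_nonneg) auto
    have "rcu_bound n K c M (\<lambda>j\<in>{1..Suc K}. triang n j (G j)) = min 1 (rcu_sum n K c M G)"
      by (simp add: rcu_bound_def rcu_sum_def)
    also have "\<dots> \<le> (\<Sum>k\<in>{1..n}. (1/2) ^ k * (if (1/2) ^ k \<le> rcu_sum n K c M G then 1 else 0)) + (1/2) ^ n"
      by (rule min_dyadic[OF x0])
    finally have "ennreal (rcu_bound n K c M (\<lambda>j\<in>{1..Suc K}. triang n j (G j)))
       \<le> ennreal ((\<Sum>k\<in>{1..n}. (1/2) ^ k * (if (1/2) ^ k \<le> rcu_sum n K c M G then 1 else 0)) + (1/2) ^ n)"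
      by (rule ennreal_leI)
    also have "\<dots> = (\<Sum>k\<in>{1..n}. ennreal ((1/2) ^ k * (if (1/2) ^ k \<le> rcu_sum n K c M G then 1 else 0))) + ennreal ((1/2) ^ n)"
      by (subst ennreal_plus) (auto intro!: sum_nonneg)
    also have "(\<Sum>k\<in>{1..n}. ennreal ((1/2) ^ k * (if (1/2) ^ k \<le> rcu_sum n K c M G then 1 else 0)))
       = (\<Sum>k\<in>{1..n}. ennreal ((1/2) ^ k) * indicator (rcu_level n K c M k) G)"
      using G by (intro sum.cong refl) (simp add: rcu_level_def indicator_def)
    finally show "ennreal (rcu_bound n K c M (\<lambda>j\<in>{1..Suc K}. triang n j (G j)))
       \<le> (\<Sum>k\<in>{1..n}. ennreal ((1/2) ^ k) * indicator (rcu_level n K c M k) G) + ennreal ((1/2) ^ n)" .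
  qed
  also have "\<dots> = (\<integral>\<^sup>+G. (\<Sum>k\<in>{1..n}. ennreal ((1/2) ^ k) * indicator (rcu_level n K c M k) G) \<partial>?M) + (\<integral>\<^sup>+G. ennreal ((1/2) ^ n) \<partial>?M)"
    by (intro nn_integral_add borel_measurable_sum borel_measurable_times_ennreal borel_measurable_const
        borel_measurable_indicator rcu_level_sets)
  also have "(\<integral>\<^sup>+G. (\<Sum>k\<in>{1..n}. ennreal ((1/2) ^ k) * indicator (rcu_level n K c M k) G) \<partial>?M)
      = (\<Sum>k\<in>{1..n}. \<integral>\<^sup>+G. ennreal ((1/2) ^ k) * indicator (rcu_level n K c M k) G \<partial>?M)"
    by (intro nn_integral_sum borel_measurable_times_ennreal borel_measurable_const
        borel_measurable_indicator rcu_level_sets)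
  also have "\<dots> = (\<Sum>k\<in>{1..n}. ennreal ((1/2) ^ k * measure ?M (rcu_level n K c M k)))"
  proof (rule sum.cong[OF refl])
    fix k
    show "(\<integral>\<^sup>+G. ennreal ((1/2) ^ k) * indicator (rcu_level n K c M k) G \<partial>?M) = ennreal ((1/2) ^ k * measure ?M (rcu_level n K c M k))"
      unfolding nn_integral_cmult_indicator[OF rcu_level_sets] M.emeasure_eq_measure by (rule ennreal_mult[symmetric]) auto
  qed
  also have "\<dots> = ennreal (\<Sum>k\<in>{1..n}. (1/2) ^ k * measure ?M (rcu_level n K c M k))"
    by (intro sum_ennreal) auto
  also have "(\<integral>\<^sup>+G. ennreal ((1/2) ^ n) \<partial>?M) = ennreal ((1/2) ^ n)"
    using M.emeasure_space_1 by simp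
  also have "ennreal (\<Sum>k\<in>{1..n}. (1/2) ^ k * measure ?M (rcu_level n K c M k)) + ennreal ((1/2) ^ n)
     = ennreal ((\<Sum>k\<in>{1..n}. (1/2) ^ k * measure ?M (rcu_level n K c M k)) + (1/2) ^ n)"
    by (subst ennreal_plus) (auto intro!: sum_nonneg)
  finally show ?thesis .
qed

text \<open>Conditionally on all coordinates but the norm of the noise in the last block, the bad event is a tail event
  of that norm.\<close>

lemma rcu_level_section:
  fixes P :: "nat \<Rightarrow> real" and D c B :: real
  assumes K: "K \<ge> 1" and P: "\<forall>i\<in>{1..K}. P i > 0" and M: "\<forall>i\<in>{1..K}. M i \<ge> 1" and n: "Suc K < n" "real n \<ge> D"
    and D: "\<And>S k G M w. S \<in> PK K \<Longrightarrow> w = chi_dev {Suc K..<n} (G (Suc K)) \<Longrightarrow> D * (quad n K G + w\<^sup>2) \<le> real n \<Longrightarrow> M > 0 \<Longrightarrow>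
       (1/2) ^ k \<le> M * cap_error n K (\<lambda>i. sqrt (real n * P i)) S (\<lambda>j\<in>{1..Suc K}. triang n j (G j)) \<Longrightarrow>
       real n * Cap (Psum P S) - sqrt (real n) * (lin_form K P S G + slope P S * w) - D * (quad n K G + w\<^sup>2 + real k)
         \<le> ln M - ln (real n) / 2"
    and D0: "D > 0" and c: "\<And>S. S \<in> PK K \<Longrightarrow> (D + 1) / slope P S \<le> c" and B: "0 \<le> B"
    and rate: "\<And>S. S \<in> PK K \<Longrightarrow> (\<Sum>s\<in>S. ln (real (M s)))
       \<le> real n * Cap (Psum P S) - sqrt (real n) * z S + ln (real n) / 2 - (B + ln (real (card (PK K))))"
    and lev: "G(Suc K := merge {..<Suc K} {Suc K..<n} (G (Suc K), y)) \<in> rcu_level n K (\<lambda>i. sqrt (real n * P i)) M k"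
  shows "threshold K P z G + (B - c * (quad n K G + real k)) / sqrt (real n)
        < chi_dev {Suc K..<n} y + c * (chi_dev {Suc K..<n} y)\<^sup>2 / sqrt (real n)
     \<or> real n < D * ((quad n K G + real k) + (chi_dev {Suc K..<n} y)\<^sup>2)"
proof -
  let ?J = "{Suc K..<n}"
  define G' where "G' = G(Suc K := merge {..<Suc K} ?J (G (Suc K), y))"
  define w where "w = chi_dev ?J y"
  define q where "q = quad n K G + real k"
  define r where "r = sqrt (real n)"
  have r: "r > 0" using n by (simp add: r_def)
  \<comment> \<open>The resampled coordinates are those of the noise from \<open>Suc K\<close> on.
    Both \<open>quad\<close> and \<open>lin_form\<close> read only noise entries below
    \<open>Suc K\<close>, so they do not change.\<close>
  have low: "G' j l = G j l" if "l < j" "j \<in> {1..Suc K}" for j l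
    using that by (auto simp: G'_def merge_def)
  have quad: "quad n K G' = quad n K G"
  proof -
    have "(\<Sum>j\<in>{1..Suc K}. \<Sum>l<j. (G' j l)\<^sup>2) = (\<Sum>j\<in>{1..Suc K}. \<Sum>l<j. (G j l)\<^sup>2)"
      by (intro sum.cong refl) (use low in auto)
    moreover have "(\<Sum>j\<in>{1..K}. (vnorm {j..<n} (G' j) - sqrt (real n))\<^sup>2) = (\<Sum>j\<in>{1..K}. (vnorm {j..<n} (G j) - sqrt (real n))\<^sup>2)"
      by (intro sum.cong refl) (auto simp: G'_def)
    ultimately show ?thesis unfolding quad_def by simp
  qed
  have lin: "lin_form K P S G' = lin_form K P S G" if S: "S \<in> PK K" for S
  proof -
    have SK: "S \<subseteq> {1..K}" using S by (auto simp: PK_def)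
    have "(\<Sum>j\<in>S. \<Sum>l\<in>{l\<in>S. l < j}. sqrt (P j) * sqrt (P l) * G' j l) = (\<Sum>j\<in>S. \<Sum>l\<in>{l\<in>S. l < j}. sqrt (P j) * sqrt (P l) * G j l)"
      by (intro sum.cong refl) (use low SK in auto)
    moreover have "(\<Sum>l\<in>S. sqrt (P l) * G' (Suc K) l) = (\<Sum>l\<in>S. sqrt (P l) * G (Suc K) l)"
      by (intro sum.cong refl) (use low SK in auto)
    ultimately show ?thesis unfolding lin_form_def by simp
  qed
  have cd: "w = chi_dev ?J (G' (Suc K))"
    unfolding w_def chi_dev_def vnorm_def dotp_def by (simp add: G'_def merge_def)
  define N where "N = real (card (PK K))"
  have N: "N > 0" unfolding N_def using finite_PK PK_nonempty[OF K] by (simp add: card_gt_0_iff)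
  define m where "m = (\<lambda>S. \<Prod>s\<in>S. real (M s))"
  define ce where "ce = (\<lambda>S. cap_error n K (\<lambda>i. sqrt (real n * P i)) S (\<lambda>j\<in>{1..Suc K}. triang n j (G' j)))"
  have mpos: "m S > 0" if "S \<in> PK K" for S
    unfolding m_def using that M by (intro prod_pos) (force simp: PK_def)
  have "(1/2) ^ k \<le> (\<Sum>S\<in>PK K. m S * ce S)"
    using lev unfolding rcu_level_def rcu_sum_def G'_def[symmetric] m_def ce_def by simp
  \<comment> \<open>Some \<open>S\<close> carries at least the average share of the sum. The factor
    \<open>N\<close> is compensated by the logarithm of the number of subsets in
    \<open>rate\<close>.\<close>
  then have "\<exists>S\<in>PK K. (1/2) ^ k \<le> N * m S * ce S"
  proof (rule contrapos_pp)
    assume "\<not> (\<exists>S\<in>PK K. (1/2) ^ k \<le> N * m S * ce S)"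
    then have "m S * ce S < (1/2) ^ k / N" if "S \<in> PK K" for S
      using that N by (auto simp: pos_less_divide_eq not_le mult_ac)
    then have "(\<Sum>S\<in>PK K. m S * ce S) < (\<Sum>S\<in>PK K. (1/2) ^ k / N)"
      using finite_PK PK_nonempty[OF K] by (intro sum_strict_mono) auto
    also have "\<dots> = (1/2) ^ k" using N by (simp add: N_def)
    finally show "\<not> (1/2) ^ k \<le> (\<Sum>S\<in>PK K. m S * ce S)" by simp
  qed
  then obtain S where S: "S \<in> PK K" and ge: "(1/2) ^ k \<le> N * m S * ce S" by blast
  have Sfin: "finite S" using S finite_subset by (auto simp: PK_def)
  have qw: "D * (quad n K G + w\<^sup>2) \<le> D * (q + w\<^sup>2)" using D0 by (intro mult_left_mono) (auto simp: q_def)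
  show ?thesis
  proof (cases "D * (quad n K G' + w\<^sup>2) \<le> real n")
    case False
    then show ?thesis using qw unfolding quad w_def[symmetric] q_def[symmetric] by linarith
  next
    case True
    define s where "s = slope P S"
    have s: "0 < s" "s \<le> 1" unfolding s_def using slope_bounds[OF S P] by auto
    define d where "d = lin_form K P S G + s * w - z S"
    have "real n * Cap (Psum P S) - r * (lin_form K P S G' + s * w) - D * (quad n K G' + w\<^sup>2 + real k)
         \<le> ln (N * m S) - ln (real n) / 2"
      unfolding r_def s_def using D[OF S cd True _ ge[unfolded ce_def]] N mpos[OF S] by simp
    moreover have "ln (N * m S) = ln N + (\<Sum>s\<in>S. ln (real (M s)))"
    proof -
      have "ln (m S) = (\<Sum>s\<in>S. ln (real (M s)))"
        unfolding m_def using Sfin S M by (intro ln_prod) (force simp: PK_def)+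
      then show ?thesis using N mpos[OF S] by (simp add: ln_mult_pos)
    qed
    moreover have "D * (quad n K G' + w\<^sup>2 + real k) = D * (q + w\<^sup>2)" by (simp add: quad q_def algebra_simps)
    moreover have "r * d = r * (lin_form K P S G' + s * w) - r * z S"
      by (simp add: d_def lin[OF S] algebra_simps)
    ultimately have rd: "B - D * (q + w\<^sup>2) \<le> r * d"
      using rate[OF S] unfolding r_def[symmetric] N_def[symmetric] by linarith
    have q1: "q \<ge> 1" using quad_ge[of n K G] by (simp add: q_def)
    have "0 < q + w\<^sup>2" using q1 zero_le_power2[of w] by linarith
    \<comment> \<open>The step from \<open>D\<close> to \<open>D + 1\<close> makes the inequality
      strict, as the tail events are open half-lines.\<close>
    then have "B - (D + 1) * (q + w\<^sup>2) < r * d" using rd by (simp add: distrib_right)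
    then have "(B - (D + 1) * (q + w\<^sup>2)) / s < r * d / s" using s by (intro divide_strict_right_mono) auto
    \<comment> \<open>Division by the slope amplifies the error terms, hence the definition of
      \<open>c\<close>, but it does not diminish \<open>B\<close>, because the slope is at most
      1.\<close>
    moreover have "B - c * (q + w\<^sup>2) \<le> (B - (D + 1) * (q + w\<^sup>2)) / s"
    proof -
      have "B * s \<le> B * 1" using s B by (intro mult_left_mono) auto
      then have "B \<le> B / s" using s by (simp add: pos_le_divide_eq)
      moreover have "(D + 1) / s * (q + w\<^sup>2) \<le> c * (q + w\<^sup>2)"
        using c[OF S] \<open>0 < q + w\<^sup>2\<close> unfolding s_def by (intro mult_right_mono) auto
      ultimately show ?thesis by (simp add: diff_divide_distrib)
    qed
    moreover have "d / s \<le> w - threshold K P z G"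
      using threshold_le[OF S, of P z G] s unfolding d_def s_def[symmetric]
      by (simp add: add_divide_distrib diff_divide_distrib)
    then have "r * d / s \<le> r * (w - threshold K P z G)"
      using r mult_left_mono[of "d / s" "w - threshold K P z G" r] by simp
    ultimately have "B - c * (q + w\<^sup>2) < r * (w - threshold K P z G)" by linarith
    then have "(B - c * (q + w\<^sup>2)) / r < w - threshold K P z G" using r by (simp add: pos_divide_less_eq mult.commute)
    moreover have "(B - c * (q + w\<^sup>2)) / r = (B - c * q) / r - c * w\<^sup>2 / r"
      by (simp add: diff_divide_distrib add_divide_distrib distrib_left)
    ultimately have "threshold K P z G + (B - c * q) / r < w + c * w\<^sup>2 / r" by linarith
    then show ?thesis unfolding w_def q_def r_def by blast
  qed
qed

text \<open>The conditional bounds are integrated over the other coordinates. The parameter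
  \<open>h\<close> is a gain granted only where \<open>quad\<close> is at most \<open>q0\<close>,
  since only there is the threshold under control; \<open>h = 0\<close> gives the plain estimate,
  and a positive \<open>h\<close> serves the first level.\<close>

lemma rcu_level_measure:
  fixes P :: "nat \<Rightarrow> real" and D c B C h q0 :: real
  assumes K: "K \<ge> 1" and P: "\<forall>i\<in>{1..K}. P i > 0" and M: "\<forall>i\<in>{1..K}. M i \<ge> 1" and n: "Suc K < n" "real n \<ge> D"
    and D: "\<And>S k G M w. S \<in> PK K \<Longrightarrow> w = chi_dev {Suc K..<n} (G (Suc K)) \<Longrightarrow> D * (quad n K G + w\<^sup>2) \<le> real n \<Longrightarrow> M > 0 \<Longrightarrow>
       (1/2) ^ k \<le> M * cap_error n K (\<lambda>i. sqrt (real n * P i)) S (\<lambda>j\<in>{1..Suc K}. triang n j (G j)) \<Longrightarrow>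
       real n * Cap (Psum P S) - sqrt (real n) * (lin_form K P S G + slope P S * w) - D * (quad n K G + w\<^sup>2 + real k)
         \<le> ln M - ln (real n) / 2"
    and D0: "D > 0" and c: "\<And>S. S \<in> PK K \<Longrightarrow> (D + 1) / slope P S \<le> c" and B: "0 \<le> B"
    and rate: "\<And>S. S \<in> PK K \<Longrightarrow> (\<Sum>s\<in>S. ln (real (M s)))
       \<le> real n * Cap (Psum P S) - sqrt (real n) * z S + ln (real n) / 2 - (B + ln (real (card (PK K))))"
    and tail1: "\<And>G. measure (gauss {Suc K..<n}) {y \<in> space (gauss {Suc K..<n}).
          threshold K P z G + (B - c * (quad n K G + real k)) / sqrt (real n)
            < chi_dev {Suc K..<n} y + c * (chi_dev {Suc K..<n} y)\<^sup>2 / sqrt (real n)}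
        + (if quad n K G \<le> q0 then h else 0)
        \<le> measure std_gauss {threshold K P z G<..} + C * (quad n K G + real k) / sqrt (real n)"
    and tail2: "\<And>q. q \<ge> 1 \<Longrightarrow> measure (gauss {Suc K..<n}) {y \<in> space (gauss {Suc K..<n}). real n < D * (q + (chi_dev {Suc K..<n} y)\<^sup>2)}
        \<le> D * C * q / sqrt (real n)"
    and h: "h \<ge> 0" and C: "C > 0" and Cq: "Cq \<ge> 0"
    and mean: "(\<integral>\<^sup>+G. ennreal (quad n K G) \<partial>PiM {1..Suc K} (\<lambda>_. gauss {..<n})) \<le> ennreal Cq"
  shows "ennreal (measure (PiM {1..Suc K} (\<lambda>_. gauss {..<n})) (rcu_level n K (\<lambda>i. sqrt (real n * P i)) M k))
      + ennreal (h * measure (PiM {1..Suc K} (\<lambda>_. gauss {..<n})) {G \<in> space (PiM {1..Suc K} (\<lambda>_. gauss {..<n})). quad n K G \<le> q0})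
    \<le> (\<integral>\<^sup>+G. ennreal (measure std_gauss {threshold K P z G<..}) \<partial>PiM {1..Suc K} (\<lambda>_. gauss {..<n}))
      + ennreal ((1 + D) * C * (Cq + real k) / sqrt (real n))"
proof -
  let ?M = "PiM {1..Suc K} (\<lambda>_. gauss {..<n})"
  let ?I = "{..<Suc K}" and ?J = "{Suc K..<n}"
  let ?U = "rcu_level n K (\<lambda>i. sqrt (real n * P i)) M k"
  let ?r = "sqrt (real n)"
  interpret M: prob_space ?M by (rule prob_space_nested)
  interpret J: prob_space "gauss ?J" by (rule prob_space_gauss)
  have Kn: "K < n" using n by simp
  have IJ: "{..<n} = ?I \<union> ?J" "?I \<inter> ?J = {}" using n by auto
  have R: "{1..Suc K} = insert (Suc K) {1..K}" by auto
  have U: "?U \<in> sets ?M" by (rule rcu_level_sets)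
  have Q: "{G \<in> space ?M. quad n K G \<le> q0} \<in> sets ?M"
    by (intro borel_measurable_le borel_measurable_quad[OF Kn] borel_measurable_const)
  define L where "L = (\<lambda>G. \<integral>\<^sup>+y. indicator ?U (G(Suc K := merge ?I ?J (G (Suc K), y))) \<partial>gauss ?J :: ennreal)"
  have iU: "indicator ?U \<in> borel_measurable (PiM (insert (Suc K) {1..K}) (\<lambda>_. gauss (?I \<union> ?J)))"
    using U unfolding R[symmetric] IJ(1)[symmetric] by simp
  have Lm: "L \<in> borel_measurable ?M"
    unfolding L_def using measurable_nn_integral_resample_row[OF IJ(2) iU] unfolding R IJ(1) .
  have LU: "(\<integral>\<^sup>+G. L G \<partial>?M) = ennreal (measure ?M ?U)"
  proof -
    have "(\<integral>\<^sup>+G. indicator ?U G \<partial>PiM (insert (Suc K) {1..K}) (\<lambda>_. gauss (?I \<union> ?J)))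
       = (\<integral>\<^sup>+G. (\<integral>\<^sup>+y. indicator ?U (G(Suc K := merge ?I ?J (G (Suc K), y))) \<partial>gauss ?J) \<partial>PiM (insert (Suc K) {1..K}) (\<lambda>_. gauss (?I \<union> ?J)))"
      by (rule nn_integral_resample_row[OF _ _ IJ(2) _ _ iU]) auto
    then have "(\<integral>\<^sup>+G. indicator ?U G \<partial>?M) = (\<integral>\<^sup>+G. L G \<partial>?M)"
      unfolding L_def R[symmetric] IJ(1)[symmetric] .
    then show ?thesis unfolding nn_integral_indicator[OF U] M.emeasure_eq_measure by (rule sym)
  qed
  have "L G + ennreal h * indicator {G \<in> space ?M. quad n K G \<le> q0} G
     \<le> ennreal (measure std_gauss {threshold K P z G<..}) + ennreal ((1 + D) * C / ?r) * (ennreal (quad n K G) + ennreal (real k))"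
    if G: "G \<in> space ?M" for G
  proof -
    define q where "q = quad n K G + real k"
    have q: "q \<ge> 1" using quad_ge[of n K G] by (simp add: q_def)
    define F1 where "F1 = {y \<in> space (gauss ?J). threshold K P z G + (B - c * q) / ?r
            < chi_dev ?J y + c * (chi_dev ?J y)\<^sup>2 / ?r}"
    define F2 where "F2 = {y \<in> space (gauss ?J). real n < D * (q + (chi_dev ?J y)\<^sup>2)}"
    have F: "F1 \<in> sets (gauss ?J)" "F2 \<in> sets (gauss ?J)"
      unfolding F1_def F2_def
      by (intro borel_measurable_less borel_measurable_const borel_measurable_add borel_measurable_times
          borel_measurable_divide borel_measurable_power borel_measurable_chi_dev)+
    have "L G \<le> (\<integral>\<^sup>+y. indicator F1 y + indicator F2 y \<partial>gauss ?J)"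
      unfolding L_def
    proof (rule nn_integral_mono)
      fix y assume y: "y \<in> space (gauss ?J)"
      show "indicator ?U (G(Suc K := merge ?I ?J (G (Suc K), y))) \<le> (indicator F1 y + indicator F2 y :: ennreal)"
      proof (cases "G(Suc K := merge ?I ?J (G (Suc K), y)) \<in> ?U")
        case True
        from rcu_level_section[OF K P M n D D0 c B rate True] have "y \<in> F1 \<or> y \<in> F2"
          using y by (simp add: F1_def F2_def q_def)
        then show ?thesis by (auto simp: indicator_def)
      qed simp
    qed
    also have "\<dots> = emeasure (gauss ?J) F1 + emeasure (gauss ?J) F2"
      using F by (subst nn_integral_add) auto
    also have "\<dots> = ennreal (measure (gauss ?J) F1 + measure (gauss ?J) F2)"
      by (simp add: J.emeasure_eq_measure)
    finally have 1: "L G \<le> ennreal (measure (gauss ?J) F1 + measure (gauss ?J) F2)" .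
    have "measure (gauss ?J) F1 + (if quad n K G \<le> q0 then h else 0) \<le> measure std_gauss {threshold K P z G<..} + C * q / ?r"
      using tail1[of G] by (simp add: F1_def q_def)
    moreover have "measure (gauss ?J) F2 \<le> D * C * q / ?r" unfolding F2_def by (rule tail2[OF q])
    moreover have "(1 + D) * C * q / ?r = C * q / ?r + D * C * q / ?r" by (simp add: algebra_simps add_divide_distrib)
    ultimately have 2: "measure (gauss ?J) F1 + measure (gauss ?J) F2 + (if quad n K G \<le> q0 then h else 0)
        \<le> measure std_gauss {threshold K P z G<..} + (1 + D) * C * q / ?r" by linarith
    have "L G + ennreal h * indicator {G \<in> space ?M. quad n K G \<le> q0} G
        = L G + ennreal (if quad n K G \<le> q0 then h else 0)"
      using G by (simp add: indicator_def)
    also have "\<dots> \<le> ennreal (measure (gauss ?J) F1 + measure (gauss ?J) F2) + ennreal (if quad n K G \<le> q0 then h else 0)"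
      using 1 by (rule add_right_mono)
    also have "\<dots> = ennreal (measure (gauss ?J) F1 + measure (gauss ?J) F2 + (if quad n K G \<le> q0 then h else 0))"
      using h by (subst ennreal_plus[symmetric]) auto
    also have "\<dots> \<le> ennreal (measure std_gauss {threshold K P z G<..} + (1 + D) * C * q / ?r)"
      using 2 by (rule ennreal_leI)
    also have "\<dots> = ennreal (measure std_gauss {threshold K P z G<..}) + ennreal ((1 + D) * C / ?r * q)"
      using q D0 C by (subst ennreal_plus) auto
    also have "ennreal ((1 + D) * C / ?r * q) = ennreal ((1 + D) * C / ?r) * (ennreal (quad n K G) + ennreal (real k))"
      unfolding q_def using quad_ge[of n K G] D0 C by (subst ennreal_mult) (auto simp: ennreal_plus)
    finally show ?thesis .
  qed
  then have "(\<integral>\<^sup>+G. L G + ennreal h * indicator {G \<in> space ?M. quad n K G \<le> q0} G \<partial>?M)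
     \<le> (\<integral>\<^sup>+G. ennreal (measure std_gauss {threshold K P z G<..}) + ennreal ((1 + D) * C / ?r) * (ennreal (quad n K G) + ennreal (real k)) \<partial>?M)"
    by (rule nn_integral_mono)
  also have "\<dots> = (\<integral>\<^sup>+G. ennreal (measure std_gauss {threshold K P z G<..}) \<partial>?M)
      + (\<integral>\<^sup>+G. ennreal ((1 + D) * C / ?r) * (ennreal (quad n K G) + ennreal (real k)) \<partial>?M)"
    by (intro nn_integral_add borel_measurable_times_ennreal borel_measurable_const borel_measurable_add
        measurable_compose[OF borel_measurable_quad[OF Kn] measurable_ennreal]
        measurable_compose[OF measurable_compose[OF borel_measurable_threshold[OF K Kn P] measurable_tail] measurable_ennreal])
  also have "(\<integral>\<^sup>+G. ennreal ((1 + D) * C / ?r) * (ennreal (quad n K G) + ennreal (real k)) \<partial>?M)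
      = ennreal ((1 + D) * C / ?r) * (\<integral>\<^sup>+G. ennreal (quad n K G) + ennreal (real k) \<partial>?M)"
    by (intro nn_integral_cmult borel_measurable_const borel_measurable_add
        measurable_compose[OF borel_measurable_quad[OF Kn] measurable_ennreal])
  also have "(\<integral>\<^sup>+G. ennreal (quad n K G) + ennreal (real k) \<partial>?M) = (\<integral>\<^sup>+G. ennreal (quad n K G) \<partial>?M) + (\<integral>\<^sup>+G. ennreal (real k) \<partial>?M)"
    by (intro nn_integral_add borel_measurable_const measurable_compose[OF borel_measurable_quad[OF Kn] measurable_ennreal])
  also have "(\<integral>\<^sup>+G. ennreal (real k) \<partial>?M) = ennreal (real k)" using M.emeasure_space_1 by simp
  also have "ennreal ((1 + D) * C / ?r) * ((\<integral>\<^sup>+G. ennreal (quad n K G) \<partial>?M) + ennreal (real k))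
     \<le> ennreal ((1 + D) * C / ?r) * (ennreal Cq + ennreal (real k))"
    using mean by (intro mult_left_mono add_right_mono) auto
  also have "ennreal ((1 + D) * C / ?r) * (ennreal Cq + ennreal (real k)) = ennreal ((1 + D) * C / ?r * (Cq + real k))"
    using Cq D0 C by (subst ennreal_mult) (auto simp: ennreal_plus)
  finally have "(\<integral>\<^sup>+G. L G + ennreal h * indicator {G \<in> space ?M. quad n K G \<le> q0} G \<partial>?M)
     \<le> (\<integral>\<^sup>+G. ennreal (measure std_gauss {threshold K P z G<..}) \<partial>?M) + ennreal ((1 + D) * C / ?r * (Cq + real k))"
    by (simp add: add_left_mono)
  moreover have "(\<integral>\<^sup>+G. L G + ennreal h * indicator {G \<in> space ?M. quad n K G \<le> q0} G \<partial>?M)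
     = (\<integral>\<^sup>+G. L G \<partial>?M) + (\<integral>\<^sup>+G. ennreal h * indicator {G \<in> space ?M. quad n K G \<le> q0} G \<partial>?M)"
    by (intro nn_integral_add Lm borel_measurable_times_ennreal borel_measurable_const borel_measurable_indicator Q)
  moreover have "(\<integral>\<^sup>+G. ennreal h * indicator {G \<in> space ?M. quad n K G \<le> q0} G \<partial>?M)
     = ennreal (h * measure ?M {G \<in> space ?M. quad n K G \<le> q0})"
    unfolding nn_integral_cmult_indicator[OF Q] M.emeasure_eq_measure using h by (intro ennreal_mult[symmetric]) auto
  ultimately show ?thesis unfolding LU by simp
qed

text \<open>Outside an event of probability \<open>Cq / r\<close> the threshold is within
  \<open>L * r\<close> of its value at zero. If that value were beyond \<open>(1 + L) * r\<close> on
  either side, the threshold itself would be beyond \<open>r\<close>, and the error probability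
  \<open>p\<close> would lie within \<open>(Cq + 1) / r\<close> of 1 or of 0. Neither is compatible
  with the assumptions on \<open>p\<close>.\<close>

lemma threshold_bounds:
  fixes P :: "nat \<Rightarrow> real"
  assumes K: "K \<ge> 1" and P: "\<forall>i\<in>{1..K}. P i > 0" and Kn: "K < n" and eps: "0 < eps" "eps < 1"
    and L: "L > 0" "\<And>G. \<bar>threshold K P z G - threshold K P z (\<lambda>_ _. 0)\<bar> \<le> L * quad n K G"
    and Cq: "Cq \<ge> 1" and mean: "(\<integral>\<^sup>+G. ennreal (quad n K G) \<partial>PiM {1..Suc K} (\<lambda>_. gauss {..<n})) \<le> ennreal Cq"
    and r: "r = 4 * (Cq + 1) / min eps (1 - eps)"
    and p: "0 \<le> p" "(\<integral>\<^sup>+G. ennreal (measure std_gauss {threshold K P z G<..}) \<partial>PiM {1..Suc K} (\<lambda>_. gauss {..<n})) = ennreal p" "p \<le> eps"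
  shows "- ((1 + L) * r) \<le> threshold K P z (\<lambda>_ _. 0)"
    and "eps / 2 < p \<Longrightarrow> threshold K P z (\<lambda>_ _. 0) \<le> (1 + L) * r"
proof -
  let ?M = "PiM {1..Suc K} (\<lambda>_. gauss {..<n})"
  interpret M: prob_space ?M by (rule prob_space_nested)
  interpret S: prob_space std_gauss by (rule prob_space_std_gauss)
  define \<delta> where "\<delta> = min eps (1 - eps)"
  have d: "0 < \<delta>" "\<delta> \<le> eps" "\<delta> \<le> 1 - eps" "\<delta> \<le> 1" using eps by (auto simp: \<delta>_def)
  \<comment> \<open>The choice of \<open>r\<close> makes the total exceptional probability a quarter
    of the smaller of \<open>eps\<close> and \<open>1 - eps\<close>.\<close>
  have r8: "r \<ge> 1" and rd: "(Cq + 1) / r = \<delta> / 4"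
  proof -
    have "\<delta> \<le> 4 * (Cq + 1)" using d Cq by (simp add: algebra_simps)
    then show "r \<ge> 1" unfolding r \<delta>_def[symmetric] using d by (simp add: pos_le_divide_eq)
    have "x / (4 * x / \<delta>) = \<delta> / 4" if "x > 0" for x using that d by (simp add: field_simps)
    from this[of "Cq + 1"] show "(Cq + 1) / r = \<delta> / 4" unfolding r \<delta>_def[symmetric] using Cq by simp
  qed
  have r0: "r > 0" using r8 by linarith
  let ?Q = "{G \<in> space ?M. r < quad n K G}"
  have Q: "?Q \<in> sets ?M" by (intro borel_measurable_less borel_measurable_const borel_measurable_quad[OF Kn])
  have mQ: "measure ?M ?Q \<le> Cq / r"
    by (rule markov_nonneg[OF prob_space_nested borel_measurable_quad[OF Kn] r0 mean]) (use Cq in simp)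
  have tail: "measure std_gauss {w. r < \<bar>w\<bar>} \<le> 1 / r"
  proof -
    have "measure std_gauss {w \<in> space std_gauss. r < \<bar>w\<bar>} \<le> 1 / r\<^sup>2"
      by (rule markov_square[OF prob_space_std_gauss _ r0]) (use nn_integral_std_gauss_square in auto)
    also have "\<dots> \<le> 1 / r" using r8 by (intro divide_left_mono) (auto simp: power2_eq_square)
    finally show ?thesis by simp
  qed
  define th0 where "th0 = threshold K P z (\<lambda>_ _. 0)"
  have near: "\<bar>threshold K P z G - th0\<bar> \<le> L * r" if "quad n K G \<le> r" for G
  proof -
    have "L * quad n K G \<le> L * r" using that L by (intro mult_left_mono) auto
    then show ?thesis using L(2)[of G] by (simp add: th0_def)
  qed
  show "- ((1 + L) * r) \<le> threshold K P z (\<lambda>_ _. 0)"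
  proof (rule ccontr)
    assume "\<not> - ((1 + L) * r) \<le> threshold K P z (\<lambda>_ _. 0)"
    then have lt: "th0 < - r - L * r" by (simp add: th0_def algebra_simps)
    have "ennreal 1 = (\<integral>\<^sup>+G. 1 \<partial>?M)" using M.emeasure_space_1 by simp
    also have "\<dots> \<le> (\<integral>\<^sup>+G. (ennreal (measure std_gauss {threshold K P z G<..}) + ennreal (1 / r)) + indicator ?Q G \<partial>?M)"
    proof (rule nn_integral_mono)
      fix G assume G: "G \<in> space ?M"
      show "1 \<le> (ennreal (measure std_gauss {threshold K P z G<..}) + ennreal (1 / r)) + indicator ?Q G"
      proof (cases "r < quad n K G")
        case True then show ?thesis using G by simp
      next
        case False
        then have "threshold K P z G < - r" using near[of G] lt by linarith
        then have "- {threshold K P z G<..} \<subseteq> {w. r < \<bar>w\<bar>}" using r0 by auto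
        then have "measure std_gauss (- {threshold K P z G<..}) \<le> 1 / r"
          using tail by (intro order_trans[OF S.finite_measure_mono tail]) auto
        moreover have "measure std_gauss (- {threshold K P z G<..}) = 1 - measure std_gauss {threshold K P z G<..}"
          using S.prob_compl[of "{threshold K P z G<..}"] by (simp add: Compl_eq_Diff_UNIV)
        ultimately have "1 \<le> measure std_gauss {threshold K P z G<..} + 1 / r" by linarith
        then have "ennreal 1 \<le> ennreal (measure std_gauss {threshold K P z G<..} + 1 / r)" by (rule ennreal_leI)
        also have "\<dots> = ennreal (measure std_gauss {threshold K P z G<..}) + ennreal (1 / r)"
          using r0 by (intro ennreal_plus) auto
        finally show ?thesis using False by (simp add: indicator_def)
      qed
    qed
    also have "\<dots> = (\<integral>\<^sup>+G. ennreal (measure std_gauss {threshold K P z G<..}) + ennreal (1 / r) \<partial>?M) + (\<integral>\<^sup>+G. indicator ?Q G \<partial>?M)"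
      by (intro nn_integral_add borel_measurable_add borel_measurable_const borel_measurable_indicator Q
        measurable_compose[OF measurable_compose[OF borel_measurable_threshold[OF K Kn P] measurable_tail] measurable_ennreal])
    also have "(\<integral>\<^sup>+G. ennreal (measure std_gauss {threshold K P z G<..}) + ennreal (1 / r) \<partial>?M)
        = (\<integral>\<^sup>+G. ennreal (measure std_gauss {threshold K P z G<..}) \<partial>?M) + (\<integral>\<^sup>+G. ennreal (1 / r) \<partial>?M)"
      by (intro nn_integral_add borel_measurable_const
        measurable_compose[OF measurable_compose[OF borel_measurable_threshold[OF K Kn P] measurable_tail] measurable_ennreal])
    also have "(\<integral>\<^sup>+G. ennreal (1 / r) \<partial>?M) = ennreal (1 / r)" using M.emeasure_space_1 by simp
    also have "(\<integral>\<^sup>+G. indicator ?Q G \<partial>?M) = ennreal (measure ?M ?Q)"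
      unfolding nn_integral_indicator[OF Q] M.emeasure_eq_measure ..
    finally have "ennreal 1 \<le> ennreal (p + 1 / r + measure ?M ?Q)" unfolding p(2) using p(1) r0 by simp
    then have "1 \<le> p + 1 / r + measure ?M ?Q" using p(1) r0 by (subst (asm) ennreal_le_iff) (auto intro!: add_nonneg_nonneg)
    then have "1 \<le> p + (Cq + 1) / r" using mQ by (simp add: add_divide_distrib)
    then show False using p(3) d eps unfolding rd by linarith
  qed
  show "threshold K P z (\<lambda>_ _. 0) \<le> (1 + L) * r" if "eps / 2 < p"
  proof (rule ccontr)
    assume "\<not> threshold K P z (\<lambda>_ _. 0) \<le> (1 + L) * r"
    then have gt: "r + L * r < th0" by (simp add: th0_def algebra_simps)
    have "ennreal p \<le> (\<integral>\<^sup>+G. ennreal (1 / r) + indicator ?Q G \<partial>?M)"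
      unfolding p(2)[symmetric]
    proof (rule nn_integral_mono)
      fix G assume G: "G \<in> space ?M"
      show "ennreal (measure std_gauss {threshold K P z G<..}) \<le> ennreal (1 / r) + indicator ?Q G"
      proof (cases "r < quad n K G")
        case True
        have "ennreal (measure std_gauss {threshold K P z G<..}) \<le> 1" by simp
        also have "\<dots> \<le> ennreal (1 / r) + indicator ?Q G" using True G by simp
        finally show ?thesis .
      next
        case False
        then have "r < threshold K P z G" using near[of G] gt by linarith
        then have "{threshold K P z G<..} \<subseteq> {w. r < \<bar>w\<bar>}" using r0 by auto
        then have "measure std_gauss {threshold K P z G<..} \<le> 1 / r"
          by (intro order_trans[OF S.finite_measure_mono tail]) auto
        then show ?thesis using False by (simp add: indicator_def ennreal_leI)
      qed
    qed
    also have "\<dots> = (\<integral>\<^sup>+G. ennreal (1 / r) \<partial>?M) + (\<integral>\<^sup>+G. indicator ?Q G \<partial>?M)"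
      by (intro nn_integral_add borel_measurable_const borel_measurable_indicator Q)
    also have "(\<integral>\<^sup>+G. ennreal (1 / r) \<partial>?M) = ennreal (1 / r)" using M.emeasure_space_1 by simp
    also have "(\<integral>\<^sup>+G. indicator ?Q G \<partial>?M) = ennreal (measure ?M ?Q)"
      unfolding nn_integral_indicator[OF Q] M.emeasure_eq_measure ..
    finally have "ennreal p \<le> ennreal (1 / r + measure ?M ?Q)" using r0 by simp
    then have "p \<le> 1 / r + measure ?M ?Q" using r0 by (subst (asm) ennreal_le_iff) (auto intro!: add_nonneg_nonneg)
    then have "p \<le> (Cq + 1) / r" using mQ by (simp add: add_divide_distrib)
    then show False using that d unfolding rd by linarith
  qed
qed

text \<open>The weights 2^-k sum to at most 1 and, multiplied by \<open>k\<close>, to at most 2. A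
  gain at the first level alone enters with weight one half.\<close>

lemma dyadic_average:
  fixes u :: "nat \<Rightarrow> real"
  assumes u: "\<And>k. k \<in> {1..n} \<Longrightarrow> u k + (if k = 1 then g else 0) \<le> p + a * (b + real k)"
    and nonneg: "p \<ge> 0" "a \<ge> 0" "b \<ge> 0" and n: "n \<ge> 1"
  shows "(\<Sum>k\<in>{1..n}. (1/2) ^ k * u k) + (1/2) ^ n \<le> p + a * (b + 2) + 1 / sqrt (real n) - g / 2"
proof -
  have g: "(\<Sum>k\<in>{1..n}. (1/2) ^ k * (if k = 1 then g else 0)) = g / 2"
  proof -
    have "(\<Sum>k\<in>{1..n}. (1/2) ^ k * (if k = 1 then g else 0)) = (\<Sum>k\<in>{1..n}. if k = 1 then g / 2 else 0)"
      by (rule sum.cong) auto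
    also have "\<dots> = g / 2" using n by (subst sum.delta) auto
    finally show ?thesis .
  qed
  have "(\<Sum>k\<in>{1..n}. (1/2) ^ k * u k) + g / 2 = (\<Sum>k\<in>{1..n}. (1/2) ^ k * (u k + (if k = 1 then g else 0)))"
    unfolding g[symmetric] distrib_left sum.distrib ..
  also have "\<dots> \<le> (\<Sum>k\<in>{1..n}. (1/2) ^ k * (p + a * (b + real k)))"
    using u by (intro sum_mono mult_left_mono) auto
  also have "\<dots> = (\<Sum>k\<in>{1..n}. (1/2) ^ k * (p + a * b) + a * ((1/2) ^ k * real k))"
    by (intro sum.cong) (auto simp: algebra_simps)
  also have "\<dots> = (p + a * b) * (1 - (1/2) ^ n) + a * (2 - (real n + 2) * (1/2) ^ n)"
    unfolding sum.distrib sum_distrib_left[symmetric] sum_distrib_right[symmetric] sum_dyadic by (simp add: mult.commute)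
  also have "\<dots> \<le> (p + a * b) * 1 + a * 2"
    using nonneg by (intro add_mono mult_left_mono) auto
  finally have 1: "(\<Sum>k\<in>{1..n}. (1/2) ^ k * u k) + g / 2 \<le> p + a * (b + 2)" by (simp add: algebra_simps)
  have "sqrt (real n) \<le> real n" using n by (intro real_le_lsqrt) (auto simp: power2_eq_square)
  also have "real n \<le> real (2 ^ n)" unfolding of_nat_le_iff using less_exp[of n] by simp
  finally have "1 / 2 ^ n \<le> 1 / sqrt (real n)" using n by (intro divide_left_mono) auto
  then show ?thesis using 1 by (simp add: power_one_over)
qed

lemma Qinv_probability:
  assumes K: "K \<ge> 1" and P: "\<forall>i\<in>{1..K}. P i > 0" and n: "K < n" and z: "z \<in> Qinv (PK K) (dispV P) eps"
    and eps: "0 < eps"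
  obtains p where "0 \<le> p" "p \<le> eps"
    "(\<integral>\<^sup>+G. ennreal (measure std_gauss {threshold K P z G<..}) \<partial>PiM {1..Suc K} (\<lambda>_. gauss {..<n})) = ennreal p"
proof -
  let ?I = "\<integral>\<^sup>+G. ennreal (measure std_gauss {threshold K P z G<..}) \<partial>PiM {1..Suc K} (\<lambda>_. gauss {..<n})"
  have le: "?I \<le> ennreal eps" by (rule Qinv_threshold[OF K P n z])
  then obtain p where p: "0 \<le> p" "?I = ennreal p"
    by (cases ?I) (auto simp: top_unique)
  have "p \<le> eps" using le p(1) eps unfolding p(2) by (simp add: ennreal_le_iff)
  then show ?thesis using that p by blast
qed

text \<open>Serves the short blocks, where the assumption on the rates has to fail for every
  \<open>z\<close> at once.\<close>

lemma Qinv_lower_bound: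
  assumes K: "K \<ge> 1" and P: "\<forall>i\<in>{1..K}. P i > 0" and eps: "0 < eps" "eps < 1"
  obtains r :: real where "r \<ge> 0" "\<And>z S. z \<in> Qinv (PK K) (dispV P) eps \<Longrightarrow> S \<in> PK K \<Longrightarrow> - r \<le> z S"
proof -
  obtain L where L: "L > 0" "\<And>n z G. \<bar>threshold K P z G - threshold K P z (\<lambda>_ _. 0)\<bar> \<le> L * quad n K G"
    using threshold_lipschitz[OF K P] by blast
  obtain Cq where Cq: "Cq \<ge> 1"
    "\<And>n. real n \<ge> Cq \<Longrightarrow> (\<integral>\<^sup>+G. ennreal (quad n K G) \<partial>PiM {1..Suc K} (\<lambda>_. gauss {..<n})) \<le> ennreal Cq"
    using quad_mean[of K] by blast
  \<comment> \<open>An auxiliary dimension: \<open>Qinv\<close> does not depend on the blocklength,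
    so any sufficiently large \<open>n\<close> may be used to locate the threshold.\<close>
  define n where "n = nat \<lceil>Cq\<rceil> + K + 1"
  have n: "K < n" "real n \<ge> Cq" unfolding n_def by (simp, linarith)
  define r where "r = 4 * (Cq + 1) / min eps (1 - eps)"
  have r: "r \<ge> 0" using Cq eps by (simp add: r_def)
  have pos: "0 \<le> (1 + L) * r" using r L by simp
  show ?thesis
  proof (rule that[OF pos])
    fix z S assume z: "z \<in> Qinv (PK K) (dispV P) eps" and S: "S \<in> PK K"
    obtain p where p: "0 \<le> p" "p \<le> eps"
      "(\<integral>\<^sup>+G. ennreal (measure std_gauss {threshold K P z G<..}) \<partial>PiM {1..Suc K} (\<lambda>_. gauss {..<n})) = ennreal p"
      using Qinv_probability[OF K P n(1) z eps(1)] by blast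
    have t: "- ((1 + L) * r) \<le> threshold K P z (\<lambda>_ _. 0)"
      by (rule threshold_bounds(1)[OF K P n(1) eps L(1) L(2)[of _ _ n] Cq(1) Cq(2)[OF n(2)] r_def p(1) p(3) p(2)])
    show "- ((1 + L) * r) \<le> z S"
    proof (rule ccontr)
      assume "\<not> - ((1 + L) * r) \<le> z S"
      \<comment> \<open>Slopes are at most 1, so a component this small would pull the threshold at
        the zero array below its lower bound.\<close>
      then have "z S < - ((1 + L) * r)" by simp
      also have "\<dots> \<le> slope P S * - ((1 + L) * r)"
        using mult_right_mono[OF slope_bounds(2)[OF S P] pos] by simp
      also have "\<dots> = lin_form K P S (\<lambda>_ _. 0) + slope P S * - ((1 + L) * r)" by (simp add: lin_form_def)
      finally have "threshold K P z (\<lambda>_ _. 0) < - ((1 + L) * r)"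
        unfolding threshold_less_iff[OF K P] using S by blast
      then show False using t by simp
    qed
  qed
qed

text \<open>There are finitely many \<open>S\<close>, and enlarging the constant weakens the claim,
  so the sum of the individual constants works for all of them.\<close>

lemma uniform_bad_event_expansion:
  fixes P :: "nat \<Rightarrow> real"
  assumes P: "\<forall>i\<in>{1..K}. P i > 0"
  obtains D :: real where "D > 0"
    "\<And>n S k G M w. real n \<ge> D \<Longrightarrow> S \<in> PK K \<Longrightarrow> w = chi_dev {Suc K..<n} (G (Suc K)) \<Longrightarrow> D * (quad n K G + w\<^sup>2) \<le> real n \<Longrightarrow> M > 0 \<Longrightarrow>
       (1/2) ^ k \<le> M * cap_error n K (\<lambda>i. sqrt (real n * P i)) S (\<lambda>j\<in>{1..Suc K}. triang n j (G j)) \<Longrightarrow>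
       real n * Cap (Psum P S) - sqrt (real n) * (lin_form K P S G + slope P S * w) - D * (quad n K G + w\<^sup>2 + real k)
         \<le> ln M - ln (real n) / 2"
proof -
  let ?Q = "\<lambda>S D. D > 0 \<and> (\<forall>n k G M w. real n \<ge> D \<longrightarrow> w = chi_dev {Suc K..<n} (G (Suc K)) \<longrightarrow> D * (quad n K G + w\<^sup>2) \<le> real n \<longrightarrow> M > 0 \<longrightarrow>
       (1/2) ^ k \<le> M * cap_error n K (\<lambda>i. sqrt (real n * P i)) S (\<lambda>j\<in>{1..Suc K}. triang n j (G j)) \<longrightarrow>
       real n * Cap (Psum P S) - sqrt (real n) * (lin_form K P S G + slope P S * w) - D * (quad n K G + w\<^sup>2 + real k)
         \<le> ln M - ln (real n) / 2)"
  have "\<exists>D. ?Q S D" if S: "S \<in> PK K" for S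
  proof (rule bad_event_expansion[of S K P, OF S])
    show "P i > 0" if "i \<in> {1..K}" for i using that P by blast
  next
    fix D :: real
    assume D: "D > 0" "\<And>n k G M w. real n \<ge> D \<Longrightarrow> w = chi_dev {Suc K..<n} (G (Suc K)) \<Longrightarrow> D * (quad n K G + w\<^sup>2) \<le> real n \<Longrightarrow> M > 0 \<Longrightarrow>
       (1/2) ^ k \<le> M * cap_error n K (\<lambda>i. sqrt (real n * P i)) S (\<lambda>j\<in>{1..Suc K}. triang n j (G j)) \<Longrightarrow>
       real n * Cap (Psum P S) - sqrt (real n) * (lin_form K P S G + slope P S * w) - D * (quad n K G + w\<^sup>2 + real k)
         \<le> ln M - ln (real n) / 2"
    show ?thesis by (rule exI[of _ D], intro conjI allI impI, rule D(1), rule D(2))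
  qed
  note ex = this
  define E where "E = (\<lambda>S. SOME D. ?Q S D)"
  have E: "?Q S (E S)" if "S \<in> PK K" for S
    unfolding E_def by (rule someI_ex) (rule ex[OF that])
  define D where "D = 1 + (\<Sum>S\<in>PK K. E S)"
  have E0: "0 \<le> E S" if "S \<in> PK K" for S using E[OF that] by simp
  have D0: "D > 0" unfolding D_def using sum_nonneg[of "PK K" E] E0 by simp
  have ED: "E S \<le> D" if "S \<in> PK K" for S
    unfolding D_def using member_le_sum[OF that _ finite_PK, of E] E0 by simp
  show ?thesis
  proof (rule that[OF D0])
    fix n S k G w and M :: real
    assume n: "real n \<ge> D" and S: "S \<in> PK K" and w: "w = chi_dev {Suc K..<n} (G (Suc K))" and le: "D * (quad n K G + w\<^sup>2) \<le> real n"
      and M: "M > 0" and bad: "(1/2) ^ k \<le> M * cap_error n K (\<lambda>i. sqrt (real n * P i)) S (\<lambda>j\<in>{1..Suc K}. triang n j (G j))"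
    have q: "0 \<le> quad n K G" using quad_ge[of n K G] by linarith
    have "E S * (quad n K G + w\<^sup>2) \<le> D * (quad n K G + w\<^sup>2)" using q ED[OF S] by (intro mult_right_mono) auto
    then have 1: "E S * (quad n K G + w\<^sup>2) \<le> real n" using le by linarith
    have 2: "E S * (quad n K G + w\<^sup>2 + real k) \<le> D * (quad n K G + w\<^sup>2 + real k)" using q ED[OF S] by (intro mult_right_mono) auto
    have "E S \<le> real n" using n ED[OF S] by linarith
    then have "real n * Cap (Psum P S) - sqrt (real n) * (lin_form K P S G + slope P S * w) - E S * (quad n K G + w\<^sup>2 + real k)
         \<le> ln M - ln (real n) / 2"
      using E[OF S] w 1 M bad by blast
    then show "real n * Cap (Psum P S) - sqrt (real n) * (lin_form K P S G + slope P S * w) - D * (quad n K G + w\<^sup>2 + real k)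
         \<le> ln M - ln (real n) / 2" using 2 by linarith
  qed
qed

text \<open>If the limiting error probability \<open>p\<close> is at most \<open>eps / 2\<close>, the error terms of order \<open>1 / sqrt n\<close> are absorbed
  by \<open>eps / 2\<close>. Otherwise the threshold is bounded, so that the back-off \<open>B\<close> shifts it to a region of positive
  Gaussian density and gains a multiple of \<open>B / sqrt n\<close>.\<close>

lemma achievability_long_blocks:
  fixes P :: "nat \<Rightarrow> real"
  assumes K: "K \<ge> 1" and P: "\<forall>i\<in>{1..K}. P i > 0" and eps: "0 < eps" "eps < 1"
  obtains N :: nat and B :: real where "N \<ge> 1" "B \<ge> 0"
    "\<And>n z M. n \<ge> N \<Longrightarrow> \<forall>i\<in>{1..K}. M i \<ge> 1 \<Longrightarrow> z \<in> Qinv (PK K) (dispV P) eps \<Longrightarrow>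
       \<forall>S\<in>PK K. (\<Sum>s\<in>S. ln (real (M s)))
          \<le> real n * Cap (Psum P S) - sqrt (real n) * z S + ln (real n) / 2 - B \<Longrightarrow>
       \<exists>f g. is_mac_code K n M eps P f g"
proof -
  obtain D where D: "D > 0"
    "\<And>n S k G M w. real n \<ge> D \<Longrightarrow> S \<in> PK K \<Longrightarrow> w = chi_dev {Suc K..<n} (G (Suc K)) \<Longrightarrow> D * (quad n K G + w\<^sup>2) \<le> real n \<Longrightarrow> M > 0 \<Longrightarrow>
       (1/2) ^ k \<le> M * cap_error n K (\<lambda>i. sqrt (real n * P i)) S (\<lambda>j\<in>{1..Suc K}. triang n j (G j)) \<Longrightarrow>
       real n * Cap (Psum P S) - sqrt (real n) * (lin_form K P S G + slope P S * w) - D * (quad n K G + w\<^sup>2 + real k)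
         \<le> ln M - ln (real n) / 2"
    using uniform_bad_event_expansion[OF P] by blast
  obtain L where L: "L > 0" "\<And>n z G. \<bar>threshold K P z G - threshold K P z (\<lambda>_ _. 0)\<bar> \<le> L * quad n K G"
    using threshold_lipschitz[OF K P] by blast
  obtain Cq where Cq: "Cq \<ge> 1"
    "\<And>n. real n \<ge> Cq \<Longrightarrow> (\<integral>\<^sup>+G. ennreal (quad n K G) \<partial>PiM {1..Suc K} (\<lambda>_. gauss {..<n})) \<le> ennreal Cq"
    using quad_mean[of K] by blast
  define c where "c = 1 + (\<Sum>S\<in>PK K. (D + 1) / slope P S)"
  have term_nonneg: "0 \<le> (D + 1) / slope P S" if "S \<in> PK K" for S
    using D(1) slope_bounds(1)[OF that P] by simp
  have c0: "c > 0" unfolding c_def using sum_nonneg[of "PK K" "\<lambda>S. (D + 1) / slope P S"] term_nonneg by simp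
  have c: "(D + 1) / slope P S \<le> c" if "S \<in> PK K" for S
    unfolding c_def using member_le_sum[OF that _ finite_PK, of "\<lambda>S. (D + 1) / slope P S"] term_nonneg by simp
  obtain C where C: "C > 0"
    "\<And>n q B t. real n \<ge> C \<Longrightarrow> q \<ge> 1 \<Longrightarrow> 0 \<le> B \<Longrightarrow>
      measure (gauss {Suc K..<n}) {y \<in> space (gauss {Suc K..<n}).
          t + (B - c * q) / sqrt (real n) < chi_dev {Suc K..<n} y + c * (chi_dev {Suc K..<n} y)\<^sup>2 / sqrt (real n)}
        \<le> measure std_gauss {t<..} + C * q / sqrt (real n)"
    "\<And>n q B t. real n \<ge> C \<Longrightarrow> q \<ge> 1 \<Longrightarrow> 2 * c * q \<le> B \<Longrightarrow> B \<le> 2 * sqrt (real n) \<Longrightarrow>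
      measure (gauss {Suc K..<n}) {y \<in> space (gauss {Suc K..<n}).
          t + (B - c * q) / sqrt (real n) < chi_dev {Suc K..<n} y + c * (chi_dev {Suc K..<n} y)\<^sup>2 / sqrt (real n)}
        + B / (2 * sqrt (real n)) * std_normal_density (\<bar>t\<bar> + 1)
        \<le> measure std_gauss {t<..} + C * q / sqrt (real n)"
    "\<And>n q d. real n \<ge> C \<Longrightarrow> q \<ge> 1 \<Longrightarrow> d \<ge> 0 \<Longrightarrow>
      measure (gauss {Suc K..<n}) {y \<in> space (gauss {Suc K..<n}). real n < d * (q + (chi_dev {Suc K..<n} y)\<^sup>2)}
        \<le> d * C * q / sqrt (real n)"
    using perturbed_tail[OF c0, of K] by blast
  \<comment> \<open>The total of all error terms of order \<open>1 / sqrt n\<close> after the dyadic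
    average; the last 1 covers the remainder \<open>(1/2) ^ n\<close>.\<close>
  define E where "E = (1 + D) * C * (Cq + 2) + 1"
  define r where "r = 4 * (Cq + 1) / min eps (1 - eps)"
  \<comment> \<open>A bound for the threshold wherever \<open>quad\<close> is at most
    \<open>2 * Cq\<close>: its location at zero plus the Lipschitz term.\<close>
  define R where "R = (1 + L) * r + L * (2 * Cq)"
  define \<phi> where "\<phi> = std_normal_density (R + 1)"
  \<comment> \<open>The first entry makes the gain, reduced by the three factors one half below,
    exceed \<open>E / sqrt n\<close>. The second gives \<open>2 * c * q \<le> B\<close> at the first
    level, where \<open>q = quad + 1\<close>.\<close>
  define B where "B = max (8 * E / \<phi>) (2 * c * (2 * Cq + 1))"
  \<comment> \<open>The squares yield \<open>B \<le> sqrt n\<close>, which keeps the net shift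
    within the range of the gain estimate, and \<open>E / sqrt n \<le> eps / 2\<close>.\<close>
  define N where "N = nat \<lceil>C + Cq + D + B\<^sup>2 + (2 * E / eps)\<^sup>2\<rceil> + K + 10"
  have E0: "E > 0" unfolding E_def using D(1) C(1) Cq(1) by (intro add_pos_pos mult_pos_pos) auto
  have r0: "r \<ge> 0" using Cq eps by (simp add: r_def)
  have R0: "R \<ge> 0" using r0 L(1) Cq(1) by (simp add: R_def)
  have phi: "\<phi> > 0" unfolding \<phi>_def by (rule normal_density_pos) simp
  have B0: "B \<ge> 0" using E0 phi by (simp add: B_def le_max_iff_disj)
  have B1: "8 * E / \<phi> \<le> B" and B2: "2 * c * (2 * Cq + 1) \<le> B" by (auto simp: B_def)
  have card: "card (PK K) \<ge> 1" using PK_nonempty[OF K] finite_PK by (simp add: Suc_leI card_gt_0_iff)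
  have lncard: "ln (real (card (PK K))) \<ge> 0" using card by simp
  show ?thesis
  proof (rule that)
    show "N \<ge> 1" by (simp add: N_def)
    show "0 \<le> B + ln (real (card (PK K)))" using B0 lncard by simp
  next
    fix n z and M :: "nat \<Rightarrow> nat"
    assume nN: "n \<ge> N" and M: "\<forall>i\<in>{1..K}. M i \<ge> 1" and z: "z \<in> Qinv (PK K) (dispV P) eps"
      and "\<forall>S\<in>PK K. (\<Sum>s\<in>S. ln (real (M s)))
          \<le> real n * Cap (Psum P S) - sqrt (real n) * z S + ln (real n) / 2 - (B + ln (real (card (PK K))))"
    then have rate: "\<And>S. S \<in> PK K \<Longrightarrow> (\<Sum>s\<in>S. ln (real (M s)))
          \<le> real n * Cap (Psum P S) - sqrt (real n) * z S + ln (real n) / 2 - (B + ln (real (card (PK K))))" by blast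
    let ?M = "PiM {1..Suc K} (\<lambda>_. gauss {..<n})"
    let ?r = "sqrt (real n)"
    let ?u = "\<lambda>k. measure ?M (rcu_level n K (\<lambda>i. sqrt (real n * P i)) M k)"
    let ?Q = "{G \<in> space ?M. quad n K G \<le> 2 * Cq}"
    interpret M: prob_space ?M by (rule prob_space_nested)
    have nK: "Suc K < n" "K < n" "n \<ge> 4" "n \<ge> 1" using nN by (auto simp: N_def)
    have "C + Cq + D + B\<^sup>2 + (2 * E / eps)\<^sup>2 \<le> real n" using nN unfolding N_def by linarith
    moreover have "0 \<le> B\<^sup>2" "0 \<le> (2 * E / eps)\<^sup>2" by auto
    ultimately have nC: "C \<le> real n" and nCq: "Cq \<le> real n" and nD: "D \<le> real n" and nB: "B\<^sup>2 \<le> real n" and nE: "(2 * E / eps)\<^sup>2 \<le> real n"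
      using C(1) Cq(1) D(1) by linarith+
    have rB: "B \<le> ?r" using nB by (rule real_le_rsqrt)
    have rE: "2 * E / eps \<le> ?r" using nE by (rule real_le_rsqrt)
    have r: "?r > 0" using nK by simp
    have Er: "E / ?r \<le> eps / 2" using rE r eps by (simp add: field_simps)
    have mean: "(\<integral>\<^sup>+G. ennreal (quad n K G) \<partial>?M) \<le> ennreal Cq" by (rule Cq(2)[OF nCq])
    obtain p where p: "0 \<le> p" "p \<le> eps"
      "(\<integral>\<^sup>+G. ennreal (measure std_gauss {threshold K P z G<..}) \<partial>?M) = ennreal p"
      using Qinv_probability[OF K P nK(2) z eps(1)] by blast
    have tail2: "measure (gauss {Suc K..<n}) {y \<in> space (gauss {Suc K..<n}). real n < D * (q + (chi_dev {Suc K..<n} y)\<^sup>2)}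
        \<le> D * C * q / ?r" if "q \<ge> 1" for q
      using C(4)[OF nC that] D(1) by simp
    have a0: "0 \<le> (1 + D) * C / ?r" using D(1) C(1) by simp
    have level: "?u k + h * measure ?M ?Q \<le> p + (1 + D) * C / ?r * (Cq + real k)"
      if h: "h \<ge> 0" and t1: "\<And>G. measure (gauss {Suc K..<n}) {y \<in> space (gauss {Suc K..<n}).
          threshold K P z G + (B - c * (quad n K G + real k)) / ?r
            < chi_dev {Suc K..<n} y + c * (chi_dev {Suc K..<n} y)\<^sup>2 / ?r}
        + (if quad n K G \<le> 2 * Cq then h else 0)
        \<le> measure std_gauss {threshold K P z G<..} + C * (quad n K G + real k) / ?r" for h k
    proof -
      have a: "0 \<le> (1 + D) * C * (Cq + real k) / ?r" using D(1) C(1) Cq(1) by simp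
      have "ennreal (?u k) + ennreal (h * measure ?M ?Q) \<le> ennreal p + ennreal ((1 + D) * C * (Cq + real k) / ?r)"
        unfolding p(3)[symmetric]
        by (rule rcu_level_measure[OF K P M nK(1) nD D(2)[OF nD] D(1) c B0 rate t1 tail2 h C(1) _ mean]) (use Cq in auto)
      then have "ennreal (?u k + h * measure ?M ?Q) \<le> ennreal (p + (1 + D) * C * (Cq + real k) / ?r)"
        using h p(1) a by (simp add: ennreal_plus)
      then have "?u k + h * measure ?M ?Q \<le> p + (1 + D) * C * (Cq + real k) / ?r"
        using p(1) a by (subst (asm) ennreal_le_iff) (auto intro!: add_nonneg_nonneg)
      then show ?thesis by simp
    qed
    have q1: "1 \<le> quad n K G + real k" for G k using quad_ge[of n K G] by linarith
    have plain: "?u k \<le> p + (1 + D) * C / ?r * (Cq + real k)" for k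
      using level[of 0 k] C(2)[OF nC q1 B0] by simp
    have split: "(1 + D) * C / ?r * (Cq + 2) + 1 / ?r = E / ?r"
      by (simp add: E_def add_divide_distrib)
    have "(\<Sum>k\<in>{1..n}. (1/2) ^ k * ?u k) + (1/2) ^ n \<le> eps"
    proof (cases "p \<le> eps / 2")
      case True
      have "(\<Sum>k\<in>{1..n}. (1/2) ^ k * ?u k) + (1/2) ^ n \<le> p + (1 + D) * C / ?r * (Cq + 2) + 1 / ?r - 0 / 2"
        by (rule dyadic_average[OF _ p(1) a0 _ nK(4)]) (use plain Cq(1) in auto)
      then show ?thesis using split Er True by linarith
    next
      case False
      then have pe: "eps / 2 < p" by simp
      have "- ((1 + L) * r) \<le> threshold K P z (\<lambda>_ _. 0)"
        by (rule threshold_bounds(1)[OF K P nK(2) eps L(1) L(2)[of _ _ n] Cq(1) mean r_def p(1) p(3) p(2)])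
      moreover have "threshold K P z (\<lambda>_ _. 0) \<le> (1 + L) * r"
        by (rule threshold_bounds(2)[OF K P nK(2) eps L(1) L(2)[of _ _ n] Cq(1) mean r_def p(1) p(3) p(2) pe])
      ultimately have t0: "\<bar>threshold K P z (\<lambda>_ _. 0)\<bar> \<le> (1 + L) * r" by simp
      define h where "h = B / (2 * ?r) * \<phi>"
      have h0: "h \<ge> 0" using B0 phi by (simp add: h_def)
      have gain: "measure (gauss {Suc K..<n}) {y \<in> space (gauss {Suc K..<n}).
          threshold K P z G + (B - c * (quad n K G + real 1)) / ?r
            < chi_dev {Suc K..<n} y + c * (chi_dev {Suc K..<n} y)\<^sup>2 / ?r}
        + (if quad n K G \<le> 2 * Cq then h else 0)
        \<le> measure std_gauss {threshold K P z G<..} + C * (quad n K G + real 1) / ?r" for G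
      proof (cases "quad n K G \<le> 2 * Cq")
        case True
        have "L * quad n K G \<le> L * (2 * Cq)" using True L(1) by (intro mult_left_mono) auto
        then have "\<bar>threshold K P z G\<bar> \<le> R" using L(2)[of z G n] t0 by (simp add: R_def)
        then have "\<phi> \<le> std_normal_density (\<bar>threshold K P z G\<bar> + 1)"
          unfolding \<phi>_def by (intro std_normal_density_antimono) auto
        then have 1: "h \<le> B / (2 * ?r) * std_normal_density (\<bar>threshold K P z G\<bar> + 1)"
          unfolding h_def using B0 by (intro mult_left_mono) auto
        have "2 * c * (quad n K G + real 1) \<le> 2 * c * (2 * Cq + 1)" using True c0 by (intro mult_left_mono) auto
        then have 2: "2 * c * (quad n K G + real 1) \<le> B" using B2 by linarith
        have 3: "B \<le> 2 * ?r" using rB r by linarith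
        show ?thesis using C(3)[OF nC q1[of G 1] 2 3, of "threshold K P z G"] 1 True by simp
      next
        case False
        then show ?thesis using C(2)[OF nC q1[of G 1] B0, of "threshold K P z G"] by simp
      qed
      \<comment> \<open>By Markov's inequality the gain is available with probability at least one
        half.\<close>
      have Q: "1 / 2 \<le> measure ?M ?Q"
      proof -
        have m: "{G \<in> space ?M. 2 * Cq < quad n K G} \<in> sets ?M"
          by (intro borel_measurable_less borel_measurable_const borel_measurable_quad[OF nK(2)])
        have "measure ?M {G \<in> space ?M. 2 * Cq < quad n K G} \<le> Cq / (2 * Cq)"
          by (rule markov_nonneg[OF prob_space_nested borel_measurable_quad[OF nK(2)] _ mean]) (use Cq(1) in auto)
        also have "Cq / (2 * Cq) = 1 / 2" using Cq(1) by simp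
        finally have "measure ?M {G \<in> space ?M. 2 * Cq < quad n K G} \<le> 1 / 2" .
        moreover have "?Q = space ?M - {G \<in> space ?M. 2 * Cq < quad n K G}" by auto
        then have "measure ?M ?Q = 1 - measure ?M {G \<in> space ?M. 2 * Cq < quad n K G}"
          using M.prob_compl[OF m] by (rule ssubst)
        ultimately show ?thesis by linarith
      qed
      have "h * (1 / 2) \<le> h * measure ?M ?Q" using Q h0 by (rule mult_left_mono)
      then have first: "?u 1 + h / 2 \<le> p + (1 + D) * C / ?r * (Cq + real 1)"
        using level[OF h0 gain] by linarith
      have "(\<Sum>k\<in>{1..n}. (1/2) ^ k * ?u k) + (1/2) ^ n \<le> p + (1 + D) * C / ?r * (Cq + 2) + 1 / ?r - (h / 2) / 2"
      proof (rule dyadic_average[OF _ p(1) a0 _ nK(4)])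
        fix k assume "k \<in> {1..n}"
        show "?u k + (if k = 1 then h / 2 else 0) \<le> p + (1 + D) * C / ?r * (Cq + real k)"
          using first plain[of k] by (cases "k = 1") auto
      qed (use Cq(1) in auto)
      \<comment> \<open>One half is the probability that the gain is available, the other is the
        weight of the first level; the third one sits in \<open>h\<close>.\<close>
      moreover have "E / ?r \<le> (h / 2) / 2"
      proof -
        have "8 * E \<le> B * \<phi>" using B1 phi by (simp add: pos_divide_le_eq)
        then have "8 * E / ?r \<le> B * \<phi> / ?r" using r by (intro divide_right_mono) auto
        then show ?thesis by (simp add: h_def)
      qed
      ultimately show ?thesis using split p(2) by linarith
    qed
    then have "(\<integral>\<^sup>+G. ennreal (rcu_bound n K (\<lambda>i. sqrt (real n * P i)) M G) \<partial>?M) \<le> ennreal eps"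
      by (intro order_trans[OF nn_integral_rcu_levels[OF nK(3) nK(1)]] ennreal_leI)
    moreover have "(sqrt (real n * P i))\<^sup>2 \<le> real n * P i" "0 \<le> P i" if "i \<in> {1..K}" for i
      using bspec[OF P that] by simp_all
    ultimately show "\<exists>f g. is_mac_code K n M eps P f g"
      using M eps by (intro random_coding[OF K nK(3)]) auto
  qed
qed

theorem theorem3:
  fixes K :: nat and eps :: real and P :: "nat \<Rightarrow> real"
  assumes "K \<ge> 1" and "0 < eps" and "eps < 1"
    and "\<forall>i\<in>{1..K}. P i > 0"
  shows "\<exists>B :: real. \<forall>(n::nat) (M :: nat \<Rightarrow> nat).
           n \<ge> 1 \<longrightarrow> (\<forall>i\<in>{1..K}. M i \<ge> 1) \<longrightarrow>
           (\<exists>z\<in>Qinv (PK K) (dispV P) eps.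
              \<forall>S\<in>PK K. (\<Sum>s\<in>S. ln (real (M s)))
                 \<le> real n * Cap (Psum P S) - sqrt (real n) * z S + ln (real n) / 2 - B)
           \<longrightarrow> (\<exists>f g. is_mac_code K n M eps P f g)"
proof -
  obtain r where r: "r \<ge> 0" "\<And>z S. z \<in> Qinv (PK K) (dispV P) eps \<Longrightarrow> S \<in> PK K \<Longrightarrow> - r \<le> z S"
    using Qinv_lower_bound[OF assms(1,4,2,3)] by blast
  obtain N B where N: "N \<ge> 1" and B: "B \<ge> 0"
    and large: "\<And>n z M. n \<ge> N \<Longrightarrow> \<forall>i\<in>{1..K}. M i \<ge> 1 \<Longrightarrow> z \<in> Qinv (PK K) (dispV P) eps \<Longrightarrow>
       \<forall>S\<in>PK K. (\<Sum>s\<in>S. ln (real (M s)))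
          \<le> real n * Cap (Psum P S) - sqrt (real n) * z S + ln (real n) / 2 - B \<Longrightarrow>
       \<exists>f g. is_mac_code K n M eps P f g"
    using achievability_long_blocks[OF assms(1,4,2,3)] by blast
  \<comment> \<open>Chosen so that no rate is admissible for \<open>n < N\<close>: by the lower
    bound on \<open>z\<close> the right-hand side for the single user 1 becomes negative, whereas
    \<open>ln (M 1)\<close> is nonnegative.\<close>
  define B' where "B' = real N * Cap (P 1) + sqrt (real N) * r + ln (real N) / 2 + 1"
  have S1: "{1} \<in> PK K" and P1: "P 1 > 0" using assms(1,4) by (auto simp: PK_def)
  have cap: "0 \<le> Cap (P 1)" using P1 by (simp add: Cap_def)
  have B'0: "B' \<ge> 0" unfolding B'_def using cap r(1) N by (intro add_nonneg_nonneg mult_nonneg_nonneg) auto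
  show ?thesis
  proof (rule exI[of _ "B + B'"], intro allI impI)
    fix n and M :: "nat \<Rightarrow> nat"
    assume n: "n \<ge> 1" and M: "\<forall>i\<in>{1..K}. M i \<ge> 1"
      and "\<exists>z\<in>Qinv (PK K) (dispV P) eps. \<forall>S\<in>PK K. (\<Sum>s\<in>S. ln (real (M s)))
             \<le> real n * Cap (Psum P S) - sqrt (real n) * z S + ln (real n) / 2 - (B + B')"
    then obtain z where z: "z \<in> Qinv (PK K) (dispV P) eps"
      and rate: "\<And>S. S \<in> PK K \<Longrightarrow> (\<Sum>s\<in>S. ln (real (M s)))
             \<le> real n * Cap (Psum P S) - sqrt (real n) * z S + ln (real n) / 2 - (B + B')" by blast
    show "\<exists>f g. is_mac_code K n M eps P f g"
    proof (cases "n \<ge> N")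
      case True
      show ?thesis
      proof (rule large[OF True M z], rule ballI)
        fix S assume "S \<in> PK K"
        then show "(\<Sum>s\<in>S. ln (real (M s))) \<le> real n * Cap (Psum P S) - sqrt (real n) * z S + ln (real n) / 2 - B"
          using rate[of S] B'0 by linarith
      qed
    next
      case False
      have "M 1 \<ge> 1" using M assms(1) by auto
      then have "0 \<le> (\<Sum>s\<in>{1}. ln (real (M s)))" by simp
      also have "\<dots> \<le> real n * Cap (P 1) - sqrt (real n) * z {1} + ln (real n) / 2 - (B + B')"
        using rate[OF S1] by (simp add: Psum_def)
      also have "\<dots> < 0"
      proof -
        have "real n * Cap (P 1) \<le> real N * Cap (P 1)" using False cap by (intro mult_right_mono) auto
        moreover have "ln (real n) \<le> ln (real N)" using False n by simp
        moreover have "sqrt (real n) * - z {1} \<le> sqrt (real n) * r"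
          using r(2)[OF z S1] by (intro mult_left_mono) auto
        moreover have "sqrt (real n) * r \<le> sqrt (real N) * r" using False r(1) by (intro mult_right_mono) auto
        ultimately show ?thesis unfolding B'_def using B by simp
      qed
      finally show ?thesis by simp
    qed
  qed
qed

end
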